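(* Let $W:\mathbb{R}\to\mathbb{R}$ be continuously differentiable and even, and suppose there is $c>0$ such that $x\mapsto W(x)+\frac{c}{2}x^2$ is convex and that $$\sup_{x\in\mathbb{R}}\frac{|W'(x)|}{1+|x|}<\infty .$$ Let $\rho_0\in\mathcal{P}(\mathbb{R})$ satisfy $\int_{\mathbb{R}}x^2\,d\rho_0(x)<\infty$ and let $v_0:\mathbb{R}\to\mathbb{R}$ be absolutely continuous. Then there is a weak solution pair $\rho$ and $v$ of the pressureless Euler equations (with interaction potential $W$) which satisfies the initial conditions $\rho|_{t=0}=\rho_0$ and $v|_{t=0}=v_0$. Moreover, $\rho$ and $v$ satisfy $$\frac12\int_{\mathbb{R}}v(x,t)^2d\rho_t(x)+\frac12\int_{\mathbb{R}}\int_{\mathbb{R}}W(x-y)\,d\rho_t(x)d\rho_t(y)\le \frac12\int_{\mathbb{R}}v(x,s)^2d\rho_s(x)+\frac12\int_{\mathbb{R}}\int_{\mathbb{R}}W(x-y)\,d\rho_s(x)d\rho_s(y)$$ for almost every $0\le s\le t$; and $$(v(x,t)-v(y,t))(x-y)\le\frac{\sqrt{c}}{\tanh(\sqrt{c}\,t)}(x-y)^2$$ for $\rho_t$ almost every $x,y\in\mathbb{R}$ and almost every $t>0$.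
   Context: $\mathcal{P}(\mathbb{R})$ is the set of Borel probability measures on $\mathbb{R}$. A sequence $(\mu^k)\subset\mathcal{P}(\mathbb{R})$ converges narrowly to $\mu$ if $\int g\,d\mu^k\to\int g\,d\mu$ for every bounded continuous $g:\mathbb{R}\to\mathbb{R}$; "narrowly continuous" refers to this topology. For $\mu\in\mathcal{P}(\mathbb{R})$, $(W'*\mu)(x)=\int_{\mathbb{R}}W'(x-y)\,d\mu(y)$. Absolutely continuous on $\mathbb{R}$ means: for every $\epsilon>0$ there is $\delta>0$ such that $\sum_k|v_0(b_k)-v_0(a_k)|<\epsilon$ for every finite family of disjoint intervals $(a_k,b_k)\subset\mathbb{R}$ with $\sum_k(b_k-a_k)<\delta$. Weak solution pair: given $\rho_0\in\mathcal{P}(\mathbb{R})$ and continuous $v_0:\mathbb{R}\to\mathbb{R}$, a narrowly continuous $\rho:(0,\infty)\to\mathcal{P}(\mathbb{R})$, $t\mapsto\rho_t$, and a Borel $v:\mathbb{R}\times(0,\infty)\to\mathbb{R}$ are a weak solution pair of the pressureless Euler equations $$\partial_t\rho+\partial_x(\rho v)=0,\qquad \partial_t(\rho v)+\partial_x(\rho v^2)=-\rho(W'*\rho)$$ satisfying the initial conditions $\rho|_{t=0}=\rho_0$ and $v|_{t=0}=v_0$ if, for each $\phi\in C_c^\infty(\mathbb{R}\times[0,\infty))$, $$\int_0^\infty\int_{\mathbb{R}}(\partial_t\phi+v\,\partial_x\phi)\,d\rho_t\,dt+\int_{\mathbb{R}}\phi(\cdot,0)\,d\rho_0=0$$ and $$\int_0^\infty\int_{\mathbb{R}}(v\,\partial_t\phi+v^2\partial_x\phi)\,d\rho_t\,dt+\int_{\mathbb{R}}\phi(\cdot,0)v_0\,d\rho_0=\int_0^\infty\int_{\mathbb{R}}\phi\,(W'*\rho_t)\,d\rho_t\,dt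 .$$ "For almost every $0\le s\le t$" means for all $s\le t$ in $[0,\infty)$ outside a Lebesgue null set of times. *)

theory Defs
  imports "HOL-Probability.Probability"
begin

text \<open>Elements of \<open>P(R)\<close> are the measures \<open>\<mu>\<close> with \<^term>\<open>real_distribution \<mu>\<close>.\<close>

definition narrowly_converges :: "(nat \<Rightarrow> real measure) \<Rightarrow> real measure \<Rightarrow> bool" where
  "narrowly_converges \<mu>s \<mu> \<longleftrightarrow>
     (\<forall>g :: real \<Rightarrow> real. continuous_on UNIV g \<and> bounded (range g) \<longrightarrow>
        (\<lambda>k. \<integral>x. g x \<partial>\<mu>s k) \<longlonglongrightarrow> (\<integral>x. g x \<partial>\<mu>))"

text \<open>
  Paths \<open>(0,\<infinity>) \<rightarrow> P(R)\<close> are total functions on the reals whose values at \<open>t \<le> 0\<close> are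
  irrelevant. Sequential continuity is continuity here, since the domain is metrizable.
\<close>

definition narrowly_continuous :: "(real \<Rightarrow> real measure) \<Rightarrow> bool" where
  "narrowly_continuous \<rho> \<longleftrightarrow>
     (\<forall>t>0. \<forall>s :: nat \<Rightarrow> real. (\<forall>k. s k > 0) \<and> s \<longlonglongrightarrow> t \<longrightarrow>
        narrowly_converges (\<lambda>k. \<rho> (s k)) (\<rho> t))"

definition absolutely_continuous_fun :: "(real \<Rightarrow> real) \<Rightarrow> bool" where
  "absolutely_continuous_fun f \<longleftrightarrow>
     (\<forall>\<epsilon>>0. \<exists>\<delta>>0. \<forall>(n::nat) a b.
        (\<forall>k<n. a k < b k) \<and> disjoint_family_on (\<lambda>k. {a k<..<b k}) {..<n} \<and>
        (\<Sum>k<n. b k - a k) < \<delta> \<longrightarrow>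
        (\<Sum>k<n. \<bar>f (b k) - f (a k)\<bar>) < \<epsilon>)"

text \<open>
  Functions of \<open>(x, t)\<close> on the closed half-plane \<open>R \<times> [0,\<infinity>)\<close>. The time derivative is
  one-sided at \<open>t = 0\<close>, and values at \<open>t < 0\<close> play no role.
\<close>

abbreviation half_plane :: "(real \<times> real) set" where
  "half_plane \<equiv> UNIV \<times> {0..}"

definition dx :: "(real \<times> real \<Rightarrow> real) \<Rightarrow> real \<times> real \<Rightarrow> real" where
  "dx \<phi> = (\<lambda>(x, t). deriv (\<lambda>y. \<phi> (y, t)) x)"

definition dt :: "(real \<times> real \<Rightarrow> real) \<Rightarrow> real \<times> real \<Rightarrow> real" where
  "dt \<phi> = (\<lambda>(x, t). vector_derivative (\<lambda>s. \<phi> (x, s)) (at t within {0..}))"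

primrec Ck_half_plane :: "nat \<Rightarrow> (real \<times> real \<Rightarrow> real) \<Rightarrow> bool" where
  "Ck_half_plane 0 \<phi> \<longleftrightarrow> continuous_on half_plane \<phi>"
| "Ck_half_plane (Suc k) \<phi> \<longleftrightarrow>
     continuous_on half_plane \<phi> \<and>
     (\<forall>x. \<forall>t\<ge>0. (\<lambda>y. \<phi> (y, t)) differentiable (at x) \<and>
                (\<lambda>s. \<phi> (x, s)) differentiable (at t within {0..})) \<and>
     Ck_half_plane k (dx \<phi>) \<and> Ck_half_plane k (dt \<phi>)"

definition test_function :: "(real \<times> real \<Rightarrow> real) \<Rightarrow> bool" where
  "test_function \<phi> \<longleftrightarrow>
     (\<forall>k. Ck_half_plane k \<phi>) \<and> compact (closure {z \<in> half_plane. \<phi> z \<noteq> 0})"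

definition conv_measure :: "(real \<Rightarrow> real) \<Rightarrow> real measure \<Rightarrow> real \<Rightarrow> real" where
  "conv_measure f \<mu> x = (\<integral>y. f (x - y) \<partial>\<mu>)"

text \<open>
  The integral \<open>\<integral>\<^sub>0\<^sup>\<infinity> \<integral> F(x,t) d\<rho>\<^sub>t(x) dt\<close>, and its absolute convergence. The latter has to be
  stated, because the Bochner integral of a non-integrable function is \<open>0\<close> by convention.
\<close>

definition spacetime_integral :: "(real \<Rightarrow> real measure) \<Rightarrow> (real \<Rightarrow> real \<Rightarrow> real) \<Rightarrow> real" where
  "spacetime_integral \<rho> F = (LBINT t:{0<..}. \<integral>x. F x t \<partial>\<rho> t)"

definition spacetime_integrable :: "(real \<Rightarrow> real measure) \<Rightarrow> (real \<Rightarrow> real \<Rightarrow> real) \<Rightarrow> bool" where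
  "spacetime_integrable \<rho> F \<longleftrightarrow>
     (AE t in lborel. t > 0 \<longrightarrow> integrable (\<rho> t) (\<lambda>x. F x t)) \<and>
     set_integrable lborel {0<..} (\<lambda>t. \<integral>x. \<bar>F x t\<bar> \<partial>\<rho> t)"

text \<open>
  The clauses on integrability only say that the integrals in the two weak equations, including
  the one defining \<open>W' * \<rho>\<^sub>t\<close>, exist.
\<close>

definition weak_solution_pair ::
  "(real \<Rightarrow> real) \<Rightarrow> real measure \<Rightarrow> (real \<Rightarrow> real) \<Rightarrow>
   (real \<Rightarrow> real measure) \<Rightarrow> (real \<Rightarrow> real \<Rightarrow> real) \<Rightarrow> bool" where
  "weak_solution_pair W \<rho>\<^sub>0 v\<^sub>0 \<rho> v \<longleftrightarrow>
     (\<forall>t>0. real_distribution (\<rho> t)) \<and>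
     narrowly_continuous \<rho> \<and>
     (\<lambda>(x, t). v x t) \<in> borel_measurable (restrict_space borel (UNIV \<times> {0<..})) \<and>
     (AE t in lborel. t > 0 \<longrightarrow>
        (AE x in \<rho> t. integrable (\<rho> t) (\<lambda>y. deriv W (x - y)))) \<and>
     (\<forall>\<phi>. test_function \<phi> \<longrightarrow>
        spacetime_integrable \<rho> (\<lambda>x t. dt \<phi> (x, t) + v x t * dx \<phi> (x, t)) \<and>
        spacetime_integrable \<rho> (\<lambda>x t. v x t * dt \<phi> (x, t) + (v x t)\<^sup>2 * dx \<phi> (x, t)) \<and>
        spacetime_integrable \<rho> (\<lambda>x t. \<phi> (x, t) * conv_measure (deriv W) (\<rho> t) x) \<and>
        spacetime_integral \<rho> (\<lambda>x t. dt \<phi> (x, t) + v x t * dx \<phi> (x, t))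
          + (\<integral>x. \<phi> (x, 0) \<partial>\<rho>\<^sub>0) = 0 \<and>
        spacetime_integral \<rho> (\<lambda>x t. v x t * dt \<phi> (x, t) + (v x t)\<^sup>2 * dx \<phi> (x, t))
          + (\<integral>x. \<phi> (x, 0) * v\<^sub>0 x \<partial>\<rho>\<^sub>0)
          = spacetime_integral \<rho> (\<lambda>x t. \<phi> (x, t) * conv_measure (deriv W) (\<rho> t) x))"

end

theory Submission
  imports Defs "HOL-Complex_Analysis.Great_Picard"
begin

text \<open>
  The solution is built in Lagrangian coordinates. Label the mass of \<open>\<rho>\<^sub>0\<close> by \<open>m \<in> (0, 1)\<close>, the
  initial position of the label being the quantile \<open>Q m\<close>, and look for a flow \<open>X t m\<close> that is
  nondecreasing in \<open>m\<close>. Write \<open>w = W'\<close> and let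
  \<^item> \<open>F\<^sub>t(m) = - \<integral> w (X\<^sub>t(m) - X\<^sub>t(m')) dm'\<close> be the force on the label \<open>m\<close>,
  \<^item> \<open>Z\<^sub>t = v\<^sub>0 (X\<^sub>0) + \<integral>\<^sub>0\<^sup>t F\<^sub>r dr\<close> the velocity that the label would have if nothing ever stuck,
  \<^item> \<open>Y\<^sub>t = X\<^sub>0 + \<integral>\<^sub>0\<^sup>t Z\<^sub>r dr\<close> the corresponding free position.

  A sticky evolution conserves the mass and the momentum of each cluster. In these terms
  \<open>X\<^sub>t = E[Y\<^sub>t | X\<^sub>t]\<close>, the velocity is \<open>V\<^sub>t = E[Z\<^sub>t | X\<^sub>t]\<close>, and \<open>X\<^sub>t\<close> is a function of \<open>X\<^sub>s\<close> for
  \<open>s \<le> t\<close>. These three facts carry the whole argument.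

  Existence of the flow. \<open>N\<close> equal particles move in time steps of length \<open>1/N\<close>. In each step the
  tentative positions \<open>x + h v\<close> are projected onto the cone of nondecreasing sequences
  (\<open>isotonic_proj_exists\<close>), velocities are averaged over the resulting clusters, and the force is
  applied. Projecting onto the cone is the same as merging colliding blocks at their centre of mass, so
  the discrete form of \<open>X\<^sub>t = E[Y\<^sub>t | X\<^sub>t]\<close> is an identity (\<open>free_pos_level_sum\<close>). Convexity of
  \<open>W + c x\<^sup>2 / 2\<close> makes the force one-sided Lipschitz with constant \<open>c\<close>, and a discrete Wronskian
  comparison with \<open>sinh (\<surd>c t)\<close> then shows that \<open>(X\<^sub>t(m') - X\<^sub>t(m)) / sinh (\<surd>c t)\<close> is nonincreasing
  in time (\<open>pos_diff_sinh_grid\<close>). A nondecreasing function with a bound in \<open>L\<^sup>2(0, 1)\<close> is bounded pointwise by a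
  multiple of the integrable function \<open>m \<mapsto> 1/\<surd>m + 1/\<surd>(1 - m)\<close> (\<open>mono_L2_bound\<close>). The comparison
  turns Lipschitz bounds in time in \<open>L\<^sup>2\<close> into pointwise ones in the same way, because
  \<open>(1 + l) X\<^sub>s - X\<^sub>t\<close> is nondecreasing for a small \<open>l\<close> (\<open>mono_pair_bound\<close>). Hence a
  diagonal subsequence converges for all times and almost all labels, with an integrable majorant, and
  every identity passes to the limit (\<open>sticky_flow_X\<close>).

  Velocity. Testing \<open>X\<^sub>t = E[Y\<^sub>t | X\<^sub>t]\<close> at two times shows that the difference quotients
  \<open>q\<^sub>n = n (X (t + 1/n) - X t)\<close> converge to \<open>Z\<^sub>t\<close> weakly against functions of \<open>X\<^sub>t\<close> (\<open>q_weak\<close>).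
  By the comparison \<open>\<lambda>\<^sub>n X\<^sub>t - q\<^sub>n\<close> is nondecreasing in \<open>m\<close> for numbers
  \<open>\<lambda>\<^sub>n \<longrightarrow> \<surd>c / tanh (\<surd>c t)\<close>, and for monotone functions weak convergence is convergence almost everywhere
  (\<open>q_AE_convergent\<close>). The limit \<open>V\<^sub>t\<close> inherits the one-sided bound, which is the
  entropy inequality (\<open>V_entropy\<close>), and it satisfies \<open>V\<^sub>t = E[Z\<^sub>t | X\<^sub>t]\<close> (\<open>V_projection\<close>).

  Conclusions. Let \<open>\<rho>\<^sub>t\<close> be the law of \<open>X\<^sub>t\<close> and let \<open>v\<close> be defined by \<open>v (X\<^sub>t(m), t) = V\<^sub>t(m)\<close>. The weak equations follow
  by integrating the derivative of \<open>\<phi> (X\<^sub>t, t)\<close> and of \<open>Z\<^sub>t \<phi> (X\<^sub>t, t)\<close> along each path, where \<open>Z\<^sub>t\<close> may be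
  replaced by \<open>V\<^sub>t\<close> against functions of \<open>X\<^sub>t\<close>. For the energy put \<open>I = Z\<^sub>t - Z\<^sub>s\<close>. As \<open>V\<^sub>t\<close> is the
  projection of \<open>V\<^sub>s + I\<close> onto the functions of \<open>X\<^sub>t\<close>, one has \<open>\<parallel>V\<^sub>t\<parallel>\<^sup>2 \<le> \<parallel>V\<^sub>s + I\<parallel>\<^sup>2\<close>,
  while the potential energy drops by exactly \<open>\<langle>V\<^sub>s, I\<rangle> + \<parallel>I\<parallel>\<^sup>2 / 2\<close> (\<open>potential_decrement\<close>,
  \<open>work_of_force\<close>).
\<close>

section \<open>Isotonic projection of finite sequences\<close>

definition sorted_upto :: "nat \<Rightarrow> (nat \<Rightarrow> real) \<Rightarrow> bool" where
  "sorted_upto N x \<longleftrightarrow> (\<forall>i j. i \<le> j \<and> j < N \<longrightarrow> x i \<le> x j)"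

text \<open>
  The Karush-Kuhn-Tucker description of the Euclidean projection \<open>x\<close> of
  \<open>y\<close> onto the cone of nondecreasing sequences: the residual \<open>y - x\<close>
  is polar to the cone, and it is orthogonal not only to \<open>x\<close> but to every function
  of \<open>x\<close>. The last property says that each block on which \<open>x\<close> is
  constant sits at the mean of its \<open>y\<close>, which is how masses merge in an inelastic
  collision.
\<close>
definition isotonic_proj :: "nat \<Rightarrow> (nat \<Rightarrow> real) \<Rightarrow> (nat \<Rightarrow> real) \<Rightarrow> bool" where
  "isotonic_proj N y x \<longleftrightarrow> sorted_upto N x \<and>
     (\<forall>g. (\<Sum>i<N. g (x i) * (y i - x i)) = 0) \<and>
     (\<forall>z. sorted_upto N z \<longrightarrow> (\<Sum>i<N. z i * (y i - x i)) \<le> 0)"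

lemma sorted_uptoD: "sorted_upto N x \<Longrightarrow> i \<le> j \<Longrightarrow> j < N \<Longrightarrow> x i \<le> x j"
  by (auto simp: sorted_upto_def)

lemma downset_lessThan:
  assumes "A \<subseteq> {..<N::nat}" "\<And>i j. j \<in> A \<Longrightarrow> i \<le> j \<Longrightarrow> i \<in> A"
  shows "A = {..<card A}"
proof -
  have fin: "finite A" using assms(1) finite_subset by blast
  show ?thesis
  proof (cases "A = {}")
    case False
    define k where "k = Suc (Max A)"
    have "i \<in> A \<longleftrightarrow> i < k" for i
      using assms(2)[OF Max_in[OF fin False], of i] Max_ge[OF fin, of i]
      by (auto simp: k_def less_Suc_eq_le)
    then have "A = {..<k}" by blast
    then show ?thesis by simp
  qed simp
qed

text \<open>
  Summation by parts: the partial sums of \<open>a\<close> are nonnegative and the increments of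
  \<open>z\<close> are nonnegative.
\<close>
lemma abel_sum_nonpos:
  fixes a z :: "nat \<Rightarrow> real"
  assumes "\<And>j. j \<le> b \<Longrightarrow> 0 \<le> (\<Sum>i<j. a i)" "(\<Sum>i<b. a i) = 0" "sorted_upto b z"
  shows "(\<Sum>i<b. z i * a i) \<le> 0"
proof -
  have "(\<Sum>i<j. z i * a i) \<le> z (j - 1) * (\<Sum>i<j. a i)" if "j \<le> b" for j
    using that
  proof (induction j)
    case (Suc j)
    have "z (j - 1) * (\<Sum>i<j. a i) \<le> z j * (\<Sum>i<j. a i)"
      using assms(1)[of j] assms(3) Suc.prems by (intro mult_right_mono) (auto simp: sorted_upto_def)
    then show ?case using Suc by (simp add: algebra_simps)
  qed simp
  from this[of b] show ?thesis using assms(2) by simp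
qed

text \<open>
  The first block of the projection ends at an index \<open>b\<close> that minimises the mean of
  \<open>y\<close> over the initial segments; the rest of the sequence is projected recursively.
  Minimality makes the partial sums of \<open>y - \<alpha>\<close> nonnegative, which gives
  polarity on the first block, and it prevents a later block from falling below
  \<open>\<alpha>\<close>.
\<close>
lemma isotonic_proj_exists: "\<exists>x. isotonic_proj N y x"
proof (induction N arbitrary: y rule: less_induct)
  case (less N)
  show ?case
  proof (cases "N = 0")
    case True
    then show ?thesis by (auto simp: isotonic_proj_def sorted_upto_def)
  next
    case False
    \<comment> \<open>the first block runs up to \<open>b\<close> and has height
        \<open>\<alpha>\<close>\<close>
    define avg where "avg = (\<lambda>b. (\<Sum>i<b. y i) / real b)"
    have "finite (avg ` {1..N})" "avg ` {1..N} \<noteq> {}" using False by auto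
    from Min_in[OF this] Min_le[OF this(1)]
    obtain b where b: "b \<in> {1..N}" "\<And>j. j \<in> {1..N} \<Longrightarrow> avg b \<le> avg j"
      by (metis imageE imageI)
    define \<alpha> where "\<alpha> = avg b"
    obtain x' where x': "isotonic_proj (N - b) (\<lambda>i. y (b + i)) x'"
      using less.IH[of "N - b"] b(1) by auto
    have srt': "sorted_upto (N - b) x'" using x' by (simp add: isotonic_proj_def)
    define x where "x = (\<lambda>i. if i < b then \<alpha> else x' (i - b))"
    have prefix: "0 \<le> (\<Sum>i<j. y i - \<alpha>)" if "j \<le> N" for j
    proof (cases "j = 0")
      case False
      then have "\<alpha> \<le> (\<Sum>i<j. y i) / real j" using b(2)[of j] that by (simp add: \<alpha>_def avg_def)
      then show ?thesis using False by (simp add: sum_subtractf field_simps)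
    qed simp
    have full: "(\<Sum>i<b. y i - \<alpha>) = 0"
      using b(1) by (simp add: sum_subtractf \<alpha>_def avg_def)
    have split: "(\<Sum>i<N. f i) = (\<Sum>i<b. f i) + (\<Sum>i<N - b. f (b + i))" for f :: "nat \<Rightarrow> real"
    proof -
      have "{..<N} = {..<b} \<union> {b..<N}" using b(1) by auto
      moreover have "(\<Sum>i\<in>{b..<N}. f i) = (\<Sum>i<N - b. f (b + i))"
        by (rule sum.reindex_bij_witness[where i = "\<lambda>i. b + i" and j = "\<lambda>i. i - b"]) auto
      ultimately show ?thesis by (simp add: sum.union_disjoint ivl_disj_int)
    qed
    have ge: "\<alpha> \<le> x' i" if "i < N - b" for i
    proof (rule ccontr)
      assume "\<not> \<alpha> \<le> x' i"
      \<comment> \<open>if a later block were below \<open>\<alpha>\<close>, extending the first block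
          to the end of the set \<open>A\<close> would decrease the mean\<close>
      define A where "A = {j. j < N - b \<and> x' j < \<alpha>}"
      have iA: "i \<in> A" using that \<open>\<not> \<alpha> \<le> x' i\<close> by (simp add: A_def)
      have finA: "finite A" by (simp add: A_def)
      have AL: "A = {..<card A}"
      proof (rule downset_lessThan[where N = "N - b"])
        show "A \<subseteq> {..<N - b}" by (auto simp: A_def)
        show "i \<in> A" if "j \<in> A" "i \<le> j" for i j
          using that sorted_uptoD[OF srt', of i j] by (auto simp: A_def)
      qed
      have cA: "card A \<le> N - b"
        using card_mono[of "{..<N-b}" A] by (auto simp: A_def)
      have "(\<Sum>j<N - b. (if x' j < \<alpha> then 1 else 0) * (y (b + j) - x' j)) = 0"
        using x' unfolding isotonic_proj_def by (elim conjE allE[of _ "\<lambda>r. if r < \<alpha> then 1 else 0"])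
      also have "(\<Sum>j<N - b. (if x' j < \<alpha> then 1 else 0) * (y (b + j) - x' j)) = (\<Sum>j\<in>A. y (b + j) - x' j)"
        by (rule sum.mono_neutral_cong_right) (auto simp: A_def)
      finally have "(\<Sum>j\<in>A. y (b + j) - \<alpha>) = (\<Sum>j\<in>A. x' j - \<alpha>)"
        by (simp add: sum_subtractf)
      also have "\<dots> < 0"
        using iA sum_strict_mono[OF finA, of "\<lambda>j. x' j - \<alpha>" "\<lambda>_. 0"] by (auto simp: A_def)
      finally have neg: "(\<Sum>j\<in>A. y (b + j) - \<alpha>) < 0" .
      define k where "k = card A"
      have Ak: "A = {..<k}" using AL by (simp only: k_def)
      have "(\<Sum>j<b + k'. y j - \<alpha>) = (\<Sum>j<b. y j - \<alpha>) + (\<Sum>j<k'. y (b + j) - \<alpha>)" for k'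
        by (induction k') auto
      moreover have "b + k \<le> N" using cA[folded k_def] b(1) by auto
      ultimately show False
        using full neg[unfolded Ak] prefix[of "b + k"] by simp
    qed
    have srt: "sorted_upto N x"
      unfolding sorted_upto_def
    proof (intro allI impI)
      fix i j assume ij: "i \<le> j \<and> j < N"
      show "x i \<le> x j"
        using ij ge[of "j - b"] sorted_uptoD[OF srt', of "i - b" "j - b"] b(1)
        by (auto simp: x_def)
    qed
    have ce: "(\<Sum>i<N. g (x i) * (y i - x i)) = 0" for g
    proof -
      have "(\<Sum>i<b. g (x i) * (y i - x i)) = g \<alpha> * (\<Sum>i<b. y i - \<alpha>)"
        by (simp add: x_def sum_distrib_left)
      moreover have "(\<Sum>i<N - b. g (x' i) * (y (b + i) - x' i)) = 0"
        using x' by (simp add: isotonic_proj_def)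
      ultimately show ?thesis unfolding split using full by (simp add: x_def)
    qed
    have pol: "(\<Sum>i<N. z i * (y i - x i)) \<le> 0" if z: "sorted_upto N z" for z
    proof -
      have "(\<Sum>i<b. z i * (y i - \<alpha>)) \<le> 0"
        using prefix full z b(1) by (intro abel_sum_nonpos) (auto simp: sorted_upto_def)
      then have "(\<Sum>i<b. z i * (y i - x i)) \<le> 0" by (simp add: x_def)
      moreover have "sorted_upto (N - b) (\<lambda>i. z (b + i))" using z by (auto simp: sorted_upto_def)
      then have "(\<Sum>i<N - b. z (b + i) * (y (b + i) - x' i)) \<le> 0"
        using x' unfolding isotonic_proj_def by (elim conjE allE[of _ "\<lambda>i. z (b + i)"]) auto
      ultimately show ?thesis unfolding split by (simp add: x_def)
    qed
    show ?thesis using srt ce pol by (auto simp: isotonic_proj_def)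
  qed
qed

text \<open>
  A gap of the projection is dominated by a gap of \<open>y\<close> between indices in the same
  range. In the block of \<open>i\<close> some entry of \<open>y\<close> at or before
  \<open>i\<close> lies above the common value, and in the block of \<open>j\<close> some entry
  at or after \<open>j\<close> lies below it; otherwise shifting part of a block would
  contradict polarity.
\<close>
lemma isotonic_proj_diff_le:
  assumes P: "isotonic_proj N y x" and ij: "j < i" "i < N" and lt: "x j < x i"
  shows "\<exists>k l. j \<le> l \<and> l < k \<and> k \<le> i \<and> x i - x j \<le> y k - y l"
proof -
  have srt: "sorted_upto N x" and ce: "\<And>g. (\<Sum>i<N. g (x i) * (y i - x i)) = 0"
    and pol: "\<And>z. sorted_upto N z \<Longrightarrow> (\<Sum>i<N. z i * (y i - x i)) \<le> 0"
    using P by (auto simp: isotonic_proj_def)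
  have "\<exists>k\<le>i. x k = x i \<and> x i \<le> y k"
  proof (rule ccontr)
    assume "\<not> ?thesis"
    then have neg: "\<And>k. k \<le> i \<Longrightarrow> x k = x i \<Longrightarrow> y k < x i" by force
    have "(\<Sum>k<N. (if i < k then 1 else 0) * (y k - x k)) \<le> 0"
      by (rule pol) (auto simp: sorted_upto_def)
    moreover have "(\<Sum>k<N. (if x i \<le> x k then 1 else 0) * (y k - x k)) = 0"
      using ce[of "\<lambda>r. if x i \<le> r then 1 else 0"] .
    moreover have "(\<Sum>k<N. (if x i \<le> x k then 1 else 0) * (y k - x k))
        < (\<Sum>k<N. (if i < k then 1 else 0) * (y k - x k))"
    proof (rule sum_strict_mono_ex1)
      show "\<forall>k\<in>{..<N}. (if x i \<le> x k then 1 else 0) * (y k - x k)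
          \<le> (if i < k then 1 else 0) * (y k - x k)"
      proof
        fix k assume "k \<in> {..<N}"
        then show "(if x i \<le> x k then 1 else 0) * (y k - x k) \<le> (if i < k then 1 else 0) * (y k - x k)"
          using neg[of k] sorted_uptoD[OF srt, of i k] sorted_uptoD[OF srt, of k i] ij
          by (cases "i < k") auto
      qed
      show "\<exists>k\<in>{..<N}. (if x i \<le> x k then 1 else 0) * (y k - x k)
          < (if i < k then 1 else 0) * (y k - x k)"
        using neg[of i] ij by (intro bexI[of _ i]) auto
    qed simp
    ultimately show False by linarith
  qed
  then obtain k where k: "k \<le> i" "x k = x i" "x i \<le> y k" by blast
  have "\<exists>l\<ge>j. l < N \<and> x l = x j \<and> y l \<le> x j"
  proof (rule ccontr)
    assume "\<not> ?thesis"
    then have pos: "\<And>l. j \<le> l \<Longrightarrow> l < N \<Longrightarrow> x l = x j \<Longrightarrow> x j < y l" by force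
    have "(\<Sum>k<N. (if j \<le> k then 1 else 0) * (y k - x k)) \<le> 0"
      by (rule pol) (auto simp: sorted_upto_def)
    moreover have "(\<Sum>k<N. (if x j < x k then 1 else 0) * (y k - x k)) = 0"
      using ce[of "\<lambda>r. if x j < r then 1 else 0"] .
    moreover have "(\<Sum>k<N. (if x j < x k then 1 else 0) * (y k - x k))
        < (\<Sum>k<N. (if j \<le> k then 1 else 0) * (y k - x k))"
    proof (rule sum_strict_mono_ex1)
      show "\<forall>k\<in>{..<N}. (if x j < x k then 1 else 0) * (y k - x k)
          \<le> (if j \<le> k then 1 else 0) * (y k - x k)"
      proof
        fix k assume "k \<in> {..<N}"
        then show "(if x j < x k then 1 else 0) * (y k - x k) \<le> (if j \<le> k then 1 else 0) * (y k - x k)"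
          using pos[of k] sorted_uptoD[OF srt, of j k] sorted_uptoD[OF srt, of k j] ij
          by (cases "j \<le> k") (auto simp: not_le less_imp_le)
      qed
      show "\<exists>k\<in>{..<N}. (if x j < x k then 1 else 0) * (y k - x k)
          < (if j \<le> k then 1 else 0) * (y k - x k)"
        using pos[of j] ij by (intro bexI[of _ j]) auto
    qed simp
    ultimately show False by linarith
  qed
  then obtain l where l: "j \<le> l" "l < N" "x l = x j" "y l \<le> x j" by blast
  have "l < k"
    using sorted_uptoD[OF srt, of k l] k l lt by force
  then show ?thesis using k l by (intro exI[of _ k] exI[of _ l]) linarith
qed

section \<open>The discrete sticky particle scheme\<close>

text \<open>
  The properties of \<open>w = W'\<close> for an even potential with linear growth of the
  derivative whose sum with \<open>c x\<^sup>2 / 2\<close> is convex.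
\<close>
locale interaction_force =
  fixes w :: "real \<Rightarrow> real" and c C :: real
  assumes w_cont: "continuous_on UNIV w"
    and w_odd: "\<And>x. w (- x) = - w x"
    and w_mono: "\<And>x y. x \<le> y \<Longrightarrow> w x + c * x \<le> w y + c * y"
    and w_growth: "\<And>x. \<bar>w x\<bar> \<le> C * (1 + \<bar>x\<bar>)"
    and c_pos: "0 < c"
begin

lemma C_nonneg: "0 \<le> C"
  using w_growth[of 0] by simp

end

definition level_fun :: "nat \<Rightarrow> (nat \<Rightarrow> real) \<Rightarrow> (nat \<Rightarrow> real) \<Rightarrow> bool" where
  "level_fun N x \<psi> \<longleftrightarrow> (\<forall>i<N. \<forall>j<N. x i = x j \<longrightarrow> \<psi> i = \<psi> j)"

lemma level_funD: "level_fun N x \<psi> \<Longrightarrow> x i = x j \<Longrightarrow> i < N \<Longrightarrow> j < N \<Longrightarrow> \<psi> i = \<psi> j"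
  unfolding level_fun_def by blast

text \<open>
  A sequence that is constant on the blocks of \<open>x\<close> is a function of
  \<open>x\<close>.
\<close>
lemma isotonic_proj_level_sum:
  assumes "isotonic_proj N y x" "level_fun N x \<psi>"
  shows "(\<Sum>i<N. \<psi> i * (y i - x i)) = 0"
proof -
  define g where "g = (\<lambda>r. \<psi> (SOME i. i < N \<and> x i = r))"
  have "g (x i) = \<psi> i" if "i < N" for i
  proof -
    have "(SOME k. k < N \<and> x k = x i) < N \<and> x (SOME k. k < N \<and> x k = x i) = x i"
      by (rule someI[of _ i]) (use that in auto)
    then show ?thesis using assms(2) that unfolding g_def level_fun_def by blast
  qed
  then have "(\<Sum>i<N. \<psi> i * (y i - x i)) = (\<Sum>i<N. g (x i) * (y i - x i))" by simp
  then show ?thesis using assms(1) by (simp add: isotonic_proj_def)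
qed

definition cluster :: "nat \<Rightarrow> (nat \<Rightarrow> real) \<Rightarrow> nat \<Rightarrow> nat set" where
  "cluster N x i = {j. j < N \<and> x j = x i}"

definition cluster_avg :: "nat \<Rightarrow> (nat \<Rightarrow> real) \<Rightarrow> (nat \<Rightarrow> real) \<Rightarrow> nat \<Rightarrow> real" where
  "cluster_avg N x u i = (\<Sum>j\<in>cluster N x i. u j) / card (cluster N x i)"

lemma finite_cluster [simp]: "finite (cluster N x i)"
  by (simp add: cluster_def)

lemma self_in_cluster: "i < N \<Longrightarrow> i \<in> cluster N x i"
  by (simp add: cluster_def)

lemma card_cluster_pos: "i < N \<Longrightarrow> 0 < card (cluster N x i)"
  using self_in_cluster by (metis card_gt_0_iff empty_iff finite_cluster)

lemma level_fun_cluster_avg: "level_fun N x (cluster_avg N x u)"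
  by (simp add: level_fun_def cluster_avg_def cluster_def)

text \<open>
  Averaging over clusters is the orthogonal projection onto the sequences that are constant on
  clusters.
\<close>
lemma cluster_avg_sum:
  assumes "level_fun N x \<psi>"
  shows "(\<Sum>i<N. \<psi> i * cluster_avg N x u i) = (\<Sum>i<N. \<psi> i * u i)"
proof -
  have cl: "(\<Sum>j\<in>cluster N x i. f j) = (\<Sum>j<N. if x j = x i then f j else 0)" for f :: "nat \<Rightarrow> real" and i
    by (rule sum.mono_neutral_cong_left) (auto simp: cluster_def)
  have "(\<Sum>i<N. \<psi> i * cluster_avg N x u i)
      = (\<Sum>i<N. \<Sum>j<N. if x j = x i then \<psi> i / card (cluster N x i) * u j else 0)"
    unfolding cluster_avg_def cl sum_divide_distrib sum_distrib_left
    by (intro sum.cong) auto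
  also have "\<dots> = (\<Sum>i<N. \<Sum>j<N. if x j = x i then \<psi> j / card (cluster N x j) * u j else 0)"
  proof (rule sum.cong[OF refl], rule sum.cong[OF refl])
    fix i j assume ij: "i \<in> {..<N}" "j \<in> {..<N}"
    show "(if x j = x i then \<psi> i / card (cluster N x i) * u j else 0)
        = (if x j = x i then \<psi> j / card (cluster N x j) * u j else 0)"
    proof (cases "x j = x i")
      case True
      then have "\<psi> i = \<psi> j" using level_funD[OF assms, of i j] ij by simp
      moreover have "cluster N x i = cluster N x j" using True by (simp add: cluster_def)
      ultimately show ?thesis by (simp only:)
    qed simp
  qed
  also have "\<dots> = (\<Sum>j<N. \<Sum>i<N. if x i = x j then \<psi> j / card (cluster N x j) * u j else 0)"
    by (subst sum.swap, rule sum.cong[OF refl], rule sum.cong[OF refl]) auto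
  also have "\<dots> = (\<Sum>j<N. \<psi> j * u j)"
  proof (intro sum.cong refl)
    fix j assume "j \<in> {..<N}"
    then show "(\<Sum>i<N. if x i = x j then \<psi> j / card (cluster N x j) * u j else 0) = \<psi> j * u j"
      using self_in_cluster[of j N x] by (auto simp: cl[symmetric])
  qed
  finally show ?thesis .
qed

lemma sinh_ge_self: "0 \<le> x \<Longrightarrow> x \<le> sinh (x::real)"
proof -
  assume "0 \<le> x"
  have "sinh 0 - 0 \<le> sinh x - x"
    by (rule DERIV_nonneg_imp_nondecreasing[OF \<open>0 \<le> x\<close>, where f = "\<lambda>x. sinh x - x"])
       (auto intro!: exI derivative_eq_intros simp: cosh_real_ge_1)
  then show ?thesis by simp
qed

text \<open>
  The second difference of \<open>sinh\<close> equals \<open>2 (cosh \<delta> - 1) sinh\<close>,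
  and \<open>2 (cosh \<delta> - 1) \<ge> \<delta>\<^sup>2\<close>. So on a uniform grid
  \<open>sinh (\<surd>c t)\<close> is a supersolution of the discretised equation \<open>u'' = c
  u\<close>.
\<close>
lemma sinh_second_difference:
  fixes a \<delta> :: real
  assumes "0 \<le> a" "0 \<le> \<delta>"
  shows "\<delta>\<^sup>2 * sinh (a + \<delta>) \<le> sinh (a + 2 * \<delta>) - 2 * sinh (a + \<delta>) + sinh a"
proof -
  have ch: "cosh \<delta> = 1 + 2 * (sinh (\<delta> / 2))\<^sup>2"
    using cosh_double[of "\<delta> / 2"] cosh_square_eq[of "\<delta> / 2"] by simp
  have "(\<delta> / 2)\<^sup>2 \<le> (sinh (\<delta> / 2))\<^sup>2"
    using sinh_ge_self[of "\<delta> / 2"] assms by (intro power_mono) auto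
  then have "\<delta>\<^sup>2 \<le> 2 * (cosh \<delta> - 1)" unfolding ch by (simp add: power_divide)
  then have "\<delta>\<^sup>2 * sinh (a + \<delta>) \<le> 2 * (cosh \<delta> - 1) * sinh (a + \<delta>)"
    using assms by (intro mult_right_mono) auto
  also have "\<dots> = sinh ((a + \<delta>) + \<delta>) - 2 * sinh (a + \<delta>) + sinh ((a + \<delta>) - \<delta>)"
    unfolding sinh_add[of "a + \<delta>" \<delta>] sinh_diff[of "a + \<delta>" \<delta>] by (simp add: algebra_simps)
  also have "(a + \<delta>) + \<delta> = a + 2 * \<delta>" by simp
  also have "(a + \<delta>) - \<delta> = a" by simp
  finally show ?thesis .
qed

text \<open>
  The norm of \<open>L\<^sup>2(0, 1)\<close> for the step function with values \<open>f 0,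
  \<dots>, f (N - 1)\<close> on \<open>N\<close> cells of equal length.
\<close>
definition rms :: "nat \<Rightarrow> (nat \<Rightarrow> real) \<Rightarrow> real" where
  "rms N f = L2_set f {..<N} / sqrt N"

lemma rms_nonneg: "0 \<le> rms N f" by (simp add: rms_def)

lemma rms_triangle: "rms N (\<lambda>i. f i + g i) \<le> rms N f + rms N g"
  unfolding rms_def add_divide_distrib[symmetric]
  by (intro divide_right_mono L2_set_triangle_ineq) simp

lemma rms_scale: "rms N (\<lambda>i. a * f i) = \<bar>a\<bar> * rms N f"
proof -
  have "L2_set (\<lambda>i. a * f i) {..<N} = \<bar>a\<bar> * L2_set f {..<N}"
    by (simp add: L2_set_def power_mult_distrib sum_distrib_left[symmetric] real_sqrt_mult)
  then show ?thesis by (simp add: rms_def)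
qed

lemma rms_mono: "(\<And>i. i < N \<Longrightarrow> \<bar>f i\<bar> \<le> \<bar>g i\<bar>) \<Longrightarrow> rms N f \<le> rms N g"
  unfolding rms_def L2_set_def
  by (intro divide_right_mono real_sqrt_le_mono sum_mono) (auto simp: abs_le_square_iff)

lemma rms_const: "0 < N \<Longrightarrow> rms N (\<lambda>_. a) = \<bar>a\<bar>"
  by (simp add: rms_def L2_set_def real_sqrt_mult)

lemma rms_square: "0 < N \<Longrightarrow> (rms N f)\<^sup>2 = (\<Sum>i<N. (f i)\<^sup>2) / N"
  by (simp add: rms_def L2_set_def power_divide sum_nonneg)

lemma rms_cauchy: "0 < N \<Longrightarrow> \<bar>\<Sum>i<N. f i * g i\<bar> \<le> N * (rms N f * rms N g)"
proof -
  assume N: "0 < N"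
  have "\<bar>\<Sum>i<N. f i * g i\<bar> \<le> (\<Sum>i<N. \<bar>f i\<bar> * \<bar>g i\<bar>)"
    by (rule order_trans[OF sum_abs]) (simp add: abs_mult)
  also have "\<dots> \<le> L2_set f {..<N} * L2_set g {..<N}" by (rule L2_set_mult_ineq)
  also have "\<dots> = N * (rms N f * rms N g)" using N by (simp add: rms_def)
  finally show ?thesis .
qed

lemma rms_le_of_inner:
  assumes "0 < N" "(\<Sum>i<N. (f i)\<^sup>2) \<le> (\<Sum>i<N. f i * g i)"
  shows "rms N f \<le> rms N g"
proof -
  have "N * (rms N f * rms N f) \<le> N * (rms N f * rms N g)"
    using assms rms_cauchy[OF assms(1), of f g] rms_square[OF assms(1), of f]
    by (simp add: power2_eq_square field_simps)
  then have "rms N f * rms N f \<le> rms N f * rms N g" using assms(1) by simp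
  then show ?thesis
    using rms_nonneg[of N f] rms_nonneg[of N g] by (cases "rms N f = 0") (auto simp: mult_le_cancel_left)
qed

lemma rms_mean: "0 < N \<Longrightarrow> (\<Sum>i<N. \<bar>f i\<bar>) / N \<le> rms N f"
proof -
  assume N: "0 < N"
  have "(\<Sum>i<N. \<bar>f i\<bar>) = \<bar>\<Sum>i<N. 1 * \<bar>f i\<bar>\<bar>" by (simp add: sum_nonneg)
  also have "\<dots> \<le> N * (rms N (\<lambda>_. 1) * rms N (\<lambda>i. \<bar>f i\<bar>))" by (rule rms_cauchy[OF N])
  also have "rms N (\<lambda>i. \<bar>f i\<bar>) = rms N f" by (simp add: rms_def L2_set_def)
  finally show ?thesis using N by (simp add: rms_const field_simps)
qed

locale sticky_particles = interaction_force +
  fixes N :: nat and h :: real and x0 :: "nat \<Rightarrow> real" and v0 :: "real \<Rightarrow> real"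
  assumes N_pos: "0 < N" and h_pos: "0 < h" and h_le: "h \<le> 1" and x0_sorted: "sorted_upto N x0"
begin

definition force :: "(nat \<Rightarrow> real) \<Rightarrow> nat \<Rightarrow> real" where
  "force x i = - (\<Sum>j<N. w (x i - x j)) / N"

text \<open>
  Positions and velocities after \<open>n\<close> steps. The force enters the velocity only
  after the averaging over clusters; as it is itself a function of the position, particles at
  the same place keep a common velocity.
\<close>
primrec traj :: "nat \<Rightarrow> (nat \<Rightarrow> real) \<times> (nat \<Rightarrow> real)" where
  "traj 0 = (x0, \<lambda>i. v0 (x0 i) + h * force x0 i)"
| "traj (Suc n) =
     (let x = (SOME x. isotonic_proj N (\<lambda>i. fst (traj n) i + h * snd (traj n) i) x)
      in (x, \<lambda>i. cluster_avg N x (snd (traj n)) i + h * force x i))"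

definition pos :: "nat \<Rightarrow> nat \<Rightarrow> real" where "pos n = fst (traj n)"
definition vel :: "nat \<Rightarrow> nat \<Rightarrow> real" where "vel n = snd (traj n)"

lemma pos_0: "pos 0 = x0" and vel_0: "vel 0 = (\<lambda>i. v0 (x0 i) + h * force x0 i)"
  by (simp_all add: pos_def vel_def)

lemma pos_Suc: "isotonic_proj N (\<lambda>i. pos n i + h * vel n i) (pos (Suc n))"
  unfolding pos_def vel_def by (simp add: Let_def) (rule someI_ex[OF isotonic_proj_exists])

lemma vel_Suc: "vel (Suc n) = (\<lambda>i. cluster_avg N (pos (Suc n)) (vel n) i + h * force (pos (Suc n)) i)"
  by (simp add: pos_def vel_def Let_def)

lemma pos_sorted: "sorted_upto N (pos n)"
  using x0_sorted pos_Suc by (cases n) (auto simp: pos_0 isotonic_proj_def)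

lemma level_fun_force: "level_fun N x (force x)"
  by (simp add: level_fun_def force_def)

lemma level_fun_vel: "level_fun N (pos n) (vel n)"
proof (cases n)
  case 0
  then show ?thesis by (simp add: level_fun_def pos_0 vel_0 force_def)
next
  case (Suc k)
  show ?thesis
    unfolding Suc level_fun_def vel_Suc
    using level_funD[OF level_fun_cluster_avg[of N "pos (Suc k)" "vel k"]] level_funD[OF level_fun_force[of "pos (Suc k)"]]
    by metis
qed

text \<open>
  Particles that meet never separate. They share position and velocity, hence the tentative
  position, and the projection opens a gap only where the tentative positions have one.
\<close>
lemma stick_Suc:
  assumes "i < N" "j < N" "pos n i = pos n j"
  shows "pos (Suc n) i = pos (Suc n) j"
proof -
  have *: "\<not> pos (Suc n) j < pos (Suc n) i" if ij: "j < i" "i < N" and eq: "pos n i = pos n j" for i j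
  proof
    assume "pos (Suc n) j < pos (Suc n) i"
    from isotonic_proj_diff_le[OF pos_Suc ij this]
    obtain k l where kl: "j \<le> l" "l < k" "k \<le> i"
      "pos (Suc n) i - pos (Suc n) j \<le> (pos n k + h * vel n k) - (pos n l + h * vel n l)" by blast
    have "pos n k = pos n l"
      using sorted_uptoD[OF pos_sorted[of n], of j l] sorted_uptoD[OF pos_sorted[of n], of l k]
        sorted_uptoD[OF pos_sorted[of n], of k i] kl ij eq by simp
    then have "vel n k = vel n l" using level_funD[OF level_fun_vel, of n k l] kl ij by simp
    with kl \<open>pos n k = pos n l\<close> \<open>pos (Suc n) j < pos (Suc n) i\<close> show False by simp
  qed
  show ?thesis
    using *[of j i] *[of i j] assms sorted_uptoD[OF pos_sorted[of "Suc n"], of i j]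
      sorted_uptoD[OF pos_sorted[of "Suc n"], of j i]
    by (cases i j rule: linorder_cases) auto
qed

lemma stick: "k \<le> n \<Longrightarrow> level_fun N (pos n) \<psi> \<Longrightarrow> level_fun N (pos k) \<psi>"
proof (induction rule: inc_induct)
  case (step k)
  then show ?case unfolding level_fun_def using stick_Suc[of _ _ k] by blast
qed

text \<open>
  A weight that is constant on the clusters at time \<open>n\<close> is constant on the smaller
  clusters of all earlier times, so neither the projection nor the averaging is seen by it: the
  weighted positions and velocities evolve freely up to time \<open>n\<close>.
\<close>
lemma cluster_momentum:
  assumes "level_fun N (pos n) \<psi>" "Suc k \<le> n"
  shows "(\<Sum>i<N. \<psi> i * pos (Suc k) i) = (\<Sum>i<N. \<psi> i * pos k i) + h * (\<Sum>i<N. \<psi> i * vel k i)"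
    and "(\<Sum>i<N. \<psi> i * vel (Suc k) i)
       = (\<Sum>i<N. \<psi> i * vel k i) + h * (\<Sum>i<N. \<psi> i * force (pos (Suc k)) i)"
proof -
  have lf: "level_fun N (pos (Suc k)) \<psi>" using stick assms by blast
  show "(\<Sum>i<N. \<psi> i * pos (Suc k) i) = (\<Sum>i<N. \<psi> i * pos k i) + h * (\<Sum>i<N. \<psi> i * vel k i)"
    using isotonic_proj_level_sum[OF pos_Suc lf]
    by (simp add: algebra_simps sum.distrib sum_subtractf sum_distrib_left)
  show "(\<Sum>i<N. \<psi> i * vel (Suc k) i)
       = (\<Sum>i<N. \<psi> i * vel k i) + h * (\<Sum>i<N. \<psi> i * force (pos (Suc k)) i)"
    using cluster_avg_sum[OF lf, of "vel k"]
    by (simp add: vel_Suc algebra_simps sum.distrib sum_distrib_left)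
qed

text \<open>
  Velocity and position of the particle \<open>i\<close> after \<open>n\<close> steps under the
  same forces, but without any sticking.
\<close>
definition impulse :: "nat \<Rightarrow> nat \<Rightarrow> real" where
  "impulse n i = v0 (x0 i) + h * (\<Sum>j<Suc n. force (pos j) i)"

definition free_pos :: "nat \<Rightarrow> nat \<Rightarrow> real" where
  "free_pos n i = x0 i + h * (\<Sum>k<n. impulse k i)"

text \<open>
  The discrete form of \<open>X\<^sub>t = E[Y\<^sub>t | X\<^sub>t]\<close>.
\<close>
lemma free_pos_level_sum:
  assumes "level_fun N (pos n) \<psi>"
  shows "(\<Sum>i<N. \<psi> i * (pos n i - free_pos n i)) = 0"
proof -
  have vz: "(\<Sum>i<N. \<psi> i * vel k i) = (\<Sum>i<N. \<psi> i * impulse k i)" if "k \<le> n" for k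
    using that
  proof (induction k)
    case 0
    then show ?case by (simp add: vel_0 impulse_def pos_0)
  next
    case (Suc k)
    have "(\<Sum>i<N. \<psi> i * impulse (Suc k) i)
        = (\<Sum>i<N. \<psi> i * impulse k i) + h * (\<Sum>i<N. \<psi> i * force (pos (Suc k)) i)"
      by (simp add: impulse_def algebra_simps sum.distrib sum_distrib_left)
    then show ?case using Suc cluster_momentum(2)[OF assms, of k] by simp
  qed
  have "(\<Sum>i<N. \<psi> i * pos k i) = (\<Sum>i<N. \<psi> i * free_pos k i)" if "k \<le> n" for k
    using that
  proof (induction k)
    case 0
    then show ?case by (simp add: free_pos_def pos_0)
  next
    case (Suc k)
    have "(\<Sum>i<N. \<psi> i * free_pos (Suc k) i)
        = (\<Sum>i<N. \<psi> i * free_pos k i) + h * (\<Sum>i<N. \<psi> i * impulse k i)"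
      by (simp add: free_pos_def algebra_simps sum.distrib sum_distrib_left)
    then show ?case using Suc cluster_momentum(1)[OF assms, of k] vz[of k] by simp
  qed
  from this[of n] show ?thesis by (simp add: algebra_simps sum_subtractf)
qed

text \<open>
  Monotonicity of \<open>w x + c x\<close>, applied to each summand of the force.
\<close>
lemma force_diff_le:
  assumes "x b \<le> x a"
  shows "force x a - force x b \<le> c * (x a - x b)"
proof -
  have "(\<Sum>j<N. w (x b - x j) - w (x a - x j)) \<le> (\<Sum>j<N. c * (x a - x b))"
    using w_mono[of "x b - x j" "x a - x j" for j] assms
    by (intro sum_mono) (simp add: algebra_simps)
  then have "(\<Sum>j<N. w (x b - x j)) - (\<Sum>j<N. w (x a - x j)) \<le> N * (c * (x a - x b))"
    by (simp add: sum_subtractf)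
  then show ?thesis using N_pos by (simp add: force_def field_simps)
qed

definition sinh_grid :: "nat \<Rightarrow> real" where "sinh_grid n = sinh (sqrt c * (n * h))"

lemma sinh_grid_mono: "n \<le> n' \<Longrightarrow> sinh_grid n \<le> sinh_grid n'"
  using c_pos h_pos by (simp add: sinh_grid_def)

lemma sinh_grid_pos: "0 < n \<Longrightarrow> 0 < sinh_grid n"
  using c_pos h_pos by (simp add: sinh_grid_def)

lemma sinh_grid_0: "sinh_grid 0 = 0" by (simp add: sinh_grid_def)

lemma sinh_grid_step: "(sinh_grid (Suc n) - sinh_grid n) / h + h * c * sinh_grid (Suc n) \<le> (sinh_grid (Suc (Suc n)) - sinh_grid (Suc n)) / h"
proof -
  have "(sqrt c * h)\<^sup>2 * sinh_grid (Suc n) \<le> sinh_grid (Suc (Suc n)) - 2 * sinh_grid (Suc n) + sinh_grid n"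
    using sinh_second_difference[of "sqrt c * (n * h)" "sqrt c * h"] c_pos h_pos
    by (simp add: sinh_grid_def algebra_simps)
  then have "h * (h * c * sinh_grid (Suc n)) \<le> sinh_grid (Suc (Suc n)) - 2 * sinh_grid (Suc n) + sinh_grid n"
    using c_pos by (simp add: power2_eq_square algebra_simps)
  then have "h * c * sinh_grid (Suc n) \<le> (sinh_grid (Suc (Suc n)) - 2 * sinh_grid (Suc n) + sinh_grid n) / h"
    using h_pos by (simp add: pos_le_divide_eq mult_ac)
  then show ?thesis by (simp add: diff_divide_distrib add_divide_distrib)
qed

text \<open>
  A discrete Wronskian argument. Let \<open>u \<ge> 0\<close> be the distance, as a function of
  time, between the centres of mass of the particles that form the two clusters at time
  \<open>n\<close>. By \<open>cluster_momentum\<close> these centres move freely until then, so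
  \<open>u'' \<le> c u\<close> in discrete form, while \<open>sinh\<close> satisfies the reverse
  inequality and starts from \<open>0\<close>. Hence \<open>u' sinh - u sinh' \<le> 0\<close> up
  to time \<open>n\<close>.
\<close>
lemma vel_diff_le:
  assumes ij: "i < N" "j < N" and le: "pos n j \<le> pos n i"
  shows "(vel n i - vel n j) * sinh_grid n \<le> (pos n i - pos n j) * ((sinh_grid (Suc n) - sinh_grid n) / h)"
proof (cases "pos n j = pos n i")
  case True
  then have "vel n i = vel n j" using level_funD[OF level_fun_vel, of n i j] ij by simp
  with True show ?thesis by simp
next
  case False
  then have lt: "pos n j < pos n i" using le by simp
  define A where "A = cluster N (pos n) i"
  define B where "B = cluster N (pos n) j"
  \<comment> \<open>the difference between the centres of mass of the clusters of \<open>i\<close> and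
      \<open>j\<close>\<close>
  define wt where "wt l = (if l \<in> A then 1 / card A else 0) - (if l \<in> B then 1 / card B else (0::real))" for l
  have cA: "0 < card A" and cB: "0 < card B"
    using ij by (auto simp: A_def B_def card_cluster_pos)
  have fin: "finite A" "finite B" by (auto simp: A_def B_def)
  have AB: "b < a \<and> a < N" if "a \<in> A" "b \<in> B" for a b
    using that lt sorted_uptoD[OF pos_sorted[of n], of a b]
    by (force simp: A_def B_def cluster_def not_less[symmetric])
  have lf: "level_fun N (pos n) wt"
    by (auto simp: level_fun_def wt_def A_def B_def cluster_def)
  have dbl: "(\<Sum>l<N. wt l * f l) = (\<Sum>a\<in>A. \<Sum>b\<in>B. f a - f b) / (card A * card B)" for f
  proof -
    have "(\<Sum>l<N. wt l * f l) = (\<Sum>l<N. if l \<in> A then f l / card A else 0) - (\<Sum>l<N. if l \<in> B then f l / card B else 0)"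
      unfolding sum_subtractf[symmetric] by (intro sum.cong) (auto simp: wt_def algebra_simps)
    also have "(\<Sum>l<N. if l \<in> A then f l / card A else 0) = (\<Sum>a\<in>A. f a / card A)"
      by (rule sum.mono_neutral_cong_right) (auto simp: A_def cluster_def)
    also have "(\<Sum>l<N. if l \<in> B then f l / card B else 0) = (\<Sum>a\<in>B. f a / card B)"
      by (rule sum.mono_neutral_cong_right) (auto simp: B_def cluster_def)
    finally show ?thesis
      using cA cB
      by (simp add: sum_subtractf sum_divide_distrib[symmetric] sum_distrib_left[symmetric]
          sum_distrib_right[symmetric] field_simps)
  qed
  define u where "u k = (\<Sum>l<N. wt l * pos k l)" for k
  define p where "p k = (\<Sum>l<N. wt l * vel k l)" for k
  have u_nonneg: "0 \<le> u k" for k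
    unfolding u_def dbl
    using AB sorted_uptoD[OF pos_sorted[of k]] by (intro divide_nonneg_nonneg sum_nonneg) (auto simp: less_imp_le)
  have f_le: "(\<Sum>l<N. wt l * force (pos k) l) \<le> c * u k" for k
  proof -
    have "(\<Sum>a\<in>A. \<Sum>b\<in>B. force (pos k) a - force (pos k) b) \<le> (\<Sum>a\<in>A. \<Sum>b\<in>B. c * (pos k a - pos k b))"
      using AB sorted_uptoD[OF pos_sorted[of k]]
      by (intro sum_mono force_diff_le) (auto simp: less_imp_le)
    then show ?thesis
      unfolding u_def dbl using cA cB by (simp add: sum_distrib_left[symmetric] divide_right_mono)
  qed
  \<comment> \<open>the Wronskian of \<open>u\<close> and \<open>sinh\<close>, with \<open>p\<close>
      as the velocity of \<open>u\<close>\<close>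
  have wron: "p k * sinh_grid k \<le> u k * ((sinh_grid (Suc k) - sinh_grid k) / h)" if "k \<le> n" for k
    using that
  proof (induction k)
    case 0
    then show ?case using u_nonneg[of 0] sinh_grid_mono[of 0 1] h_pos by (simp add: sinh_grid_0)
  next
    case (Suc k)
    define q where "q = (sinh_grid (Suc k) - sinh_grid k) / h"
    have uS: "u (Suc k) = u k + h * p k" and pS: "p (Suc k) = p k + h * (\<Sum>l<N. wt l * force (pos (Suc k)) l)"
      using cluster_momentum[OF lf] Suc.prems by (auto simp: u_def p_def)
    have "sinh_grid (Suc k) = sinh_grid k + h * q" using h_pos by (simp add: q_def)
    then have gS: "p k * sinh_grid (Suc k) = p k * sinh_grid k + h * p k * q" by (simp add: algebra_simps)
    have "p (Suc k) * sinh_grid (Suc k) \<le> (p k + h * (c * u (Suc k))) * sinh_grid (Suc k)"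
      unfolding pS using f_le[of "Suc k"] h_pos sinh_grid_pos[of "Suc k"]
      by (intro mult_right_mono add_left_mono mult_left_mono) auto
    also have "\<dots> = p k * sinh_grid k + h * p k * q + u (Suc k) * (h * c * sinh_grid (Suc k))"
      using gS by (simp add: algebra_simps)
    also have "\<dots> \<le> u k * q + h * p k * q + u (Suc k) * (h * c * sinh_grid (Suc k))"
      using Suc by (simp add: q_def)
    also have "\<dots> = u (Suc k) * (q + h * c * sinh_grid (Suc k))"
      by (simp add: uS algebra_simps)
    also have "\<dots> \<le> u (Suc k) * ((sinh_grid (Suc (Suc k)) - sinh_grid (Suc k)) / h)"
      unfolding q_def using sinh_grid_step u_nonneg by (intro mult_left_mono) auto
    finally show ?case .
  qed
  have "u n = pos n i - pos n j"
  proof -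
    have "(\<Sum>a\<in>A. \<Sum>b\<in>B. pos n a - pos n b) = (\<Sum>a\<in>A. \<Sum>b\<in>B. pos n i - pos n j)"
      by (intro sum.cong) (auto simp: A_def B_def cluster_def)
    then show ?thesis unfolding u_def dbl using cA cB by simp
  qed
  moreover have "p n = vel n i - vel n j"
  proof -
    have "(\<Sum>a\<in>A. \<Sum>b\<in>B. vel n a - vel n b) = (\<Sum>a\<in>A. \<Sum>b\<in>B. vel n i - vel n j)"
    proof (intro sum.cong refl)
      fix a b assume "a \<in> A" "b \<in> B"
      then have "vel n a = vel n i" "vel n b = vel n j"
        using level_funD[OF level_fun_vel, of n a i] level_funD[OF level_fun_vel, of n b j] ij
        by (auto simp: A_def B_def cluster_def)
      then show "vel n a - vel n b = vel n i - vel n j" by simp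
    qed
    then show ?thesis unfolding p_def dbl using cA cB by simp
  qed
  ultimately show ?thesis using wron[of n] by simp
qed

text \<open>
  One step of the monotonicity of \<open>(x\<^sub>i - x\<^sub>j) / sinh\<close>: the gap after
  the step is dominated by a tentative gap between two particles \<open>k, l\<close> in between,
  and \<open>vel_diff_le\<close> bounds the growth of that gap.
\<close>
lemma pos_diff_Suc:
  assumes "j \<le> i" "i < N"
  shows "(pos (Suc n) i - pos (Suc n) j) * sinh_grid n \<le> (pos n i - pos n j) * sinh_grid (Suc n)"
proof (cases "pos (Suc n) j < pos (Suc n) i")
  case True
  then have "j < i" using assms by (cases "i = j") auto
  from isotonic_proj_diff_le[OF pos_Suc this assms(2) True]
  obtain k l where kl: "j \<le> l" "l < k" "k \<le> i"
    "pos (Suc n) i - pos (Suc n) j \<le> (pos n k + h * vel n k) - (pos n l + h * vel n l)" by blast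
  have srt: "pos n j \<le> pos n l" "pos n l \<le> pos n k" "pos n k \<le> pos n i"
    using kl assms by (auto intro!: sorted_uptoD[OF pos_sorted])
  have gn: "0 \<le> sinh_grid n" using sinh_grid_mono[of 0 n] by (simp add: sinh_grid_0)
  have "(pos (Suc n) i - pos (Suc n) j) * sinh_grid n \<le> ((pos n k - pos n l) + h * (vel n k - vel n l)) * sinh_grid n"
    using kl(4) gn by (intro mult_right_mono) (auto simp: algebra_simps)
  also have "\<dots> = (pos n k - pos n l) * sinh_grid n + h * ((vel n k - vel n l) * sinh_grid n)"
    by (simp add: algebra_simps)
  also have "\<dots> \<le> (pos n k - pos n l) * sinh_grid n + h * ((pos n k - pos n l) * ((sinh_grid (Suc n) - sinh_grid n) / h))"
    using vel_diff_le[of k l n] kl assms srt h_pos by (intro add_left_mono mult_left_mono) auto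
  also have "\<dots> = (pos n k - pos n l) * sinh_grid (Suc n)"
    using h_pos by (simp add: field_simps)
  also have "\<dots> \<le> (pos n i - pos n j) * sinh_grid (Suc n)"
    using srt sinh_grid_pos[of "Suc n"] by (intro mult_right_mono) auto
  finally show ?thesis .
next
  case False
  then have "(pos (Suc n) i - pos (Suc n) j) * sinh_grid n \<le> 0"
    using sinh_grid_mono[of 0 n] by (simp add: sinh_grid_0 mult_nonpos_nonneg)
  also have "0 \<le> (pos n i - pos n j) * sinh_grid (Suc n)"
    using sorted_uptoD[OF pos_sorted[of n] assms] sinh_grid_pos[of "Suc n"] by simp
  finally show ?thesis .
qed

lemma pos_diff_sinh_grid:
  assumes "j \<le> i" "i < N" "0 < n" "n \<le> n'"
  shows "(pos n' i - pos n' j) * sinh_grid n \<le> (pos n i - pos n j) * sinh_grid n'"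
  using assms(4)
proof (induction rule: dec_induct)
  case (step k)
  have pk: "0 < sinh_grid k" "0 < sinh_grid n" "0 < sinh_grid (Suc k)" using step assms by (auto intro!: sinh_grid_pos)
  have "((pos (Suc k) i - pos (Suc k) j) * sinh_grid n) * sinh_grid k = ((pos (Suc k) i - pos (Suc k) j) * sinh_grid k) * sinh_grid n"
    by simp
  also have "\<dots> \<le> ((pos k i - pos k j) * sinh_grid (Suc k)) * sinh_grid n"
    using pos_diff_Suc[OF assms(1,2), of k] pk by (intro mult_right_mono) auto
  also have "\<dots> = ((pos k i - pos k j) * sinh_grid n) * sinh_grid (Suc k)" by simp
  also have "\<dots> \<le> ((pos n i - pos n j) * sinh_grid k) * sinh_grid (Suc k)"
    using step pk by (intro mult_right_mono) auto
  finally have "((pos (Suc k) i - pos (Suc k) j) * sinh_grid n) * sinh_grid k \<le> ((pos n i - pos n j) * sinh_grid (Suc k)) * sinh_grid k"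
    by (simp add: mult_ac)
  then show ?case using pk by simp
qed simp

lemma rms_force_le: "rms N (force x) \<le> C * (1 + 2 * rms N x)"
proof -
  have bd: "\<bar>force x i\<bar> \<le> \<bar>C * (1 + rms N x) + C * \<bar>x i\<bar>\<bar>" for i
  proof -
    have "\<bar>\<Sum>j<N. w (x i - x j)\<bar> \<le> (\<Sum>j<N. C * (1 + \<bar>x i\<bar>) + C * \<bar>x j\<bar>)"
    proof (rule order_trans[OF sum_abs sum_mono])
      fix j
      have "\<bar>w (x i - x j)\<bar> \<le> C * (1 + \<bar>x i - x j\<bar>)" by (rule w_growth)
      also have "\<dots> \<le> C * (1 + (\<bar>x i\<bar> + \<bar>x j\<bar>))"
        using C_nonneg by (intro mult_left_mono add_left_mono) auto
      finally show "\<bar>w (x i - x j)\<bar> \<le> C * (1 + \<bar>x i\<bar>) + C * \<bar>x j\<bar>" by (simp add: algebra_simps)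
    qed
    then have "\<bar>force x i\<bar> \<le> C * (1 + \<bar>x i\<bar>) + C * ((\<Sum>j<N. \<bar>x j\<bar>) / N)"
      using N_pos by (simp add: force_def abs_divide sum.distrib sum_distrib_left[symmetric] field_simps)
    also have "\<dots> \<le> C * (1 + \<bar>x i\<bar>) + C * rms N x"
      using C_nonneg rms_mean[OF N_pos] by (intro add_left_mono mult_left_mono) auto
    finally show ?thesis by (simp add: algebra_simps)
  qed
  have "rms N (force x) \<le> rms N (\<lambda>i. C * (1 + rms N x) + C * \<bar>x i\<bar>)"
    by (rule rms_mono) (rule bd)
  also have "\<dots> \<le> rms N (\<lambda>i. C * (1 + rms N x)) + rms N (\<lambda>i. C * \<bar>x i\<bar>)"
    by (rule rms_triangle)
  also have "rms N (\<lambda>i. C * (1 + rms N x)) = C * (1 + rms N x)"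
    using N_pos C_nonneg rms_nonneg[of N x] by (simp add: rms_const abs_mult)
  also have "rms N (\<lambda>i. C * \<bar>x i\<bar>) = C * rms N (\<lambda>i. \<bar>x i\<bar>)" using C_nonneg by (simp only: rms_scale abs_of_nonneg)
  also have "rms N (\<lambda>i. \<bar>x i\<bar>) = rms N x" by (simp add: rms_def L2_set_def)
  finally show ?thesis by (simp add: algebra_simps)
qed

text \<open>
  Projections do not increase the norm.
\<close>
lemma rms_pos_Suc: "rms N (pos (Suc n)) \<le> rms N (pos n) + h * rms N (vel n)"
proof -
  have "(\<Sum>i<N. pos (Suc n) i * ((pos n i + h * vel n i) - pos (Suc n) i)) = 0"
    using isotonic_proj_level_sum[OF pos_Suc[of n], where \<psi> = "pos (Suc n)"] by (simp add: level_fun_def)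
  then have "(\<Sum>i<N. (pos (Suc n) i)\<^sup>2) \<le> (\<Sum>i<N. pos (Suc n) i * (pos n i + h * vel n i))"
    by (simp add: right_diff_distrib sum_subtractf power2_eq_square)
  from rms_le_of_inner[OF N_pos this] show ?thesis
    using rms_triangle[of N "pos n" "\<lambda>i. h * vel n i"] h_pos by (simp add: rms_scale)
qed

lemma rms_vel_Suc: "rms N (vel (Suc n)) \<le> rms N (vel n) + h * (C * (1 + 2 * rms N (pos (Suc n))))"
proof -
  let ?a = "cluster_avg N (pos (Suc n)) (vel n)"
  have "(\<Sum>i<N. (?a i)\<^sup>2) \<le> (\<Sum>i<N. ?a i * vel n i)"
    using cluster_avg_sum[OF level_fun_cluster_avg, of N "pos (Suc n)" "vel n" "vel n"]
    by (simp add: power2_eq_square)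
  from rms_le_of_inner[OF N_pos this] have "rms N ?a \<le> rms N (vel n)" .
  moreover have "rms N (vel (Suc n)) \<le> rms N ?a + rms N (\<lambda>i. h * force (pos (Suc n)) i)"
    unfolding vel_Suc by (rule rms_triangle)
  moreover have "rms N (\<lambda>i. h * force (pos (Suc n)) i) \<le> h * (C * (1 + 2 * rms N (pos (Suc n))))"
    using rms_force_le h_pos by (simp add: rms_scale)
  ultimately show ?thesis by linarith
qed

lemma energy_growth:
  "1 + rms N (pos n) + rms N (vel n) \<le> (1 + rms N (pos 0) + rms N (vel 0)) * exp ((1 + 2 * C) * (n * h))"
proof (induction n)
  case (Suc n)
  let ?e = "1 + rms N (pos n) + rms N (vel n)"
  have nn: "0 \<le> rms N (pos n)" "0 \<le> rms N (vel n)" by (auto simp: rms_nonneg)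
  have "h * rms N (vel n) \<le> rms N (vel n)" using h_le h_pos nn by (simp add: mult_left_le_one_le)
  then have "rms N (pos (Suc n)) \<le> rms N (pos n) + rms N (vel n)" using rms_pos_Suc[of n] by linarith
  then have "h * (C * (1 + 2 * rms N (pos (Suc n)))) \<le> h * (C * (2 * ?e))"
    using h_pos C_nonneg by (intro mult_left_mono) auto
  then have "rms N (vel (Suc n)) \<le> rms N (vel n) + h * (C * (2 * ?e))"
    using rms_vel_Suc[of n] by linarith
  moreover have "h * rms N (vel n) \<le> h * ?e" using h_pos nn by (intro mult_left_mono) auto
  ultimately have "1 + rms N (pos (Suc n)) + rms N (vel (Suc n)) \<le> ?e + h * ?e + h * (C * (2 * ?e))"
    using rms_pos_Suc[of n] by linarith
  also have "\<dots> = ?e * (1 + (1 + 2 * C) * h)" by (simp add: algebra_simps)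
  also have "\<dots> \<le> ?e * exp ((1 + 2 * C) * h)"
    using nn by (intro mult_left_mono exp_ge_add_one_self) auto
  also have "\<dots> \<le> ((1 + rms N (pos 0) + rms N (vel 0)) * exp ((1 + 2 * C) * (n * h))) * exp ((1 + 2 * C) * h)"
    using Suc by (intro mult_right_mono) auto
  finally show ?case by (simp add: exp_add[symmetric] algebra_simps)
qed simp

text \<open>
  The projection is nonexpansive and fixes the sorted sequence \<open>pos n\<close>.
\<close>
lemma rms_pos_step: "rms N (\<lambda>i. pos (Suc n) i - pos n i) \<le> h * rms N (vel n)"
proof -
  let ?y = "\<lambda>i. pos n i + h * vel n i" and ?x' = "pos (Suc n)"
  have e: "(\<Sum>i<N. ?x' i * (?y i - ?x' i)) = 0"
    using isotonic_proj_level_sum[OF pos_Suc[of n], where \<psi> = "pos (Suc n)"] by (simp add: level_fun_def)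
  have l: "(\<Sum>i<N. pos n i * (?y i - ?x' i)) \<le> 0"
    using pos_Suc[of n] pos_sorted[of n] unfolding isotonic_proj_def by blast
  have "(\<Sum>i<N. (?x' i - pos n i)\<^sup>2)
      = (\<Sum>i<N. (?x' i - pos n i) * (h * vel n i)) - ((\<Sum>i<N. ?x' i * (?y i - ?x' i)) - (\<Sum>i<N. pos n i * (?y i - ?x' i)))"
    unfolding sum_subtractf[symmetric] by (intro sum.cong) (auto simp: power2_eq_square algebra_simps)
  then have "(\<Sum>i<N. (?x' i - pos n i)\<^sup>2) \<le> (\<Sum>i<N. (?x' i - pos n i) * (h * vel n i))"
    using e l by linarith
  from rms_le_of_inner[OF N_pos this] show ?thesis using h_pos by (simp add: rms_scale)
qed

lemma rms_pos_diff:
  assumes "n \<le> n'" and K: "\<And>k. k < n' \<Longrightarrow> rms N (vel k) \<le> K"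
  shows "rms N (\<lambda>i. pos n' i - pos n i) \<le> K * (h * (n' - n))"
  using assms
proof (induction rule: dec_induct)
  case base
  then show ?case by (simp add: rms_def L2_set_def)
next
  case (step k)
  have "rms N (\<lambda>i. pos (Suc k) i - pos n i) \<le> rms N (\<lambda>i. pos (Suc k) i - pos k i) + rms N (\<lambda>i. pos k i - pos n i)"
    using rms_triangle[of N "\<lambda>i. pos (Suc k) i - pos k i" "\<lambda>i. pos k i - pos n i"] by simp
  also have "\<dots> \<le> h * K + K * (h * (k - n))"
  proof (rule add_mono)
    have "h * rms N (vel k) \<le> h * K" using h_pos step.prems[of k] by (intro mult_left_mono) auto
    then show "rms N (\<lambda>i. pos (Suc k) i - pos k i) \<le> h * K" using rms_pos_step[of k] by linarith
    show "rms N (\<lambda>i. pos k i - pos n i) \<le> K * (h * (k - n))" by (rule step.IH) (use step.prems in auto)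
  qed
  finally show ?case using step by (simp add: algebra_simps of_nat_diff)
qed

lemma energy_bound:
  assumes "\<And>x. \<bar>v0 x\<bar> \<le> D * (1 + \<bar>x\<bar>)" "rms N x0 \<le> A" "0 \<le> D"
  shows "1 + rms N (pos n) + rms N (vel n)
    \<le> (1 + A + D * (1 + A) + C * (1 + 2 * A)) * exp ((1 + 2 * C) * (n * h))"
proof -
  have "rms N (\<lambda>i. v0 (x0 i)) \<le> rms N (\<lambda>i. D + D * \<bar>x0 i\<bar>)"
    using assms(1)[of "x0 i" for i] assms(3) by (intro rms_mono) (simp add: algebra_simps)
  also have "\<dots> \<le> rms N (\<lambda>i. D) + rms N (\<lambda>i. D * \<bar>x0 i\<bar>)" by (rule rms_triangle)
  also have "\<dots> = D + D * rms N (\<lambda>i. \<bar>x0 i\<bar>)" using N_pos assms(3) by (simp add: rms_const rms_scale)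
  also have "rms N (\<lambda>i. \<bar>x0 i\<bar>) = rms N x0" by (simp add: rms_def L2_set_def)
  finally have 1: "rms N (\<lambda>i. v0 (x0 i)) \<le> D + D * A" using assms by (smt (verit) mult_left_mono)
  have "rms N (\<lambda>i. h * force x0 i) \<le> C * (1 + 2 * rms N x0)"
    using rms_force_le[of x0] h_le h_pos rms_nonneg[of N "force x0"]
    by (simp add: rms_scale) (smt (verit) mult_left_le_one_le)
  also have "\<dots> \<le> C * (1 + 2 * A)" using assms C_nonneg by (intro mult_left_mono) auto
  finally have "rms N (vel 0) \<le> D + D * A + C * (1 + 2 * A)"
    using rms_triangle[of N "\<lambda>i. v0 (x0 i)" "\<lambda>i. h * force x0 i"] 1 by (simp add: vel_0)
  then have "1 + rms N (pos 0) + rms N (vel 0) \<le> 1 + A + D * (1 + A) + C * (1 + 2 * A)"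
    using assms(2) by (simp add: pos_0 algebra_simps)
  then show ?thesis
    using energy_growth[of n] mult_right_mono[of _ _ "exp ((1 + 2 * C) * (n * h))"]
    by (meson exp_ge_zero order_trans)
qed

end

section \<open>Square-integrable functions on the unit interval\<close>

text \<open>
  The space of mass labels: Lebesgue measure on the open unit interval.
\<close>
abbreviation U :: "real measure" where "U \<equiv> restrict_space lborel {0<..<1}"

lemma space_U [simp]: "space U = {0<..<1}" by (simp add: space_restrict_space)

lemma prob_space_U: "prob_space U"
  by (rule prob_spaceI) (simp add: emeasure_restrict_space space_restrict_space)

interpretation U: prob_space U by (rule prob_space_U)

lemma borel_measurable_U [measurable (raw)]: "f \<in> borel_measurable borel \<Longrightarrow> f \<in> borel_measurable U"
  by (simp add: measurable_restrict_space1)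

lemma integral_U: "(\<integral>m. f m \<partial>U) = (LBINT m:{0<..<1}. (f m :: real))"
  by (simp add: integral_restrict_space set_lebesgue_integral_def)

lemma integrable_U: "integrable U f \<longleftrightarrow> set_integrable lborel {0<..<1} (f :: real \<Rightarrow> real)"
  by (simp add: integrable_restrict_space set_integrable_def)

lemma AE_U: "(AE m in U. P m) \<longleftrightarrow> (AE m in lborel. m \<in> {0<..<1} \<longrightarrow> P m)"
  by (simp add: AE_restrict_space_iff)

lemma AE_U_countable: "countable A \<Longrightarrow> (\<And>m. m \<in> {0<..<1} \<Longrightarrow> m \<notin> A \<Longrightarrow> P m) \<Longrightarrow> AE m in U. P m"
  unfolding AE_U using AE_not_in[OF countable_imp_null_set_lborel, of A] by (auto elim!: eventually_mono)

lemma step_integral: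
  fixes f :: "nat \<Rightarrow> real"
  assumes "0 < G"
  shows "set_integrable lborel {0<..real n / G} (\<lambda>s. f (nat \<lfloor>s * G\<rfloor>))"
    and "(LBINT s:{0<..real n / G}. f (nat \<lfloor>s * G\<rfloor>)) = (\<Sum>j<n. f j) / G"
proof -
  let ?F = "\<lambda>s. \<Sum>j<n. indicator {real j / G..<real (Suc j) / G} s * f j"
  have ae: "AE s in lborel. ?F s = indicator {0<..real n / G} s *\<^sub>R f (nat \<lfloor>s * G\<rfloor>)"
    using AE_lborel_singleton[of 0] AE_lborel_singleton[of "real n / G"]
  proof eventually_elim
    case (elim s)
    have ind: "indicator {real j / G..<real (Suc j) / G} s = (if 0 \<le> s \<and> nat \<lfloor>s * G\<rfloor> = j then 1 else (0::real))" for j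
    proof -
      have "s \<in> {real j / G..<real (Suc j) / G} \<longleftrightarrow> real j \<le> s * G \<and> s * G < real j + 1"
        using assms by (auto simp: field_simps)
      also have "\<dots> \<longleftrightarrow> \<lfloor>s * G\<rfloor> = int j" by (simp add: floor_eq_iff)
      also have "\<dots> \<longleftrightarrow> 0 \<le> s \<and> nat \<lfloor>s * G\<rfloor> = j"
        using assms by (auto simp: zero_le_mult_iff) (smt (verit) floor_less_zero mult_less_0_iff of_nat_0_le_iff)+
      finally show ?thesis by (simp add: indicator_def)
    qed
    have "0 \<le> s \<Longrightarrow> nat \<lfloor>s * G\<rfloor> < n \<longleftrightarrow> s < real n / G"
      using assms by (simp add: nat_less_iff floor_less_iff field_simps)
    then have iff: "0 \<le> s \<and> nat \<lfloor>s * G\<rfloor> < n \<longleftrightarrow> s \<in> {0<..real n / G}"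
      using elim by auto
    have "?F s = (\<Sum>j<n. if j = nat \<lfloor>s * G\<rfloor> then (if 0 \<le> s then f j else 0) else 0)"
      unfolding ind by (intro sum.cong) auto
    also have "\<dots> = (if 0 \<le> s \<and> nat \<lfloor>s * G\<rfloor> < n then f (nat \<lfloor>s * G\<rfloor>) else 0)"
      by (subst sum.delta) auto
    also have "\<dots> = indicator {0<..real n / G} s *\<^sub>R f (nat \<lfloor>s * G\<rfloor>)"
      unfolding iff by (simp add: indicator_def)
    finally show ?case .
  qed
  have int1: "integrable lborel (\<lambda>s. indicator {real j / G..<real (Suc j) / G} s * f j)" for j
    using assms by (intro integrable_mult_left) (simp add: integrable_indicator_iff divide_right_mono)
  have int: "integrable lborel ?F" by (rule Bochner_Integration.integrable_sum) (rule int1)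
  have m: "(\<lambda>s. indicator {0<..real n / G} s *\<^sub>R f (nat \<lfloor>s * G\<rfloor>)) \<in> borel_measurable lborel"
    by measurable
  show "set_integrable lborel {0<..real n / G} (\<lambda>s. f (nat \<lfloor>s * G\<rfloor>))"
    unfolding set_integrable_def using integrable_cong_AE_imp[OF int m] ae by simp
  have "(LBINT s:{0<..real n / G}. f (nat \<lfloor>s * G\<rfloor>)) = integral\<^sup>L lborel ?F"
    unfolding set_lebesgue_integral_def
    by (rule integral_cong_AE[OF m]) (use int ae in auto)
  also have "\<dots> = (\<Sum>j<n. (real (Suc j) / G - real j / G) * f j)"
    using assms int1 by (subst Bochner_Integration.integral_sum) (simp_all add: divide_right_mono)
  also have "\<dots> = (\<Sum>j<n. f j) / G"
    unfolding sum_divide_distrib by (intro sum.cong) (auto simp: add_divide_distrib)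
  finally show "(LBINT s:{0<..real n / G}. f (nat \<lfloor>s * G\<rfloor>)) = (\<Sum>j<n. f j) / G" .
qed

lemma step_integral_U:
  fixes f :: "nat \<Rightarrow> real"
  assumes "0 < N"
  shows "integrable U (\<lambda>m. f (nat \<lfloor>m * real N\<rfloor>))"
    and "(\<integral>m. f (nat \<lfloor>m * real N\<rfloor>) \<partial>U) = (\<Sum>i<N. f i) / N"
proof -
  have N: "0 < real N" "real N / real N = 1" using assms by auto
  note s = step_integral[OF N(1), of N f, unfolded N(2)]
  have ae: "AE m in lborel. indicator {0<..1} m *\<^sub>R f (nat \<lfloor>m * real N\<rfloor>) = indicator {0<..<1} m *\<^sub>R f (nat \<lfloor>m * real N\<rfloor>)"
    using AE_lborel_singleton[of 1] by eventually_elim (auto simp: indicator_def)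
  have m: "(\<lambda>s. indicator {0<..<1} s *\<^sub>R f (nat \<lfloor>s * real N\<rfloor>)) \<in> borel_measurable lborel"
    by measurable
  show "integrable U (\<lambda>m. f (nat \<lfloor>m * real N\<rfloor>))"
    unfolding integrable_U set_integrable_def
    by (rule integrable_cong_AE_imp[OF s(1)[unfolded set_integrable_def] m ae])
  show "(\<integral>m. f (nat \<lfloor>m * real N\<rfloor>) \<partial>U) = (\<Sum>i<N. f i) / N"
    unfolding integral_U s(2)[symmetric] set_lebesgue_integral_def
    by (rule integral_cong_AE[OF _ m ae, symmetric]) measurable
qed

text \<open>
  The common majorant of all nondecreasing functions in the unit ball of \<open>L\<^sup>2(0,
  1)\<close>. It is integrable but not square-integrable, so quadratic quantities have to be
  controlled by \<open>L\<^sup>2\<close> bounds instead.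
\<close>
definition \<beta> :: "real \<Rightarrow> real" where "\<beta> m = 1 / sqrt m + 1 / sqrt (1 - m)"

lemma \<beta>_ge1: "m \<in> {0<..<1} \<Longrightarrow> 1 \<le> \<beta> m"
proof -
  assume m: "m \<in> {0<..<1}"
  then have "1 \<le> 1 / sqrt m" "0 \<le> 1 / sqrt (1 - m)" by auto
  then show ?thesis unfolding \<beta>_def by linarith
qed

lemma measurable_\<beta> [measurable]: "\<beta> \<in> borel_measurable borel"
  unfolding \<beta>_def[abs_def] by measurable

lemma integrable_\<beta>: "integrable U \<beta>"
proof -
  have "set_integrable lborel (einterval (ereal 0) (ereal 1)) \<beta>"
  proof (rule interval_integral_FTC_nonneg(1))
    let ?F = "\<lambda>m. 2 * sqrt m - 2 * sqrt (1 - m)"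
    show "DERIV ?F x :> \<beta> x" if "ereal 0 < ereal x" "ereal x < ereal 1" for x
      using that unfolding \<beta>_def by (auto intro!: derivative_eq_intros simp: field_simps)
    show "isCont \<beta> x" if "ereal 0 < ereal x" "ereal x < ereal 1" for x
      using that unfolding \<beta>_def[abs_def] by (auto intro!: continuous_intros)
    show "AE x in lborel. ereal 0 < ereal x \<longrightarrow> ereal x < ereal 1 \<longrightarrow> 0 \<le> \<beta> x"
      by (auto simp: \<beta>_def)
    have "(?F \<longlongrightarrow> ?F 0) (at_right 0)"
      by (intro tendsto_intros)
    then show "((?F \<circ> real_of_ereal) \<longlongrightarrow> ?F 0) (at_right (ereal 0))"
      by (simp add: ereal_tendsto_simps1)
    have "(?F \<longlongrightarrow> ?F 1) (at_left 1)"
      by (intro tendsto_intros)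
    then show "((?F \<circ> real_of_ereal) \<longlongrightarrow> ?F 1) (at_left (ereal 1))"
      by (simp add: ereal_tendsto_simps1)
  qed auto
  then show ?thesis unfolding integrable_U by (simp add: einterval_eq)
qed

text \<open>
  If \<open>f m \<ge> 0\<close> then \<open>f \<ge> f m\<close> on the interval \<open>(m,
  1)\<close>, and Chebyshev's inequality applies on an interval of length \<open>1 - m\<close>;
  for \<open>f m < 0\<close> the interval \<open>(0, m)\<close> is used.
\<close>
lemma mono_L2_bound:
  fixes f :: "real \<Rightarrow> real"
  assumes mono: "\<And>m m'. 0 < m \<Longrightarrow> m \<le> m' \<Longrightarrow> m' < 1 \<Longrightarrow> f m \<le> f m'"
    and int: "integrable U (\<lambda>m. (f m)\<^sup>2)" and K: "(\<integral>m. (f m)\<^sup>2 \<partial>U) \<le> K\<^sup>2" "0 \<le> K"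
    and m: "m \<in> {0<..<1}"
  shows "\<bar>f m\<bar> \<le> K * \<beta> m"
proof -
  have key: "\<bar>f m\<bar> \<le> K / sqrt (measure U A)"
    if A: "A \<in> sets U" "0 < measure U A" "\<And>m'. m' \<in> A \<Longrightarrow> (f m)\<^sup>2 \<le> (f m')\<^sup>2" for A
  proof -
    have "measure U A * (f m)\<^sup>2 = (\<integral>m'. indicator A m' * (f m)\<^sup>2 \<partial>U)"
      using sets.sets_into_space[OF A(1)] by (simp add: Int_absorb2)
    also have "\<dots> \<le> (\<integral>m. (f m)\<^sup>2 \<partial>U)"
    proof (rule integral_mono)
      show "integrable U (\<lambda>m'. indicator A m' * (f m)\<^sup>2)"
        by (intro integrable_mult_left integrable_real_indicator A(1)) (simp add: U.emeasure_finite less_top[symmetric])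
      show "indicator A m' * (f m)\<^sup>2 \<le> (f m')\<^sup>2" for m'
        using A(3)[of m'] by (simp add: indicator_def)
    qed (rule int)
    also have "\<dots> \<le> K\<^sup>2" by (rule K)
    finally have "(sqrt (measure U A) * \<bar>f m\<bar>)\<^sup>2 \<le> K\<^sup>2"
      by (simp add: power_mult_distrib)
    then have "sqrt (measure U A) * \<bar>f m\<bar> \<le> K" using K(2) by (rule power2_le_imp_le)
    then show ?thesis using A(2) by (simp add: field_simps)
  qed
  show ?thesis
  proof (cases "0 \<le> f m")
    case True
    have A: "measure U {m<..<1} = 1 - m" "{m<..<1} \<in> sets U"
      using m by (subst measure_restrict_space, auto) (auto simp: sets_restrict_space_iff)
    have "(f m)\<^sup>2 \<le> (f m')\<^sup>2" if "m' \<in> {m<..<1}" for m'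
      using that m True mono[of m m'] by (intro power_mono) auto
    then have "\<bar>f m\<bar> \<le> K / sqrt (1 - m)"
      using key[of "{m<..<1}"] A m by auto
    also have "\<dots> \<le> K * \<beta> m" using m K(2) by (simp add: \<beta>_def algebra_simps)
    finally show ?thesis .
  next
    case False
    have A: "measure U {0<..<m} = m" "{0<..<m} \<in> sets U"
      using m by (subst measure_restrict_space, auto) (auto simp: sets_restrict_space_iff)
    have "(f m)\<^sup>2 \<le> (f m')\<^sup>2" if "m' \<in> {0<..<m}" for m'
      using that m False mono[of m' m] by (simp add: abs_le_square_iff[symmetric])
    then have "\<bar>f m\<bar> \<le> K / sqrt m"
      using key[of "{0<..<m}"] A m by auto
    also have "\<dots> \<le> K * \<beta> m" using m K(2) by (simp add: \<beta>_def algebra_simps)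
    finally show ?thesis .
  qed
qed

lemma square_sum_le: "((a::real) + b)\<^sup>2 \<le> 2 * a\<^sup>2 + 2 * b\<^sup>2"
  using zero_le_power2[of "a - b"] by (simp add: power2_eq_square algebra_simps)

lemma integrable_square_add:
  fixes f g :: "real \<Rightarrow> real"
  assumes [measurable]: "f \<in> borel_measurable U" "g \<in> borel_measurable U"
    and "integrable U (\<lambda>m. (f m)\<^sup>2)" "integrable U (\<lambda>m. (g m)\<^sup>2)"
  shows "integrable U (\<lambda>m. (a * f m + b * g m)\<^sup>2)"
proof (rule Bochner_Integration.integrable_bound)
  show "integrable U (\<lambda>m. 2 * a\<^sup>2 * (f m)\<^sup>2 + 2 * b\<^sup>2 * (g m)\<^sup>2)" using assms by simp
  show "AE m in U. norm ((a * f m + b * g m)\<^sup>2) \<le> norm (2 * a\<^sup>2 * (f m)\<^sup>2 + 2 * b\<^sup>2 * (g m)\<^sup>2)"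
    using square_sum_le[of "a * f _" "b * g _"] by (auto simp: power_mult_distrib mult.assoc)
qed simp

lemma integrable_mult_square:
  fixes f g :: "real \<Rightarrow> real"
  assumes [measurable]: "f \<in> borel_measurable U" "g \<in> borel_measurable U"
    and "integrable U (\<lambda>m. (f m)\<^sup>2)" "integrable U (\<lambda>m. (g m)\<^sup>2)"
  shows "integrable U (\<lambda>m. f m * g m)"
proof (rule Bochner_Integration.integrable_bound)
  show "integrable U (\<lambda>m. (f m)\<^sup>2 + (g m)\<^sup>2)" using assms by simp
  have "\<bar>f m * g m\<bar> \<le> (f m)\<^sup>2 + (g m)\<^sup>2" for m
  proof -
    have "0 \<le> \<bar>f m\<bar> * \<bar>g m\<bar>" by simp
    then show ?thesis
      using sum_squares_bound[of "\<bar>f m\<bar>" "\<bar>g m\<bar>"] unfolding abs_mult power2_abs by linarith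
  qed
  then show "AE m in U. norm (f m * g m) \<le> norm ((f m)\<^sup>2 + (g m)\<^sup>2)" by auto
qed simp

lemma integrable_of_square:
  fixes f :: "real \<Rightarrow> real"
  assumes [measurable]: "f \<in> borel_measurable U" and "integrable U (\<lambda>m. (f m)\<^sup>2)"
  shows "integrable U f"
  using integrable_mult_square[of f "\<lambda>_. 1"] assms by simp

lemma cauchy_schwarz_U:
  fixes f g :: "real \<Rightarrow> real"
  assumes [measurable]: "f \<in> borel_measurable U" "g \<in> borel_measurable U"
    and f: "integrable U (\<lambda>m. (f m)\<^sup>2)" and g: "integrable U (\<lambda>m. (g m)\<^sup>2)"
    and A: "(\<integral>m. (f m)\<^sup>2 \<partial>U) \<le> A\<^sup>2" "0 \<le> A" and B: "(\<integral>m. (g m)\<^sup>2 \<partial>U) \<le> B\<^sup>2" "0 \<le> B"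
  shows "(\<integral>m. \<bar>f m * g m\<bar> \<partial>U) \<le> A * B"
proof -
  have *: "2 * s * r * (\<integral>m. \<bar>f m * g m\<bar> \<partial>U) \<le> s\<^sup>2 * A\<^sup>2 + r\<^sup>2 * B\<^sup>2" for s r :: real
  proof -
    have "2 * s * r * (\<integral>m. \<bar>f m * g m\<bar> \<partial>U) = (\<integral>m. 2 * s * r * \<bar>f m * g m\<bar> \<partial>U)" by simp
    also have "\<dots> \<le> (\<integral>m. s\<^sup>2 * (f m)\<^sup>2 + r\<^sup>2 * (g m)\<^sup>2 \<partial>U)"
    proof (rule integral_mono)
      show "integrable U (\<lambda>m. 2 * s * r * \<bar>f m * g m\<bar>)"
        using integrable_mult_square[OF assms(1-4)] by (intro integrable_mult_right integrable_abs)
      show "integrable U (\<lambda>m. s\<^sup>2 * (f m)\<^sup>2 + r\<^sup>2 * (g m)\<^sup>2)" using f g by simp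
      show "2 * s * r * \<bar>f m * g m\<bar> \<le> s\<^sup>2 * (f m)\<^sup>2 + r\<^sup>2 * (g m)\<^sup>2" for m
        using sum_squares_bound[of "s * \<bar>f m\<bar>" "r * \<bar>g m\<bar>"]
        by (simp add: abs_mult power_mult_distrib mult_ac)
    qed
    also have "\<dots> = s\<^sup>2 * (\<integral>m. (f m)\<^sup>2 \<partial>U) + r\<^sup>2 * (\<integral>m. (g m)\<^sup>2 \<partial>U)" using f g by simp
    also have "\<dots> \<le> s\<^sup>2 * A\<^sup>2 + r\<^sup>2 * B\<^sup>2" using A B by (intro add_mono mult_left_mono) auto
    finally show ?thesis .
  qed
  let ?I = "\<integral>m. \<bar>f m * g m\<bar> \<partial>U"
  have I: "0 \<le> ?I" by simp
  have pos: "?I \<le> (A + e) * (B + e)" if "0 < e" for e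
  proof -
    have "2 * (B + e) * (A + e) * ?I \<le> (B + e)\<^sup>2 * A\<^sup>2 + (A + e)\<^sup>2 * B\<^sup>2" by (rule *)
    also have "\<dots> \<le> (B + e)\<^sup>2 * (A + e)\<^sup>2 + (A + e)\<^sup>2 * (B + e)\<^sup>2"
      using A B that by (intro add_mono mult_left_mono power_mono) auto
    also have "\<dots> = 2 * (B + e) * (A + e) * ((A + e) * (B + e))" by (simp add: power2_eq_square)
    finally show ?thesis using A B that by (subst (asm) mult_le_cancel_left_pos) auto
  qed
  have "((\<lambda>e. (A + e) * (B + e)) \<longlongrightarrow> (A + 0) * (B + 0)) (at_right 0)"
    by (intro tendsto_intros)
  then have "?I \<le> (A + 0) * (B + 0)"
    by (rule tendsto_lowerbound) (auto simp: eventually_at_right_less eventually_at_filter intro!: pos always_eventually eventually_mono[OF eventually_at_right_less[of 0]])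
  then show ?thesis by simp
qed

lemma minkowski_U:
  fixes f g :: "real \<Rightarrow> real"
  assumes [measurable]: "f \<in> borel_measurable U" "g \<in> borel_measurable U"
    and f: "integrable U (\<lambda>m. (f m)\<^sup>2)" and g: "integrable U (\<lambda>m. (g m)\<^sup>2)"
    and A: "(\<integral>m. (f m)\<^sup>2 \<partial>U) \<le> A\<^sup>2" "0 \<le> A" and B: "(\<integral>m. (g m)\<^sup>2 \<partial>U) \<le> B\<^sup>2" "0 \<le> B"
  shows "(\<integral>m. (f m + g m)\<^sup>2 \<partial>U) \<le> (A + B)\<^sup>2"
proof -
  have fg: "integrable U (\<lambda>m. f m * g m)" by (rule integrable_mult_square) (use f g in auto)
  have "(\<integral>m. (f m + g m)\<^sup>2 \<partial>U) = (\<integral>m. (f m)\<^sup>2 + (g m)\<^sup>2 + 2 * (f m * g m) \<partial>U)"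
    by (intro Bochner_Integration.integral_cong) (auto simp: power2_eq_square algebra_simps)
  also have "\<dots> = (\<integral>m. (f m)\<^sup>2 \<partial>U) + (\<integral>m. (g m)\<^sup>2 \<partial>U) + 2 * (\<integral>m. f m * g m \<partial>U)"
    using f g fg by simp
  also have "(\<integral>m. f m * g m \<partial>U) \<le> (\<integral>m. \<bar>f m * g m\<bar> \<partial>U)"
    using fg by (intro integral_mono) auto
  also have "(\<integral>m. \<bar>f m * g m\<bar> \<partial>U) \<le> A * B"
    by (rule cauchy_schwarz_U) (use assms in auto)
  finally show ?thesis using A B by (simp add: power2_eq_square algebra_simps)
qed

text \<open>
  Lower semicontinuity of the \<open>L\<^sup>2\<close> norm under convergence almost everywhere.
\<close>
lemma fatou_square_U:
  fixes f :: "nat \<Rightarrow> real \<Rightarrow> real"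
  assumes [measurable]: "\<And>k. f k \<in> borel_measurable U" "g \<in> borel_measurable U"
    and int: "\<And>k. integrable U (\<lambda>m. (f k m)\<^sup>2)" and bd: "\<And>k. (\<integral>m. (f k m)\<^sup>2 \<partial>U) \<le> E k"
    and E: "E \<longlonglongrightarrow> e" and lim: "AE m in U. (\<lambda>k. f k m) \<longlonglongrightarrow> g m"
  shows "integrable U (\<lambda>m. (g m)\<^sup>2)" "(\<integral>m. (g m)\<^sup>2 \<partial>U) \<le> e"
proof -
  have "0 \<le> E k" for k
    by (rule order_trans[OF Bochner_Integration.integral_nonneg bd[of k]]) simp
  then have e0: "0 \<le> e" using E by (intro LIMSEQ_le_const) auto
  have "(\<integral>\<^sup>+m. ennreal ((g m)\<^sup>2) \<partial>U) = (\<integral>\<^sup>+m. liminf (\<lambda>k. ennreal ((f k m)\<^sup>2)) \<partial>U)"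
  proof (rule nn_integral_cong_AE)
    show "AE m in U. ennreal ((g m)\<^sup>2) = liminf (\<lambda>k. ennreal ((f k m)\<^sup>2))"
      using lim
    proof eventually_elim
      case (elim m)
      then have "(\<lambda>k. ennreal ((f k m)\<^sup>2)) \<longlonglongrightarrow> ennreal ((g m)\<^sup>2)"
        by (intro tendsto_ennrealI tendsto_power)
      then show ?case using lim_imp_Liminf[OF trivial_limit_sequentially, of "\<lambda>k. ennreal ((f k m)\<^sup>2)"] by metis
    qed
  qed
  also have "\<dots> \<le> liminf (\<lambda>k. \<integral>\<^sup>+m. ennreal ((f k m)\<^sup>2) \<partial>U)"
    by (rule nn_integral_liminf) simp
  also have "\<dots> \<le> liminf (\<lambda>k. ennreal (E k))"
  proof (rule Liminf_mono, rule always_eventually, rule allI)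
    fix k
    have "(\<integral>\<^sup>+m. ennreal ((f k m)\<^sup>2) \<partial>U) = ennreal (\<integral>m. (f k m)\<^sup>2 \<partial>U)"
      by (rule nn_integral_eq_integral[OF int]) simp
    then show "(\<integral>\<^sup>+m. ennreal ((f k m)\<^sup>2) \<partial>U) \<le> ennreal (E k)" using bd by (simp add: ennreal_leI)
  qed
  also have "\<dots> = ennreal e"
    by (rule lim_imp_Liminf[OF trivial_limit_sequentially tendsto_ennrealI[OF E]])
  finally have *: "(\<integral>\<^sup>+m. ennreal ((g m)\<^sup>2) \<partial>U) \<le> ennreal e" .
  show int: "integrable U (\<lambda>m. (g m)\<^sup>2)"
    by (rule integrableI_bounded) (use * in \<open>auto intro: le_less_trans\<close>)
  have "ennreal (\<integral>m. (g m)\<^sup>2 \<partial>U) \<le> ennreal e"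
    using * nn_integral_eq_integral[OF int] by simp
  then show "(\<integral>m. (g m)\<^sup>2 \<partial>U) \<le> e" using e0 by (simp add: ennreal_le_iff)
qed

text \<open>
  Closeness in \<open>L\<^sup>2\<close> gives pointwise closeness when \<open>g\<close> does not
  expand gaps of \<open>f\<close> by more than a factor \<open>1 + l\<close>: then \<open>(1 +
  l) f - g\<close> is nondecreasing and \<open>mono_L2_bound\<close> applies to it. With
  \<open>f = X\<^sub>s\<close> and \<open>g = X\<^sub>t\<close> this turns the continuity of the
  flow in \<open>L\<^sup>2\<close> into continuity for each label.
\<close>
lemma mono_pair_bound:
  fixes f g :: "real \<Rightarrow> real"
  assumes [measurable]: "f \<in> borel_measurable U" "g \<in> borel_measurable U"
    and f_mono: "\<And>m m'. 0 < m \<Longrightarrow> m \<le> m' \<Longrightarrow> m' < 1 \<Longrightarrow> f m \<le> f m'"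
    and fg: "\<And>m m'. 0 < m \<Longrightarrow> m \<le> m' \<Longrightarrow> m' < 1 \<Longrightarrow> g m' - g m \<le> (1 + l) * (f m' - f m)"
    and int: "integrable U (\<lambda>m. (f m)\<^sup>2)" "integrable U (\<lambda>m. (g m - f m)\<^sup>2)"
    and K: "(\<integral>m. (f m)\<^sup>2 \<partial>U) \<le> K\<^sup>2" "0 \<le> K" and E: "(\<integral>m. (g m - f m)\<^sup>2 \<partial>U) \<le> E\<^sup>2" "0 \<le> E"
    and l: "0 \<le> l" and m: "m \<in> {0<..<1}"
  shows "\<bar>g m - f m\<bar> \<le> (E + 2 * l * K) * \<beta> m"
proof -
  \<comment> \<open>nondecreasing, with norm at most \<open>l K + E\<close>\<close>
  let ?d = "\<lambda>m. l * f m + (f m - g m)"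
  have E': "(\<integral>m. (f m - g m)\<^sup>2 \<partial>U) \<le> E\<^sup>2" and i': "integrable U (\<lambda>m. (f m - g m)\<^sup>2)"
    using E int(2) by (simp_all add: power2_commute[of "f _"])
  have "(\<integral>m. (?d m)\<^sup>2 \<partial>U) \<le> (l * K + E)\<^sup>2"
  proof (rule minkowski_U)
    show "(\<integral>m. (l * f m)\<^sup>2 \<partial>U) \<le> (l * K)\<^sup>2"
      using K l int by (simp add: power_mult_distrib mult_left_mono)
  qed (use int i' K E' E l in \<open>auto simp: power_mult_distrib\<close>)
  moreover have "integrable U (\<lambda>m. (?d m)\<^sup>2)"
    using integrable_square_add[of f "\<lambda>m. f m - g m" l 1] int(1) i' by simp
  moreover have "?d a \<le> ?d b" if "0 < a" "a \<le> b" "b < 1" for a b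
    using fg[OF that] by (simp add: algebra_simps)
  ultimately have "\<bar>?d m\<bar> \<le> (l * K + E) * \<beta> m"
    using m K(2) E(2) l by (intro mono_L2_bound) auto
  moreover have "\<bar>l * f m\<bar> \<le> l * (K * \<beta> m)"
    using mono_L2_bound[of f K m] f_mono int K m l by (simp add: abs_mult mult_left_mono)
  ultimately show ?thesis by (simp add: algebra_simps abs_le_iff)
qed

text \<open>
  Relative growth of \<open>sinh\<close>, uniform on time intervals away from \<open>0\<close>.
\<close>
lemma sinh_ratio:
  fixes \<kappa> :: real
  assumes "0 < \<kappa>" "0 < a" "a \<le> s" "s \<le> t" "t \<le> T"
  shows "sinh (\<kappa> * t) / sinh (\<kappa> * s) - 1 \<le> \<kappa> * cosh (\<kappa> * T) / sinh (\<kappa> * a) * (t - s)"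
    and "0 \<le> sinh (\<kappa> * t) / sinh (\<kappa> * s) - 1"
proof -
  have ps: "0 < sinh (\<kappa> * a)" "sinh (\<kappa> * a) \<le> sinh (\<kappa> * s)" "sinh (\<kappa> * s) \<le> sinh (\<kappa> * t)" using assms by auto
  have "sinh (\<kappa> * t) - sinh (\<kappa> * s) \<le> \<kappa> * cosh (\<kappa> * T) * (t - s)"
  proof (cases "s = t")
    case False
    then have "s < t" using assms by simp
    have "((\<lambda>x. sinh (\<kappa> * x)) has_real_derivative \<kappa> * cosh (\<kappa> * x)) (at x)" for x
      by (auto intro!: derivative_eq_intros)
    from MVT2[OF \<open>s < t\<close>, of "\<lambda>x. sinh (\<kappa> * x)" "\<lambda>x. \<kappa> * cosh (\<kappa> * x)", OF this]
    obtain z where z: "s < z" "z < t" "sinh (\<kappa> * t) - sinh (\<kappa> * s) = (t - s) * (\<kappa> * cosh (\<kappa> * z))" by blast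
    have "cosh (\<kappa> * z) \<le> cosh (\<kappa> * T)" using z assms by (subst cosh_real_nonneg_le_iff) auto
    then have "(t - s) * (\<kappa> * cosh (\<kappa> * z)) \<le> (t - s) * (\<kappa> * cosh (\<kappa> * T))"
      using assms by (intro mult_left_mono) auto
    then show ?thesis using z by (simp add: mult_ac)
  qed simp
  then have "(sinh (\<kappa> * t) - sinh (\<kappa> * s)) / sinh (\<kappa> * s) \<le> (\<kappa> * cosh (\<kappa> * T) * (t - s)) / sinh (\<kappa> * a)"
    using ps assms by (intro frac_le) auto
  then show "sinh (\<kappa> * t) / sinh (\<kappa> * s) - 1 \<le> \<kappa> * cosh (\<kappa> * T) / sinh (\<kappa> * a) * (t - s)"
    using ps assms by (simp add: diff_divide_distrib)
  show "0 \<le> sinh (\<kappa> * t) / sinh (\<kappa> * s) - 1" using ps by simp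
qed

section \<open>Compactness of the discrete flows\<close>

text \<open>
  Force, impulse and free position of the labels along a flow \<open>X\<close>; the impulse is
  the initial velocity plus the time integral of the force.
\<close>
definition lag_force :: "(real \<Rightarrow> real) \<Rightarrow> (real \<Rightarrow> real \<Rightarrow> real) \<Rightarrow> real \<Rightarrow> real \<Rightarrow> real" where
  "lag_force w X t m = - (\<integral>m'. w (X t m - X t m') \<partial>U)"

definition lag_impulse :: "(real \<Rightarrow> real) \<Rightarrow> (real \<Rightarrow> real) \<Rightarrow> (real \<Rightarrow> real \<Rightarrow> real) \<Rightarrow> real \<Rightarrow> real \<Rightarrow> real" where
  "lag_impulse w v0 X t m = v0 (X 0 m) + (LBINT r:{0<..t}. lag_force w X r m)"

definition lag_free :: "(real \<Rightarrow> real) \<Rightarrow> (real \<Rightarrow> real) \<Rightarrow> (real \<Rightarrow> real \<Rightarrow> real) \<Rightarrow> real \<Rightarrow> real \<Rightarrow> real" where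
  "lag_free w v0 X t m = X 0 m + (LBINT s:{0<..t}. lag_impulse w v0 X s m)"

text \<open>
  What is kept of the discrete scheme in the limit. The essential conditions are monotonicity in
  the label, the comparison \<open>X_sinh\<close> of gaps with \<open>sinh\<close>, the
  Lipschitz bound in time in \<open>L\<^sup>2\<close> and the projection identity
  \<open>X\<^sub>t = E[Y\<^sub>t | X\<^sub>t]\<close>, stated with bounded continuous test
  functions (\<open>X_projection\<close>).
\<close>
locale sticky_flow = interaction_force +
  fixes v0 :: "real \<Rightarrow> real" and D :: real and X :: "real \<Rightarrow> real \<Rightarrow> real" and Kb :: "real \<Rightarrow> real"
  assumes v0_cont: "continuous_on UNIV v0" and v0_growth: "\<And>x. \<bar>v0 x\<bar> \<le> D * (1 + \<bar>x\<bar>)"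
    and X_meas: "(\<lambda>(t, m). X t m) \<in> borel_measurable (borel \<Otimes>\<^sub>M borel)"
    and X_mono: "\<And>t m m'. 0 \<le> t \<Longrightarrow> 0 < m \<Longrightarrow> m \<le> m' \<Longrightarrow> m' < 1 \<Longrightarrow> X t m \<le> X t m'"
    and X_sinh: "\<And>s t m m'. 0 < s \<Longrightarrow> s \<le> t \<Longrightarrow> 0 < m \<Longrightarrow> m \<le> m' \<Longrightarrow> m' < 1 \<Longrightarrow>
        (X t m' - X t m) * sinh (sqrt c * s) \<le> (X s m' - X s m) * sinh (sqrt c * t)"
    and Kb_nonneg: "\<And>T. 0 \<le> T \<Longrightarrow> 0 \<le> Kb T"
    and X_int: "\<And>t. 0 \<le> t \<Longrightarrow> integrable U (\<lambda>m. (X t m)\<^sup>2)"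
    and X_bound: "\<And>t T. 0 \<le> t \<Longrightarrow> t \<le> T \<Longrightarrow> (\<integral>m. (X t m)\<^sup>2 \<partial>U) \<le> (Kb T)\<^sup>2"
    and X_lip: "\<And>s t T. 0 \<le> s \<Longrightarrow> s \<le> t \<Longrightarrow> t \<le> T \<Longrightarrow>
        (\<integral>m. (X t m - X s m)\<^sup>2 \<partial>U) \<le> (Kb T * (t - s))\<^sup>2"
    and X_projection: "\<And>t g B. 0 \<le> t \<Longrightarrow> continuous_on UNIV g \<Longrightarrow> (\<And>x. \<bar>g x\<bar> \<le> B) \<Longrightarrow>
        (\<integral>m. g (X t m) * (X t m - lag_free w v0 X t m) \<partial>U) = 0"

locale sticky_limit = interaction_force +
  fixes v0 :: "real \<Rightarrow> real" and D :: real and Q :: "real \<Rightarrow> real"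
  assumes v0_cont: "continuous_on UNIV v0" and v0_growth: "\<And>x. \<bar>v0 x\<bar> \<le> D * (1 + \<bar>x\<bar>)"
    and Q_meas [measurable]: "Q \<in> borel_measurable U"
    and Q_mono: "\<And>m m'. 0 < m \<Longrightarrow> m \<le> m' \<Longrightarrow> m' < 1 \<Longrightarrow> Q m \<le> Q m'"
    and Q_int: "integrable U (\<lambda>m. (Q m)\<^sup>2)"
begin

declare of_nat_Suc [simp del]

lemma D_nonneg: "0 \<le> D" using v0_growth[of 0] by simp

text \<open>
  The particle \<open>i\<close> out of \<open>k + 1\<close> starts at the point of the interval
  from \<open>Q (i / (k + 1))\<close> to \<open>Q ((i + 1) / (k + 1))\<close> that is closest to
  \<open>0\<close>, where the two outermost intervals are unbounded. Any point of the interval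
  converges to \<open>Q\<close>; this one also satisfies \<open>\<bar>x0 k i\<bar> \<le> \<bar>Q
  m\<bar>\<close> for the labels \<open>m\<close> of the cell, which keeps the initial norms
  bounded although \<open>Q\<close> may be infinite at both ends.
\<close>
definition x0 :: "nat \<Rightarrow> nat \<Rightarrow> real" where
  "x0 k i = (let u = (if Suc i < Suc k then min 0 (Q (real (Suc i) / Suc k)) else 0)
     in if i = 0 then u else max (Q (real i / Suc k)) u)"

text \<open>
  Labels and times are both discretised with mesh \<open>1 / (k + 1)\<close>.
\<close>
abbreviation cell :: "nat \<Rightarrow> real \<Rightarrow> nat" where "cell k t \<equiv> nat \<lfloor>t * real (Suc k)\<rfloor>"
definition grid_time :: "nat \<Rightarrow> real \<Rightarrow> real" where "grid_time k t = real (cell k t) / Suc k"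
abbreviation mesh :: "nat \<Rightarrow> real" where "mesh k \<equiv> 1 / real (Suc k)"

lemma x0_le: "Suc i < Suc k \<Longrightarrow> x0 k i \<le> Q (real (Suc i) / Suc k)"
  using Q_mono[of "real i / Suc k" "real (Suc i) / Suc k"]
  by (auto simp: x0_def Let_def divide_simps)

lemma x0_ge: "0 < i \<Longrightarrow> Q (real i / Suc k) \<le> x0 k i"
  by (auto simp: x0_def Let_def)

lemma x0_sorted: "sorted_upto (Suc k) (x0 k)"
  unfolding sorted_upto_def
proof (intro allI impI)
  fix i j assume ij: "i \<le> j \<and> j < Suc k"
  show "x0 k i \<le> x0 k j"
  proof (cases "i = j")
    case False
    then have "i < j" using ij by simp
    then have "x0 k i \<le> Q (real (Suc i) / Suc k)" using ij by (intro x0_le) auto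
    also have "\<dots> \<le> Q (real j / Suc k)" using ij \<open>i < j\<close> by (intro Q_mono) (auto simp: divide_simps)
    also have "\<dots> \<le> x0 k j" using \<open>i < j\<close> by (intro x0_ge) auto
    finally show ?thesis .
  qed simp
qed

lemma cell_bounds: "0 \<le> t \<Longrightarrow> real (cell k t) \<le> t * Suc k" "0 \<le> t \<Longrightarrow> t * Suc k < real (cell k t) + 1"
proof -
  assume t: "0 \<le> t"
  then have "0 \<le> \<lfloor>t * real (Suc k)\<rfloor>" by simp
  then have "real (cell k t) = of_int \<lfloor>t * real (Suc k)\<rfloor>" by simp
  then show "real (cell k t) \<le> t * Suc k" "t * Suc k < real (cell k t) + 1" by linarith+
qed

lemma cell_mono: "s \<le> t \<Longrightarrow> cell k s \<le> cell k t"
  by (intro nat_mono floor_mono mult_right_mono) auto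

lemma cell_lt: "m \<in> {0<..<1} \<Longrightarrow> cell k m < Suc k"
proof -
  assume m: "m \<in> {0<..<1}"
  then have "m * real (Suc k) < 1 * real (Suc k)" by (intro mult_strict_right_mono) auto
  moreover have "real (cell k m) \<le> m * real (Suc k)" using m by (intro cell_bounds(1)) simp
  ultimately have "real (cell k m) < real (Suc k)" unfolding mult_1 by (rule le_less_trans[rotated])
  then show ?thesis by (simp only: of_nat_less_iff)
qed

lemma grid_time_le: "0 \<le> t \<Longrightarrow> grid_time k t \<le> t" and grid_time_gt: "0 \<le> t \<Longrightarrow> t < grid_time k t + mesh k"
  using cell_bounds[of t k] by (simp_all add: grid_time_def field_simps)

lemma grid_time_nonneg: "0 \<le> grid_time k t" by (simp add: grid_time_def)

lemma grid_time_mono: "s \<le> t \<Longrightarrow> grid_time k s \<le> grid_time k t"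
  unfolding grid_time_def by (intro divide_right_mono) (use cell_mono in auto)

lemma mesh_tendsto: "mesh \<longlonglongrightarrow> 0"
  using LIMSEQ_inverse_real_of_nat by (simp add: inverse_eq_divide)

lemma grid_time_tendsto: assumes "0 \<le> t" shows "(\<lambda>k. grid_time k t) \<longlonglongrightarrow> t"
proof (rule tendsto_sandwich)
  show "(\<lambda>k. t - mesh k) \<longlonglongrightarrow> t" using tendsto_diff[OF tendsto_const mesh_tendsto, of t] by simp
  show "\<forall>\<^sub>F k in sequentially. t - mesh k \<le> grid_time k t"
    using grid_time_gt[OF assms] by (intro always_eventually allI) (smt (verit))
  show "\<forall>\<^sub>F k in sequentially. grid_time k t \<le> t"
    using grid_time_le[OF assms] by (intro always_eventually) auto
qed simp

lemma particles: "sticky_particles w c C (Suc k) (mesh k) (x0 k)"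
  by unfold_locales (auto simp: x0_sorted)

abbreviation pos :: "nat \<Rightarrow> nat \<Rightarrow> nat \<Rightarrow> real" where
  "pos k \<equiv> sticky_particles.pos w (Suc k) (mesh k) (x0 k) v0"

definition approx_flow :: "nat \<Rightarrow> real \<Rightarrow> real \<Rightarrow> real" where
  "approx_flow k t m = pos k (cell k t) (cell k m)"

text \<open>
  \<open>Kb T\<close> bounds the norms of positions and velocities up to time \<open>T\<close>,
  uniformly in the number of particles.
\<close>
definition A :: real where "A = sqrt (\<integral>m. (Q m)\<^sup>2 \<partial>U)"
definition Kb :: "real \<Rightarrow> real" where
  "Kb T = (1 + A + D * (1 + A) + C * (1 + 2 * A)) * exp ((1 + 2 * C) * T)"

lemma A_nonneg: "0 \<le> A" by (simp add: A_def)

lemma Kb_nonneg: "0 \<le> Kb T"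
  using A_nonneg D_nonneg C_nonneg by (simp add: Kb_def)

lemma approx_flow_0: "approx_flow k 0 m = x0 k (cell k m)"
  by (simp add: approx_flow_def sticky_particles.pos_0[OF particles])

lemma approx_flow_0_le:
  assumes m: "m \<in> {0<..<1}"
  shows "\<bar>approx_flow k 0 m\<bar> \<le> \<bar>Q m\<bar>"
proof -
  define i where "i = cell k m"
  have m0: "0 \<le> m" using m by simp
  have i: "real i \<le> m * Suc k" "m * Suc k \<le> real (Suc i)" "i < Suc k"
    using cell_bounds[OF m0, of k, folded i_def] cell_lt[OF m, of k, folded i_def] by (simp_all add: of_nat_Suc[of i])
  have lo: "Q (real i / Suc k) \<le> Q m" if "0 < i"
    using that i m by (intro Q_mono) (auto simp: divide_simps)
  have hi: "Q m \<le> Q (real (Suc i) / Suc k)" if "Suc i < Suc k"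
    using that i m by (intro Q_mono) (auto simp: divide_simps)
  show ?thesis
    unfolding approx_flow_0 x0_def Let_def i_def[symmetric] using lo hi by (auto simp: max_def min_def)
qed

lemma rms_approx_flow: "(rms (Suc k) f)\<^sup>2 = (\<integral>m. (f (cell k m))\<^sup>2 \<partial>U)"
  using step_integral_U(2)[of "Suc k" "\<lambda>i. (f i)\<^sup>2"] by (simp add: rms_square)

lemma rms_x0: "rms (Suc k) (x0 k) \<le> A"
proof -
  have "(rms (Suc k) (x0 k))\<^sup>2 = (\<integral>m. (approx_flow k 0 m)\<^sup>2 \<partial>U)" unfolding rms_approx_flow approx_flow_0 ..
  also have "\<dots> \<le> (\<integral>m. (Q m)\<^sup>2 \<partial>U)"
  proof (rule integral_mono[OF _ Q_int])
    show "integrable U (\<lambda>m. (approx_flow k 0 m)\<^sup>2)"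
      unfolding approx_flow_def by (rule step_integral_U(1)) simp
    show "(approx_flow k 0 m)\<^sup>2 \<le> (Q m)\<^sup>2" if "m \<in> space U" for m
      using approx_flow_0_le[of m k] that by (simp add: abs_le_square_iff[symmetric])
  qed
  also have "\<dots> = A\<^sup>2" by (simp add: A_def)
  finally show ?thesis using A_nonneg by (rule power2_le_imp_le)
qed

lemma energy_Kb:
  assumes "real n * mesh k \<le> T"
  shows "1 + rms (Suc k) (pos k n) + rms (Suc k) (sticky_particles.vel w (Suc k) (mesh k) (x0 k) v0 n) \<le> Kb T"
proof -
  have "1 + rms (Suc k) (pos k n) + rms (Suc k) (sticky_particles.vel w (Suc k) (mesh k) (x0 k) v0 n)
     \<le> (1 + A + D * (1 + A) + C * (1 + 2 * A)) * exp ((1 + 2 * C) * (n * mesh k))"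
    by (rule sticky_particles.energy_bound[OF particles v0_growth rms_x0 D_nonneg])
  also have "\<dots> \<le> Kb T"
    unfolding Kb_def
  proof (rule mult_left_mono)
    have "(1 + 2 * C) * (n * mesh k) \<le> (1 + 2 * C) * T"
      using C_nonneg by (intro mult_left_mono assms) auto
    then show "exp ((1 + 2 * C) * (n * mesh k)) \<le> exp ((1 + 2 * C) * T)" by (simp only: exp_le_cancel_iff)
    show "0 \<le> 1 + A + D * (1 + A) + C * (1 + 2 * A)" using A_nonneg D_nonneg C_nonneg by simp
  qed
  finally show ?thesis .
qed

lemma approx_flow_int: "integrable U (\<lambda>m. f (approx_flow k t m) (approx_flow k s m) :: real)"
  unfolding approx_flow_def by (rule step_integral_U(1)[of "Suc k" "\<lambda>i. f (pos k (cell k t) i) (pos k (cell k s) i)"]) simp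

lemma approx_flow_bound:
  assumes "0 \<le> t" "t \<le> T"
  shows "(\<integral>m. (approx_flow k t m)\<^sup>2 \<partial>U) \<le> (Kb T)\<^sup>2"
proof -
  have "real (cell k t) * mesh k \<le> T" using grid_time_le[OF assms(1), of k] assms by (simp add: grid_time_def)
  from energy_Kb[OF this] have "rms (Suc k) (pos k (cell k t)) \<le> Kb T"
    using rms_nonneg[of "Suc k" "sticky_particles.vel w (Suc k) (mesh k) (x0 k) v0 (cell k t)"] by linarith
  then show ?thesis
    unfolding approx_flow_def rms_approx_flow[symmetric] using rms_nonneg by (intro power_mono)
qed

lemma approx_flow_lip:
  assumes "0 \<le> s" "s \<le> t" "t \<le> T"
  shows "(\<integral>m. (approx_flow k t m - approx_flow k s m)\<^sup>2 \<partial>U) \<le> (Kb T * (grid_time k t - grid_time k s))\<^sup>2"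
proof -
  have "rms (Suc k) (\<lambda>i. pos k (cell k t) i - pos k (cell k s) i) \<le> Kb T * (mesh k * (real (cell k t) - real (cell k s)))"
  proof (rule order_trans[OF sticky_particles.rms_pos_diff[OF particles cell_mono[OF assms(2)]]])
    fix j assume "j < cell k t"
    then have "real j * mesh k \<le> real (cell k t) * mesh k" by (intro mult_right_mono) auto
    also have "\<dots> \<le> T" using grid_time_le[of t k] assms by (simp add: grid_time_def)
    finally show "rms (Suc k) (sticky_particles.vel w (Suc k) (mesh k) (x0 k) v0 j) \<le> Kb T"
      using energy_Kb[of j k T] rms_nonneg[of "Suc k" "pos k j"] by linarith
  qed (simp add: of_nat_diff cell_mono[OF assms(2)])
  also have "mesh k * (real (cell k t) - real (cell k s)) = grid_time k t - grid_time k s"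
    by (simp add: grid_time_def diff_divide_distrib)
  finally show ?thesis
    unfolding approx_flow_def using rms_nonneg
    by (subst rms_approx_flow[of k "\<lambda>i. pos k (cell k t) i - pos k (cell k s) i", symmetric]) (intro power_mono)
qed

lemma approx_flow_mono: "0 < m \<Longrightarrow> m \<le> m' \<Longrightarrow> m' < 1 \<Longrightarrow> approx_flow k t m \<le> approx_flow k t m'"
  unfolding approx_flow_def using sorted_uptoD[OF sticky_particles.pos_sorted[OF particles]] cell_mono cell_lt
  by (metis greaterThanLessThan_iff order_less_le_trans)

lemma approx_flow_sinh:
  assumes "0 < grid_time k s" "s \<le> t" "0 < m" "m \<le> m'" "m' < 1"
  shows "(approx_flow k t m' - approx_flow k t m) * sinh (sqrt c * grid_time k s) \<le> (approx_flow k s m' - approx_flow k s m) * sinh (sqrt c * grid_time k t)"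
proof -
  have "0 < cell k s" using assms(1) by (simp add: grid_time_def zero_less_divide_iff)
  from sticky_particles.pos_diff_sinh_grid[OF particles cell_mono[OF assms(4)] cell_lt this cell_mono[OF assms(2)], of k v0] assms
  show ?thesis by (simp add: approx_flow_def sticky_particles.sinh_grid_def[OF particles] grid_time_def)
qed

lemma approx_flow_meas [measurable]: "(\<lambda>p. approx_flow k (fst p) (snd p)) \<in> borel_measurable (borel \<Otimes>\<^sub>M borel)"
  unfolding approx_flow_def
proof (rule measurable_compose_countable[where f = "\<lambda>i p. pos k i (cell k (snd p))"])
  show "(\<lambda>p. pos k i (cell k (snd p))) \<in> borel_measurable (borel \<Otimes>\<^sub>M borel)" for i
    by (rule measurable_compose_countable[where f = "\<lambda>j p. pos k i j"]) measurable
qed measurable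

lemma approx_flow_meas2 [measurable]: "f \<in> borel_measurable M \<Longrightarrow> g \<in> borel_measurable M \<Longrightarrow> (\<lambda>x. approx_flow k (f x) (g x)) \<in> borel_measurable M"
  using measurable_compose[OF measurable_Pair approx_flow_meas, of f M g] by simp

lemma approx_flow_pointwise:
  assumes "0 \<le> t" "t \<le> T" "m \<in> {0<..<1}"
  shows "\<bar>approx_flow k t m\<bar> \<le> Kb T * \<beta> m"
  using approx_flow_int[of "\<lambda>x y. x\<^sup>2" k t t]
  by (intro mono_L2_bound[where f = "approx_flow k t"] approx_flow_mono approx_flow_bound[OF assms(1,2)] Kb_nonneg assms(3)) auto

definition Lc :: "real \<Rightarrow> real \<Rightarrow> real" where
  "Lc a T = Kb T * (1 + 2 * (sqrt c * cosh (sqrt c * T) / sinh (sqrt c * a)))"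

text \<open>
  The Lipschitz constant blows up at time \<open>0\<close>, where the gaps of the flow are not
  controlled by \<open>sinh\<close>.
\<close>
lemma approx_flow_time:
  assumes "0 < a" "a \<le> grid_time k s" "0 \<le> s" "s \<le> t" "t \<le> T" "m \<in> {0<..<1}"
  shows "\<bar>approx_flow k t m - approx_flow k s m\<bar> \<le> Lc a T * (grid_time k t - grid_time k s) * \<beta> m"
proof -
  define l where "l = sinh (sqrt c * grid_time k t) / sinh (sqrt c * grid_time k s) - 1"
  have st: "grid_time k s \<le> grid_time k t" "grid_time k t \<le> T" using grid_time_mono[of s t k] grid_time_le[of t k] assms by auto
  have l: "l \<le> sqrt c * cosh (sqrt c * T) / sinh (sqrt c * a) * (grid_time k t - grid_time k s)" "0 \<le> l"
    unfolding l_def using sinh_ratio[of "sqrt c" a "grid_time k s" "grid_time k t" T] assms st c_pos by auto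
  have sp: "0 < sinh (sqrt c * grid_time k s)" using assms c_pos by simp
  have "\<bar>approx_flow k t m - approx_flow k s m\<bar> \<le> (Kb T * (grid_time k t - grid_time k s) + 2 * l * Kb T) * \<beta> m"
  proof (rule mono_pair_bound)
    show "approx_flow k t m' - approx_flow k t m \<le> (1 + l) * (approx_flow k s m' - approx_flow k s m)" if "0 < m" "m \<le> m'" "m' < 1" for m m'
    proof -
      have "approx_flow k t m' - approx_flow k t m \<le> (approx_flow k s m' - approx_flow k s m) * sinh (sqrt c * grid_time k t) / sinh (sqrt c * grid_time k s)"
        using approx_flow_sinh[OF _ assms(4) that, of k] assms sp by (simp add: pos_le_divide_eq)
      then show ?thesis by (simp add: l_def mult_ac)
    qed
    show "integrable U (\<lambda>m. (approx_flow k s m)\<^sup>2)" "integrable U (\<lambda>m. (approx_flow k t m - approx_flow k s m)\<^sup>2)"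
      using approx_flow_int[of "\<lambda>x y. x\<^sup>2" k s s] approx_flow_int[of "\<lambda>x y. (x - y)\<^sup>2" k t s] by auto
    show "(\<integral>m. (approx_flow k s m)\<^sup>2 \<partial>U) \<le> (Kb T)\<^sup>2" using approx_flow_bound[of s T k] assms by auto
    show "(\<integral>m. (approx_flow k t m - approx_flow k s m)\<^sup>2 \<partial>U) \<le> (Kb T * (grid_time k t - grid_time k s))\<^sup>2"
      using approx_flow_lip[of s t T k] assms by auto
  qed (use approx_flow_mono Kb_nonneg l assms st in auto)
  also have "\<dots> \<le> Lc a T * (grid_time k t - grid_time k s) * \<beta> m"
  proof (rule mult_right_mono)
    have "2 * Kb T * l \<le> 2 * Kb T * (sqrt c * cosh (sqrt c * T) / sinh (sqrt c * a) * (grid_time k t - grid_time k s))"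
      using l Kb_nonneg by (intro mult_left_mono) auto
    then show "Kb T * (grid_time k t - grid_time k s) + 2 * l * Kb T \<le> Lc a T * (grid_time k t - grid_time k s)"
      by (simp add: Lc_def algebra_simps)
    show "0 \<le> \<beta> m" using \<beta>_ge1[OF assms(6)] by simp
  qed
  finally show ?thesis .
qed

lemma Lc_nonneg: "0 < a \<Longrightarrow> 0 \<le> Lc a T"
  using Kb_nonneg[of T] c_pos by (simp add: Lc_def)

text \<open>
  A diagonal argument over the countable set of rational times and labels, after normalising by
  the pointwise bound.
\<close>
lemma subsequence_exists:
  "\<exists>\<sigma>. strict_mono \<sigma> \<and> (\<forall>t\<in>\<rat>. \<forall>q\<in>\<rat>. 0 \<le> t \<longrightarrow> q \<in> {0<..<1} \<longrightarrow> convergent (\<lambda>k. approx_flow (\<sigma> k) t q))"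
proof -
  define S :: "(real \<times> real) set" where "S = {p \<in> \<rat> \<times> \<rat>. 0 \<le> fst p \<and> snd p \<in> {0<..<1::real}}"
  have cS: "countable S"
    unfolding S_def by (rule countable_subset[of _ "\<rat> \<times> \<rat>"]) (auto simp: countable_rat)
  define b where "b p = Kb (fst p) * \<beta> (snd p) + 1" for p
  have bpos: "0 < b p" if "p \<in> S" for p
    using that Kb_nonneg[of "fst p"] \<beta>_ge1[of "snd p"] by (simp add: b_def S_def add_nonneg_pos)
  define f where "f k p = approx_flow k (fst p) (snd p) / b p" for k p
  have f1: "norm (f k p) \<le> 1" if "p \<in> S" for k p
    unfolding f_def using approx_flow_pointwise[of "fst p" "fst p" "snd p" k] bpos[OF that] that by (simp add: S_def b_def abs_divide)
  obtain \<sigma> :: "nat \<Rightarrow> nat" where \<sigma>: "strict_mono \<sigma>" "\<And>p. p \<in> S \<Longrightarrow> \<exists>l. (\<lambda>k. f (\<sigma> k) p) \<longlonglongrightarrow> l"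
    by (rule function_convergent_subsequence[OF cS, of f 1]) (use f1 in blast)+
  have "convergent (\<lambda>k. approx_flow (\<sigma> k) t q)" if tq: "(t, q) \<in> S" for t q
  proof -
    obtain l where "(\<lambda>k. approx_flow (\<sigma> k) t q / b (t, q)) \<longlonglongrightarrow> l"
      using \<sigma>(2)[OF tq] by (auto simp: f_def)
    from tendsto_mult_right[OF this, of "b (t, q)"]
    have "(\<lambda>k. approx_flow (\<sigma> k) t q) \<longlonglongrightarrow> l * b (t, q)" using bpos[OF tq] by simp
    then show ?thesis by (auto simp: convergent_def)
  qed
  then show ?thesis using \<sigma>(1) by (auto simp: S_def intro!: exI[of _ \<sigma>])
qed

definition \<sigma> :: "nat \<Rightarrow> nat" where
  "\<sigma> = (SOME \<sigma>. strict_mono \<sigma> \<and> (\<forall>t\<in>\<rat>. \<forall>q\<in>\<rat>. 0 \<le> t \<longrightarrow> q \<in> {0<..<1} \<longrightarrow> convergent (\<lambda>k. approx_flow (\<sigma> k) t q)))"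

lemma \<sigma>_mono: "strict_mono \<sigma>"
  and \<sigma>_conv: "t \<in> \<rat> \<Longrightarrow> q \<in> \<rat> \<Longrightarrow> 0 \<le> t \<Longrightarrow> q \<in> {0<..<1} \<Longrightarrow> convergent (\<lambda>k. approx_flow (\<sigma> k) t q)"
  using someI_ex[OF subsequence_exists] unfolding \<sigma>_def by blast+

lemma mesh_\<sigma>: "(\<lambda>k. mesh (\<sigma> k)) \<longlonglongrightarrow> 0"
  using LIMSEQ_subseq_LIMSEQ[OF mesh_tendsto \<sigma>_mono] by (simp add: o_def)

lemma grid_time_\<sigma>: "0 \<le> t \<Longrightarrow> (\<lambda>k. grid_time (\<sigma> k) t) \<longlonglongrightarrow> t"
  using LIMSEQ_subseq_LIMSEQ[OF grid_time_tendsto \<sigma>_mono, of t] by (simp add: o_def)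

text \<open>
  Convergence spreads from rational to real times by the equicontinuity \<open>approx_flow_time\<close>.
\<close>
lemma \<sigma>_conv_real:
  assumes q: "q \<in> \<rat>" "q \<in> {0<..<1}" and t: "0 \<le> t"
  shows "convergent (\<lambda>k. approx_flow (\<sigma> k) t q)"
proof (cases "t = 0")
  case True
  then show ?thesis using \<sigma>_conv[of 0 q] q by simp
next
  case False
  then have t0: "0 < t" using t by simp
  define L where "L = Lc (t / 4) t * \<beta> q"
  have L: "0 \<le> L" using Lc_nonneg[of "t/4" t] t0 \<beta>_ge1[OF q(2)] by (simp add: L_def)
  show ?thesis
  proof (rule Cauchy_convergent, rule metric_CauchyI)
    fix e :: real assume e: "0 < e"
    \<comment> \<open>the rational time \<open>s\<close> is taken within \<open>d\<close> of
        \<open>t\<close>, and the discrete times are within \<open>2 d\<close> of each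
        other\<close>
    define d where "d = min (t / 2) (e / (6 * (L + 1)))"
    have d: "0 < d" using t0 e L by (simp add: d_def)
    obtain s where s: "s \<in> \<rat>" "t - d < s" "s < t" using Rats_dense_in_real[of "t - d" t] d by auto
    have s2: "t / 2 \<le> s" using s by (simp add: d_def)
    have "0 < min (t / 4) d" using t0 d by simp
    then obtain N1 where N1: "\<And>k. N1 \<le> k \<Longrightarrow> mesh (\<sigma> k) < min (t / 4) d"
      using mesh_\<sigma>[THEN order_tendstoD(2)] unfolding eventually_sequentially by blast
    have "Cauchy (\<lambda>k. approx_flow (\<sigma> k) s q)" using \<sigma>_conv[of s q] s s2 t0 q by (intro convergent_Cauchy) auto
    then obtain N2 where N2: "\<And>j k. N2 \<le> j \<Longrightarrow> N2 \<le> k \<Longrightarrow> dist (approx_flow (\<sigma> j) s q) (approx_flow (\<sigma> k) s q) < e / 3"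
      using e unfolding Cauchy_def by (meson divide_pos_pos zero_less_numeral)
    have cl: "\<bar>approx_flow (\<sigma> k) t q - approx_flow (\<sigma> k) s q\<bar> < e / 3" if "N1 \<le> k" for k
    proof -
      have a: "t / 4 \<le> grid_time (\<sigma> k) s" using N1[OF that] grid_time_gt[of s "\<sigma> k"] s2 t0 by simp
      have "\<bar>approx_flow (\<sigma> k) t q - approx_flow (\<sigma> k) s q\<bar> \<le> Lc (t / 4) t * (grid_time (\<sigma> k) t - grid_time (\<sigma> k) s) * \<beta> q"
        using a t0 s s2 q by (intro approx_flow_time) auto
      also have "\<dots> = L * (grid_time (\<sigma> k) t - grid_time (\<sigma> k) s)" by (simp add: L_def)
      also have "\<dots> \<le> L * (2 * d)"
        using L N1[OF that] grid_time_gt[of s "\<sigma> k"] grid_time_le[of t "\<sigma> k"] s s2 t0 by (intro mult_left_mono) auto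
      also have "\<dots> \<le> L * (2 * (e / (6 * (L + 1))))"
        using L by (intro mult_left_mono) (auto simp: d_def)
      also have "\<dots> < e / 3" using L e by (simp add: field_simps)
      finally show ?thesis .
    qed
    show "\<exists>M. \<forall>m\<ge>M. \<forall>n\<ge>M. dist (approx_flow (\<sigma> m) t q) (approx_flow (\<sigma> n) t q) < e"
    proof (intro exI allI impI)
      fix m n assume "max N1 N2 \<le> m" "max N1 N2 \<le> n"
      then show "dist (approx_flow (\<sigma> m) t q) (approx_flow (\<sigma> n) t q) < e"
        using N2[of m n] cl[of m] cl[of n] by (simp add: dist_real_def abs_if split: if_splits)
    qed
  qed
qed

definition \<Xi> :: "real \<Rightarrow> real \<Rightarrow> real" where "\<Xi> t q = lim (\<lambda>k. approx_flow (\<sigma> k) t q)"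

lemma \<Xi>_lim: "q \<in> \<rat> \<Longrightarrow> q \<in> {0<..<1} \<Longrightarrow> 0 \<le> t \<Longrightarrow> (\<lambda>k. approx_flow (\<sigma> k) t q) \<longlonglongrightarrow> \<Xi> t q"
  unfolding \<Xi>_def using \<sigma>_conv_real convergent_LIMSEQ_iff by blast

lemma \<Xi>_mono: "q \<in> \<rat> \<Longrightarrow> q' \<in> \<rat> \<Longrightarrow> 0 < q \<Longrightarrow> q \<le> q' \<Longrightarrow> q' < 1 \<Longrightarrow> 0 \<le> t \<Longrightarrow> \<Xi> t q \<le> \<Xi> t q'"
  by (rule LIMSEQ_le[OF \<Xi>_lim \<Xi>_lim]) (auto intro!: exI approx_flow_mono)

text \<open>
  The right-continuous regularisation in the label, so that \<open>X t\<close> is nondecreasing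
  on the whole interval. The value \<open>0\<close> outside the relevant range only serves joint
  measurability.
\<close>
definition X :: "real \<Rightarrow> real \<Rightarrow> real" where
  "X t m = (if 0 \<le> t \<and> m \<in> {0<..<1} then Inf (\<Xi> t ` {q\<in>\<rat>. m < q \<and> q < 1}) else 0)"

lemma rat_set: "m \<in> {0<..<1::real} \<Longrightarrow> {q\<in>\<rat>. m < q \<and> q < 1} \<noteq> {}"
  using Rats_dense_in_real[of m 1] by auto

lemma \<Xi>_bdd: "m \<in> {0<..<1} \<Longrightarrow> 0 \<le> t \<Longrightarrow> bdd_below (\<Xi> t ` {q\<in>\<rat>. m < q \<and> q < 1})"
proof -
  assume m: "m \<in> {0<..<1}" and t: "0 \<le> t"
  obtain q where q: "q \<in> \<rat>" "0 < q" "q < m" using Rats_dense_in_real[of 0 m] m by auto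
  show ?thesis by (rule bdd_belowI[of _ "\<Xi> t q"]) (use q m t in \<open>auto intro!: \<Xi>_mono\<close>)
qed

lemma X_le_\<Xi>: "m \<in> {0<..<1} \<Longrightarrow> 0 \<le> t \<Longrightarrow> q \<in> \<rat> \<Longrightarrow> m < q \<Longrightarrow> q < 1 \<Longrightarrow> X t m \<le> \<Xi> t q"
  unfolding X_def using \<Xi>_bdd[of m t] by (auto intro!: cInf_lower)

lemma X_less_iff:
  assumes "m \<in> {0<..<1}" "0 \<le> t"
  shows "X t m < a \<longleftrightarrow> (\<exists>q\<in>\<rat>. m < q \<and> q < 1 \<and> \<Xi> t q < a)"
proof -
  have "X t m < a \<longleftrightarrow> (\<exists>x\<in>\<Xi> t ` {q\<in>\<rat>. m < q \<and> q < 1}. x < a)"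
    unfolding X_def using cInf_less_iff[OF _ \<Xi>_bdd[OF assms], of a] rat_set[OF assms(1)] assms by simp
  then show ?thesis by auto
qed

lemma X_mono:
  assumes "0 \<le> t" "0 < m" "m \<le> m'" "m' < 1"
  shows "X t m \<le> X t m'"
proof (rule ccontr)
  assume "\<not> ?thesis"
  then have "X t m' < X t m" by simp
  then obtain r where r: "r \<in> \<rat>" "m' < r" "r < 1" "\<Xi> t r < X t m"
    using X_less_iff[of m' t] assms by auto
  have "X t m \<le> \<Xi> t r" using assms r by (intro X_le_\<Xi>) auto
  then show False using r by simp
qed

lemma right_seq:
  assumes m: "m \<in> {0<..<1::real}"
  obtains q :: "nat \<Rightarrow> real" where "\<And>n::nat. q n \<in> \<rat>" "\<And>n. m < q n" "\<And>n. q n < 1" "q \<longlonglongrightarrow> m"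
proof -
  have "\<exists>r\<in>\<rat>. m < r \<and> r < m + (1 - m) / Suc n" for n
    using m by (intro Rats_dense_in_real) auto
  then obtain q where q: "\<And>n::nat. q n \<in> \<rat> \<and> m < q n \<and> q n < m + (1 - m) / Suc n" by metis
  have "(\<lambda>n. m + (1 - m) * (1 / Suc n)) \<longlonglongrightarrow> m + (1 - m) * 0"
    by (intro tendsto_intros mesh_tendsto)
  then have u: "(\<lambda>n. m + (1 - m) / Suc n) \<longlonglongrightarrow> m" by simp
  have "q \<longlonglongrightarrow> m"
    by (rule tendsto_sandwich[OF _ _ tendsto_const u]) (use q in \<open>auto intro!: always_eventually less_imp_le\<close>)
  moreover have "q n < 1" for n
  proof -
    have "(1 - m) / Suc n \<le> (1 - m) / 1" using m by (intro divide_left_mono) auto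
    then show ?thesis using q[of n] by simp
  qed
  ultimately show ?thesis using that q by blast
qed

lemma \<Xi>_right:
  assumes m: "m \<in> {0<..<1}" and t: "0 \<le> t" and q: "\<And>n::nat. q n \<in> \<rat>" "\<And>n. m < q n" "\<And>n. q n < 1" "q \<longlonglongrightarrow> m"
  shows "(\<lambda>n. \<Xi> t (q n)) \<longlonglongrightarrow> X t m"
proof (rule order_tendstoI)
  fix a assume "a < X t m"
  then show "\<forall>\<^sub>F n in sequentially. a < \<Xi> t (q n)"
    using X_le_\<Xi>[OF m t q(1) q(2) q(3)] by (intro always_eventually allI) (rule less_le_trans)
next
  fix a assume "X t m < a"
  then obtain r where r: "r \<in> \<rat>" "m < r" "r < 1" "\<Xi> t r < a" using X_less_iff[OF m t] by auto
  show "\<forall>\<^sub>F n in sequentially. \<Xi> t (q n) < a"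
    using order_tendstoD(2)[OF q(4) r(2)]
  proof eventually_elim
    case (elim n)
    have "\<Xi> t (q n) \<le> \<Xi> t r" using q[of] r m t elim less_trans[OF _ q(2)[of n]] by (intro \<Xi>_mono) auto
    then show ?case using r by simp
  qed
qed

text \<open>
  Monotone functions that converge at the rational labels converge at every continuity point of
  the limit, and a monotone function has only countably many discontinuities.
\<close>
lemma X_AE_lim:
  assumes t: "0 \<le> t"
  shows "AE m in U. (\<lambda>k. approx_flow (\<sigma> k) t m) \<longlonglongrightarrow> X t m"
proof (rule AE_U_countable)
  show "countable {m \<in> {0<..<1}. \<not> isCont (X t) m}"
    by (rule mono_on_ctble_discont_open) (use X_mono[OF t] in \<open>auto intro!: mono_onI\<close>)
  fix m assume m: "m \<in> {0<..<1::real}" "m \<notin> {m \<in> {0<..<1}. \<not> isCont (X t) m}"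
  then have c: "isCont (X t) m" by simp
  show "(\<lambda>k. approx_flow (\<sigma> k) t m) \<longlonglongrightarrow> X t m"
  proof (rule order_tendstoI)
    fix a assume a: "X t m < a"
    then obtain r where r: "r \<in> \<rat>" "m < r" "r < 1" "\<Xi> t r < a" using X_less_iff[OF m(1) t] by auto
    have rm: "r \<in> {0<..<1}" using r m by auto
    show "\<forall>\<^sub>F k in sequentially. approx_flow (\<sigma> k) t m < a"
      using order_tendstoD(2)[OF \<Xi>_lim[OF r(1) rm t] r(4)]
    proof eventually_elim
      case (elim k)
      then show ?case using approx_flow_mono[of m r "\<sigma> k" t] r m by simp
    qed
  next
    fix a assume a: "a < X t m"
    from order_tendstoD(1)[OF c[unfolded isCont_def] a]
    obtain d where d: "0 < d" "\<And>x. x \<noteq> m \<Longrightarrow> dist x m < d \<Longrightarrow> a < X t x"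
      unfolding eventually_at by auto
    define x where "x = max (m / 2) (m - d / 2)"
    have x: "0 < x" "x < m" "a < X t x" using d m(1) by (auto simp: x_def dist_real_def)
    obtain q where q: "q \<in> \<rat>" "x < q" "q < m" using Rats_dense_in_real[OF x(2)] by auto
    have aq: "a < \<Xi> t q" using x q m X_le_\<Xi>[of x t q] t by auto
    have qm: "q \<in> {0<..<1}" using q x m by auto
    show "\<forall>\<^sub>F k in sequentially. a < approx_flow (\<sigma> k) t m"
      using order_tendstoD(1)[OF \<Xi>_lim[OF q(1) qm t] aq]
    proof eventually_elim
      case (elim k)
      then show ?case using approx_flow_mono[of q m "\<sigma> k" t] q qm m by simp
    qed
  qed
qed

lemma X_meas: "(\<lambda>(t, m). X t m) \<in> borel_measurable (borel \<Otimes>\<^sub>M borel)"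
  unfolding borel_measurable_iff_less
proof
  fix a
  have [measurable]: "(\<lambda>t. \<Xi> t q) \<in> borel_measurable borel" for q
    unfolding \<Xi>_def by measurable
  let ?P = "\<lambda>p::real \<times> real. 0 \<le> fst p \<and> snd p \<in> {0<..<1}"
  have "{p \<in> space (borel \<Otimes>\<^sub>M borel). (case p of (t, m) \<Rightarrow> X t m) < a} =
    (\<Union>q\<in>\<rat>. {p \<in> space (borel \<Otimes>\<^sub>M borel). ?P p \<and> snd p < q \<and> q < 1 \<and> \<Xi> (fst p) q < a})
     \<union> {p \<in> space (borel \<Otimes>\<^sub>M borel). \<not> ?P p \<and> 0 < a}"
    (is "?L = ?R")
  proof (intro set_eqI iffI)
    fix p assume "p \<in> ?L" then show "p \<in> ?R"
      using X_less_iff[of "snd p" "fst p" a] by (cases "?P p") (auto simp: X_def split: prod.splits)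
  next
    fix p assume "p \<in> ?R" then show "p \<in> ?L"
      using X_less_iff[of "snd p" "fst p" a] by (cases "?P p") (auto simp: X_def split: prod.splits)
  qed
  also have "\<dots> \<in> sets (borel \<Otimes>\<^sub>M borel)"
    by (intro sets.Un sets.countable_UN'' countable_rat) measurable
  finally show "{p \<in> space (borel \<Otimes>\<^sub>M borel). (case p of (t, m) \<Rightarrow> X t m) < a} \<in> sets (borel \<Otimes>\<^sub>M borel)" .
qed

lemma X_meas2 [measurable]: "f \<in> borel_measurable M \<Longrightarrow> g \<in> borel_measurable M \<Longrightarrow> (\<lambda>x. X (f x) (g x)) \<in> borel_measurable M"
  using measurable_compose[OF measurable_Pair X_meas, of f M g] by simp

lemma X_int: "0 \<le> t \<Longrightarrow> integrable U (\<lambda>m. (X t m)\<^sup>2)"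
  and X_bound: "0 \<le> t \<Longrightarrow> t \<le> T \<Longrightarrow> (\<integral>m. (X t m)\<^sup>2 \<partial>U) \<le> (Kb T)\<^sup>2"
proof -
  have *: "integrable U (\<lambda>m. (X t m)\<^sup>2)" "(\<integral>m. (X t m)\<^sup>2 \<partial>U) \<le> (Kb T)\<^sup>2" if "0 \<le> t" "t \<le> T" for T
    using fatou_square_U[of "\<lambda>k. approx_flow (\<sigma> k) t" "X t" "\<lambda>_. (Kb T)\<^sup>2"] approx_flow_int[of "\<lambda>x y. x\<^sup>2"] approx_flow_bound[OF that] X_AE_lim[OF that(1)]
    by auto
  show "0 \<le> t \<Longrightarrow> integrable U (\<lambda>m. (X t m)\<^sup>2)" using *[of t] by simp
  show "0 \<le> t \<Longrightarrow> t \<le> T \<Longrightarrow> (\<integral>m. (X t m)\<^sup>2 \<partial>U) \<le> (Kb T)\<^sup>2" using *[of T] by simp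
qed

lemma X_lip:
  assumes "0 \<le> s" "s \<le> t" "t \<le> T"
  shows "(\<integral>m. (X t m - X s m)\<^sup>2 \<partial>U) \<le> (Kb T * (t - s))\<^sup>2"
proof (rule fatou_square_U(2)[where f = "\<lambda>k m. approx_flow (\<sigma> k) t m - approx_flow (\<sigma> k) s m" and E = "\<lambda>k. (Kb T * (grid_time (\<sigma> k) t - grid_time (\<sigma> k) s))\<^sup>2"])
  show "AE m in U. (\<lambda>k. approx_flow (\<sigma> k) t m - approx_flow (\<sigma> k) s m) \<longlonglongrightarrow> X t m - X s m"
    using X_AE_lim[of s] X_AE_lim[of t] assms by (auto elim!: eventually_elim2 intro: tendsto_diff)
  show "(\<lambda>k. (Kb T * (grid_time (\<sigma> k) t - grid_time (\<sigma> k) s))\<^sup>2) \<longlonglongrightarrow> (Kb T * (t - s))\<^sup>2"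
    using assms by (intro tendsto_intros grid_time_\<sigma>) auto
qed (use approx_flow_int[of "\<lambda>x y. (x - y)\<^sup>2"] approx_flow_lip assms in auto)

lemma X_sinh:
  assumes st: "0 < s" "s \<le> t" and m: "0 < m" "m \<le> m'" "m' < 1"
  shows "(X t m' - X t m) * sinh (sqrt c * s) \<le> (X s m' - X s m) * sinh (sqrt c * t)"
proof (cases "m = m'")
  case False
  have rat: "(\<Xi> t q' - \<Xi> t q) * sinh (sqrt c * s) \<le> (\<Xi> s q' - \<Xi> s q) * sinh (sqrt c * t)"
    if q: "q \<in> \<rat>" "q' \<in> \<rat>" "0 < q" "q \<le> q'" "q' < 1" for q q'
  proof (rule tendsto_le[OF trivial_limit_sequentially])
    show "(\<lambda>k. (approx_flow (\<sigma> k) t q' - approx_flow (\<sigma> k) t q) * sinh (sqrt c * grid_time (\<sigma> k) s)) \<longlonglongrightarrow> (\<Xi> t q' - \<Xi> t q) * sinh (sqrt c * s)"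
      using q st by (intro tendsto_intros \<Xi>_lim grid_time_\<sigma>) auto
    show "(\<lambda>k. (approx_flow (\<sigma> k) s q' - approx_flow (\<sigma> k) s q) * sinh (sqrt c * grid_time (\<sigma> k) t)) \<longlonglongrightarrow> (\<Xi> s q' - \<Xi> s q) * sinh (sqrt c * t)"
      using q st by (intro tendsto_intros \<Xi>_lim grid_time_\<sigma>) auto
    show "\<forall>\<^sub>F k in sequentially. (approx_flow (\<sigma> k) t q' - approx_flow (\<sigma> k) t q) * sinh (sqrt c * grid_time (\<sigma> k) s)
        \<le> (approx_flow (\<sigma> k) s q' - approx_flow (\<sigma> k) s q) * sinh (sqrt c * grid_time (\<sigma> k) t)"
      using order_tendstoD(1)[OF grid_time_\<sigma> st(1)] st
      by (auto elim!: eventually_mono intro!: approx_flow_sinh q)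
  qed
  have mm: "m \<in> {0<..<1}" "m' \<in> {0<..<1}" using m by auto
  obtain q where q: "\<And>n::nat. q n \<in> \<rat>" "\<And>n. m < q n" "\<And>n. q n < 1" "q \<longlonglongrightarrow> m"
    by (rule right_seq[OF mm(1)], rule that)
  obtain q' where q': "\<And>n::nat. q' n \<in> \<rat>" "\<And>n. m' < q' n" "\<And>n. q' n < 1" "q' \<longlonglongrightarrow> m'"
    by (rule right_seq[OF mm(2)], rule that)
  show ?thesis
  proof (rule tendsto_le[OF trivial_limit_sequentially])
    show "(\<lambda>n. (\<Xi> t (q' n) - \<Xi> t (q n)) * sinh (sqrt c * s)) \<longlonglongrightarrow> (X t m' - X t m) * sinh (sqrt c * s)"
      using st by (intro tendsto_intros \<Xi>_right[OF mm(1) _ q] \<Xi>_right[OF mm(2) _ q']) auto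
    show "(\<lambda>n. (\<Xi> s (q' n) - \<Xi> s (q n)) * sinh (sqrt c * t)) \<longlonglongrightarrow> (X s m' - X s m) * sinh (sqrt c * t)"
      using st by (intro tendsto_intros \<Xi>_right[OF mm(1) _ q] \<Xi>_right[OF mm(2) _ q']) auto
    have "m < m'" using False m by simp
    show "\<forall>\<^sub>F n in sequentially. (\<Xi> t (q' n) - \<Xi> t (q n)) * sinh (sqrt c * s) \<le> (\<Xi> s (q' n) - \<Xi> s (q n)) * sinh (sqrt c * t)"
      using order_tendstoD(2)[OF q(4) \<open>m < m'\<close>]
    proof eventually_elim
      case (elim n)
      have "0 < q n" using q(2)[of n] m by linarith
      moreover have "q n \<le> q' n" using elim q'(2)[of n] by linarith
      ultimately show ?case by (intro rat q q')
    qed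
  qed
qed simp

lemma X_0: "AE m in U. X 0 m = Q m"
proof -
  have "AE m in U. (\<lambda>k. approx_flow k 0 m) \<longlonglongrightarrow> Q m"
  proof (rule AE_U_countable)
    show "countable {m \<in> {0<..<1}. \<not> isCont Q m}"
      by (rule mono_on_ctble_discont_open) (use Q_mono in \<open>auto intro!: mono_onI\<close>)
    fix m assume m: "m \<in> {0<..<1::real}" "m \<notin> {m \<in> {0<..<1}. \<not> isCont Q m}"
    then have c: "isCont Q m" by simp
    have l: "(\<lambda>k. real (cell k m) / Suc k) \<longlonglongrightarrow> m" using grid_time_tendsto[of m] m by (simp add: grid_time_def)
    have u: "(\<lambda>k. real (Suc (cell k m)) / Suc k) \<longlonglongrightarrow> m"
      using tendsto_add[OF l mesh_tendsto] by (simp add: of_nat_Suc[of "nat \<lfloor>x\<rfloor>" for x] add_divide_distrib add.commute)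
    show "(\<lambda>k. approx_flow k 0 m) \<longlonglongrightarrow> Q m"
    proof (rule tendsto_sandwich)
      show "(\<lambda>k. Q (real (cell k m) / Suc k)) \<longlonglongrightarrow> Q m" by (rule isCont_tendsto_compose[OF c l])
      show "(\<lambda>k. Q (real (Suc (cell k m)) / Suc k)) \<longlonglongrightarrow> Q m" by (rule isCont_tendsto_compose[OF c u])
      have "0 < m" "m < 1" using m by auto
      show "\<forall>\<^sub>F k in sequentially. Q (real (cell k m) / Suc k) \<le> approx_flow k 0 m"
        using order_tendstoD(1)[OF l \<open>0 < m\<close>]
      proof eventually_elim
        case (elim k)
        then have "0 < cell k m" by (auto simp: zero_less_divide_iff)
        from x0_ge[OF this] show ?case unfolding approx_flow_0 .
      qed
      show "\<forall>\<^sub>F k in sequentially. approx_flow k 0 m \<le> Q (real (Suc (cell k m)) / Suc k)"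
        using order_tendstoD(2)[OF u \<open>m < 1\<close>]
        by eventually_elim (auto simp: approx_flow_0 intro!: x0_le simp del: of_nat_Suc)
    qed
  qed
  then show ?thesis using X_AE_lim[of 0, OF order_refl]
  proof eventually_elim
    case (elim m)
    from LIMSEQ_subseq_LIMSEQ[OF elim(1) \<sigma>_mono] have "(\<lambda>k. approx_flow (\<sigma> k) 0 m) \<longlonglongrightarrow> Q m" by (simp add: o_def)
    then show ?case using elim(2) LIMSEQ_unique by blast
  qed
qed

end

section \<open>The projection identity in the limit\<close>

lemma set_int_abs_le:
  fixes f :: "real \<Rightarrow> real"
  assumes "a \<le> b" "0 \<le> B" "\<And>r. a < r \<Longrightarrow> r \<le> b \<Longrightarrow> \<bar>f r\<bar> \<le> B"
  shows "\<bar>LBINT r:{a<..b}. f r\<bar> \<le> (b - a) * B"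
proof (cases "set_integrable lborel {a<..b} f")
  case True
  have "\<bar>LBINT r:{a<..b}. f r\<bar> \<le> (\<integral>r. norm (indicator {a<..b} r *\<^sub>R f r) \<partial>lborel)"
    unfolding set_lebesgue_integral_def
    using integral_norm_bound[of lborel "\<lambda>r. indicator {a<..b} r *\<^sub>R f r"] by simp
  also have "\<dots> \<le> (\<integral>r. indicator {a<..b} r * B \<partial>lborel)"
  proof (rule integral_mono)
    show "integrable lborel (\<lambda>r. norm (indicator {a<..b} r *\<^sub>R f r))"
      using True unfolding set_integrable_def by (rule integrable_norm)
    show "integrable lborel (\<lambda>r. indicator {a<..b} r * B)"
      using assms(1) by (intro integrable_mult_left) (simp add: integrable_indicator_iff)
    show "norm (indicator {a<..b} r *\<^sub>R f r) \<le> indicator {a<..b} r * B" for r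
      using assms(3)[of r] by (simp add: indicator_def)
  qed
  also have "\<dots> = (b - a) * B" using assms(1) by simp
  finally show ?thesis .
next
  case False
  then have "(LBINT r:{a<..b}. f r) = 0"
    unfolding set_integrable_def set_lebesgue_integral_def by (rule not_integrable_integral_eq)
  then show ?thesis using assms by simp
qed

lemma LIMSEQ_inverse_iff:
  fixes a :: "nat \<Rightarrow> real"
  shows "a \<longlonglongrightarrow> l \<longleftrightarrow> (\<forall>j. \<exists>n. \<forall>k\<ge>n. \<bar>a k - l\<bar> < inverse (real (Suc j)))"
proof
  assume "a \<longlonglongrightarrow> l"
  then have "\<exists>n. \<forall>k\<ge>n. \<bar>a k - l\<bar> < e" if "0 < e" for e
    using that unfolding LIMSEQ_def dist_real_def by blast
  then show "\<forall>j. \<exists>n. \<forall>k\<ge>n. \<bar>a k - l\<bar> < inverse (real (Suc j))" by simp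
next
  assume *: "\<forall>j. \<exists>n. \<forall>k\<ge>n. \<bar>a k - l\<bar> < inverse (real (Suc j))"
  show "a \<longlonglongrightarrow> l"
    unfolding LIMSEQ_def dist_real_def
  proof (intro allI impI)
    fix r :: real assume "0 < r"
    then obtain j where "inverse (real (Suc j)) < r" using reals_Archimedean by blast
    with * show "\<exists>no. \<forall>n\<ge>no. \<bar>a n - l\<bar> < r" by (meson less_trans)
  qed
qed

lemma borel_measurable_into_U: "f \<in> measurable M U \<Longrightarrow> f \<in> borel_measurable M"
  using measurable_compose[of f M U "\<lambda>x. x" borel] by simp

lemma measurable_fst_U [measurable]: "fst \<in> borel_measurable (U \<Otimes>\<^sub>M N)"
  and measurable_snd_U [measurable]: "snd \<in> borel_measurable (M \<Otimes>\<^sub>M U)"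
  by (auto intro: borel_measurable_into_U)

text \<open>
  Joint measurability in the form in which the measurability prover can use it for any
  arguments.
\<close>
lemma measurable_uncurried:
  assumes "(\<lambda>(t, m). F t m) \<in> borel_measurable (borel \<Otimes>\<^sub>M borel)"
    and "f \<in> borel_measurable N" "g \<in> borel_measurable N"
  shows "(\<lambda>x. F (f x) (g x)) \<in> borel_measurable N"
  using measurable_compose[OF measurable_Pair assms(1), of f N g] assms by simp

lemma measurable_lag_force:
  assumes w: "continuous_on UNIV w" and X: "(\<lambda>(t, m). X t m) \<in> borel_measurable (borel \<Otimes>\<^sub>M borel)"
    and fg: "f \<in> borel_measurable M" "g \<in> borel_measurable M"
  shows "(\<lambda>x. lag_force w X (f x) (g x)) \<in> borel_measurable M"
proof -
  have [measurable]: "w \<in> borel_measurable borel" using w by (rule borel_measurable_continuous_onI)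
  note [measurable] = measurable_uncurried[OF X]
  have "(\<lambda>p. lag_force w X (fst p) (snd p)) \<in> borel_measurable (borel \<Otimes>\<^sub>M borel)"
    unfolding lag_force_def
    by (intro borel_measurable_uminus U.borel_measurable_lebesgue_integral) (simp add: split_beta')
  from measurable_compose[OF measurable_Pair this, of f M g] fg show ?thesis by simp
qed

lemma measurable_time_integral:
  fixes F :: "real \<Rightarrow> real \<Rightarrow> real"
  assumes F: "(\<lambda>(t, m). F t m) \<in> borel_measurable (borel \<Otimes>\<^sub>M borel)"
    and fg: "f \<in> borel_measurable M" "g \<in> borel_measurable M"
  shows "(\<lambda>x. LBINT r:{0<..f x}. F r (g x)) \<in> borel_measurable M"
proof -
  note [measurable] = measurable_uncurried[OF F]
  have "(\<lambda>p. \<integral>r. (if 0 < r \<and> r \<le> fst p then 1 else 0) * F r (snd p) \<partial>lborel) \<in> borel_measurable (borel \<Otimes>\<^sub>M borel)"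
    by (intro lborel.borel_measurable_lebesgue_integral) (simp add: split_beta')
  also have "(\<lambda>p. \<integral>r. (if 0 < r \<and> r \<le> fst p then 1 else 0) * F r (snd p) \<partial>lborel) = (\<lambda>p. LBINT r:{0<..fst p}. F r (snd p))"
    unfolding set_lebesgue_integral_def
    by (intro ext Bochner_Integration.integral_cong) (auto simp: indicator_def)
  finally have "(\<lambda>p. LBINT r:{0<..fst p}. F r (snd p)) \<in> borel_measurable (borel \<Otimes>\<^sub>M borel)" .
  from measurable_compose[OF measurable_Pair this, of f M g] fg show ?thesis by simp
qed

lemma measurable_lag_impulse:
  assumes w: "continuous_on UNIV w" and v: "continuous_on UNIV v" and X: "(\<lambda>(t, m). X t m) \<in> borel_measurable (borel \<Otimes>\<^sub>M borel)"
    and fg: "f \<in> borel_measurable M" "g \<in> borel_measurable M"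
  shows "(\<lambda>x. lag_impulse w v X (f x) (g x)) \<in> borel_measurable M"
proof -
  have [measurable]: "v \<in> borel_measurable borel" using v by (rule borel_measurable_continuous_onI)
  have [measurable]: "(\<lambda>x. X 0 (g x)) \<in> borel_measurable M"
    using measurable_compose[OF measurable_Pair X, of "\<lambda>_. 0" M g] fg by simp
  have "(\<lambda>(t, m). lag_force w X t m) \<in> borel_measurable (borel \<Otimes>\<^sub>M borel)"
    using measurable_lag_force[OF w X, of fst "borel \<Otimes>\<^sub>M borel" snd] by (simp add: split_beta')
  from measurable_time_integral[OF this fg] show ?thesis unfolding lag_impulse_def by measurable
qed

lemma measurable_lag_free:
  assumes w: "continuous_on UNIV w" and v: "continuous_on UNIV v" and X: "(\<lambda>(t, m). X t m) \<in> borel_measurable (borel \<Otimes>\<^sub>M borel)"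
    and fg: "f \<in> borel_measurable M" "g \<in> borel_measurable M"
  shows "(\<lambda>x. lag_free w v X (f x) (g x)) \<in> borel_measurable M"
proof -
  have [measurable]: "(\<lambda>x. X 0 (g x)) \<in> borel_measurable M"
    using measurable_compose[OF measurable_Pair X, of "\<lambda>_. 0" M g] fg by simp
  have "(\<lambda>(t, m). lag_impulse w v X t m) \<in> borel_measurable (borel \<Otimes>\<^sub>M borel)"
    using measurable_lag_impulse[OF w v X, of fst "borel \<Otimes>\<^sub>M borel" snd] by (simp add: split_beta')
  from measurable_time_integral[OF this fg] show ?thesis unfolding lag_free_def by measurable
qed

definition b\<beta> :: real where "b\<beta> = (\<integral>m. \<beta> m \<partial>U)"

lemma b\<beta>_nonneg: "0 \<le> b\<beta>"
  unfolding b\<beta>_def by (rule integral_nonneg_AE) (auto intro!: AE_I2 order_trans[OF zero_le_one \<beta>_ge1])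

context interaction_force
begin

text \<open>
  The bound depends on the flow only through its majorant; this makes dominated convergence in
  the time integrals uniform.
\<close>
lemma lag_force_bound:
  assumes X: "X t \<in> borel_measurable U" "\<And>m. m \<in> {0<..<1} \<Longrightarrow> \<bar>X t m\<bar> \<le> K * \<beta> m" and m: "m \<in> {0<..<1}" and K: "0 \<le> K"
  shows "\<bar>lag_force w X t m\<bar> \<le> C * (1 + K * (\<beta> m + b\<beta>))"
    and "integrable U (\<lambda>m'. w (X t m - X t m'))"
proof -
  have [measurable]: "w \<in> borel_measurable borel" using w_cont by (rule borel_measurable_continuous_onI)
  note [measurable] = X(1)
  have bd: "\<bar>w (X t m - X t m')\<bar> \<le> C * (1 + K * (\<beta> m + \<beta> m'))" if "m' \<in> {0<..<1}" for m'
  proof -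
    have "\<bar>w (X t m - X t m')\<bar> \<le> C * (1 + \<bar>X t m - X t m'\<bar>)" by (rule w_growth)
    also have "\<dots> \<le> C * (1 + K * (\<beta> m + \<beta> m'))"
      using X(2)[OF m] X(2)[OF that] C_nonneg by (intro mult_left_mono add_left_mono) (auto simp: algebra_simps)
    finally show ?thesis .
  qed
  have ib: "integrable U (\<lambda>m'. C * (1 + K * (\<beta> m + \<beta> m')))" using integrable_\<beta> by simp
  show int: "integrable U (\<lambda>m'. w (X t m - X t m'))"
    by (rule Bochner_Integration.integrable_bound[OF ib]) (use bd in \<open>auto intro!: AE_I2 order_trans[OF bd abs_ge_self]\<close>)
  have "\<bar>lag_force w X t m\<bar> \<le> (\<integral>m'. \<bar>w (X t m - X t m')\<bar> \<partial>U)"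
    unfolding lag_force_def using integral_norm_bound[of U "\<lambda>m'. w (X t m - X t m')"] by simp
  also have "\<dots> \<le> (\<integral>m'. C * (1 + K * (\<beta> m + \<beta> m')) \<partial>U)"
    using int ib bd by (intro integral_mono) auto
  also have "\<dots> = C * (1 + K * (\<beta> m + b\<beta>))"
    using integrable_\<beta> by (simp add: b\<beta>_def U.prob_space[unfolded space_U])
  finally show "\<bar>lag_force w X t m\<bar> \<le> C * (1 + K * (\<beta> m + b\<beta>))" .
qed

lemma lag_force_tendsto:
  assumes meas: "\<And>k. Y k s \<in> borel_measurable U" "X t \<in> borel_measurable U"
    and bd: "\<And>k m. m \<in> {0<..<1} \<Longrightarrow> \<bar>Y k s m\<bar> \<le> K * \<beta> m"
    and m: "m \<in> {0<..<1}" and lim: "(\<lambda>k. Y k s m) \<longlonglongrightarrow> X t m" "AE m in U. (\<lambda>k. Y k s m) \<longlonglongrightarrow> X t m"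
  shows "(\<lambda>k. lag_force w (Y k) s m) \<longlonglongrightarrow> lag_force w X t m"
  unfolding lag_force_def
proof (rule tendsto_minus, rule integral_dominated_convergence)
  have [measurable]: "w \<in> borel_measurable borel" using w_cont by (rule borel_measurable_continuous_onI)
  note [measurable] = meas
  show "(\<lambda>m'. w (X t m - X t m')) \<in> borel_measurable U" by measurable
  show "(\<lambda>m'. w (Y k s m - Y k s m')) \<in> borel_measurable U" for k by measurable
  show "integrable U (\<lambda>m'. C * (1 + K * (\<beta> m + \<beta> m')))" using integrable_\<beta> by simp
  show "AE m' in U. (\<lambda>k. w (Y k s m - Y k s m')) \<longlonglongrightarrow> w (X t m - X t m')"
    using lim(2)
  proof eventually_elim
    case (elim m')
    have "isCont w (X t m - X t m')" using w_cont by (simp add: continuous_on_eq_continuous_at)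
    then show ?case by (rule isCont_tendsto_compose) (intro tendsto_diff lim(1) elim)
  qed
  show "AE m' in U. norm (w (Y k s m - Y k s m')) \<le> C * (1 + K * (\<beta> m + \<beta> m'))" for k
  proof (rule AE_I2)
    fix m' assume m': "m' \<in> space U"
    have "\<bar>w (Y k s m - Y k s m')\<bar> \<le> C * (1 + \<bar>Y k s m - Y k s m'\<bar>)" by (rule w_growth)
    also have "\<dots> \<le> C * (1 + K * (\<beta> m + \<beta> m'))"
      using bd[OF m, of k] bd[of m' k] m' C_nonneg by (intro mult_left_mono add_left_mono) (auto simp: algebra_simps)
    finally show "norm (w (Y k s m - Y k s m')) \<le> C * (1 + K * (\<beta> m + \<beta> m'))" by simp
  qed
qed

end

context sticky_limit
begin

declare of_nat_Suc [simp del]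

lemma measurable_step_fun2:
  assumes [measurable]: "a \<in> borel_measurable M" "b \<in> borel_measurable M"
  shows "(\<lambda>x. f (cell k (a x)) (cell k (b x)) :: real) \<in> borel_measurable M"
proof (rule measurable_compose_countable[where f = "\<lambda>i x. f i (cell k (b x))"])
  show "(\<lambda>x. f i (cell k (b x))) \<in> borel_measurable M" for i
    by (rule measurable_compose_countable[where f = "\<lambda>j x. f i j"]) measurable
qed measurable

abbreviation step_force where "step_force k n \<equiv> sticky_particles.force w (Suc k) (pos k n)"
abbreviation step_impulse where "step_impulse k \<equiv> sticky_particles.impulse w (Suc k) (mesh k) (x0 k) v0"
abbreviation step_free where "step_free k \<equiv> sticky_particles.free_pos w (Suc k) (mesh k) (x0 k) v0"

text \<open>
  The sums of the particle system are the integrals of the step functions that represent it. The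
  impulse contains one more time step than the position, because the initial velocity of the
  scheme already contains a kick by the force.
\<close>
lemma force_step: "step_force k (cell k r) (cell k m) = lag_force w (approx_flow k) r m"
  unfolding sticky_particles.force_def[OF particles] lag_force_def approx_flow_def
    step_integral_U(2)[OF zero_less_Suc, where f = "\<lambda>j. w (pos k (cell k r) (cell k m) - pos k (cell k r) j)"]
  by (rule minus_divide_left[symmetric])

lemma impulse_step: "step_impulse k (cell k s) (cell k m) = v0 (approx_flow k 0 m) + (LBINT r:{0<..grid_time k s + mesh k}. lag_force w (approx_flow k) r m)"
proof -
  have "(LBINT r:{0<..real (Suc (cell k s)) / real (Suc k)}. step_force k (cell k r) (cell k m))
      = (\<Sum>j<Suc (cell k s). step_force k j (cell k m)) / real (Suc k)"
    by (rule step_integral(2)[where f = "\<lambda>j. step_force k j (cell k m)"]) simp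
  moreover have "real (Suc (cell k s)) / real (Suc k) = grid_time k s + mesh k"
    by (simp add: grid_time_def of_nat_Suc[of "nat \<lfloor>x\<rfloor>" for x] add_divide_distrib add.commute)
  ultimately show ?thesis
    unfolding force_step by (simp add: sticky_particles.impulse_def[OF particles] approx_flow_0)
qed

lemma free_step: "step_free k (cell k t) (cell k m) = approx_flow k 0 m + (LBINT s:{0<..grid_time k t}. step_impulse k (cell k s) (cell k m))"
proof -
  have "(LBINT s:{0<..real (cell k t) / real (Suc k)}. step_impulse k (cell k s) (cell k m))
      = (\<Sum>j<cell k t. step_impulse k j (cell k m)) / real (Suc k)"
    by (rule step_integral(2)[where f = "\<lambda>j. step_impulse k j (cell k m)"]) simp
  then show ?thesis
    by (simp add: sticky_particles.free_pos_def[OF particles] approx_flow_0 grid_time_def)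
qed

text \<open>
  Functions of the position are constant on clusters.
\<close>
lemma approx_flow_projection: "(\<integral>m. g (approx_flow k t m) * (approx_flow k t m - step_free k (cell k t) (cell k m)) \<partial>U) = 0"
proof -
  have "(\<integral>m. g (approx_flow k t m) * (approx_flow k t m - step_free k (cell k t) (cell k m)) \<partial>U)
     = (\<Sum>i<Suc k. g (pos k (cell k t) i) * (pos k (cell k t) i - step_free k (cell k t) i)) / real (Suc k)"
    unfolding approx_flow_def
    by (rule step_integral_U(2)[of "Suc k" "\<lambda>i. g (pos k (cell k t) i) * (pos k (cell k t) i - step_free k (cell k t) i)"]) simp
  also have "\<dots> = 0"
    using sticky_particles.free_pos_level_sum[OF particles, of k v0 "cell k t" "\<lambda>i. g (pos k (cell k t) i)"]
    by (simp add: level_fun_def)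
  finally show ?thesis .
qed

lemma X_pointwise:
  assumes "0 \<le> t" "t \<le> T" "m \<in> {0<..<1}"
  shows "\<bar>X t m\<bar> \<le> Kb T * \<beta> m"
  by (intro mono_L2_bound[where f = "X t"] X_mono X_int X_bound Kb_nonneg assms)

definition BF :: "real \<Rightarrow> real \<Rightarrow> real" where "BF T m = C * (1 + Kb T * (\<beta> m + b\<beta>))"

lemma BF_nonneg: "m \<in> {0<..<1} \<Longrightarrow> 0 \<le> BF T m"
  using C_nonneg Kb_nonneg[of T] b\<beta>_nonneg \<beta>_ge1[of m] by (simp add: BF_def)

lemma force_bound:
  "0 \<le> r \<Longrightarrow> r \<le> T \<Longrightarrow> m \<in> {0<..<1} \<Longrightarrow> \<bar>lag_force w (approx_flow k) r m\<bar> \<le> BF T m"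
  unfolding BF_def by (intro lag_force_bound approx_flow_pointwise Kb_nonneg) auto

text \<open>
  For almost every label the flow converges at almost every time; this order of the quantifiers
  comes from Fubini's theorem.
\<close>
lemma AE_all_lim: "AE m in U. AE r in lborel. 0 \<le> r \<longrightarrow> (\<lambda>k. approx_flow (\<sigma> k) r m) \<longlonglongrightarrow> X r m"
proof -
  interpret P: pair_sigma_finite U lborel by unfold_locales
  have "(AE m in U. AE r in lborel. 0 \<le> r \<longrightarrow> (\<lambda>k. approx_flow (\<sigma> k) r m) \<longlonglongrightarrow> X r m) \<longleftrightarrow>
        (AE r in lborel. AE m in U. 0 \<le> r \<longrightarrow> (\<lambda>k. approx_flow (\<sigma> k) r m) \<longlonglongrightarrow> X r m)"
    unfolding LIMSEQ_inverse_iff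
    by (rule P.AE_commute[where P = "\<lambda>m r. 0 \<le> r \<longrightarrow> (\<forall>j. \<exists>n. \<forall>k\<ge>n. \<bar>approx_flow (\<sigma> k) r m - X r m\<bar> < inverse (real (Suc j)))"]) measurable
  moreover have "AE r in lborel. AE m in U. 0 \<le> r \<longrightarrow> (\<lambda>k. approx_flow (\<sigma> k) r m) \<longlonglongrightarrow> X r m"
  proof (rule AE_I2)
    fix r :: real
    show "AE m in U. 0 \<le> r \<longrightarrow> (\<lambda>k. approx_flow (\<sigma> k) r m) \<longlonglongrightarrow> X r m"
      using X_AE_lim[of r] by (cases "0 \<le> r") simp_all
  qed
  ultimately show ?thesis by blast
qed

lemma force_lim:
  assumes "0 \<le> r" "m \<in> {0<..<1}" "(\<lambda>k. approx_flow (\<sigma> k) r m) \<longlonglongrightarrow> X r m"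
  shows "(\<lambda>k. lag_force w (approx_flow (\<sigma> k)) r m) \<longlonglongrightarrow> lag_force w X r m"
  by (rule lag_force_tendsto[where K = "Kb r"]) (use assms approx_flow_pointwise[OF assms(1) order_refl] X_AE_lim in auto)

lemma grid_time_mesh_tendsto: "0 \<le> s \<Longrightarrow> (\<lambda>k. grid_time (\<sigma> k) s + mesh (\<sigma> k)) \<longlonglongrightarrow> s"
  using tendsto_add[OF grid_time_\<sigma> mesh_\<sigma>, of s] by simp

lemma mesh_le1: "mesh k \<le> 1" by simp

lemma impulse_lim:
  assumes m: "m \<in> {0<..<1}" and lim: "(\<lambda>k. approx_flow (\<sigma> k) 0 m) \<longlonglongrightarrow> X 0 m"
    "AE r in lborel. 0 \<le> r \<longrightarrow> (\<lambda>k. approx_flow (\<sigma> k) r m) \<longlonglongrightarrow> X r m" and s: "0 \<le> s"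
  shows "(\<lambda>k. step_impulse (\<sigma> k) (cell (\<sigma> k) s) (cell (\<sigma> k) m)) \<longlonglongrightarrow> lag_impulse w v0 X s m"
  unfolding impulse_step lag_impulse_def
proof (rule tendsto_add)
  have "isCont v0 (X 0 m)" using v0_cont by (simp add: continuous_on_eq_continuous_at)
  then show "(\<lambda>k. v0 (approx_flow (\<sigma> k) 0 m)) \<longlonglongrightarrow> v0 (X 0 m)" by (rule isCont_tendsto_compose[OF _ lim(1)])
  show "(\<lambda>k. LBINT r:{0<..grid_time (\<sigma> k) s + mesh (\<sigma> k)}. lag_force w (approx_flow (\<sigma> k)) r m) \<longlonglongrightarrow> (LBINT r:{0<..s}. lag_force w X r m)"
    unfolding set_lebesgue_integral_def
  proof (rule integral_dominated_convergence)
    have [measurable]: "(\<lambda>r. lag_force w X r m) \<in> borel_measurable lborel"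
      by (rule measurable_lag_force[OF w_cont X_meas]) auto
    have [measurable]: "(\<lambda>r. lag_force w (approx_flow k) r m) \<in> borel_measurable lborel" for k
      unfolding force_step[symmetric] by (rule measurable_step_fun2[where f = "\<lambda>i j. step_force k i j"]) auto
    show "(\<lambda>r. indicator {0<..s} r *\<^sub>R lag_force w X r m) \<in> borel_measurable lborel" by measurable
    show "(\<lambda>r. indicator {0<..grid_time (\<sigma> k) s + mesh (\<sigma> k)} r *\<^sub>R lag_force w (approx_flow (\<sigma> k)) r m) \<in> borel_measurable lborel" for k
      by measurable
    show "integrable lborel (\<lambda>r. indicator {0<..s + 1} r * BF (s + 1) m)"
      using s by (intro integrable_mult_left) (simp add: integrable_indicator_iff)
    show "AE r in lborel. (\<lambda>k. indicator {0<..grid_time (\<sigma> k) s + mesh (\<sigma> k)} r *\<^sub>R lag_force w (approx_flow (\<sigma> k)) r m)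
        \<longlonglongrightarrow> indicator {0<..s} r *\<^sub>R lag_force w X r m"
      using lim(2) AE_lborel_singleton[of s]
    proof eventually_elim
      case (elim r)
      consider "r \<le> 0" | "0 < r" "r < s" | "0 < r" "s < r" using elim by linarith
      then show ?case
      proof cases
        case 2
        then have "r \<le> grid_time (\<sigma> k) s + mesh (\<sigma> k)" for k using grid_time_gt[OF s, of "\<sigma> k"] by linarith
        then show ?thesis using 2 force_lim[of r m] m elim by simp
      next
        case 3
        from order_tendstoD(2)[OF grid_time_mesh_tendsto[OF s] 3(2)]
        have "\<forall>\<^sub>F k in sequentially. 0 = indicator {0<..grid_time (\<sigma> k) s + mesh (\<sigma> k)} r *\<^sub>R lag_force w (approx_flow (\<sigma> k)) r m"
          by eventually_elim simp
        then show ?thesis using 3 by (intro Lim_transform_eventually[OF tendsto_const]) auto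
      qed simp
    qed
    show "AE r in lborel. norm (indicator {0<..grid_time (\<sigma> k) s + mesh (\<sigma> k)} r *\<^sub>R lag_force w (approx_flow (\<sigma> k)) r m)
        \<le> indicator {0<..s + 1} r * BF (s + 1) m" for k
    proof (rule AE_I2)
      fix r
      have "grid_time (\<sigma> k) s + mesh (\<sigma> k) \<le> s + 1" using grid_time_le[OF s, of "\<sigma> k"] mesh_le1[of "\<sigma> k"] by linarith
      then show "norm (indicator {0<..grid_time (\<sigma> k) s + mesh (\<sigma> k)} r *\<^sub>R lag_force w (approx_flow (\<sigma> k)) r m)
        \<le> indicator {0<..s + 1} r * BF (s + 1) m"
        using force_bound[of r "s + 1" m "\<sigma> k"] m BF_nonneg[OF m] by (auto simp: indicator_def)
    qed
  qed
qed

definition BZ :: "real \<Rightarrow> real \<Rightarrow> real" where "BZ t m = D * (1 + Kb t * \<beta> m) + (t + 1) * BF (t + 1) m"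

lemma BZ_nonneg: "m \<in> {0<..<1} \<Longrightarrow> 0 \<le> t \<Longrightarrow> 0 \<le> BZ t m"
  using BF_nonneg[of m "t + 1"] D_nonneg Kb_nonneg[of t] \<beta>_ge1[of m] by (simp add: BZ_def)

lemma impulse_bound:
  assumes m: "m \<in> {0<..<1}" and s: "0 \<le> s" "s \<le> t"
  shows "\<bar>step_impulse k (cell k s) (cell k m)\<bar> \<le> BZ t m"
proof -
  have "grid_time k s + mesh k \<le> t + 1" using grid_time_le[OF s(1), of k] mesh_le1[of k] s by linarith
  moreover have "0 \<le> grid_time k s + mesh k" using grid_time_nonneg[of k s] by simp
  ultimately have "\<bar>LBINT r:{0<..grid_time k s + mesh k}. lag_force w (approx_flow k) r m\<bar> \<le> (grid_time k s + mesh k - 0) * BF (t + 1) m"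
    using BF_nonneg[OF m] force_bound[OF _ _ m, of _ "t + 1" k] by (intro set_int_abs_le) auto
  also have "\<dots> \<le> (t + 1) * BF (t + 1) m"
    using \<open>grid_time k s + mesh k \<le> t + 1\<close> BF_nonneg[OF m] by (intro mult_right_mono) auto
  finally have 1: "\<bar>LBINT r:{0<..grid_time k s + mesh k}. lag_force w (approx_flow k) r m\<bar> \<le> (t + 1) * BF (t + 1) m" .
  have "\<bar>v0 (approx_flow k 0 m)\<bar> \<le> D * (1 + \<bar>approx_flow k 0 m\<bar>)" by (rule v0_growth)
  also have "\<dots> \<le> D * (1 + Kb t * \<beta> m)"
    using approx_flow_pointwise[of 0 t m k] m s D_nonneg by (intro mult_left_mono add_left_mono) auto
  finally show ?thesis unfolding impulse_step BZ_def using 1 by linarith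
qed

lemma free_lim:
  assumes m: "m \<in> {0<..<1}" and lim: "(\<lambda>k. approx_flow (\<sigma> k) 0 m) \<longlonglongrightarrow> X 0 m"
    "AE r in lborel. 0 \<le> r \<longrightarrow> (\<lambda>k. approx_flow (\<sigma> k) r m) \<longlonglongrightarrow> X r m" and t: "0 \<le> t"
  shows "(\<lambda>k. step_free (\<sigma> k) (cell (\<sigma> k) t) (cell (\<sigma> k) m)) \<longlonglongrightarrow> lag_free w v0 X t m"
  unfolding free_step lag_free_def
proof (rule tendsto_add[OF lim(1)])
  show "(\<lambda>k. LBINT s:{0<..grid_time (\<sigma> k) t}. step_impulse (\<sigma> k) (cell (\<sigma> k) s) (cell (\<sigma> k) m)) \<longlonglongrightarrow> (LBINT s:{0<..t}. lag_impulse w v0 X s m)"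
    unfolding set_lebesgue_integral_def
  proof (rule integral_dominated_convergence)
    have [measurable]: "(\<lambda>r. lag_impulse w v0 X r m) \<in> borel_measurable lborel"
      by (rule measurable_lag_impulse[OF w_cont v0_cont X_meas]) auto
    have [measurable]: "(\<lambda>r. step_impulse k (cell k r) (cell k m)) \<in> borel_measurable lborel" for k
      by (rule measurable_step_fun2) auto
    show "(\<lambda>r. indicator {0<..t} r *\<^sub>R lag_impulse w v0 X r m) \<in> borel_measurable lborel" by measurable
    show "(\<lambda>r. indicator {0<..grid_time (\<sigma> k) t} r *\<^sub>R step_impulse (\<sigma> k) (cell (\<sigma> k) r) (cell (\<sigma> k) m)) \<in> borel_measurable lborel" for k
      by measurable
    show "integrable lborel (\<lambda>r. indicator {0<..t} r * BZ t m)"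
      using t by (intro integrable_mult_left) (simp add: integrable_indicator_iff)
    show "AE r in lborel. (\<lambda>k. indicator {0<..grid_time (\<sigma> k) t} r *\<^sub>R step_impulse (\<sigma> k) (cell (\<sigma> k) r) (cell (\<sigma> k) m))
        \<longlonglongrightarrow> indicator {0<..t} r *\<^sub>R lag_impulse w v0 X r m"
      using AE_lborel_singleton[of t]
    proof eventually_elim
      case (elim r)
      consider "r \<le> 0" | "0 < r" "r < t" | "0 < r" "t < r" using elim by linarith
      then show ?case
      proof cases
        case 2
        have i: "(\<lambda>k. step_impulse (\<sigma> k) (cell (\<sigma> k) r) (cell (\<sigma> k) m)) \<longlonglongrightarrow> lag_impulse w v0 X r m"
          using 2 by (intro impulse_lim m lim) auto
        from order_tendstoD(1)[OF grid_time_\<sigma>[OF t] 2(2)]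
        have "\<forall>\<^sub>F k in sequentially. step_impulse (\<sigma> k) (cell (\<sigma> k) r) (cell (\<sigma> k) m)
           = indicator {0<..grid_time (\<sigma> k) t} r *\<^sub>R step_impulse (\<sigma> k) (cell (\<sigma> k) r) (cell (\<sigma> k) m)"
          by eventually_elim (use 2 in auto)
        from Lim_transform_eventually[OF i this] show ?thesis using 2 by simp
      next
        case 3
        then have "\<not> r \<le> grid_time (\<sigma> k) t" for k using grid_time_le[OF t, of "\<sigma> k"] by linarith
        then show ?thesis using 3 by simp
      qed simp
    qed
    show "AE r in lborel. norm (indicator {0<..grid_time (\<sigma> k) t} r *\<^sub>R step_impulse (\<sigma> k) (cell (\<sigma> k) r) (cell (\<sigma> k) m))
        \<le> indicator {0<..t} r * BZ t m" for k
      using grid_time_le[OF t, of "\<sigma> k"] impulse_bound[OF m, of _ t "\<sigma> k"] BZ_nonneg[OF m t]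
      by (intro AE_I2) (auto simp: indicator_def)
  qed
qed

lemma free_bound:
  assumes m: "m \<in> {0<..<1}" and t: "0 \<le> t"
  shows "\<bar>step_free k (cell k t) (cell k m)\<bar> \<le> Kb t * \<beta> m + t * BZ t m"
proof -
  have "\<bar>LBINT s:{0<..grid_time k t}. step_impulse k (cell k s) (cell k m)\<bar> \<le> (grid_time k t - 0) * BZ t m"
    using BZ_nonneg[OF m t] impulse_bound[OF m, of _ t k] grid_time_le[OF t, of k] grid_time_nonneg[of k t]
    by (intro set_int_abs_le) auto
  also have "\<dots> \<le> t * BZ t m" using BZ_nonneg[OF m t] grid_time_le[OF t, of k] by (intro mult_right_mono) auto
  finally show ?thesis unfolding free_step using approx_flow_pointwise[of 0 t m k] m t by linarith
qed

text \<open>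
  The projection identity passes to the limit by dominated convergence, since
  \<open>\<beta>\<close> majorises positions and free positions.
\<close>
lemma X_projection:
  assumes t: "0 \<le> t" and g: "continuous_on UNIV g" and B: "\<And>x. \<bar>g x\<bar> \<le> B"
  shows "(\<integral>m. g (X t m) * (X t m - lag_free w v0 X t m) \<partial>U) = 0"
proof -
  have [measurable]: "g \<in> borel_measurable borel" using g by (rule borel_measurable_continuous_onI)
  have [measurable]: "(\<lambda>m. lag_free w v0 X t m) \<in> borel_measurable U"
    by (rule measurable_lag_free[OF w_cont v0_cont X_meas]) auto
  have [measurable]: "(\<lambda>m. step_free k (cell k t) (cell k m)) \<in> borel_measurable U" for k
    by (rule measurable_step_fun2) auto
  have B0: "0 \<le> B" using B[of 0] by simp
  have "(\<lambda>k. \<integral>m. g (approx_flow (\<sigma> k) t m) * (approx_flow (\<sigma> k) t m - step_free (\<sigma> k) (cell (\<sigma> k) t) (cell (\<sigma> k) m)) \<partial>U)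
      \<longlonglongrightarrow> (\<integral>m. g (X t m) * (X t m - lag_free w v0 X t m) \<partial>U)"
  proof (rule integral_dominated_convergence)
    show "integrable U (\<lambda>m. B * (2 * (Kb t * \<beta> m) + t * BZ t m))"
      unfolding BZ_def BF_def using integrable_\<beta> by simp
    show "AE m in U. (\<lambda>k. g (approx_flow (\<sigma> k) t m) * (approx_flow (\<sigma> k) t m - step_free (\<sigma> k) (cell (\<sigma> k) t) (cell (\<sigma> k) m)))
        \<longlonglongrightarrow> g (X t m) * (X t m - lag_free w v0 X t m)"
      using X_AE_lim[OF t] X_AE_lim[of 0, OF order_refl] AE_all_lim AE_space[of U]
    proof eventually_elim
      case (elim m)
      have "isCont g (X t m)" using g by (simp add: continuous_on_eq_continuous_at)
      then have "(\<lambda>k. g (approx_flow (\<sigma> k) t m)) \<longlonglongrightarrow> g (X t m)" by (rule isCont_tendsto_compose[OF _ elim(1)])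
      then show ?case using elim t by (intro tendsto_intros free_lim) auto
    qed
    show "AE m in U. norm (g (approx_flow (\<sigma> k) t m) * (approx_flow (\<sigma> k) t m - step_free (\<sigma> k) (cell (\<sigma> k) t) (cell (\<sigma> k) m)))
        \<le> B * (2 * (Kb t * \<beta> m) + t * BZ t m)" for k
    proof (rule AE_I2)
      fix m assume "m \<in> space U"
      then have m: "m \<in> {0<..<1}" by simp
      have "\<bar>approx_flow (\<sigma> k) t m - step_free (\<sigma> k) (cell (\<sigma> k) t) (cell (\<sigma> k) m)\<bar> \<le> 2 * (Kb t * \<beta> m) + t * BZ t m"
        using free_bound[OF m t, of "\<sigma> k"] approx_flow_pointwise[OF t order_refl m, of "\<sigma> k"] by linarith
      then show "norm (g (approx_flow (\<sigma> k) t m) * (approx_flow (\<sigma> k) t m - step_free (\<sigma> k) (cell (\<sigma> k) t) (cell (\<sigma> k) m)))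
        \<le> B * (2 * (Kb t * \<beta> m) + t * BZ t m)"
        using B B0 by (simp add: abs_mult mult_mono)
    qed
  qed measurable
  then show ?thesis unfolding approx_flow_projection by (simp add: LIMSEQ_const_iff)
qed

lemma sticky_flow_X: "sticky_flow w c C v0 D X Kb"
  by unfold_locales
    ((rule v0_cont v0_growth X_meas X_mono X_sinh Kb_nonneg X_int X_bound X_lip X_projection; assumption)+)

end

text \<open>
  The quantile function transports Lebesgue measure on the unit interval to a given law.
\<close>
lemma quantile_exists:
  assumes "real_distribution M"
  shows "\<exists>Q. Q \<in> borel_measurable U \<and> (\<forall>m m'. 0 < m \<and> m \<le> m' \<and> m' < 1 \<longrightarrow> Q m \<le> Q m') \<and> distr U borel Q = M"
proof -
  interpret cdf_distribution M using assms by (simp add: cdf_distribution_def)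
  have "I \<in> borel_measurable U"
    using measurable_CI by (simp add: measurable_def space_restrict_space sets_restrict_space)
  moreover have "I m \<le> I m'" if "0 < m" "m \<le> m'" "m' < 1" for m m'
    using mono_I that by (auto simp: mono_on_def)
  ultimately show ?thesis using distr_I_eq_M by blast
qed

section \<open>Forces, impulses and free paths\<close>

lemma set_integral_empty_real [simp]: "(LBINT r:{}. (f r :: real)) = 0"
  by (simp add: set_lebesgue_integral_def)

lemma bounded_set_integrable:
  fixes f :: "real \<Rightarrow> real"
  assumes [measurable]: "f \<in> borel_measurable borel" and "\<And>r. a < r \<Longrightarrow> r \<le> b \<Longrightarrow> \<bar>f r\<bar> \<le> B"
  shows "set_integrable lborel {a<..b} f"
proof (cases "a \<le> b")
  case True
  show ?thesis unfolding set_integrable_def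
  proof (rule Bochner_Integration.integrable_bound)
    show "integrable lborel (\<lambda>r. indicator {a<..b} r * B)"
      using True by (intro integrable_mult_left) (simp add: integrable_indicator_iff)
    show "AE r in lborel. norm (indicator {a<..b} r *\<^sub>R f r) \<le> norm (indicator {a<..b} r * B)"
      using assms(2) by (intro AE_I2) (auto simp: indicator_def intro: order_trans abs_ge_self)
  qed simp
qed (simp add: set_integrable_def)

lemma time_integral_split:
  fixes f :: "real \<Rightarrow> real"
  assumes "f \<in> borel_measurable borel" "\<And>r. a < r \<Longrightarrow> r \<le> c \<Longrightarrow> \<bar>f r\<bar> \<le> B" "a \<le> b" "b \<le> c"
  shows "(LBINT r:{a<..c}. f r) = (LBINT r:{a<..b}. f r) + (LBINT r:{b<..c}. f r)"
proof -
  have "{a<..c} = {a<..b} \<union> {b<..c}" using assms by auto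
  moreover have "set_integrable lborel {a<..b} f" "set_integrable lborel {b<..c} f"
    using assms by (auto intro!: bounded_set_integrable[where B = B])
  ultimately show ?thesis by (simp add: set_integral_Un)
qed

text \<open>
  Minkowski's integral inequality, here from the Cauchy-Schwarz inequality in time and Fubini's
  theorem.
\<close>
lemma time_integral_L2:
  fixes G :: "real \<Rightarrow> real \<Rightarrow> real"
  assumes G: "(\<lambda>(r, m). G r m) \<in> borel_measurable (borel \<Otimes>\<^sub>M borel)"
    and st: "s \<le> t" and K: "0 \<le> K"
    and int: "\<And>r. s < r \<Longrightarrow> r \<le> t \<Longrightarrow> integrable U (\<lambda>m. (G r m)\<^sup>2)"
    and bd: "\<And>r. s < r \<Longrightarrow> r \<le> t \<Longrightarrow> (\<integral>m. (G r m)\<^sup>2 \<partial>U) \<le> K\<^sup>2"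
    and pw: "\<And>r m. m \<in> {0<..<1} \<Longrightarrow> s < r \<Longrightarrow> r \<le> t \<Longrightarrow> \<bar>G r m\<bar> \<le> B m"
    and meas: "(\<lambda>m. LBINT r:{s<..t}. G r m) \<in> borel_measurable U"
  shows "integrable U (\<lambda>m. (LBINT r:{s<..t}. G r m)\<^sup>2)"
    and "(\<integral>m. (LBINT r:{s<..t}. G r m)\<^sup>2 \<partial>U) \<le> ((t - s) * K)\<^sup>2"
proof -
  interpret P: pair_sigma_finite U lborel by unfold_locales
  note [measurable] = measurable_uncurried[OF G] meas
  let ?I = "\<lambda>m. LBINT r:{s<..t}. G r m"
  have cs: "(?I m)\<^sup>2 \<le> (t - s) * (LBINT r:{s<..t}. (G r m)\<^sup>2)"
    and si2: "set_integrable lborel {s<..t} (\<lambda>r. (G r m)\<^sup>2)" if m: "m \<in> {0<..<1}" for m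
  proof -
    have si: "set_integrable lborel {s<..t} (\<lambda>r. G r m)"
      using pw[OF m] by (intro bounded_set_integrable) auto
    have B2: "\<bar>(G r m)\<^sup>2\<bar> \<le> (B m)\<^sup>2" if "s < r" "r \<le> t" for r
      using pw[OF m that] by (simp add: abs_le_square_iff[symmetric])
    show si2: "set_integrable lborel {s<..t} (\<lambda>r. (G r m)\<^sup>2)"
      using B2 by (intro bounded_set_integrable) auto
    show "(?I m)\<^sup>2 \<le> (t - s) * (LBINT r:{s<..t}. (G r m)\<^sup>2)"
    proof (cases "s = t")
      case True
      then show ?thesis by (simp add: set_lebesgue_integral_def)
    next
      case False
      then have p: "0 < t - s" using st by simp
      define a where "a = ?I m / (t - s)"
      have ic: "set_integrable lborel {s<..t} (\<lambda>r. a\<^sup>2)" using st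
        by (intro bounded_set_integrable[where B = "a\<^sup>2"]) auto
      have "0 \<le> (LBINT r:{s<..t}. (G r m - a)\<^sup>2)"
        unfolding set_lebesgue_integral_def by (rule integral_nonneg_AE) auto
      also have "\<dots> = (LBINT r:{s<..t}. ((G r m)\<^sup>2 - (2 * a) * G r m) + a\<^sup>2)"
        by (simp add: power2_eq_square algebra_simps)
      also have "\<dots> = (LBINT r:{s<..t}. (G r m)\<^sup>2) - (2 * a) * ?I m + (LBINT r:{s<..t}. a\<^sup>2)"
        using si si2 ic by (simp add: set_integral_add set_integral_diff)
      also have "(LBINT r:{s<..t}. a\<^sup>2) = (t - s) * a\<^sup>2"
        using st by (simp add: set_lebesgue_integral_def)
      finally have "0 \<le> (LBINT r:{s<..t}. (G r m)\<^sup>2) - (?I m)\<^sup>2 / (t - s)"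
        using p by (simp add: a_def power2_eq_square)
      then show ?thesis using p by (simp add: field_simps)
    qed
  qed
  have "(\<integral>\<^sup>+m. ennreal ((?I m)\<^sup>2) \<partial>U) \<le> (\<integral>\<^sup>+m. ennreal (t - s) * (\<integral>\<^sup>+r. ennreal (indicator {s<..t} r * (G r m)\<^sup>2) \<partial>lborel) \<partial>U)"
  proof (rule nn_integral_mono)
    fix m assume "m \<in> space U"
    then have m: "m \<in> {0<..<1}" by simp
    have "ennreal ((?I m)\<^sup>2) \<le> ennreal ((t - s) * (LBINT r:{s<..t}. (G r m)\<^sup>2))"
      using cs[OF m] by (rule ennreal_leI)
    also have "\<dots> = ennreal (t - s) * ennreal (LBINT r:{s<..t}. (G r m)\<^sup>2)"
      using st by (simp add: ennreal_mult')
    also have "ennreal (LBINT r:{s<..t}. (G r m)\<^sup>2) = (\<integral>\<^sup>+r. ennreal (indicator {s<..t} r * (G r m)\<^sup>2) \<partial>lborel)"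
      using nn_integral_eq_integral[OF si2[OF m, unfolded set_integrable_def]]
      by (simp add: set_lebesgue_integral_def)
    finally show "ennreal ((?I m)\<^sup>2) \<le> ennreal (t - s) * (\<integral>\<^sup>+r. ennreal (indicator {s<..t} r * (G r m)\<^sup>2) \<partial>lborel)" .
  qed
  also have "\<dots> = ennreal (t - s) * (\<integral>\<^sup>+m. (\<integral>\<^sup>+r. ennreal (indicator {s<..t} r * (G r m)\<^sup>2) \<partial>lborel) \<partial>U)"
    by (rule nn_integral_cmult) measurable
  also have "(\<integral>\<^sup>+m. (\<integral>\<^sup>+r. ennreal (indicator {s<..t} r * (G r m)\<^sup>2) \<partial>lborel) \<partial>U)
      = (\<integral>\<^sup>+r. (\<integral>\<^sup>+m. ennreal (indicator {s<..t} r * (G r m)\<^sup>2) \<partial>U) \<partial>lborel)"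
    by (rule P.Fubini'[symmetric]) measurable
  also have "\<dots> \<le> (\<integral>\<^sup>+r. ennreal (K\<^sup>2) * indicator {s<..t} r \<partial>lborel)"
  proof (rule nn_integral_mono)
    fix r
    show "(\<integral>\<^sup>+m. ennreal (indicator {s<..t} r * (G r m)\<^sup>2) \<partial>U) \<le> ennreal (K\<^sup>2) * indicator {s<..t} r"
    proof (cases "r \<in> {s<..t}")
      case True
      then have "(\<integral>\<^sup>+m. ennreal ((G r m)\<^sup>2) \<partial>U) \<le> ennreal (K\<^sup>2)"
        using int[of r] bd[of r] by (subst nn_integral_eq_integral) (auto intro: ennreal_leI)
      then show ?thesis using True by simp
    qed simp
  qed
  also have "\<dots> = ennreal (K\<^sup>2) * ennreal (t - s)" using st by (simp add: nn_integral_cmult_indicator)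
  also have "ennreal (t - s) * (ennreal (K\<^sup>2) * ennreal (t - s)) = ennreal (((t - s) * K)\<^sup>2)"
    using st by (simp add: ennreal_mult'[symmetric] power2_eq_square mult_ac)
  finally have *: "(\<integral>\<^sup>+m. ennreal ((?I m)\<^sup>2) \<partial>U) \<le> ennreal (((t - s) * K)\<^sup>2)"
    by (simp add: mult_left_mono)
  show i: "integrable U (\<lambda>m. (?I m)\<^sup>2)"
    by (rule integrableI_bounded) (use * in \<open>auto intro: le_less_trans\<close>)
  show "(\<integral>m. (?I m)\<^sup>2 \<partial>U) \<le> ((t - s) * K)\<^sup>2"
    using * nn_integral_eq_integral[OF i] by (simp add: ennreal_le_iff)
qed

text \<open>
  If \<open>f\<close> is orthogonal to all bounded Lipschitz functions of \<open>h\<close>, then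
  it is orthogonal to all Borel functions of \<open>h\<close>, that is \<open>E[f | h] =
  0\<close>. Ramps approximate the indicators of half-lines, and the images under
  \<open>h\<close> of the positive and of the negative part of \<open>f\<close> are finite
  measures that agree on half-lines.
\<close>
lemma test_functions_suffice:
  fixes f h \<psi> :: "real \<Rightarrow> real"
  assumes f: "integrable U f" and [measurable]: "h \<in> borel_measurable U" "\<psi> \<in> borel_measurable borel"
    and test: "\<And>g L. (\<And>x. \<bar>g x\<bar> \<le> 1) \<Longrightarrow> (\<And>x y. \<bar>g x - g y\<bar> \<le> L * \<bar>x - y\<bar>) \<Longrightarrow> (\<integral>m. g (h m) * f m \<partial>U) = 0"
    and int: "integrable U (\<lambda>m. \<psi> (h m) * f m)"
  shows "(\<integral>m. \<psi> (h m) * f m \<partial>U) = 0"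
proof -
  have [measurable]: "f \<in> borel_measurable U" using f by simp
  let ?p = "\<lambda>m. max 0 (f m)" and ?n = "\<lambda>m. max 0 (- f m)"
  \<comment> \<open>images under \<open>h\<close> of the positive and the negative part of
      \<open>f\<close>\<close>
  define M1 where "M1 = distr (density U (\<lambda>m. ennreal (?p m))) borel h"
  define M2 where "M2 = distr (density U (\<lambda>m. ennreal (?n m))) borel h"
  have ip: "integrable U ?p" and in': "integrable U ?n" using f by (auto intro!: integrable_max)
  have half: "(\<integral>m. indicator {x<..} (h m) * f m \<partial>U) = 0" for x
  proof -
    let ?g = "\<lambda>j::nat. \<lambda>y. min 1 (max 0 (real j * (y - x)))"
    have "(\<lambda>j. \<integral>m. ?g j (h m) * f m \<partial>U) \<longlonglongrightarrow> (\<integral>m. indicator {x<..} (h m) * f m \<partial>U)"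
    proof (rule integral_dominated_convergence)
      show "integrable U (\<lambda>m. \<bar>f m\<bar>)" using f by simp
      show "AE m in U. (\<lambda>j. ?g j (h m) * f m) \<longlonglongrightarrow> indicator {x<..} (h m) * f m"
      proof (rule AE_I2, rule tendsto_mult[OF _ tendsto_const])
        fix m
        show "(\<lambda>j. ?g j (h m)) \<longlonglongrightarrow> indicator {x<..} (h m)"
        proof (cases "x < h m")
          case True
          obtain N :: nat where N: "1 / (h m - x) < real N" using reals_Archimedean2 by blast
          have "?g j (h m) = 1" if "N \<le> j" for j
          proof -
            have "1 \<le> real N * (h m - x)" using N True by (simp add: field_simps)
            also have "\<dots> \<le> real j * (h m - x)" using that True by (intro mult_right_mono) auto
            finally show ?thesis by simp
          qed
          then have "\<forall>\<^sub>F j in sequentially. 1 = ?g j (h m)" unfolding eventually_sequentially by metis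
          then show ?thesis using True by (intro Lim_transform_eventually[OF tendsto_const]) simp
        next
          case False
          then have "real j * (h m - x) \<le> 0" for j by (simp add: mult_nonneg_nonpos)
          then show ?thesis using False by (simp add: max_absorb1)
        qed
      qed
      show "AE m in U. norm (?g j (h m) * f m) \<le> \<bar>f m\<bar>" for j
        by (intro AE_I2) (auto simp: abs_mult intro!: mult_left_le_one_le)
    qed measurable
    moreover have "(\<integral>m. ?g j (h m) * f m \<partial>U) = 0" for j
    proof (rule test[where L = "real j"])
      fix a b
      have "\<bar>?g j a - ?g j b\<bar> \<le> \<bar>real j * (a - x) - real j * (b - x)\<bar>" by (auto simp: min_def max_def abs_if)
      also have "real j * (a - x) - real j * (b - x) = real j * (a - b)" by (simp add: algebra_simps)
      also have "\<bar>real j * (a - b)\<bar> = real j * \<bar>a - b\<bar>" by (simp add: abs_mult)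
      finally show "\<bar>?g j a - ?g j b\<bar> \<le> real j * \<bar>a - b\<bar>" .
    qed auto
    ultimately show ?thesis by (simp add: LIMSEQ_const_iff)
  qed
  have em: "emeasure (distr (density U (\<lambda>m. ennreal (u m))) borel h) {x<..} = ennreal (\<integral>m. indicator {x<..} (h m) * u m \<partial>U)"
    if u: "integrable U u" "\<And>m. 0 \<le> u m" for u x
  proof -
    note [measurable] = borel_measurable_integrable[OF u(1)]
    have s: "h -` {x<..} \<inter> space U \<in> sets U" by measurable
    have "emeasure (distr (density U (\<lambda>m. ennreal (u m))) borel h) {x<..} = (\<integral>\<^sup>+m. ennreal (u m) * indicator (h -` {x<..} \<inter> space U) m \<partial>U)"
      by (subst emeasure_distr) (use s in \<open>auto simp: emeasure_density\<close>)
    also have "\<dots> = (\<integral>\<^sup>+m. ennreal (indicator {x<..} (h m) * u m) \<partial>U)"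
      by (rule nn_integral_cong) (auto simp: indicator_def)
    also have "\<dots> = ennreal (\<integral>m. indicator {x<..} (h m) * u m \<partial>U)"
    proof (rule nn_integral_eq_integral)
      show "integrable U (\<lambda>m. indicator {x<..} (h m) * u m)"
        by (rule Bochner_Integration.integrable_bound[OF u(1)]) (auto simp: indicator_def)
      show "AE m in U. 0 \<le> indicator {x<..} (h m) * u m" using u(2) by (intro AE_I2) (auto simp: indicator_def)
    qed
    finally show ?thesis .
  qed
  have "M1 = M2"
  proof (rule measure_eqI_lessThan)
    show "sets M1 = sets borel" "sets M2 = sets borel" by (simp_all add: M1_def M2_def)
    show "emeasure M1 {x<..} < \<infinity>" for x unfolding M1_def by (subst em[OF ip]) auto
    show "emeasure M1 {x<..} = emeasure M2 {x<..}" for x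
    proof -
      have i: "integrable U (\<lambda>m. indicator {x<..} (h m) * ?p m)" "integrable U (\<lambda>m. indicator {x<..} (h m) * ?n m)"
        by (rule Bochner_Integration.integrable_bound[OF ip] Bochner_Integration.integrable_bound[OF in'];
            auto simp: indicator_def)+
      have "(\<integral>m. indicator {x<..} (h m) * f m \<partial>U)
          = (\<integral>m. indicator {x<..} (h m) * ?p m - indicator {x<..} (h m) * ?n m \<partial>U)"
        by (intro Bochner_Integration.integral_cong) (auto simp: indicator_def)
      then have "(\<integral>m. indicator {x<..} (h m) * ?p m \<partial>U) = (\<integral>m. indicator {x<..} (h m) * ?n m \<partial>U)"
        using half[of x] i by simp
      then show ?thesis unfolding M1_def M2_def using em[OF ip] em[OF in'] by simp
    qed
  qed
  have dens: "integral\<^sup>L (distr (density U (\<lambda>m. ennreal (u m))) borel h) \<psi> = (\<integral>m. \<psi> (h m) * u m \<partial>U)"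
    if [measurable]: "u \<in> borel_measurable U" and u: "\<And>m. 0 \<le> u m" for u
  proof -
    have "integral\<^sup>L (distr (density U (\<lambda>m. ennreal (u m))) borel h) \<psi> = (\<integral>m. \<psi> (h m) \<partial>density U (\<lambda>m. ennreal (u m)))"
      by (rule integral_distr) measurable
    also have "\<dots> = (\<integral>m. u m *\<^sub>R \<psi> (h m) \<partial>U)"
      by (rule integral_density) (use u in auto)
    finally show ?thesis by (simp add: mult.commute)
  qed
  have i: "integrable U (\<lambda>m. \<psi> (h m) * ?p m)" "integrable U (\<lambda>m. \<psi> (h m) * ?n m)"
    by (auto intro!: Bochner_Integration.integrable_bound[OF int] AE_I2 simp: abs_mult max_def mult_left_mono)
  have "(\<integral>m. \<psi> (h m) * f m \<partial>U) = (\<integral>m. \<psi> (h m) * ?p m - \<psi> (h m) * ?n m \<partial>U)"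
    by (intro Bochner_Integration.integral_cong) (auto simp: max_def)
  also have "\<dots> = integral\<^sup>L M1 \<psi> - integral\<^sup>L M2 \<psi>"
    unfolding M1_def M2_def using i by (subst (1 2) dens) auto
  finally show ?thesis using \<open>M1 = M2\<close> by simp
qed

context sticky_flow
begin

lemma D_nonneg: "0 \<le> D" using v0_growth[of 0] by simp

abbreviation "F \<equiv> lag_force w X"
abbreviation "Z \<equiv> lag_impulse w v0 X"
abbreviation "Y \<equiv> lag_free w v0 X"

lemmas X_m [measurable] = measurable_uncurried[OF X_meas]
lemmas F_m [measurable] = measurable_lag_force[OF w_cont X_meas]
lemmas Z_m [measurable] = measurable_lag_impulse[OF w_cont v0_cont X_meas]
lemmas Y_m [measurable] = measurable_lag_free[OF w_cont v0_cont X_meas]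

lemma v0_m [measurable]: "v0 \<in> borel_measurable borel"
  using v0_cont by (rule borel_measurable_continuous_onI)

lemma w_m [measurable]: "w \<in> borel_measurable borel"
  using w_cont by (rule borel_measurable_continuous_onI)

lemma X_pointwise:
  assumes "0 \<le> t" "t \<le> T" "m \<in> {0<..<1}"
  shows "\<bar>X t m\<bar> \<le> Kb T * \<beta> m"
proof -
  have "0 \<le> T" using assms by simp
  then show ?thesis using assms
    by (intro mono_L2_bound[where f = "X t"] X_mono X_int X_bound Kb_nonneg) auto
qed

text \<open>
  Constants come in two kinds. \<open>BF\<close> and \<open>BZ\<close> majorise the force and
  the impulse pointwise up to time \<open>T\<close>, as functions of the label;
  \<open>KF\<close> and \<open>KZ\<close> below bound their norms in \<open>L\<^sup>2\<close>.
\<close>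
definition BF :: "real \<Rightarrow> real \<Rightarrow> real" where "BF T m = C * (1 + Kb T * (\<beta> m + b\<beta>))"

lemma BF_nonneg: "m \<in> {0<..<1} \<Longrightarrow> 0 \<le> T \<Longrightarrow> 0 \<le> BF T m"
  using C_nonneg Kb_nonneg[of T] b\<beta>_nonneg \<beta>_ge1[of m] by (simp add: BF_def)

lemma F_bound: "0 \<le> r \<Longrightarrow> r \<le> T \<Longrightarrow> m \<in> {0<..<1} \<Longrightarrow> \<bar>F r m\<bar> \<le> BF T m"
  unfolding BF_def by (intro lag_force_bound X_pointwise Kb_nonneg) auto

lemma w_integrable: "0 \<le> r \<Longrightarrow> m \<in> {0<..<1} \<Longrightarrow> integrable U (\<lambda>m'. w (X r m - X r m'))"
  by (rule lag_force_bound(2)[where K = "Kb r"]) (use X_pointwise Kb_nonneg in auto)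

definition BZ :: "real \<Rightarrow> real \<Rightarrow> real" where "BZ T m = D * (1 + Kb T * \<beta> m) + T * BF T m"

lemma BZ_nonneg: "m \<in> {0<..<1} \<Longrightarrow> 0 \<le> T \<Longrightarrow> 0 \<le> BZ T m"
  using BF_nonneg[of m T] D_nonneg Kb_nonneg[of T] \<beta>_ge1[of m] by (simp add: BZ_def)

lemma Z_diff:
  assumes "0 \<le> s" "s \<le> t" "m \<in> {0<..<1}"
  shows "Z t m - Z s m = (LBINT r:{s<..t}. F r m)"
  using time_integral_split[of "\<lambda>r. F r m" 0 t "BF t m" s] F_bound[of _ t m] assms
  by (simp add: lag_impulse_def)

lemma Z_lip:
  assumes "0 \<le> s" "s \<le> t" "t \<le> T" "m \<in> {0<..<1}"
  shows "\<bar>Z t m - Z s m\<bar> \<le> (t - s) * BF T m"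
  unfolding Z_diff[OF assms(1,2,4)] using assms F_bound[of _ T m] BF_nonneg[of m T]
  by (intro set_int_abs_le) auto

lemma Z_0: "Z 0 m = v0 (X 0 m)" by (simp add: lag_impulse_def set_lebesgue_integral_def)

lemma Z_bound:
  assumes "0 \<le> t" "t \<le> T" "m \<in> {0<..<1}"
  shows "\<bar>Z t m\<bar> \<le> BZ T m"
proof -
  have "\<bar>v0 (X 0 m)\<bar> \<le> D * (1 + \<bar>X 0 m\<bar>)" by (rule v0_growth)
  also have "\<dots> \<le> D * (1 + Kb T * \<beta> m)"
    using X_pointwise[of 0 T m] assms D_nonneg by (intro mult_left_mono add_left_mono) auto
  finally have "\<bar>Z 0 m\<bar> \<le> D * (1 + Kb T * \<beta> m)" by (simp add: Z_0)
  moreover have "\<bar>Z t m - Z 0 m\<bar> \<le> (t - 0) * BF T m" using assms by (intro Z_lip) auto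
  moreover have "(t - 0) * BF T m \<le> T * BF T m" using assms BF_nonneg[of m T] by (intro mult_right_mono) auto
  ultimately show ?thesis unfolding BZ_def by linarith
qed

lemma Y_diff:
  assumes "0 \<le> s" "s \<le> t" "m \<in> {0<..<1}"
  shows "Y t m - Y s m = (LBINT r:{s<..t}. Z r m)"
  using time_integral_split[of "\<lambda>r. Z r m" 0 t "BZ t m" s] Z_bound[of _ t m] assms
  by (simp add: lag_free_def)

lemma Y_0: "Y 0 m = X 0 m" by (simp add: lag_free_def set_lebesgue_integral_def)

lemma Y_lip:
  assumes "0 \<le> s" "s \<le> t" "t \<le> T" "m \<in> {0<..<1}"
  shows "\<bar>Y t m - Y s m\<bar> \<le> (t - s) * BZ T m"
  unfolding Y_diff[OF assms(1,2,4)] using assms Z_bound[of _ T m] BZ_nonneg[of m T]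
  by (intro set_int_abs_le) auto

lemma integrable_BF: "integrable U (BF T)" and integrable_BZ: "integrable U (BZ T)"
  unfolding BF_def[abs_def] BZ_def[abs_def] using integrable_\<beta> by simp_all

lemma BF_m [measurable]: "BF T \<in> borel_measurable borel" and BZ_m [measurable]: "BZ T \<in> borel_measurable borel"
  unfolding BF_def[abs_def] BZ_def[abs_def] by measurable

lemma X_U_m [measurable]: "X t \<in> borel_measurable U"
  and F_U_m [measurable]: "F t \<in> borel_measurable U"
  and Z_U_m [measurable]: "Z t \<in> borel_measurable U"
  and Y_U_m [measurable]: "Y t \<in> borel_measurable U"
  using X_m[of "\<lambda>_. t" U "\<lambda>x. x"] F_m[of "\<lambda>_. t" U "\<lambda>x. x"] Z_m[of "\<lambda>_. t" U "\<lambda>x. x"] Y_m[of "\<lambda>_. t" U "\<lambda>x. x"]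
  by simp_all

lemma X_integrable: "0 \<le> t \<Longrightarrow> integrable U (X t)"
  by (rule integrable_of_square[OF X_U_m X_int])

lemma Y_integrable: assumes "0 \<le> t" shows "integrable U (Y t)"
proof (rule Bochner_Integration.integrable_bound)
  show "integrable U (\<lambda>m. Kb t * \<beta> m + t * BZ t m)" using integrable_BZ integrable_\<beta> by simp
  show "AE m in U. norm (Y t m) \<le> norm (Kb t * \<beta> m + t * BZ t m)"
  proof (rule AE_I2)
    fix m assume "m \<in> space U"
    then have m: "m \<in> {0<..<1}" by simp
    have "\<bar>Y t m\<bar> \<le> Kb t * \<beta> m + t * BZ t m"
      using Y_lip[of 0 t t m] X_pointwise[of 0 t m] assms m by (simp add: Y_0 abs_le_iff)
    then show "norm (Y t m) \<le> norm (Kb t * \<beta> m + t * BZ t m)" by simp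
  qed
qed measurable

lemma mean_abs_X: "0 \<le> t \<Longrightarrow> t \<le> T \<Longrightarrow> (\<integral>m. \<bar>X t m\<bar> \<partial>U) \<le> Kb T"
  using cauchy_schwarz_U[of "X t" "\<lambda>_. 1" "Kb T" 1] X_int X_bound[of t T] Kb_nonneg[of T] by simp

definition KF :: "real \<Rightarrow> real" where "KF T = C * (1 + 2 * Kb T)"

lemma KF_nonneg: "0 \<le> T \<Longrightarrow> 0 \<le> KF T"
  using C_nonneg Kb_nonneg[of T] by (simp add: KF_def)

lemma F_int: "0 \<le> r \<Longrightarrow> integrable U (\<lambda>m. (F r m)\<^sup>2)"
  and F_L2: "0 \<le> r \<Longrightarrow> r \<le> T \<Longrightarrow> (\<integral>m. (F r m)\<^sup>2 \<partial>U) \<le> (KF T)\<^sup>2"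
proof -
  have main: "integrable U (\<lambda>m. (F r m)\<^sup>2)" "(\<integral>m. (F r m)\<^sup>2 \<partial>U) \<le> (KF T)\<^sup>2" if r: "0 \<le> r" "r \<le> T" for T
  proof -
    have T: "0 \<le> T" using r by simp
    have pw: "\<bar>F r m\<bar> \<le> C * (1 + Kb T) + C * \<bar>X r m\<bar>" if m: "m \<in> {0<..<1}" for m
    proof -
      have "\<bar>F r m\<bar> \<le> (\<integral>m'. \<bar>w (X r m - X r m')\<bar> \<partial>U)"
        unfolding lag_force_def using integral_norm_bound[of U "\<lambda>m'. w (X r m - X r m')"] by simp
      also have "\<dots> \<le> (\<integral>m'. C * (1 + \<bar>X r m\<bar>) + C * \<bar>X r m'\<bar> \<partial>U)"
      proof (rule integral_mono)
        show "integrable U (\<lambda>m'. \<bar>w (X r m - X r m')\<bar>)" using w_integrable[OF r(1) m] by simp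
        show "integrable U (\<lambda>m'. C * (1 + \<bar>X r m\<bar>) + C * \<bar>X r m'\<bar>)" using X_integrable[OF r(1)] by simp
        fix m'
        have "\<bar>w (X r m - X r m')\<bar> \<le> C * (1 + \<bar>X r m - X r m'\<bar>)" by (rule w_growth)
        also have "\<dots> \<le> C * (1 + (\<bar>X r m\<bar> + \<bar>X r m'\<bar>))" using C_nonneg by (intro mult_left_mono add_left_mono) auto
        finally show "\<bar>w (X r m - X r m')\<bar> \<le> C * (1 + \<bar>X r m\<bar>) + C * \<bar>X r m'\<bar>" by (simp add: algebra_simps)
      qed
      also have "\<dots> = C * (1 + \<bar>X r m\<bar>) + C * (\<integral>m'. \<bar>X r m'\<bar> \<partial>U)"
        using X_integrable[OF r(1)] by (simp add: U.prob_space[unfolded space_U])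
      also have "\<dots> \<le> C * (1 + \<bar>X r m\<bar>) + C * Kb T"
        using mean_abs_X[OF r] C_nonneg by (intro add_left_mono mult_left_mono) auto
      finally show ?thesis by (simp add: algebra_simps)
    qed
    let ?b = "\<lambda>m. C * (1 + Kb T) + C * \<bar>X r m\<bar>"
    have ib: "integrable U (\<lambda>m. (?b m)\<^sup>2)"
      using integrable_square_add[of "\<lambda>_. 1" "\<lambda>m. \<bar>X r m\<bar>" "C * (1 + Kb T)" C] X_int[OF r(1)] by simp
    have sq: "(F r m)\<^sup>2 \<le> (?b m)\<^sup>2" if "m \<in> {0<..<1}" for m
      using pw[OF that] by (simp add: abs_le_square_iff[symmetric])
    show i: "integrable U (\<lambda>m. (F r m)\<^sup>2)"
      by (rule Bochner_Integration.integrable_bound[OF ib]) (use sq in \<open>auto intro!: AE_I2\<close>)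
    have "(\<integral>m. (F r m)\<^sup>2 \<partial>U) \<le> (\<integral>m. (?b m)\<^sup>2 \<partial>U)" using i ib sq by (intro integral_mono) auto
    also have "\<dots> \<le> (C * (1 + Kb T) + C * Kb T)\<^sup>2"
    proof (rule minkowski_U)
      show "(\<integral>m. (C * \<bar>X r m\<bar>)\<^sup>2 \<partial>U) \<le> (C * Kb T)\<^sup>2"
        using X_bound[OF r] by (simp add: power_mult_distrib mult_left_mono)
    qed (use X_int[OF r(1)] C_nonneg Kb_nonneg[OF T] in \<open>auto simp: power_mult_distrib U.prob_space[unfolded space_U]\<close>)
    finally show "(\<integral>m. (F r m)\<^sup>2 \<partial>U) \<le> (KF T)\<^sup>2" by (simp add: KF_def algebra_simps)
  qed
  show "0 \<le> r \<Longrightarrow> integrable U (\<lambda>m. (F r m)\<^sup>2)" using main[of r] by simp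
  show "0 \<le> r \<Longrightarrow> r \<le> T \<Longrightarrow> (\<integral>m. (F r m)\<^sup>2 \<partial>U) \<le> (KF T)\<^sup>2" using main[of T] by simp
qed

lemma impulse_increment_L2:
  assumes "0 \<le> s" "s \<le> t"
  shows "integrable U (\<lambda>m. (Z t m - Z s m)\<^sup>2)" "(\<integral>m. (Z t m - Z s m)\<^sup>2 \<partial>U) \<le> ((t - s) * KF t)\<^sup>2"
proof -
  have F: "(\<lambda>(r, m). F r m) \<in> borel_measurable (borel \<Otimes>\<^sub>M borel)"
    using F_m[of fst "borel \<Otimes>\<^sub>M borel" snd] by (simp add: split_beta')
  have zd: "m \<in> {0<..<1} \<Longrightarrow> Z t m - Z s m = (LBINT r:{s<..t}. F r m)" for m using Z_diff[OF assms] .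
  have "(\<lambda>m. Z t m - Z s m) \<in> borel_measurable U" by measurable
  then have "(\<lambda>m. LBINT r:{s<..t}. F r m) \<in> borel_measurable U"
    by (subst measurable_cong[of _ _ "\<lambda>m. Z t m - Z s m"]) (use zd in auto)
  note L = time_integral_L2[OF F assms(2) KF_nonneg F_int F_L2 F_bound[of _ t] this, of t]
  have "integrable U (\<lambda>m. (LBINT r:{s<..t}. F r m)\<^sup>2)" by (rule L(1)) (use assms in auto)
  then show "integrable U (\<lambda>m. (Z t m - Z s m)\<^sup>2)"
    by (subst Bochner_Integration.integrable_cong[OF refl, of _ _ "\<lambda>m. (LBINT r:{s<..t}. F r m)\<^sup>2"]) (use zd in auto)
  have "(\<integral>m. (LBINT r:{s<..t}. F r m)\<^sup>2 \<partial>U) \<le> ((t - s) * KF t)\<^sup>2" by (rule L(2)) (use assms in auto)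
  then show "(\<integral>m. (Z t m - Z s m)\<^sup>2 \<partial>U) \<le> ((t - s) * KF t)\<^sup>2"
    by (subst Bochner_Integration.integral_cong[OF refl, of _ _ "\<lambda>m. (LBINT r:{s<..t}. F r m)\<^sup>2"]) (use zd in auto)
qed

definition KZ :: "real \<Rightarrow> real" where "KZ T = D * (1 + Kb T) + T * KF T"

lemma KZ_nonneg: "0 \<le> T \<Longrightarrow> 0 \<le> KZ T"
  using D_nonneg Kb_nonneg[of T] KF_nonneg[of T] by (simp add: KZ_def)

lemma Z_int: "0 \<le> t \<Longrightarrow> integrable U (\<lambda>m. (Z t m)\<^sup>2)"
  and Z_L2: "0 \<le> t \<Longrightarrow> t \<le> T \<Longrightarrow> (\<integral>m. (Z t m)\<^sup>2 \<partial>U) \<le> (KZ T)\<^sup>2"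
proof -
  have v: "integrable U (\<lambda>m. (v0 (X 0 m))\<^sup>2)" "(\<integral>m. (v0 (X 0 m))\<^sup>2 \<partial>U) \<le> (D * (1 + Kb T))\<^sup>2" if T: "0 \<le> T" for T
  proof -
    let ?b = "\<lambda>m. D + D * \<bar>X 0 m\<bar>"
    have ib: "integrable U (\<lambda>m. (?b m)\<^sup>2)"
      using integrable_square_add[of "\<lambda>_. 1" "\<lambda>m. \<bar>X 0 m\<bar>" D D] X_int[of 0] by simp
    have sq: "(v0 (X 0 m))\<^sup>2 \<le> (?b m)\<^sup>2" for m
      using v0_growth[of "X 0 m"] D_nonneg by (simp add: abs_le_square_iff[symmetric] algebra_simps)
    show i: "integrable U (\<lambda>m. (v0 (X 0 m))\<^sup>2)"
      by (rule Bochner_Integration.integrable_bound[OF ib]) (use sq in \<open>auto intro!: AE_I2\<close>)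
    have "(\<integral>m. (v0 (X 0 m))\<^sup>2 \<partial>U) \<le> (\<integral>m. (?b m)\<^sup>2 \<partial>U)" using i ib sq by (intro integral_mono) auto
    also have "\<dots> \<le> (D + D * Kb T)\<^sup>2"
    proof (rule minkowski_U)
      show "(\<integral>m. (D * \<bar>X 0 m\<bar>)\<^sup>2 \<partial>U) \<le> (D * Kb T)\<^sup>2"
        using X_bound[of 0 T] T by (simp add: power_mult_distrib mult_left_mono)
    qed (use X_int[of 0] D_nonneg Kb_nonneg[OF T] in \<open>auto simp: power_mult_distrib U.prob_space[unfolded space_U]\<close>)
    finally show "(\<integral>m. (v0 (X 0 m))\<^sup>2 \<partial>U) \<le> (D * (1 + Kb T))\<^sup>2" by (simp add: algebra_simps)
  qed
  have main: "integrable U (\<lambda>m. (Z t m)\<^sup>2)" "(\<integral>m. (Z t m)\<^sup>2 \<partial>U) \<le> (D * (1 + Kb T) + t * KF t)\<^sup>2" if t: "0 \<le> t" "0 \<le> T" for T t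
  proof -
    have e: "Z t m = v0 (X 0 m) + (Z t m - Z 0 m)" for m by (simp add: Z_0)
    show "integrable U (\<lambda>m. (Z t m)\<^sup>2)"
      using integrable_square_add[of "\<lambda>m. v0 (X 0 m)" "\<lambda>m. Z t m - Z 0 m" 1 1] v(1)[of 0] impulse_increment_L2(1)[of 0 t] t
      by (simp add: Z_0)
    have "(\<integral>m. (v0 (X 0 m) + (Z t m - Z 0 m))\<^sup>2 \<partial>U) \<le> (D * (1 + Kb T) + t * KF t)\<^sup>2"
      using impulse_increment_L2[of 0 t] v[OF t(2)] t D_nonneg Kb_nonneg[OF t(2)] KF_nonneg[OF t(1)]
      by (intro minkowski_U) auto
    then show "(\<integral>m. (Z t m)\<^sup>2 \<partial>U) \<le> (D * (1 + Kb T) + t * KF t)\<^sup>2" by (simp add: Z_0)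
  qed
  show "0 \<le> t \<Longrightarrow> integrable U (\<lambda>m. (Z t m)\<^sup>2)" using main[of t t] by simp
  show "(\<integral>m. (Z t m)\<^sup>2 \<partial>U) \<le> (KZ T)\<^sup>2" if t: "0 \<le> t" "t \<le> T"
  proof -
    have F: "(\<lambda>(r, m). F r m) \<in> borel_measurable (borel \<Otimes>\<^sub>M borel)"
      using F_m[of fst "borel \<Otimes>\<^sub>M borel" snd] by (simp add: split_beta')
    have "(\<integral>m. (LBINT r:{0<..t}. F r m)\<^sup>2 \<partial>U) \<le> ((t - 0) * KF T)\<^sup>2"
    proof (rule time_integral_L2(2)[OF F, where B = "BF T"])
      show "(\<lambda>m. LBINT r:{0<..t}. F r m) \<in> borel_measurable U"
        by (rule measurable_time_integral[OF F]) auto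
    qed (use t F_int F_L2 F_bound[of _ T] KF_nonneg in auto)
    then have "(\<integral>m. (Z t m - Z 0 m)\<^sup>2 \<partial>U) \<le> (t * KF T)\<^sup>2" by (simp add: lag_impulse_def)
    then have "(\<integral>m. (v0 (X 0 m) + (Z t m - Z 0 m))\<^sup>2 \<partial>U) \<le> (D * (1 + Kb T) + t * KF T)\<^sup>2"
      using impulse_increment_L2(1)[of 0 t] v[of T] t D_nonneg Kb_nonneg[of T] KF_nonneg[of T]
      by (intro minkowski_U) auto
    also have "\<dots> \<le> (KZ T)\<^sup>2"
      unfolding KZ_def using t D_nonneg Kb_nonneg[of T] KF_nonneg[of T]
      by (intro power_mono add_left_mono mult_right_mono) auto
    finally show ?thesis by (simp add: Z_0)
  qed
qed

text \<open>
  A label of the mass at the point \<open>x\<close>: the mean of the masses strictly to the left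
  of \<open>x\<close> and weakly to the left of \<open>x\<close>. Unlike a one-sided inverse it
  lands inside the block of labels at \<open>x\<close> also when that block is a nondegenerate
  interval, so \<open>X t (Minv t x) = x\<close> there.
\<close>
definition Minv :: "real \<Rightarrow> real \<Rightarrow> real" where
  "Minv t x = (\<integral>m. (if X t m < x then 1 else 0) + (if X t m \<le> x then 1 else 0) \<partial>U) / 2"

lemma Minv_meas: "(\<lambda>(t, x). Minv t x) \<in> borel_measurable (borel \<Otimes>\<^sub>M borel)"
proof -
  have "(\<lambda>p. Minv (fst p) (snd p)) \<in> borel_measurable (borel \<Otimes>\<^sub>M borel)"
    unfolding Minv_def by (intro borel_measurable_divide U.borel_measurable_lebesgue_integral) (simp_all add: split_beta')
  then show ?thesis by (simp add: split_beta')
qed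

lemmas Minv_m [measurable] = measurable_uncurried[OF Minv_meas]

lemma Minv_X:
  assumes t: "0 \<le> t" and m: "m \<in> {0<..<1}"
  shows "Minv t (X t m) \<in> {0<..<1}" "X t (Minv t (X t m)) = X t m"
proof -
  let ?x = "X t m"
  define A where "A = {m' \<in> space U. X t m' < ?x}"
  define B where "B = {m' \<in> space U. X t m' \<le> ?x}"
  have AB: "A \<in> sets U" "B \<in> sets U" unfolding A_def B_def by measurable
  have AI: "A \<inter> {0<..<1} = A" "B \<inter> {0<..<1} = B" by (auto simp: A_def B_def)
  define a where "a = measure U A"
  define b where "b = measure U B"
  have p: "Minv t ?x = (a + b) / 2"
  proof -
    have "(\<integral>m'. (if X t m' < ?x then 1 else 0) + (if X t m' \<le> ?x then 1 else 0) \<partial>U)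
        = (\<integral>m'. indicator A m' + indicator B m' \<partial>U)"
      by (intro Bochner_Integration.integral_cong) (auto simp: A_def B_def indicator_def)
    also have "\<dots> = a + b"
      using AB by (subst Bochner_Integration.integral_add)
        (auto simp: a_def b_def AI U.emeasure_finite less_top[symmetric] intro!: integrable_real_indicator)
    finally show ?thesis by (simp add: Minv_def)
  qed
  have Iio: "measure U {0<..<y} = y" "{0<..<y} \<in> sets U" "measure U {0<..y} = y" "{0<..y} \<in> sets U" if "y \<in> {0<..<1}" for y
    using that by (subst measure_restrict_space | auto simp: sets_restrict_space_iff)+
  \<comment> \<open>the labels strictly between \<open>a\<close> and \<open>b\<close> are all at the
      position \<open>?x\<close>\<close>
  have hiA: "?x \<le> X t y" if "y \<in> {0<..<1}" "a < y" for y
  proof (rule ccontr)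
    assume "\<not> ?thesis"
    then have "X t z < ?x" if "0 < z" "z \<le> y" for z
      using X_mono[OF t that] \<open>y \<in> {0<..<1}\<close> by auto
    then have "{0<..y} \<subseteq> A" using that by (auto simp: A_def)
    then have "y \<le> a" unfolding a_def using U.finite_measure_mono[OF _ AB(1)] Iio(3)[OF that(1)] by metis
    then show False using that by simp
  qed
  have loB: "X t y \<le> ?x" if "y \<in> {0<..<1}" "y < b" for y
  proof (rule ccontr)
    assume n: "\<not> ?thesis"
    have "z < y" if "z \<in> B" for z
      using that n X_mono[OF t, of y z] \<open>y \<in> {0<..<1}\<close> by (force simp: B_def not_less[symmetric])
    then have "B \<subseteq> {0<..<y}" by (auto simp: B_def)
    then have "b \<le> y" unfolding b_def using U.finite_measure_mono[OF _ Iio(2)[OF that(1)]] Iio(1)[OF that(1)] by metis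
    then show False using that by simp
  qed
  have "A \<subseteq> {0<..<m}"
    using X_mono[OF t, of m] m by (force simp: A_def not_less[symmetric])
  then have am: "a \<le> m" unfolding a_def using U.finite_measure_mono[OF _ Iio(2)[OF m]] Iio(1)[OF m] by metis
  have "{0<..m} \<subseteq> B" using X_mono[OF t, of _ m] m by (auto simp: B_def)
  then have bm: "m \<le> b" unfolding b_def using U.finite_measure_mono[OF _ AB(2)] Iio(3)[OF m] by metis
  have ab: "0 \<le> a" "b \<le> 1" by (auto simp: a_def b_def)
  show pin: "Minv t ?x \<in> {0<..<1}" using am bm m ab by (auto simp: p)
  show "X t (Minv t ?x) = ?x"
  proof (cases "a < b")
    case True
    then show ?thesis using hiA[OF pin] loB[OF pin] by (auto simp: p)
  next
    case False
    then have "Minv t ?x = m" using am bm by (simp add: p)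
    then show ?thesis by simp
  qed
qed

text \<open>
  Sticking: by the comparison with \<open>sinh\<close> a gap that is zero stays zero.
\<close>
lemma X_stick:
  assumes "0 < s" "s \<le> t" "m \<in> {0<..<1}" "m' \<in> {0<..<1}" "X s m = X s m'"
  shows "X t m = X t m'"
proof -
  have p: "0 < sinh (sqrt c * s)" using assms c_pos by simp
  have *: "X t b = X t a" if ab: "a \<in> {0<..<1}" "b \<in> {0<..<1}" "X s a = X s b" "a \<le> b" for a b
  proof -
    have "(X t b - X t a) * sinh (sqrt c * s) \<le> 0" using X_sinh[of s t a b] assms(1,2) ab by simp
    then have "\<not> 0 < X t b - X t a" using mult_pos_pos[OF _ p, of "X t b - X t a"] by linarith
    moreover have "X t a \<le> X t b" using X_mono[of t a b] assms(1,2) ab by simp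
    ultimately show ?thesis by simp
  qed
  show ?thesis using *[of m m'] *[of m' m] assms by (cases "m \<le> m'") auto
qed

text \<open>
  Positions at a later time are functions of the position at an earlier one.
\<close>
lemma X_Minv: "0 < s \<Longrightarrow> s \<le> t \<Longrightarrow> m \<in> {0<..<1} \<Longrightarrow> X t (Minv s (X s m)) = X t m"
  by (rule X_stick[of s]) (use Minv_X[of s m] in auto)

text \<open>
  The projection identity for all bounded Borel test functions.
\<close>
lemma X_Y_orthogonal:
  assumes t: "0 \<le> t" and [measurable]: "\<psi> \<in> borel_measurable borel" and B: "\<And>x. \<bar>\<psi> x\<bar> \<le> B"
  shows "(\<integral>m. \<psi> (X t m) * (X t m - Y t m) \<partial>U) = 0"
proof (rule test_functions_suffice[where h = "X t" and f = "\<lambda>m. X t m - Y t m"])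
  show i: "integrable U (\<lambda>m. X t m - Y t m)" using X_integrable[OF t] Y_integrable[OF t] by simp
  show "(\<integral>m. g (X t m) * (X t m - Y t m) \<partial>U) = 0" if g: "\<And>x. \<bar>g x\<bar> \<le> 1" "\<And>x y. \<bar>g x - g y\<bar> \<le> L * \<bar>x - y\<bar>" for g L
  proof (rule X_projection[OF t _ g(1)])
    have "L-lipschitz_on UNIV g \<or> L < 0"
      using g(2) by (auto simp: lipschitz_on_def dist_real_def)
    moreover have "\<not> L < 0" using g(2)[of 0 1] by auto
    ultimately show "continuous_on UNIV g" using lipschitz_on_continuous_on by blast
  qed
  show "integrable U (\<lambda>m. \<psi> (X t m) * (X t m - Y t m))"
    by (rule Bochner_Integration.integrable_bound[OF integrable_mult_right[OF i, of B]])
       (use B in \<open>auto intro!: AE_I2 simp: abs_mult intro!: mult_right_mono order_trans[OF B abs_ge_self]\<close>)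
qed measurable

text \<open>
  The identity at time \<open>t\<close> is tested with \<open>g (X \<tau> m)\<close>, which is a
  function of \<open>X t m\<close> by \<open>X_Minv\<close>; subtracting it from the identity at
  time \<open>\<tau>\<close> leaves the increments.
\<close>
lemma increment_projection:
  assumes t: "0 < t" "t \<le> \<tau>" and [measurable]: "g \<in> borel_measurable borel" and B: "\<And>x. \<bar>g x\<bar> \<le> B"
  shows "(\<integral>m. g (X \<tau> m) * (X \<tau> m - X t m) \<partial>U) = (\<integral>m. g (X \<tau> m) * (Y \<tau> m - Y t m) \<partial>U)"
proof -
  have bi: "integrable U (\<lambda>m. g (X \<tau> m) * f m)" if "integrable U f" for f
    by (rule Bochner_Integration.integrable_bound[OF integrable_mult_right[OF that, of B]])
       (use that B in \<open>auto intro!: AE_I2 simp: abs_mult intro!: mult_right_mono order_trans[OF B abs_ge_self]\<close>)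
  have i: "integrable U (X \<tau>)" "integrable U (Y \<tau>)" "integrable U (X t)" "integrable U (Y t)"
    using X_integrable[of \<tau>] X_integrable[of t] Y_integrable[of \<tau>] Y_integrable[of t] t by auto
  have 1: "(\<integral>m. g (X \<tau> m) * (X \<tau> m - Y \<tau> m) \<partial>U) = 0" using t B by (intro X_Y_orthogonal) auto
  have "(\<integral>m. g (X \<tau> (Minv t (X t m))) * (X t m - Y t m) \<partial>U) = 0"
    using t B by (intro X_Y_orthogonal[where \<psi> = "\<lambda>x. g (X \<tau> (Minv t x))"]) auto
  then have 2: "(\<integral>m. g (X \<tau> m) * (X t m - Y t m) \<partial>U) = 0"
    using X_Minv[OF t] by (subst (asm) Bochner_Integration.integral_cong[OF refl, of _ _ "\<lambda>m. g (X \<tau> m) * (X t m - Y t m)"]) auto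
  show ?thesis using 1 2 bi[OF i(1)] bi[OF i(2)] bi[OF i(3)] bi[OF i(4)]
    by (simp add: right_diff_distrib)
qed

end

section \<open>The velocity of the flow\<close>

text \<open>
  An upper limit with values in the reals. It makes the velocity a total, measurable function
  with bounds for every label, also where the difference quotients do not converge.
\<close>
definition rlimsup :: "(nat \<Rightarrow> real) \<Rightarrow> real" where
  "rlimsup a = real_of_ereal (limsup (\<lambda>n. ereal (a n)))"

lemma rlimsup_ereal:
  assumes "\<And>n. \<bar>a n\<bar> \<le> B"
  shows "ereal (rlimsup a) = limsup (\<lambda>n. ereal (a n))"
proof -
  have "limsup (\<lambda>n. ereal (a n)) \<le> ereal B"
    using assms by (intro Limsup_bounded always_eventually) (auto simp: abs_le_iff)
  moreover have "ereal (- B) \<le> limsup (\<lambda>n. ereal (a n))"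
  proof (rule le_Limsup[OF trivial_limit_sequentially], rule always_eventually, rule allI)
    fix n show "ereal (- B) \<le> ereal (a n)" using assms[of n] by (simp add: abs_le_iff)
  qed
  ultimately show ?thesis
    unfolding rlimsup_def by (cases "limsup (\<lambda>n. ereal (a n))") auto
qed

lemma rlimsup_lessD:
  assumes "\<And>n. \<bar>a n\<bar> \<le> B" "rlimsup a < c"
  shows "\<forall>\<^sub>F n in sequentially. a n < c"
proof -
  have "limsup (\<lambda>n. ereal (a n)) < ereal c" using assms by (simp flip: rlimsup_ereal[OF assms(1)])
  from Limsup_lessD[OF this] show ?thesis by simp
qed

lemma rlimsup_le:
  assumes "\<And>n. \<bar>a n\<bar> \<le> B" "\<forall>\<^sub>F n in sequentially. a n \<le> c"
  shows "rlimsup a \<le> c"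
proof -
  have "limsup (\<lambda>n. ereal (a n)) \<le> ereal c"
    using assms(2) by (intro Limsup_bounded) (auto elim: eventually_mono)
  then show ?thesis by (simp flip: rlimsup_ereal[OF assms(1)])
qed

lemma rlimsup_ge:
  assumes "\<And>n. \<bar>a n\<bar> \<le> B" "\<forall>\<^sub>F n in sequentially. c \<le> a n"
  shows "c \<le> rlimsup a"
proof (rule ccontr)
  assume "\<not> ?thesis"
  then have "rlimsup a < c" by simp
  from eventually_conj[OF rlimsup_lessD[OF assms(1) this] assms(2)]
  have "\<forall>\<^sub>F n::nat in sequentially. False" by (rule eventually_mono) auto
  then show False by simp
qed

lemma rlimsup_eq: "a \<longlonglongrightarrow> l \<Longrightarrow> rlimsup a = l"
  unfolding rlimsup_def using lim_imp_Limsup[OF trivial_limit_sequentially, of "\<lambda>n. ereal (a n)" "ereal l"] by simp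

lemma tendsto_by_approximation:
  fixes a :: "nat \<Rightarrow> real"
  assumes b: "\<And>j. (\<lambda>n. b j n) \<longlonglongrightarrow> B j" and e: "e \<longlonglongrightarrow> 0"
    and ab: "\<And>j n. \<bar>a n - b j n\<bar> \<le> e j" and AB: "\<And>j. \<bar>A - B j\<bar> \<le> e j"
  shows "a \<longlonglongrightarrow> A"
  unfolding LIMSEQ_def dist_real_def
proof (intro allI impI)
  fix r :: real assume r: "0 < r"
  then have "0 < r / 3" by simp
  then have "\<forall>\<^sub>F j in sequentially. e j < r / 3" by (rule order_tendstoD(2)[OF e])
  then obtain j where j: "e j < r / 3" using eventually_happens'[OF trivial_limit_sequentially] by blast
  have "0 < r / 3" using r by simp
  then obtain N where N: "\<And>n. N \<le> n \<Longrightarrow> \<bar>b j n - B j\<bar> < r / 3"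
    using b[of j] unfolding LIMSEQ_def dist_real_def by blast
  show "\<exists>N. \<forall>n\<ge>N. \<bar>a n - A\<bar> < r"
  proof (intro exI allI impI)
    fix n assume "N \<le> n"
    then show "\<bar>a n - A\<bar> < r" using N[of n] ab[of n j] AB[of j] j by linarith
  qed
qed

context sticky_flow
begin

declare of_nat_Suc [simp del]

definition Lc :: "real \<Rightarrow> real \<Rightarrow> real" where
  "Lc a T = Kb T * (1 + 2 * (sqrt c * cosh (sqrt c * T) / sinh (sqrt c * a)))"

text \<open>
  The constant degenerates at time \<open>0\<close>, where \<open>sinh\<close> vanishes.
\<close>
lemma X_time:
  assumes "0 < a" "a \<le> s" "s \<le> t" "t \<le> T" "m \<in> {0<..<1}"
  shows "\<bar>X t m - X s m\<bar> \<le> Lc a T * (t - s) * \<beta> m"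
proof -
  define l where "l = sinh (sqrt c * t) / sinh (sqrt c * s) - 1"
  have T: "0 \<le> Kb T" using assms by (intro Kb_nonneg) simp
  have l: "l \<le> sqrt c * cosh (sqrt c * T) / sinh (sqrt c * a) * (t - s)" "0 \<le> l"
    unfolding l_def using sinh_ratio[of "sqrt c" a s t T] assms c_pos by auto
  have sp: "0 < sinh (sqrt c * s)" using assms c_pos by simp
  have "\<bar>X t m - X s m\<bar> \<le> (Kb T * (t - s) + 2 * l * Kb T) * \<beta> m"
  proof (rule mono_pair_bound)
    show "X t m' - X t m \<le> (1 + l) * (X s m' - X s m)" if "0 < m" "m \<le> m'" "m' < 1" for m m'
    proof -
      have "X t m' - X t m \<le> (X s m' - X s m) * sinh (sqrt c * t) / sinh (sqrt c * s)"
        using X_sinh[OF _ assms(3) that] assms sp by (simp add: pos_le_divide_eq)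
      then show ?thesis by (simp add: l_def mult_ac)
    qed
    show "integrable U (\<lambda>m. (X t m - X s m)\<^sup>2)"
      using integrable_square_add[of "X t" "X s" 1 "-1"] X_int[of t] X_int[of s] assms by simp
    show "(\<integral>m. (X t m - X s m)\<^sup>2 \<partial>U) \<le> (Kb T * (t - s))\<^sup>2" using X_lip[of s t T] assms by auto
  qed (use X_mono X_int X_bound T l assms in auto)
  also have "\<dots> \<le> Lc a T * (t - s) * \<beta> m"
  proof (rule mult_right_mono)
    have "2 * Kb T * l \<le> 2 * Kb T * (sqrt c * cosh (sqrt c * T) / sinh (sqrt c * a) * (t - s))"
      using l T by (intro mult_left_mono) auto
    then show "Kb T * (t - s) + 2 * l * Kb T \<le> Lc a T * (t - s)"
      by (simp add: Lc_def algebra_simps)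
    show "0 \<le> \<beta> m" using \<beta>_ge1[OF assms(5)] by simp
  qed
  finally show ?thesis .
qed

lemma Lc_nonneg: "0 < a \<Longrightarrow> 0 \<le> T \<Longrightarrow> 0 \<le> Lc a T"
  using Kb_nonneg[of T] c_pos by (simp add: Lc_def)

lemma X_isCont:
  assumes t: "0 < t" and m: "m \<in> {0<..<1}"
  shows "isCont (\<lambda>s. X s m) t"
proof -
  define L where "L = Lc (t / 2) (t + 1) * \<beta> m"
  have "((\<lambda>s. X s m - X t m) \<longlongrightarrow> 0) (at t)"
  proof (rule Lim_null_comparison)
    have "\<forall>\<^sub>F s in at t. s \<in> {t / 2<..<t + 1}"
      using t by (intro eventually_at_in_open') auto
    then show "\<forall>\<^sub>F s in at t. norm (X s m - X t m) \<le> L * \<bar>s - t\<bar>"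
    proof eventually_elim
      case (elim s)
      then show ?case
        using X_time[of "t / 2" s t "t + 1" m] X_time[of "t / 2" t s "t + 1" m] t m
        by (cases "s \<le> t") (auto simp: L_def abs_minus_commute mult_ac)
    qed
    have "((\<lambda>s. L * \<bar>s - t\<bar>) \<longlongrightarrow> L * \<bar>t - t\<bar>) (at t)" by (intro tendsto_intros)
    then show "((\<lambda>s. L * \<bar>s - t\<bar>) \<longlongrightarrow> 0) (at t)" by simp
  qed
  then show ?thesis unfolding isCont_def by (simp add: LIM_zero_iff)
qed

abbreviation tstep :: "nat \<Rightarrow> real" where "tstep n \<equiv> 1 / real (Suc n)"

lemma tstep_tendsto: "tstep \<longlonglongrightarrow> 0"
  using LIMSEQ_inverse_real_of_nat by (simp add: inverse_eq_divide)

lemma tstep_le1: "tstep n \<le> 1" by simp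

lemma shift_le [simp]: "t \<le> T \<Longrightarrow> t + 1 / real (Suc n) \<le> T + 1"
  by (rule add_mono[OF _ tstep_le1])

text \<open>
  Forward difference quotient in time. Only forward increments are functions of the present
  position.
\<close>
definition q :: "nat \<Rightarrow> real \<Rightarrow> real \<Rightarrow> real" where
  "q n t m = real (Suc n) * (X (t + tstep n) m - X t m)"

lemma q_m [measurable (raw)]:
  assumes [measurable]: "f \<in> borel_measurable M" "g \<in> borel_measurable M"
  shows "(\<lambda>x. q n (f x) (g x)) \<in> borel_measurable M"
  unfolding q_def by measurable

lemma q_U_m [measurable]: "q n t \<in> borel_measurable U"
  unfolding q_def[abs_def] by measurable

lemma q_bound:
  assumes "0 < a" "a \<le> t" "t \<le> T" "m \<in> {0<..<1}"
  shows "\<bar>q n t m\<bar> \<le> Lc a (T + 1) * \<beta> m"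
proof -
  have "\<bar>X (t + tstep n) m - X t m\<bar> \<le> Lc a (T + 1) * (t + tstep n - t) * \<beta> m"
    using assms tstep_le1[of n] by (intro X_time) auto
  then have "real (Suc n) * \<bar>X (t + tstep n) m - X t m\<bar> \<le> real (Suc n) * (Lc a (T + 1) * tstep n * \<beta> m)"
    by (intro mult_left_mono) auto
  then show ?thesis by (simp add: q_def abs_mult)
qed

lemma q_int: "0 \<le> t \<Longrightarrow> integrable U (\<lambda>m. (q n t m)\<^sup>2)"
  using integrable_square_add[of "X (t + tstep n)" "X t" "real (Suc n)" "- real (Suc n)"] X_int[of t] X_int[of "t + tstep n"]
  by (simp add: q_def right_diff_distrib)

lemma q_L2:
  assumes "0 \<le> t" "t \<le> T"
  shows "(\<integral>m. (q n t m)\<^sup>2 \<partial>U) \<le> (Kb (T + 1))\<^sup>2"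
proof -
  have "(\<integral>m. (X (t + tstep n) m - X t m)\<^sup>2 \<partial>U) \<le> (Kb (T + 1) * (t + tstep n - t))\<^sup>2"
    using assms tstep_le1[of n] by (intro X_lip) auto
  then have "(real (Suc n))\<^sup>2 * (\<integral>m. (X (t + tstep n) m - X t m)\<^sup>2 \<partial>U) \<le> (real (Suc n))\<^sup>2 * (Kb (T + 1) * tstep n)\<^sup>2"
    by (intro mult_left_mono) auto
  also have "\<dots> = (Kb (T + 1))\<^sup>2" by (simp add: power_mult_distrib power_divide)
  finally show ?thesis by (simp add: q_def power_mult_distrib)
qed

lemma X_shift_tendsto: "0 < t \<Longrightarrow> m \<in> {0<..<1} \<Longrightarrow> (\<lambda>n. X (t + tstep n) m) \<longlonglongrightarrow> X t m"
  using isCont_tendsto_compose[OF X_isCont[of t m], of "\<lambda>n. t + tstep n"] tendsto_add[OF tendsto_const tstep_tendsto, of t]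
  by simp

lemma Y_quotient:
  assumes t: "0 \<le> t" and m: "m \<in> {0<..<1}"
  shows "\<bar>real (Suc n) * (Y (t + tstep n) m - Y t m) - Z t m\<bar> \<le> BF (t + 1) m * tstep n"
proof -
  have si: "set_integrable lborel {t<..t + tstep n} (\<lambda>r. Z r m)"
  proof (rule bounded_set_integrable[where B = "BZ (t + 1) m"])
    fix r assume "t < r" "r \<le> t + tstep n"
    moreover have "t + tstep n \<le> t + 1" by simp
    ultimately show "\<bar>Z r m\<bar> \<le> BZ (t + 1) m" using t m by (intro Z_bound) linarith+
  qed measurable
  have ic: "set_integrable lborel {t<..t + tstep n} (\<lambda>r. Z t m)"
    by (intro bounded_set_integrable[where B = "\<bar>Z t m\<bar>"]) auto
  have "(LBINT r:{t<..t + tstep n}. Z r m - Z t m) = (LBINT r:{t<..t + tstep n}. Z r m) - (LBINT r:{t<..t + tstep n}. Z t m)"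
    by (rule set_integral_diff(2)[OF si ic])
  also have "(LBINT r:{t<..t + tstep n}. Z t m) = tstep n * Z t m"
    by (simp add: set_lebesgue_integral_def)
  also have "(LBINT r:{t<..t + tstep n}. Z r m) = Y (t + tstep n) m - Y t m"
    using t m by (intro Y_diff[symmetric]) auto
  finally have e: "Y (t + tstep n) m - Y t m - tstep n * Z t m = (LBINT r:{t<..t + tstep n}. Z r m - Z t m)" by simp
  have "\<bar>LBINT r:{t<..t + tstep n}. Z r m - Z t m\<bar> \<le> (t + tstep n - t) * (tstep n * BF (t + 1) m)"
  proof (rule set_int_abs_le)
    fix r assume r: "t < r" "r \<le> t + tstep n"
    have "\<bar>Z r m - Z t m\<bar> \<le> (r - t) * BF (t + 1) m"
      using r t m shift_le[OF order_refl, of t n] by (intro Z_lip) linarith+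
    also have "\<dots> \<le> tstep n * BF (t + 1) m" using r t BF_nonneg[OF m, of "t + 1"] by (intro mult_right_mono) auto
    finally show "\<bar>Z r m - Z t m\<bar> \<le> tstep n * BF (t + 1) m" .
  qed (use t BF_nonneg[OF m, of "t + 1"] in auto)
  then have "\<bar>Y (t + tstep n) m - Y t m - tstep n * Z t m\<bar> \<le> tstep n * (tstep n * BF (t + 1) m)" unfolding e by simp
  then have "real (Suc n) * \<bar>Y (t + tstep n) m - Y t m - tstep n * Z t m\<bar> \<le> real (Suc n) * (tstep n * (tstep n * BF (t + 1) m))"
    by (intro mult_left_mono) auto
  then have "\<bar>real (Suc n) * (Y (t + tstep n) m - Y t m - tstep n * Z t m)\<bar> \<le> tstep n * BF (t + 1) m"
    by (simp add: abs_mult)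
  also have "real (Suc n) * (Y (t + tstep n) m - Y t m - tstep n * Z t m) = real (Suc n) * (Y (t + tstep n) m - Y t m) - Z t m"
    by (simp add: right_diff_distrib)
  finally show ?thesis by (simp add: mult.commute)
qed

lemma integrable_bounded_mult:
  assumes f: "integrable U f" and g: "g \<in> borel_measurable U" "\<And>m. \<bar>g m\<bar> \<le> B"
  shows "integrable U (\<lambda>m. g m * f m :: real)"
  by (rule Bochner_Integration.integrable_bound[OF integrable_mult_right[OF f, of B]])
     (use f g in \<open>auto intro!: AE_I2 simp: abs_mult intro!: mult_right_mono order_trans[OF g(2) abs_ge_self]\<close>)

lemma q_integrable: "0 \<le> t \<Longrightarrow> integrable U (q n t)"
  by (rule integrable_of_square[OF q_U_m q_int])

lemma Z_integrable: "0 \<le> t \<Longrightarrow> integrable U (Z t)"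
  by (rule integrable_of_square[OF Z_U_m Z_int])

text \<open>
  The increments of \<open>X\<close> and of \<open>Y\<close> have the same integral against
  functions of the later position \<open>X (t + 1/n)\<close>, and \<open>Y\<close> is
  differentiable with derivative \<open>Z\<close>. Replacing the later position by the present
  one costs \<open>L / n \<integral> q\<^sub>n\<^sup>2\<close>, which tends to \<open>0\<close>.
\<close>
lemma q_weak:
  assumes t: "0 < t" and g1: "\<And>x. \<bar>g x\<bar> \<le> 1" and gL: "\<And>x y. \<bar>g x - g y\<bar> \<le> L * \<bar>x - y\<bar>"
  shows "(\<lambda>n. \<integral>m. g (X t m) * q n t m \<partial>U) \<longlonglongrightarrow> (\<integral>m. g (X t m) * Z t m \<partial>U)"
proof -
  have L0: "0 \<le> L" using gL[of 0 1] by auto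
  have "L-lipschitz_on UNIV g" using gL L0 by (auto simp: lipschitz_on_def dist_real_def)
  then have gc: "continuous_on UNIV g" by (rule lipschitz_on_continuous_on)
  then have [measurable]: "g \<in> borel_measurable borel" by (rule borel_measurable_continuous_onI)
  have qi: "integrable U (q n t)" for n using q_integrable[of t n] t by simp
  have gq: "integrable U (\<lambda>m. g (X s m) * q n t m)" for n s
    by (rule integrable_bounded_mult[OF qi]) (use g1 in auto)
  have A: "(\<lambda>n. \<integral>m. g (X (t + tstep n) m) * q n t m \<partial>U) \<longlonglongrightarrow> (\<integral>m. g (X t m) * Z t m \<partial>U)"
  proof -
    have e: "(\<integral>m. g (X (t + tstep n) m) * q n t m \<partial>U) = (\<integral>m. g (X (t + tstep n) m) * (real (Suc n) * (Y (t + tstep n) m - Y t m)) \<partial>U)" for n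
    proof -
      have "(\<integral>m. g (X (t + tstep n) m) * q n t m \<partial>U) = (\<integral>m. real (Suc n) * (g (X (t + tstep n) m) * (X (t + tstep n) m - X t m)) \<partial>U)"
        by (intro Bochner_Integration.integral_cong) (auto simp: q_def)
      also have "\<dots> = real (Suc n) * (\<integral>m. g (X (t + tstep n) m) * (Y (t + tstep n) m - Y t m) \<partial>U)"
        using increment_projection[of t "t + tstep n" g 1] t g1 by simp
      also have "\<dots> = (\<integral>m. g (X (t + tstep n) m) * (real (Suc n) * (Y (t + tstep n) m - Y t m)) \<partial>U)"
        unfolding integral_mult_right_zero[symmetric] by (intro Bochner_Integration.integral_cong) auto
      finally show ?thesis .
    qed
    show ?thesis unfolding e
    proof (rule integral_dominated_convergence)
      show "integrable U (\<lambda>m. BZ t m + BF (t + 1) m)" using integrable_BZ integrable_BF by simp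
      show "AE m in U. (\<lambda>n. g (X (t + tstep n) m) * (real (Suc n) * (Y (t + tstep n) m - Y t m))) \<longlonglongrightarrow> g (X t m) * Z t m"
      proof (rule AE_I2, rule tendsto_mult)
        fix m assume "m \<in> space U"
        then have m: "m \<in> {0<..<1}" by simp
        have "isCont g (X t m)" using gc by (simp add: continuous_on_eq_continuous_at)
        then show "(\<lambda>n. g (X (t + tstep n) m)) \<longlonglongrightarrow> g (X t m)"
          by (rule isCont_tendsto_compose) (rule X_shift_tendsto[OF t m])
        have "(\<lambda>n. real (Suc n) * (Y (t + tstep n) m - Y t m) - Z t m) \<longlonglongrightarrow> 0"
        proof (rule Lim_null_comparison)
          show "\<forall>\<^sub>F n in sequentially. norm (real (Suc n) * (Y (t + tstep n) m - Y t m) - Z t m) \<le> BF (t + 1) m * tstep n"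
            using Y_quotient[of t m] t m by (intro always_eventually) auto
          show "(\<lambda>n. BF (t + 1) m * tstep n) \<longlonglongrightarrow> 0" using tendsto_mult[OF tendsto_const tstep_tendsto, of "BF (t + 1) m"] by simp
        qed
        then show "(\<lambda>n. real (Suc n) * (Y (t + tstep n) m - Y t m)) \<longlonglongrightarrow> Z t m" by (simp add: LIM_zero_iff)
      qed
      show "AE m in U. norm (g (X (t + tstep n) m) * (real (Suc n) * (Y (t + tstep n) m - Y t m))) \<le> BZ t m + BF (t + 1) m" for n
      proof (rule AE_I2)
        fix m assume "m \<in> space U"
        then have m: "m \<in> {0<..<1}" by simp
        have "BF (t + 1) m * tstep n \<le> BF (t + 1) m * 1" using BF_nonneg[OF m, of "t + 1"] t tstep_le1[of n] by (intro mult_left_mono) auto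
        then have "\<bar>real (Suc n) * (Y (t + tstep n) m - Y t m)\<bar> \<le> BZ t m + BF (t + 1) m"
          using Y_quotient[of t m n] Z_bound[of t t m] t m by linarith
        then have "\<bar>g (X (t + tstep n) m)\<bar> * \<bar>real (Suc n) * (Y (t + tstep n) m - Y t m)\<bar> \<le> 1 * (BZ t m + BF (t + 1) m)"
          using g1 by (intro mult_mono) auto
        then show "norm (g (X (t + tstep n) m) * (real (Suc n) * (Y (t + tstep n) m - Y t m))) \<le> BZ t m + BF (t + 1) m"
          by (simp add: abs_mult)
      qed
    qed measurable
  qed
  have "(\<lambda>n. (\<integral>m. g (X t m) * q n t m \<partial>U) - (\<integral>m. g (X (t + tstep n) m) * q n t m \<partial>U)) \<longlonglongrightarrow> 0"
  proof (rule Lim_null_comparison)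
    show "\<forall>\<^sub>F n in sequentially. norm ((\<integral>m. g (X t m) * q n t m \<partial>U) - (\<integral>m. g (X (t + tstep n) m) * q n t m \<partial>U)) \<le> (L * (Kb (t + 1))\<^sup>2) * tstep n"
    proof (intro always_eventually allI)
      fix n
      have "norm ((\<integral>m. g (X t m) * q n t m \<partial>U) - (\<integral>m. g (X (t + tstep n) m) * q n t m \<partial>U))
          = norm (\<integral>m. (g (X t m) - g (X (t + tstep n) m)) * q n t m \<partial>U)"
        using gq by (simp add: left_diff_distrib)
      also have "\<dots> \<le> (\<integral>m. norm ((g (X t m) - g (X (t + tstep n) m)) * q n t m) \<partial>U)"
        by (rule integral_norm_bound)
      also have "\<dots> \<le> (\<integral>m. (L * tstep n) * (q n t m)\<^sup>2 \<partial>U)"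
      proof (rule integral_mono)
        have "integrable U (\<lambda>m. (g (X t m) - g (X (t + tstep n) m)) * q n t m)"
          using gq by (simp add: left_diff_distrib)
        then show "integrable U (\<lambda>m. norm ((g (X t m) - g (X (t + tstep n) m)) * q n t m))" by simp
        show "integrable U (\<lambda>m. (L * tstep n) * (q n t m)\<^sup>2)" using q_int[of t n] t by simp
        fix m
        have "\<bar>g (X t m) - g (X (t + tstep n) m)\<bar> \<le> L * \<bar>X t m - X (t + tstep n) m\<bar>" by (rule gL)
        also have "\<bar>X t m - X (t + tstep n) m\<bar> = tstep n * \<bar>q n t m\<bar>" by (simp add: q_def abs_mult abs_minus_commute)
        finally have "\<bar>g (X t m) - g (X (t + tstep n) m)\<bar> * \<bar>q n t m\<bar> \<le> (L * (tstep n * \<bar>q n t m\<bar>)) * \<bar>q n t m\<bar>"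
          by (rule mult_right_mono) simp
        also have "\<dots> = (L * tstep n) * (q n t m)\<^sup>2" by (simp add: power2_eq_square)
        finally show "norm ((g (X t m) - g (X (t + tstep n) m)) * q n t m) \<le> (L * tstep n) * (q n t m)\<^sup>2" by (simp add: abs_mult)
      qed
      also have "\<dots> = (L * tstep n) * (\<integral>m. (q n t m)\<^sup>2 \<partial>U)" by simp
      also have "\<dots> \<le> (L * tstep n) * (Kb (t + 1))\<^sup>2" using q_L2[of t t n] t L0 by (intro mult_left_mono) auto
      finally show "norm ((\<integral>m. g (X t m) * q n t m \<partial>U) - (\<integral>m. g (X (t + tstep n) m) * q n t m \<partial>U)) \<le> (L * (Kb (t + 1))\<^sup>2) * tstep n"
        by (simp add: mult_ac)
    qed
    show "(\<lambda>n. (L * (Kb (t + 1))\<^sup>2) * tstep n) \<longlonglongrightarrow> 0" using tendsto_mult[OF tendsto_const tstep_tendsto, of "L * (Kb (t + 1))\<^sup>2"] by simp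
  qed
  from tendsto_add[OF this A] show ?thesis by simp
qed

text \<open>
  Indicators of closed intervals are limits of Lipschitz functions, with an error that is
  uniform in \<open>n\<close> by the common majorant.
\<close>
lemma q_weak_interval:
  assumes t: "0 < t" and xx: "x \<le> x'"
  shows "(\<lambda>n. \<integral>m. indicator {x..x'} (X t m) * q n t m \<partial>U) \<longlonglongrightarrow> (\<integral>m. indicator {x..x'} (X t m) * Z t m \<partial>U)"
proof -
  \<comment> \<open>Lipschitz functions that decrease to the indicator of the interval\<close>
  define g where "g j y = max 0 (1 - real j * max 0 (max (x - y) (y - x')))" for j :: nat and y
  have g01: "0 \<le> g j y" "g j y \<le> 1" for j y by (auto simp: g_def)
  then have g1: "\<bar>g j y\<bar> \<le> 1" for j y by (simp add: abs_le_iff order_trans[of _ 0])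
  have gL: "\<bar>g j y - g j z\<bar> \<le> real j * \<bar>y - z\<bar>" for j y z
  proof -
    let ?d = "\<lambda>y. max 0 (max (x - y) (y - x'))"
    have "\<bar>g j y - g j z\<bar> \<le> \<bar>real j * ?d y - real j * ?d z\<bar>" by (auto simp: g_def max_def abs_if)
    also have "\<dots> = real j * \<bar>?d y - ?d z\<bar>" unfolding right_diff_distrib[symmetric] by (simp add: abs_mult)
    also have "\<dots> \<le> real j * \<bar>y - z\<bar>" by (rule mult_left_mono) (auto simp: max_def abs_if)
    finally show ?thesis .
  qed
  have [measurable]: "g j \<in> borel_measurable borel" for j unfolding g_def[abs_def] by measurable
  have glim: "(\<lambda>j. g j y) \<longlonglongrightarrow> indicator {x..x'} y" for y
  proof (cases "y \<in> {x..x'}")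
    case True
    then have "max 0 (max (x - y) (y - x')) = 0" by auto
    then show ?thesis using True by (simp add: g_def)
  next
    case False
    define d where "d = max 0 (max (x - y) (y - x'))"
    have d: "0 < d" using False by (auto simp: d_def)
    obtain N :: nat where N: "1 / d < real N" using reals_Archimedean2 by blast
    have "0 = g j y" if "N \<le> j" for j
    proof -
      have "1 \<le> real N * d" using N d by (simp add: field_simps)
      also have "\<dots> \<le> real j * d" using that d by (intro mult_right_mono) auto
      finally show ?thesis by (simp add: g_def d_def)
    qed
    then have "\<forall>\<^sub>F j in sequentially. 0 = g j y" unfolding eventually_sequentially by blast
    then show ?thesis using False by (intro Lim_transform_eventually[OF tendsto_const]) auto
  qed
  define W where "W m = Lc t (t + 1) * \<beta> m + BZ t m" for m
  have iW: "integrable U W" unfolding W_def[abs_def] using integrable_\<beta> integrable_BZ by simp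
  have W: "\<bar>q n t m\<bar> \<le> W m" "\<bar>Z t m\<bar> \<le> W m" if m: "m \<in> {0<..<1}" for n m
  proof -
    have "0 \<le> Lc t (t + 1) * \<beta> m" using Lc_nonneg[OF t, of "t + 1"] t \<beta>_ge1[OF m] by simp
    moreover have "0 \<le> BZ t m" using BZ_nonneg[OF m] t by simp
    ultimately show "\<bar>q n t m\<bar> \<le> W m" "\<bar>Z t m\<bar> \<le> W m"
      using q_bound[OF t order_refl order_refl m, of n] Z_bound[of t t m] t m by (auto simp: W_def)
  qed
  define e where "e j = (\<integral>m. \<bar>indicator {x..x'} (X t m) - g j (X t m)\<bar> * W m \<partial>U)" for j
  have bd1: "\<bar>indicator {x..x'} y - g j y\<bar> \<le> 1" for j y using g01[of j y] by (auto simp: indicator_def)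
  have ie: "integrable U (\<lambda>m. \<bar>indicator {x..x'} (X t m) - g j (X t m)\<bar> * W m)" for j
    by (rule integrable_bounded_mult[OF iW]) (use bd1 in auto)
  have "e \<longlonglongrightarrow> (\<integral>m. 0 \<partial>U)"
    unfolding e_def
  proof (rule integral_dominated_convergence[OF _ _ iW])
    show "AE m in U. (\<lambda>j. \<bar>indicator {x..x'} (X t m) - g j (X t m)\<bar> * W m) \<longlonglongrightarrow> 0"
    proof (rule AE_I2)
      fix m
      have "(\<lambda>j. \<bar>indicator {x..x'} (X t m) - g j (X t m)\<bar> * W m) \<longlonglongrightarrow> \<bar>indicator {x..x'} (X t m) - indicator {x..x'} (X t m)\<bar> * W m"
        by (intro tendsto_intros glim)
      then show "(\<lambda>j. \<bar>indicator {x..x'} (X t m) - g j (X t m)\<bar> * W m) \<longlonglongrightarrow> 0" by simp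
    qed
    show "AE m in U. norm (\<bar>indicator {x..x'} (X t m) - g j (X t m)\<bar> * W m) \<le> W m" for j
    proof (rule AE_I2)
      fix m assume "m \<in> space U"
      then have "0 \<le> W m" using W(2)[of m] by force
      then show "norm (\<bar>indicator {x..x'} (X t m) - g j (X t m)\<bar> * W m) \<le> W m"
        using bd1[of "X t m" j] by (simp add: abs_mult mult_left_le_one_le)
    qed
  qed (use iW in \<open>auto simp: W_def[abs_def]\<close>)
  then have e0: "e \<longlonglongrightarrow> 0" by simp
  have diff: "\<bar>(\<integral>m. indicator {x..x'} (X t m) * f m \<partial>U) - (\<integral>m. g j (X t m) * f m \<partial>U)\<bar> \<le> e j"
    if f: "integrable U f" "\<And>m. m \<in> {0<..<1} \<Longrightarrow> \<bar>f m\<bar> \<le> W m" for f j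
  proof -
    have i: "integrable U (\<lambda>m. indicator {x..x'} (X t m) * f m)" "integrable U (\<lambda>m. g j (X t m) * f m)"
      by (rule integrable_bounded_mult[OF f(1), where B = 1]; use g1 in \<open>auto simp: indicator_def\<close>)+
    have "\<bar>(\<integral>m. indicator {x..x'} (X t m) * f m \<partial>U) - (\<integral>m. g j (X t m) * f m \<partial>U)\<bar>
        = norm (\<integral>m. (indicator {x..x'} (X t m) - g j (X t m)) * f m \<partial>U)"
      using i by (simp add: left_diff_distrib)
    also have "\<dots> \<le> (\<integral>m. norm ((indicator {x..x'} (X t m) - g j (X t m)) * f m) \<partial>U)"
      by (rule integral_norm_bound)
    also have "\<dots> \<le> e j"
      unfolding e_def
    proof (rule integral_mono[OF _ ie])
      show "integrable U (\<lambda>m. norm ((indicator {x..x'} (X t m) - g j (X t m)) * f m))"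
        using i by (auto simp: left_diff_distrib)
      show "norm ((indicator {x..x'} (X t m) - g j (X t m)) * f m) \<le> \<bar>indicator {x..x'} (X t m) - g j (X t m)\<bar> * W m"
        if "m \<in> space U" for m
        using f(2)[of m] that by (simp add: abs_mult mult_left_mono)
    qed
    finally show ?thesis .
  qed
  show ?thesis
  proof (rule tendsto_by_approximation[where e = e])
    show "(\<lambda>n. \<integral>m. g j (X t m) * q n t m \<partial>U) \<longlonglongrightarrow> (\<integral>m. g j (X t m) * Z t m \<partial>U)" for j
      by (rule q_weak[OF t g1 gL])
    show "\<bar>(\<integral>m. indicator {x..x'} (X t m) * q n t m \<partial>U) - (\<integral>m. g j (X t m) * q n t m \<partial>U)\<bar> \<le> e j" for j n
      using t by (intro diff q_integrable W) auto
    show "\<bar>(\<integral>m. indicator {x..x'} (X t m) * Z t m \<partial>U) - (\<integral>m. g j (X t m) * Z t m \<partial>U)\<bar> \<le> e j" for j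
      using t by (intro diff Z_integrable W) auto
  qed (rule e0)
qed

text \<open>
  The one-sided Lipschitz constant of the difference quotient as a function of the position.
\<close>
definition sinh_rate :: "nat \<Rightarrow> real \<Rightarrow> real" where
  "sinh_rate n t = real (Suc n) * (sinh (sqrt c * (t + tstep n)) / sinh (sqrt c * t) - 1)"

lemma sinh_rate_tendsto:
  assumes t: "0 < t"
  shows "(\<lambda>n. sinh_rate n t) \<longlonglongrightarrow> sqrt c / tanh (sqrt c * t)"
proof -
  have sp: "0 < sinh (sqrt c * t)" using t c_pos by simp
  have "((\<lambda>x. sinh (sqrt c * x)) has_real_derivative sqrt c * cosh (sqrt c * t)) (at t)"
    by (auto intro!: derivative_eq_intros)
  then have "((\<lambda>h. (sinh (sqrt c * (t + h)) - sinh (sqrt c * t)) / h) \<longlongrightarrow> sqrt c * cosh (sqrt c * t)) (at 0)"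
    by (rule DERIV_D)
  moreover have "filterlim tstep (at 0) sequentially"
    using tstep_tendsto by (intro filterlim_atI) auto
  ultimately have "(\<lambda>n. (sinh (sqrt c * (t + tstep n)) - sinh (sqrt c * t)) / tstep n) \<longlonglongrightarrow> sqrt c * cosh (sqrt c * t)"
    by (rule filterlim_compose)
  then have "(\<lambda>n. (sinh (sqrt c * (t + tstep n)) - sinh (sqrt c * t)) / tstep n / sinh (sqrt c * t)) \<longlonglongrightarrow> sqrt c * cosh (sqrt c * t) / sinh (sqrt c * t)"
    using sp by (intro tendsto_divide tendsto_const) auto
  also have "(\<lambda>n. (sinh (sqrt c * (t + tstep n)) - sinh (sqrt c * t)) / tstep n / sinh (sqrt c * t)) = (\<lambda>n. sinh_rate n t)"
  proof
    fix n
    have alg: "(x - y) / (1 / s) / y = s * (x / y - 1)" if "y \<noteq> 0" for x y s :: real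
      using that by (simp add: field_simps)
    show "(sinh (sqrt c * (t + tstep n)) - sinh (sqrt c * t)) / tstep n / sinh (sqrt c * t) = sinh_rate n t"
      unfolding sinh_rate_def by (rule alg) (use t c_pos in simp)
  qed
  also have "sqrt c * cosh (sqrt c * t) / sinh (sqrt c * t) = sqrt c / tanh (sqrt c * t)"
    by (simp add: tanh_def)
  finally show ?thesis .
qed

lemma q_diff:
  assumes t: "0 < t" and m: "0 < m" "m \<le> m'" "m' < 1"
  shows "q n t m' - q n t m \<le> sinh_rate n t * (X t m' - X t m)"
proof -
  have sp: "0 < sinh (sqrt c * t)" using t c_pos by simp
  have "(X (t + tstep n) m' - X (t + tstep n) m) * sinh (sqrt c * t) \<le> (X t m' - X t m) * sinh (sqrt c * (t + tstep n))"
    using t m by (intro X_sinh) auto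
  then have "X (t + tstep n) m' - X (t + tstep n) m \<le> (X t m' - X t m) * sinh (sqrt c * (t + tstep n)) / sinh (sqrt c * t)"
    using sp by (simp add: pos_le_divide_eq)
  then have "real (Suc n) * (X (t + tstep n) m' - X (t + tstep n) m) \<le> real (Suc n) * ((X t m' - X t m) * (sinh (sqrt c * (t + tstep n)) / sinh (sqrt c * t)))"
    by (intro mult_left_mono) auto
  then show ?thesis by (simp add: q_def sinh_rate_def algebra_simps)
qed

text \<open>
  By \<open>q_diff\<close> the function \<open>d\<^sub>n = \<lambda>\<^sub>n X\<^sub>t -
  q\<^sub>n\<close> is nondecreasing in the label, and \<open>q_weak_interval\<close> yields a
  limit \<open>l\<close> for its mean over the labels whose position lies in
  \<open>[X\<^sub>t(m), X\<^sub>t(m')]\<close>. Monotonicity places this mean between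
  \<open>d\<^sub>n m\<close> and \<open>d\<^sub>n m'\<close>, so the upper limit at
  \<open>m\<close> is at most the lower limit at \<open>m'\<close>. At continuity points of the
  upper limit the two therefore coincide.
\<close>
lemma q_AE_convergent:
  assumes t: "0 < t"
  shows "AE m in U. convergent (\<lambda>n. q n t m)"
proof -
  define d where "d n m = sinh_rate n t * X t m - q n t m" for n m
  define lm where "lm = sqrt c / tanh (sqrt c * t)"
  have laml: "(\<lambda>n. sinh_rate n t) \<longlonglongrightarrow> lm" unfolding lm_def by (rule sinh_rate_tendsto[OF t])
  then obtain Bl where Bl: "\<And>n. \<bar>sinh_rate n t\<bar> \<le> Bl"
    using convergent_imp_Bseq[of "\<lambda>n. sinh_rate n t"] by (auto simp: convergent_def Bseq_def)
  define Bd where "Bd m = Bl * \<bar>X t m\<bar> + Lc t (t + 1) * \<beta> m" for m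
  have dB: "\<bar>d n m\<bar> \<le> Bd m" if m: "m \<in> {0<..<1}" for n m
  proof -
    have "\<bar>sinh_rate n t * X t m\<bar> \<le> Bl * \<bar>X t m\<bar>" unfolding abs_mult by (intro mult_right_mono Bl) auto
    then show ?thesis using q_bound[OF t order_refl order_refl m, of n] by (simp add: d_def Bd_def)
  qed
  have dmono: "d n m \<le> d n m'" if "0 < m" "m \<le> m'" "m' < 1" for n m m'
    using q_diff[OF t that, of n] by (simp add: d_def algebra_simps)
  have q_fun: "q n t m = q n t m'" if "m \<in> {0<..<1}" "m' \<in> {0<..<1}" "X t m = X t m'" for n m m'
    using X_stick[of t "t + tstep n" m m'] t that by (simp add: q_def)
  have key: "\<exists>l. \<forall>e>0. (\<forall>\<^sub>F n in sequentially. d n m \<le> l + e) \<and> (\<forall>\<^sub>F n in sequentially. l - e \<le> d n m')"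
    if mm: "0 < m" "m < m'" "m' < 1" for m m'
  proof -
    have m01: "m \<in> {0<..<1}" "m' \<in> {0<..<1}" using mm by auto
    let ?J = "\<lambda>z. indicator {X t m..X t m'} (X t z) :: real"
    have ord: "X t m \<le> X t m'" using X_mono[of t m m'] t mm by simp
    have iJ: "integrable U (\<lambda>z. ?J z * f z)" if "integrable U f" for f
      by (rule integrable_bounded_mult[OF that, where B = 1]) (auto simp: indicator_def)
    define \<mu> where "\<mu> = (\<integral>z. ?J z \<partial>U)"
    have iJ1: "integrable U ?J" using iJ[of "\<lambda>_. 1"] by simp
    have "m' - m = (\<integral>z. indicator {m<..<m'} z \<partial>U)"
    proof -
      have "{m<..<m'} \<inter> space U = {m<..<m'}" using mm by auto
      moreover have "measure U {m<..<m'} = m' - m" using mm by (subst measure_restrict_space) auto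
      ultimately show ?thesis by (simp del: space_U)
    qed
    also have "\<dots> \<le> \<mu>"
      unfolding \<mu>_def
    proof (rule integral_mono[OF _ iJ1])
      show "integrable U (indicat_real {m<..<m'})"
        by (intro integrable_real_indicator) (use mm in \<open>auto simp: sets_restrict_space_iff U.emeasure_finite less_top[symmetric]\<close>)
      show "indicat_real {m<..<m'} z \<le> ?J z" if "z \<in> space U" for z
        using X_mono[of t m z] X_mono[of t z m'] t mm that by (auto simp: indicator_def)
    qed
    finally have \<mu>: "0 < \<mu>" using mm by simp
    have id: "integrable U (d n)" for n
      unfolding d_def[abs_def] using X_integrable[of t] q_integrable[of t n] t by simp
    \<comment> \<open>the limit of the mean of \<open>d n\<close> over the labels with position in the
        interval\<close>
    define l where "l = (lm * (\<integral>z. ?J z * X t z \<partial>U) - (\<integral>z. ?J z * Z t z \<partial>U)) / \<mu>"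
    have dint: "(\<integral>z. ?J z * d n z \<partial>U) = sinh_rate n t * (\<integral>z. ?J z * X t z \<partial>U) - (\<integral>z. ?J z * q n t z \<partial>U)" for n
    proof -
      have "(\<integral>z. ?J z * d n z \<partial>U) = (\<integral>z. sinh_rate n t * (?J z * X t z) - ?J z * q n t z \<partial>U)"
        by (intro Bochner_Integration.integral_cong) (auto simp: d_def algebra_simps)
      also have "\<dots> = sinh_rate n t * (\<integral>z. ?J z * X t z \<partial>U) - (\<integral>z. ?J z * q n t z \<partial>U)"
        using iJ[OF X_integrable, of t] iJ[OF q_integrable, of t n] t by simp
      finally show ?thesis .
    qed
    have lim: "(\<lambda>n. (\<integral>z. ?J z * d n z \<partial>U) / \<mu>) \<longlonglongrightarrow> l"
      unfolding dint l_def using \<mu> ord t by (intro tendsto_intros laml q_weak_interval) auto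
    \<comment> \<open>a label outside \<open>[m, m']\<close> whose position is in the interval shares
        the position, and hence the quotient, of \<open>m\<close> or of
        \<open>m'\<close>\<close>
    have dJ: "d n m * ?J z \<le> ?J z * d n z \<and> ?J z * d n z \<le> d n m' * ?J z" if "z \<in> {0<..<1}" for n z
    proof (cases "X t z \<in> {X t m..X t m'}")
      case True
      have "d n m \<le> d n z"
      proof (cases "m \<le> z")
        case False
        then have "X t z = X t m" using X_mono[of t z m] t that True mm by auto
        then show ?thesis using q_fun[of z m n] that m01 by (simp add: d_def)
      qed (use dmono that mm in auto)
      moreover have "d n z \<le> d n m'"
      proof (cases "z \<le> m'")
        case False
        then have "X t z = X t m'" using X_mono[of t m' z] t that True mm by auto
        then show ?thesis using q_fun[of z m' n] that m01 by (simp add: d_def)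
      qed (use dmono that mm in auto)
      ultimately show ?thesis using True by simp
    qed simp
    have lo: "d n m \<le> (\<integral>z. ?J z * d n z \<partial>U) / \<mu>" for n
    proof -
      have "(\<integral>z. d n m * ?J z \<partial>U) \<le> (\<integral>z. ?J z * d n z \<partial>U)"
        using iJ1 iJ[OF id] dJ by (intro integral_mono) auto
      then show ?thesis using \<mu> by (simp add: \<mu>_def pos_le_divide_eq)
    qed
    have hi: "(\<integral>z. ?J z * d n z \<partial>U) / \<mu> \<le> d n m'" for n
    proof -
      have "(\<integral>z. ?J z * d n z \<partial>U) \<le> (\<integral>z. d n m' * ?J z \<partial>U)"
        using iJ1 iJ[OF id] dJ by (intro integral_mono) auto
      then show ?thesis using \<mu> by (simp add: \<mu>_def pos_divide_le_eq)
    qed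
    show ?thesis
    proof (intro exI allI impI conjI)
      fix e :: real assume e: "0 < e"
      have "l < l + e" "l - e < l" using e by auto
      show "\<forall>\<^sub>F n in sequentially. d n m \<le> l + e"
        using order_tendstoD(2)[OF lim \<open>l < l + e\<close>]
      proof eventually_elim
        case (elim n) then show ?case using lo[of n] by linarith
      qed
      show "\<forall>\<^sub>F n in sequentially. l - e \<le> d n m'"
        using order_tendstoD(1)[OF lim \<open>l - e < l\<close>]
      proof eventually_elim
        case (elim n) then show ?case using hi[of n] by linarith
      qed
    qed
  qed
  \<comment> \<open>nondecreasing by \<open>key\<close>, hence continuous off a countable set\<close>
  define S where "S m = rlimsup (\<lambda>n. d n m)" for m
  have Skey: "\<exists>l. S m \<le> l \<and> l \<le> S m' \<and> (\<forall>e>0. \<forall>\<^sub>F n in sequentially. l - e \<le> d n m')"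
    if mm: "0 < m" "m < m'" "m' < 1" for m m'
  proof -
    obtain l where l: "\<And>e. 0 < e \<Longrightarrow> (\<forall>\<^sub>F n in sequentially. d n m \<le> l + e) \<and> (\<forall>\<^sub>F n in sequentially. l - e \<le> d n m')"
      using key[OF mm] by blast
    have "S m \<le> l"
    proof (rule field_le_epsilon)
      fix e :: real assume "0 < e"
      then show "S m \<le> l + e" unfolding S_def using l mm by (intro rlimsup_le[OF dB]) auto
    qed
    moreover have "l \<le> S m'"
    proof (rule field_le_epsilon)
      fix e :: real assume "0 < e"
      then have "l - e \<le> S m'" unfolding S_def using l mm by (intro rlimsup_ge[OF dB]) auto
      then show "l \<le> S m' + e" by simp
    qed
    ultimately show ?thesis using l by blast
  qed
  show ?thesis
  proof (rule AE_U_countable)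
    have "S m \<le> S m'" if "0 < m" "m < m'" "m' < 1" for m m' using Skey[OF that] by auto
    then have "mono_on {0<..<1} S"
      by (intro mono_onI) (metis greaterThanLessThan_iff order_le_less order_refl)
    then show "countable {m \<in> {0<..<1}. \<not> isCont S m}" by (intro mono_on_ctble_discont_open) auto
    fix m assume m: "m \<in> {0<..<1::real}" "m \<notin> {m \<in> {0<..<1}. \<not> isCont S m}"
    then have c: "isCont S m" by simp
    have "(\<lambda>n. d n m) \<longlonglongrightarrow> S m"
    proof (rule order_tendstoI)
      fix a assume "S m < a"
      then show "\<forall>\<^sub>F n in sequentially. d n m < a" unfolding S_def by (intro rlimsup_lessD[OF dB[OF m(1)]])
    next
      fix a assume a: "a < S m"
      from order_tendstoD(1)[OF c[unfolded isCont_def] a]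
      obtain r where r: "0 < r" "\<And>x. x \<noteq> m \<Longrightarrow> dist x m < r \<Longrightarrow> a < S x"
        unfolding eventually_at by auto
      define x where "x = max (m / 2) (m - r / 2)"
      have x: "0 < x" "x < m" "a < S x" using r m(1) by (auto simp: x_def dist_real_def)
      obtain l where l: "S x \<le> l" "\<And>e. 0 < e \<Longrightarrow> \<forall>\<^sub>F n in sequentially. l - e \<le> d n m"
        using Skey[of x m] x m by auto
      have "0 < (l - a) / 2" using l x by simp
      from l(2)[OF this] show "\<forall>\<^sub>F n in sequentially. a < d n m"
      proof eventually_elim
        case (elim n)
        have "a < l" using l x by simp
        then show ?case using elim by (simp add: field_simps)
      qed
    qed
    then have "(\<lambda>n. sinh_rate n t * X t m - d n m) \<longlonglongrightarrow> lm * X t m - S m" by (intro tendsto_intros laml)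
    then show "convergent (\<lambda>n. q n t m)" by (auto simp: d_def convergent_def)
  qed
qed

text \<open>
  The Lagrangian velocity.
\<close>
definition V :: "real \<Rightarrow> real \<Rightarrow> real" where "V t m = rlimsup (\<lambda>n. q n t m)"

lemma V_m [measurable (raw)]:
  assumes [measurable]: "f \<in> borel_measurable M" "g \<in> borel_measurable M"
  shows "(\<lambda>x. V (f x) (g x)) \<in> borel_measurable M"
  unfolding V_def rlimsup_def by measurable

lemma V_U_m [measurable]: "V t \<in> borel_measurable U"
  using V_m[of "\<lambda>_. t" U "\<lambda>x. x"] by simp

lemma V_lim:
  assumes "0 < t"
  shows "AE m in U. (\<lambda>n. q n t m) \<longlonglongrightarrow> V t m"
  using q_AE_convergent[OF assms]
proof eventually_elim
  case (elim m)
  then obtain l where "(\<lambda>n. q n t m) \<longlonglongrightarrow> l" by (auto simp: convergent_def)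
  then show ?case using rlimsup_eq[of "\<lambda>n. q n t m" l] by (simp add: V_def)
qed

lemma V_bound:
  assumes "0 < a" "a \<le> t" "t \<le> T" "m \<in> {0<..<1}"
  shows "\<bar>V t m\<bar> \<le> Lc a (T + 1) * \<beta> m"
proof -
  note b = q_bound[OF assms]
  have "V t m \<le> Lc a (T + 1) * \<beta> m" unfolding V_def
    by (rule rlimsup_le[OF b]) (use b in \<open>auto simp: abs_le_iff intro!: always_eventually\<close>)
  moreover have "- (Lc a (T + 1) * \<beta> m) \<le> V t m" unfolding V_def
  proof (rule rlimsup_ge[OF b], intro always_eventually allI)
    fix n show "- (Lc a (T + 1) * \<beta> m) \<le> q n t m" using b[of n] by (simp add: abs_le_iff)
  qed
  ultimately show ?thesis by (simp add: abs_le_iff)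
qed

text \<open>
  The velocity is a function of the position, because particles at the same place stay together.
\<close>
lemma V_fun:
  assumes "0 < t" "m \<in> {0<..<1}" "m' \<in> {0<..<1}" "X t m = X t m'"
  shows "V t m = V t m'"
proof -
  have "q n t m = q n t m'" for n using X_stick[of t "t + tstep n" m m'] assms by (simp add: q_def)
  then show ?thesis by (simp add: V_def)
qed

lemma V_Minv: "0 < t \<Longrightarrow> m \<in> {0<..<1} \<Longrightarrow> V t (Minv t (X t m)) = V t m"
  by (rule V_fun) (use Minv_X[of t m] in auto)

text \<open>
  The bound \<open>q_diff\<close> survives in the upper limit for every pair of labels, not only
  for almost every one.
\<close>
lemma V_entropy:
  assumes t: "0 < t" and m: "0 < m" "m \<le> m'" "m' < 1"
  shows "V t m' - V t m \<le> sqrt c / tanh (sqrt c * t) * (X t m' - X t m)"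
proof -
  have m01: "m \<in> {0<..<1}" "m' \<in> {0<..<1}" using m by auto
  note b = q_bound[OF t order_refl order_refl m01(1)] q_bound[OF t order_refl order_refl m01(2)]
  let ?R = "sqrt c / tanh (sqrt c * t) * (X t m' - X t m)"
  have l: "(\<lambda>n. sinh_rate n t * (X t m' - X t m)) \<longlonglongrightarrow> ?R" by (intro tendsto_intros sinh_rate_tendsto t)
  have "V t m' \<le> V t m + ?R"
  proof (rule field_le_epsilon)
    fix e :: real assume e: "0 < e"
    have "rlimsup (\<lambda>n. q n t m) < V t m + e / 2" "?R < ?R + e / 2" using e by (auto simp: V_def)
    from eventually_conj[OF rlimsup_lessD[OF b(1) this(1)] order_tendstoD(2)[OF l this(2)]]
    have "\<forall>\<^sub>F n in sequentially. q n t m' \<le> V t m + ?R + e"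
    proof eventually_elim
      case (elim n)
      then show ?case using q_diff[OF t m, of n] by linarith
    qed
    then show "V t m' \<le> V t m + ?R + e" unfolding V_def[of t m'] by (rule rlimsup_le[OF b(2)])
  qed
  then show ?thesis by simp
qed

lemma V_int: "0 < t \<Longrightarrow> integrable U (\<lambda>m. (V t m)\<^sup>2)"
  and V_L2: "0 < t \<Longrightarrow> t \<le> T \<Longrightarrow> (\<integral>m. (V t m)\<^sup>2 \<partial>U) \<le> (Kb (T + 1))\<^sup>2"
proof -
  have *: "integrable U (\<lambda>m. (V t m)\<^sup>2)" "(\<integral>m. (V t m)\<^sup>2 \<partial>U) \<le> (Kb (T + 1))\<^sup>2" if "0 < t" "t \<le> T" for T
    using fatou_square_U[of "\<lambda>n. q n t" "V t" "\<lambda>_. (Kb (T + 1))\<^sup>2" "(Kb (T + 1))\<^sup>2"] q_int[of t] q_L2[of t T] V_lim[of t] that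
    by auto
  show "0 < t \<Longrightarrow> integrable U (\<lambda>m. (V t m)\<^sup>2)" using *[of t] by simp
  show "0 < t \<Longrightarrow> t \<le> T \<Longrightarrow> (\<integral>m. (V t m)\<^sup>2 \<partial>U) \<le> (Kb (T + 1))\<^sup>2" using *[of T] by simp
qed

lemma V_integrable: "0 < t \<Longrightarrow> integrable U (V t)"
  by (rule integrable_of_square[OF V_U_m V_int])

text \<open>
  \<open>V\<^sub>t = E[Z\<^sub>t | X\<^sub>t]\<close>: the difference quotients converge to
  \<open>V\<^sub>t\<close> almost everywhere and to \<open>Z\<^sub>t\<close> weakly.
\<close>
lemma V_projection:
  assumes t: "0 < t" and [measurable]: "\<psi> \<in> borel_measurable borel"
    and i: "integrable U (\<lambda>m. \<psi> (X t m) * V t m)" "integrable U (\<lambda>m. \<psi> (X t m) * Z t m)"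
  shows "(\<integral>m. \<psi> (X t m) * V t m \<partial>U) = (\<integral>m. \<psi> (X t m) * Z t m \<partial>U)"
proof -
  have "(\<integral>m. \<psi> (X t m) * (V t m - Z t m) \<partial>U) = 0"
  proof (rule test_functions_suffice[where h = "X t" and f = "\<lambda>m. V t m - Z t m"])
    show "integrable U (\<lambda>m. V t m - Z t m)" using V_integrable[OF t] Z_integrable[of t] t by simp
    show "integrable U (\<lambda>m. \<psi> (X t m) * (V t m - Z t m))" using i by (simp add: right_diff_distrib)
    fix g :: "real \<Rightarrow> real" and L assume g: "\<And>x. \<bar>g x\<bar> \<le> 1" "\<And>x y. \<bar>g x - g y\<bar> \<le> L * \<bar>x - y\<bar>"
    have L0: "0 \<le> L" using g(2)[of 0 1] by auto
    have "L-lipschitz_on UNIV g" using g(2) L0 by (auto simp: lipschitz_on_def dist_real_def)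
    then have [measurable]: "g \<in> borel_measurable borel"
      by (intro borel_measurable_continuous_onI lipschitz_on_continuous_on)
    have "(\<lambda>n. \<integral>m. g (X t m) * q n t m \<partial>U) \<longlonglongrightarrow> (\<integral>m. g (X t m) * V t m \<partial>U)"
    proof (rule integral_dominated_convergence)
      show "integrable U (\<lambda>m. Lc t (t + 1) * \<beta> m)" using integrable_\<beta> by simp
      show "AE m in U. (\<lambda>n. g (X t m) * q n t m) \<longlonglongrightarrow> g (X t m) * V t m"
        using V_lim[OF t] by eventually_elim (intro tendsto_intros)
      show "AE m in U. norm (g (X t m) * q n t m) \<le> Lc t (t + 1) * \<beta> m" for n
      proof (rule AE_I2)
        fix m assume "m \<in> space U"
        then have "\<bar>q n t m\<bar> \<le> Lc t (t + 1) * \<beta> m" using q_bound[OF t order_refl order_refl, of m n] by simp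
        then have "\<bar>g (X t m)\<bar> * \<bar>q n t m\<bar> \<le> 1 * (Lc t (t + 1) * \<beta> m)" using g(1) by (intro mult_mono) auto
        then show "norm (g (X t m) * q n t m) \<le> Lc t (t + 1) * \<beta> m" by (simp add: abs_mult)
      qed
    qed measurable
    then have "(\<integral>m. g (X t m) * V t m \<partial>U) = (\<integral>m. g (X t m) * Z t m \<partial>U)"
      using q_weak[OF t g] LIMSEQ_unique by blast
    then show "(\<integral>m. g (X t m) * (V t m - Z t m) \<partial>U) = 0"
      using integrable_bounded_mult[OF V_integrable[OF t], of "\<lambda>m. g (X t m)" 1]
        integrable_bounded_mult[OF Z_integrable, of t "\<lambda>m. g (X t m)" 1] g(1) t
      by (simp add: right_diff_distrib)
  qed measurable
  then show ?thesis using i by (simp add: right_diff_distrib)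
qed

end

section \<open>The energy inequality\<close>

declare of_nat_Suc [simp del]

lemma inverse_nat_tendsto: "(\<lambda>n. 1 / real (Suc n)) \<longlonglongrightarrow> 0"
  using LIMSEQ_inverse_real_of_nat by (simp add: inverse_eq_divide)

text \<open>
  Continuity at \<open>t\<close> makes the means over shrinking right neighbourhoods converge.
\<close>
lemma average_tendsto:
  fixes f :: "real \<Rightarrow> real"
  assumes [measurable]: "f \<in> borel_measurable borel" and c: "isCont f t"
  shows "(\<lambda>n. real (Suc n) * (LBINT r:{t<..t + 1 / real (Suc n)}. f r)) \<longlonglongrightarrow> f t"
  unfolding LIMSEQ_def dist_real_def
proof (intro allI impI)
  fix e :: real assume e: "0 < e"
  then obtain d where d: "0 < d" "\<And>r. \<bar>r - t\<bar> < d \<Longrightarrow> \<bar>f r - f t\<bar> < e / 2"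
    using c[unfolded continuous_at_eps_delta, rule_format, of "e / 2"] by (auto simp: dist_real_def)
  obtain N where N: "\<And>n. N \<le> n \<Longrightarrow> 1 / real (Suc n) < d"
    using order_tendstoD(2)[OF inverse_nat_tendsto d(1)] unfolding eventually_sequentially by blast
  show "\<exists>N. \<forall>n\<ge>N. \<bar>real (Suc n) * (LBINT r:{t<..t + 1 / real (Suc n)}. f r) - f t\<bar> < e"
  proof (intro exI allI impI)
    fix n assume "N \<le> n"
    define h where "h = 1 / real (Suc n)"
    have h: "0 < h" "h < d" "real (Suc n) * h = 1" using N[OF \<open>N \<le> n\<close>] by (auto simp: h_def)
    have near: "\<bar>f r - f t\<bar> \<le> e / 2" if "t < r" "r \<le> t + h" for r
      using d(2)[of r] that h by (auto simp: less_imp_le)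
    have si: "set_integrable lborel {t<..t + h} f"
    proof (rule bounded_set_integrable[where B = "\<bar>f t\<bar> + e / 2"])
      show "\<bar>f r\<bar> \<le> \<bar>f t\<bar> + e / 2" if "t < r" "r \<le> t + h" for r using near[OF that] by linarith
    qed measurable
    have ic: "set_integrable lborel {t<..t + h} (\<lambda>r. f t)"
      by (intro bounded_set_integrable[where B = "\<bar>f t\<bar>"]) auto
    have "(LBINT r:{t<..t + h}. f r) - h * f t = (LBINT r:{t<..t + h}. f r - f t)"
      using set_integral_diff(2)[OF si ic] h by (simp add: set_lebesgue_integral_def)
    also have "\<bar>\<dots>\<bar> \<le> (t + h - t) * (e / 2)" using near h e by (intro set_int_abs_le) auto
    finally have "real (Suc n) * \<bar>(LBINT r:{t<..t + h}. f r) - h * f t\<bar> \<le> real (Suc n) * (h * (e / 2))"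
      by (intro mult_left_mono) auto
    also have "\<dots> = e / 2" using h(3) by (simp add: mult.assoc[symmetric])
    finally have "\<bar>real (Suc n) * ((LBINT r:{t<..t + h}. f r) - h * f t)\<bar> \<le> e / 2" by (simp add: abs_mult)
    also have "real (Suc n) * ((LBINT r:{t<..t + h}. f r) - h * f t) = real (Suc n) * (LBINT r:{t<..t + h}. f r) - f t"
      using h(3) by (simp add: right_diff_distrib mult.assoc[symmetric])
    finally show "\<bar>real (Suc n) * (LBINT r:{t<..t + 1 / real (Suc n)}. f r) - f t\<bar> < e"
      using e unfolding h_def by linarith
  qed
qed

lemma set_integral_shift:
  fixes f :: "real \<Rightarrow> real"
  shows "(LBINT r:{a<..b}. f (r + h)) = (LBINT r:{a + h<..b + h}. f r)"
proof -
  have "(LBINT r:{a + h<..b + h}. f r) = (\<integral>r. indicator {a + h<..b + h} (h + 1 * r) *\<^sub>R f (h + 1 * r) \<partial>lborel)"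
    unfolding set_lebesgue_integral_def
    by (subst lborel_integral_real_affine[of 1 _ h]) auto
  also have "\<dots> = (LBINT r:{a<..b}. f (r + h))"
    unfolding set_lebesgue_integral_def
    by (intro Bochner_Integration.integral_cong) (auto simp: indicator_def add.commute)
  finally show ?thesis by simp
qed

text \<open>
  A fundamental theorem of calculus for functions whose forward difference quotients along
  \<open>1/n\<close> are bounded and converge almost everywhere. The integral of the quotient
  telescopes to a difference of averages near the two end points.
\<close>
lemma seq_FTC:
  fixes f f' :: "real \<Rightarrow> real"
  assumes st: "s \<le> t" and [measurable]: "f \<in> borel_measurable borel" "f' \<in> borel_measurable borel"
    and cont: "\<And>r. s \<le> r \<Longrightarrow> isCont f r"
    and bd: "\<And>n r. s < r \<Longrightarrow> r \<le> t \<Longrightarrow> \<bar>real (Suc n) * (f (r + 1 / real (Suc n)) - f r)\<bar> \<le> B"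
    and lim: "AE r in lborel. s < r \<and> r \<le> t \<longrightarrow> (\<lambda>n. real (Suc n) * (f (r + 1 / real (Suc n)) - f r)) \<longlonglongrightarrow> f' r"
  shows "f t - f s = (LBINT r:{s<..t}. f' r)"
proof -
  let ?q = "\<lambda>n r. real (Suc n) * (f (r + 1 / real (Suc n)) - f r)"
  have "continuous_on {s..t + 1} f" using cont by (intro continuous_at_imp_continuous_on) auto
  then have "bounded (f ` {s..t + 1})" using compact_continuous_image compact_Icc compact_imp_bounded by blast
  then obtain Bf where Bf: "\<And>r. s \<le> r \<Longrightarrow> r \<le> t + 1 \<Longrightarrow> \<bar>f r\<bar> \<le> Bf"
    unfolding bounded_iff by force
  have 1: "(\<lambda>n. LBINT r:{s<..t}. ?q n r) \<longlonglongrightarrow> (LBINT r:{s<..t}. f' r)"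
    unfolding set_lebesgue_integral_def
  proof (rule integral_dominated_convergence)
    show "integrable lborel (\<lambda>r. indicator {s<..t} r * \<bar>B\<bar>)"
      using st by (intro integrable_mult_left) (simp add: integrable_indicator_iff)
    show "AE r in lborel. (\<lambda>n. indicator {s<..t} r *\<^sub>R ?q n r) \<longlonglongrightarrow> indicator {s<..t} r *\<^sub>R f' r"
      using lim by eventually_elim (auto simp: indicator_def)
    show "AE r in lborel. norm (indicator {s<..t} r *\<^sub>R ?q n r) \<le> indicator {s<..t} r * \<bar>B\<bar>" for n
      using order_trans[OF bd abs_ge_self] by (intro AE_I2) (auto simp: indicator_def)
  qed measurable
  \<comment> \<open>the shifted integral cancels except near the end points\<close>
  have 2: "(LBINT r:{s<..t}. ?q n r) = real (Suc n) * (LBINT r:{t<..t + 1 / real (Suc n)}. f r)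
      - real (Suc n) * (LBINT r:{s<..s + 1 / real (Suc n)}. f r)" for n
  proof -
    define h where "h = 1 / real (Suc n)"
    have h: "0 < h" "h \<le> 1" by (auto simp: h_def)
    have si: "set_integrable lborel {s<..t} f" "set_integrable lborel {s<..t} (\<lambda>r. f (r + h))"
      using Bf h by (auto intro!: bounded_set_integrable[where B = Bf])
    have "(LBINT r:{s<..t}. real (Suc n) * (f (r + h) - f r)) = real (Suc n) * ((LBINT r:{s<..t}. f (r + h)) - (LBINT r:{s<..t}. f r))"
      using set_integral_diff(2)[OF si(2,1)] by simp
    also have "(LBINT r:{s<..t}. f (r + h)) = (LBINT r:{s + h<..t + h}. f r)" by (rule set_integral_shift)
    also have "\<dots> - (LBINT r:{s<..t}. f r) = (LBINT r:{t<..t + h}. f r) - (LBINT r:{s<..s + h}. f r)"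
      using time_integral_split[of f s "t + h" Bf t] time_integral_split[of f s "t + h" Bf "s + h"] Bf h st by simp
    finally show ?thesis unfolding h_def by (simp add: right_diff_distrib)
  qed
  have "(\<lambda>n. LBINT r:{s<..t}. ?q n r) \<longlonglongrightarrow> f t - f s"
    unfolding 2 using cont st by (intro tendsto_diff average_tendsto) auto
  with 1 show ?thesis using LIMSEQ_unique by blast
qed

lemma integrable_cong_U: "(\<And>m. m \<in> {0<..<1} \<Longrightarrow> f m = g m) \<Longrightarrow> integrable U f \<longleftrightarrow> integrable U (g :: real \<Rightarrow> real)"
  and integral_cong_U: "(\<And>m. m \<in> {0<..<1} \<Longrightarrow> f m = g m) \<Longrightarrow> (\<integral>m. f m \<partial>U) = (\<integral>m. g m \<partial>U)"
  by (auto intro!: Bochner_Integration.integrable_cong Bochner_Integration.integral_cong)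

text \<open>
  Fubini's theorem for time and label, with integrability from a bound on the
  \<open>L\<^sup>1\<close> norms that is uniform in time.
\<close>
lemma time_space_fubini:
  fixes H :: "real \<Rightarrow> real \<Rightarrow> real"
  assumes H: "(\<lambda>(r, m). H r m) \<in> borel_measurable (borel \<Otimes>\<^sub>M borel)" and st: "s \<le> t"
    and int: "\<And>r. s < r \<Longrightarrow> r \<le> t \<Longrightarrow> integrable U (H r)"
    and bd: "\<And>r. s < r \<Longrightarrow> r \<le> t \<Longrightarrow> (\<integral>m. \<bar>H r m\<bar> \<partial>U) \<le> M"
  shows "set_integrable lborel {s<..t} (\<lambda>r. \<integral>m. H r m \<partial>U)"
    and "integrable U (\<lambda>m. LBINT r:{s<..t}. H r m)"
    and "(\<integral>m. (LBINT r:{s<..t}. H r m) \<partial>U) = (LBINT r:{s<..t}. \<integral>m. H r m \<partial>U)"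
proof -
  interpret P: pair_sigma_finite lborel U by unfold_locales
  note [measurable] = measurable_uncurried[OF H]
  have mi: "(\<lambda>r. \<integral>m. g (H r m) \<partial>U) \<in> borel_measurable borel" if [measurable]: "g \<in> borel_measurable borel" for g :: "real \<Rightarrow> real"
    by (intro U.borel_measurable_lebesgue_integral) (simp add: split_beta')
  have abs_le: "\<bar>\<integral>m. H r m \<partial>U\<bar> \<le> M" if "s < r" "r \<le> t" for r
    by (rule order_trans[OF integral_abs_bound bd[OF that]])
  show "set_integrable lborel {s<..t} (\<lambda>r. \<integral>m. H r m \<partial>U)"
    using mi[of "\<lambda>x. x"] abs_le by (intro bounded_set_integrable[where B = M]) auto
  have ae: "AE r in lborel. integrable U (\<lambda>m. indicator {s<..t} r * H r m)"
    using int by (intro AE_I2) (auto simp: indicator_def)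
  have si: "set_integrable lborel {s<..t} (\<lambda>r. \<integral>m. \<bar>H r m\<bar> \<partial>U)"
    using mi[of abs] bd by (intro bounded_set_integrable[where B = M]) auto
  have I: "integrable (lborel \<Otimes>\<^sub>M U) (\<lambda>(r, m). indicator {s<..t} r * H r m)"
  proof (rule P.Fubini_integrable)
    show "(\<lambda>(r, m). indicator {s<..t} r * H r m) \<in> borel_measurable (lborel \<Otimes>\<^sub>M U)"
      by (simp add: split_beta')
    have "(\<lambda>r. \<integral>m. norm (case (r, m) of (r, m) \<Rightarrow> indicator {s<..t} r * H r m) \<partial>U) = (\<lambda>r. indicator {s<..t} r *\<^sub>R (\<integral>m. \<bar>H r m\<bar> \<partial>U))"
      by (auto simp: indicator_def)
    then show "integrable lborel (\<lambda>r. \<integral>m. norm (case (r, m) of (r, m) \<Rightarrow> indicator {s<..t} r * H r m) \<partial>U)"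
      using si unfolding set_integrable_def by simp
    show "AE r in lborel. integrable U (\<lambda>m. case (r, m) of (r, m) \<Rightarrow> indicator {s<..t} r * H r m)" using ae by simp
  qed
  show "integrable U (\<lambda>m. LBINT r:{s<..t}. H r m)"
    using P.integrable_snd[OF I] by (simp add: set_lebesgue_integral_def)
  have "(\<integral>m. (LBINT r:{s<..t}. H r m) \<partial>U) = (\<integral>r. (\<integral>m. indicator {s<..t} r * H r m \<partial>U) \<partial>lborel)"
    using P.Fubini_integral[OF I] by (simp add: set_lebesgue_integral_def)
  also have "\<dots> = (LBINT r:{s<..t}. \<integral>m. H r m \<partial>U)"
    unfolding set_lebesgue_integral_def by (intro Bochner_Integration.integral_cong) auto
  finally show "(\<integral>m. (LBINT r:{s<..t}. H r m) \<partial>U) = (LBINT r:{s<..t}. \<integral>m. H r m \<partial>U)" .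
qed

text \<open>
  The chain rule along a sequence of increments; it needs no differentiability of the inner
  function.
\<close>
lemma quotient_chain_rule:
  fixes W :: "real \<Rightarrow> real"
  assumes W: "(W has_real_derivative w) (at a)" and b: "(\<lambda>n. real (Suc n) * (b n - a)) \<longlonglongrightarrow> v"
  shows "(\<lambda>n. real (Suc n) * (W (b n) - W a)) \<longlonglongrightarrow> w * v"
proof -
  obtain g where g: "\<And>z. W z - W a = g z * (z - a)" "isCont g a" "g a = w"
    using W unfolding CARAT_DERIV by blast
  have "(\<lambda>n. (1 / real (Suc n)) * (real (Suc n) * (b n - a))) \<longlonglongrightarrow> 0 * v"
    by (intro tendsto_mult inverse_nat_tendsto b)
  then have "(\<lambda>n. b n - a) \<longlonglongrightarrow> 0" by simp
  then have "b \<longlonglongrightarrow> a" by (simp add: LIM_zero_iff)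
  then have "(\<lambda>n. g (b n)) \<longlonglongrightarrow> w" using isCont_tendsto_compose[OF g(2)] g(3) by simp
  from tendsto_mult[OF this b] show ?thesis by (simp add: g(1) mult_ac)
qed

context sticky_flow
begin

lemma F_isCont:
  assumes t: "0 < t" and m: "m \<in> {0<..<1}"
  shows "isCont (\<lambda>s. F s m) t"
  unfolding continuous_at_sequentially
proof (intro allI impI)
  fix x assume x: "x \<longlonglongrightarrow> t"
  have "\<forall>\<^sub>F k in sequentially. 0 < x k \<and> x k < t + 1"
    using eventually_conj[OF order_tendstoD(1)[OF x t] order_tendstoD(2)[OF x, of "t + 1"]] by simp
  then obtain N where N: "\<And>k. N \<le> k \<Longrightarrow> 0 < x k \<and> x k < t + 1" unfolding eventually_sequentially by blast
  have lim: "(\<lambda>k. X (x (k + N)) a) \<longlonglongrightarrow> X t a" if "a \<in> {0<..<1}" for a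
    using isCont_tendsto_compose[OF X_isCont[OF t that] x] by (rule LIMSEQ_ignore_initial_segment)
  have "(\<lambda>k. lag_force w (\<lambda>_. X (x (k + N))) 0 m) \<longlonglongrightarrow> F t m"
  proof (rule lag_force_tendsto[where K = "Kb (t + 1)"])
    show "\<bar>X (x (k + N)) a\<bar> \<le> Kb (t + 1) * \<beta> a" if "a \<in> {0<..<1}" for k a
      using N[of "k + N"] that by (intro X_pointwise) auto
  qed (use lim m in auto)
  then have "(\<lambda>k. F (x (k + N)) m) \<longlonglongrightarrow> F t m" by (simp add: lag_force_def)
  then show "((\<lambda>s. F s m) \<circ> x) \<longlonglongrightarrow> F t m" unfolding o_def by (rule LIMSEQ_offset)
qed

lemma Z_isCont:
  assumes t: "0 < t" and m: "m \<in> {0<..<1}"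
  shows "isCont (\<lambda>s. Z s m) t"
proof -
  have "((\<lambda>s. Z s m - Z t m) \<longlongrightarrow> 0) (at t)"
  proof (rule Lim_null_comparison)
    have "\<forall>\<^sub>F s in at t. s \<in> {0<..<t + 1}"
      using t by (intro eventually_at_in_open') auto
    then show "\<forall>\<^sub>F s in at t. norm (Z s m - Z t m) \<le> BF (t + 1) m * \<bar>s - t\<bar>"
    proof eventually_elim
      case (elim s)
      then show ?case
        using Z_lip[of s t "t + 1" m] Z_lip[of t s "t + 1" m] t m
        by (cases "s \<le> t") (auto simp: abs_minus_commute mult_ac)
    qed
    have "((\<lambda>s. BF (t + 1) m * \<bar>s - t\<bar>) \<longlongrightarrow> BF (t + 1) m * \<bar>t - t\<bar>) (at t)" by (intro tendsto_intros)
    then show "((\<lambda>s. BF (t + 1) m * \<bar>s - t\<bar>) \<longlongrightarrow> 0) (at t)" by simp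
  qed
  then show ?thesis unfolding isCont_def by (simp add: LIM_zero_iff)
qed

lemma Z_quotient:
  assumes r: "0 < r" and m: "m \<in> {0<..<1}"
  shows "(\<lambda>n. real (Suc n) * (Z (r + tstep n) m - Z r m)) \<longlonglongrightarrow> F r m"
proof -
  have "Z (r + tstep n) m - Z r m = (LBINT s:{r<..r + tstep n}. F s m)" for n
    using r m by (intro Z_diff) auto
  then show ?thesis
    using average_tendsto[OF _ F_isCont[OF r m]] by simp
qed

lemma Z_quotient_bound:
  assumes "0 \<le> r" "r \<le> T" "m \<in> {0<..<1}"
  shows "\<bar>real (Suc n) * (Z (r + tstep n) m - Z r m)\<bar> \<le> BF (T + 1) m"
proof -
  have "\<bar>Z (r + tstep n) m - Z r m\<bar> \<le> (r + tstep n - r) * BF (T + 1) m"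
    using assms by (intro Z_lip) auto
  then have "real (Suc n) * \<bar>Z (r + tstep n) m - Z r m\<bar> \<le> real (Suc n) * (tstep n * BF (T + 1) m)"
    by (intro mult_left_mono) auto
  then show ?thesis by (simp add: abs_mult)
qed

text \<open>
  Fubini's theorem exchanges almost every label and almost every time.
\<close>
lemma V_lim_time: "AE m in U. AE r in lborel. 0 < r \<longrightarrow> (\<lambda>n. q n r m) \<longlonglongrightarrow> V r m"
proof -
  interpret P: pair_sigma_finite U lborel by unfold_locales
  have "(AE m in U. AE r in lborel. 0 < r \<longrightarrow> (\<lambda>n. q n r m) \<longlonglongrightarrow> V r m) \<longleftrightarrow>
        (AE r in lborel. AE m in U. 0 < r \<longrightarrow> (\<lambda>n. q n r m) \<longlonglongrightarrow> V r m)"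
    unfolding LIMSEQ_inverse_iff
    by (rule P.AE_commute[where P = "\<lambda>m r. 0 < r \<longrightarrow> (\<forall>j. \<exists>n. \<forall>k\<ge>n. \<bar>q k r m - V r m\<bar> < inverse (real (Suc j)))"]) measurable
  moreover have "AE r in lborel. AE m in U. 0 < r \<longrightarrow> (\<lambda>n. q n r m) \<longlonglongrightarrow> V r m"
  proof (rule AE_I2)
    fix r :: real
    show "AE m in U. 0 < r \<longrightarrow> (\<lambda>n. q n r m) \<longlonglongrightarrow> V r m"
      using V_lim[of r] by (cases "0 < r") simp_all
  qed
  ultimately show ?thesis by blast
qed

lemma abs_le_square_sum: "\<bar>a * b\<bar> \<le> a\<^sup>2 + (b::real)\<^sup>2"
proof -
  have "0 \<le> \<bar>a\<bar> * \<bar>b\<bar>" by simp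
  then show ?thesis using sum_squares_bound[of "\<bar>a\<bar>" "\<bar>b\<bar>"] unfolding abs_mult power2_abs by linarith
qed

lemma potential_bound:
  assumes W: "\<And>x. (W has_real_derivative w x) (at x)"
  shows "\<bar>x\<bar> \<le> R \<Longrightarrow> \<bar>y\<bar> \<le> R \<Longrightarrow> \<bar>W x - W y\<bar> \<le> C * (1 + R) * \<bar>x - y\<bar>"
    and "\<bar>W (a - b)\<bar> \<le> \<bar>W 0\<bar> + 4 * C * (1 + a\<^sup>2 + b\<^sup>2)"
proof -
  have L: "\<bar>W x - W y\<bar> \<le> C * (1 + R) * \<bar>x - y\<bar>" if "\<bar>x\<bar> \<le> R" "\<bar>y\<bar> \<le> R" for x y R
  proof -
    have "norm (W x - W y) \<le> C * (1 + R) * norm (x - y)"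
    proof (rule field_differentiable_bound[of "{- R..R}" W w])
      show "norm (w z) \<le> C * (1 + R)" if "z \<in> {- R..R}" for z
      proof -
        have "\<bar>w z\<bar> \<le> C * (1 + \<bar>z\<bar>)" by (rule w_growth)
        also have "\<dots> \<le> C * (1 + R)" using that C_nonneg by (intro mult_left_mono) auto
        finally show ?thesis by simp
      qed
    qed (use that W in \<open>auto intro: has_field_derivative_at_within\<close>)
    then show ?thesis by simp
  qed
  then show "\<bar>x\<bar> \<le> R \<Longrightarrow> \<bar>y\<bar> \<le> R \<Longrightarrow> \<bar>W x - W y\<bar> \<le> C * (1 + R) * \<bar>x - y\<bar>" .
  have "\<bar>W (a - b) - W 0\<bar> \<le> C * (1 + \<bar>a - b\<bar>) * \<bar>a - b - 0\<bar>" by (rule L) auto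
  also have "\<dots> = C * ((1 + \<bar>a - b\<bar>) * \<bar>a - b\<bar>)" by simp
  also have "\<dots> \<le> C * (4 * (1 + a\<^sup>2 + b\<^sup>2))"
  proof (rule mult_left_mono[OF _ C_nonneg])
    have "(1 + \<bar>a - b\<bar>) * \<bar>a - b\<bar> = \<bar>a - b\<bar> + (a - b)\<^sup>2" by (simp add: algebra_simps power2_eq_square abs_mult_self_eq)
    moreover have "\<bar>a - b\<bar> \<le> 1 + (a - b)\<^sup>2" using abs_le_square_sum[of 1 "a - b"] by simp
    moreover have "(a - b)\<^sup>2 \<le> 2 * a\<^sup>2 + 2 * b\<^sup>2" using square_sum_le[of a "- b"] by simp
    moreover have "p \<le> 4 * (1 + A + B)"
      if "p = d + E" "d \<le> 1 + E" "E \<le> 2 * A + 2 * B" "0 \<le> A" "0 \<le> B" for p d E A B :: real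
    proof -
      have "2 * E \<le> 4 * A + 4 * B" using that(3) by simp
      then show ?thesis using that(1,2) unfolding distrib_left by simp
    qed
    ultimately show "(1 + \<bar>a - b\<bar>) * \<bar>a - b\<bar> \<le> 4 * (1 + a\<^sup>2 + b\<^sup>2)" by (meson zero_le_power2)
  qed
  finally show "\<bar>W (a - b)\<bar> \<le> \<bar>W 0\<bar> + 4 * C * (1 + a\<^sup>2 + b\<^sup>2)" by linarith
qed

text \<open>
  Potential energy of a pair of labels along the flow.
\<close>
lemma W_path:
  assumes W: "\<And>x. (W has_real_derivative w x) (at x)" and st: "0 < s" "s \<le> t"
    and a: "a \<in> {0<..<1}" "AE r in lborel. 0 < r \<longrightarrow> (\<lambda>n. q n r a) \<longlonglongrightarrow> V r a"
    and b: "b \<in> {0<..<1}" "AE r in lborel. 0 < r \<longrightarrow> (\<lambda>n. q n r b) \<longlonglongrightarrow> V r b"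
  shows "W (X t a - X t b) - W (X s a - X s b) = (LBINT r:{s<..t}. w (X r a - X r b) * (V r a - V r b))"
proof -
  define R where "R = Kb (t + 1) * \<beta> a + Kb (t + 1) * \<beta> b"
  define L where "L = Lc s (t + 1) * \<beta> a + Lc s (t + 1) * \<beta> b"
  have Wc: "isCont W x" for x using W by (rule DERIV_isCont)
  then have [measurable]: "W \<in> borel_measurable borel"
    by (intro borel_measurable_continuous_onI) (simp add: continuous_on_eq_continuous_at)
  have R: "\<bar>X r a - X r b\<bar> \<le> R" if "0 \<le> r" "r \<le> t + 1" for r
    using X_pointwise[OF that a(1)] X_pointwise[OF that b(1)] by (simp add: R_def)
  have R0: "0 \<le> R" using R[of 0] st by simp
  show ?thesis
  proof (rule seq_FTC[OF st(2), where f = "\<lambda>r. W (X r a - X r b)" and B = "C * (1 + R) * L"])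
    show "isCont (\<lambda>r. W (X r a - X r b)) r" if "s \<le> r" for r
      using that st X_isCont[of r a] X_isCont[of r b] a b by (intro isCont_o2[OF _ Wc] isCont_diff) auto
    show "\<bar>real (Suc n) * (W (X (r + 1 / real (Suc n)) a - X (r + 1 / real (Suc n)) b) - W (X r a - X r b))\<bar> \<le> C * (1 + R) * L"
      if r: "s < r" "r \<le> t" for n r
    proof -
      have "r + 1 / real (Suc n) \<le> t + 1" "0 \<le> 1 / real (Suc n)" using r by auto
      then have "\<bar>W (X (r + tstep n) a - X (r + tstep n) b) - W (X r a - X r b)\<bar>
          \<le> C * (1 + R) * \<bar>(X (r + tstep n) a - X (r + tstep n) b) - (X r a - X r b)\<bar>"
        using r st by (intro potential_bound(1)[OF W] R) linarith+
      then have "real (Suc n) * \<bar>W (X (r + tstep n) a - X (r + tstep n) b) - W (X r a - X r b)\<bar>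
          \<le> real (Suc n) * (C * (1 + R) * \<bar>(X (r + tstep n) a - X (r + tstep n) b) - (X r a - X r b)\<bar>)"
        by (intro mult_left_mono) auto
      also have "\<dots> = C * (1 + R) * \<bar>q n r a - q n r b\<bar>"
      proof -
        have "q n r a - q n r b = real (Suc n) * ((X (r + tstep n) a - X (r + tstep n) b) - (X r a - X r b))"
          by (simp add: q_def algebra_simps)
        then show ?thesis by (simp add: abs_mult)
      qed
      also have "\<dots> \<le> C * (1 + R) * L"
        using q_bound[OF st(1), of r t a n] q_bound[OF st(1), of r t b n] r a b C_nonneg R0
        by (intro mult_left_mono) (auto simp: L_def)
      finally show ?thesis by (simp add: abs_mult)
    qed
    show "AE r in lborel. s < r \<and> r \<le> t \<longrightarrow>
        (\<lambda>n. real (Suc n) * (W (X (r + 1 / real (Suc n)) a - X (r + 1 / real (Suc n)) b) - W (X r a - X r b)))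
          \<longlonglongrightarrow> w (X r a - X r b) * (V r a - V r b)"
      using a(2) b(2)
    proof eventually_elim
      case (elim r)
      show ?case
      proof
        assume "s < r \<and> r \<le> t"
        then have "(\<lambda>n. q n r a - q n r b) \<longlonglongrightarrow> V r a - V r b" using elim st by (intro tendsto_diff) auto
        also have "(\<lambda>n. q n r a - q n r b) = (\<lambda>n. real (Suc n) * ((X (r + tstep n) a - X (r + tstep n) b) - (X r a - X r b)))"
          by (simp add: q_def algebra_simps)
        finally show "(\<lambda>n. real (Suc n) * (W (X (r + 1 / real (Suc n)) a - X (r + 1 / real (Suc n)) b) - W (X r a - X r b)))
          \<longlonglongrightarrow> w (X r a - X r b) * (V r a - V r b)"
          by (rule quotient_chain_rule[OF W])
      qed
    qed
  qed measurable
qed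

lemma W_integrable:
  assumes W: "\<And>x. (W has_real_derivative w x) (at x)" and t: "0 \<le> t"
  shows "integrable (U \<Otimes>\<^sub>M U) (\<lambda>(a, b). W (X t a - X t b))"
proof -
  interpret P: pair_sigma_finite U U by unfold_locales
  have "isCont W x" for x using W by (rule DERIV_isCont)
  then have [measurable]: "W \<in> borel_measurable borel"
    by (intro borel_measurable_continuous_onI) (simp add: continuous_on_eq_continuous_at)
  let ?M = "\<lambda>a b. \<bar>W 0\<bar> + 4 * C * (1 + (X t a)\<^sup>2 + (X t b)\<^sup>2)"
  have iM: "integrable U (?M a)" for a using X_int[OF t] by simp
  have bd: "\<bar>W (X t a - X t b)\<bar> \<le> ?M a b" for a b by (rule potential_bound(2)[OF W])
  have M0: "0 \<le> ?M a b" for a b using C_nonneg by simp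
  have i1: "integrable U (\<lambda>b. W (X t a - X t b))" for a
    by (rule Bochner_Integration.integrable_bound[OF iM[of a]])
       (use bd M0 in \<open>auto intro!: AE_I2 order_trans[OF bd abs_ge_self]\<close>)
  have eq: "(\<integral>b. ?M a b \<partial>U) = \<bar>W 0\<bar> + 4 * C * (1 + (X t a)\<^sup>2 + (\<integral>b. (X t b)\<^sup>2 \<partial>U))" for a
    using X_int[OF t] by (simp add: U.prob_space[unfolded space_U] distrib_left)
  show ?thesis
  proof (rule P.Fubini_integrable)
    show "(\<lambda>(a, b). W (X t a - X t b)) \<in> borel_measurable (U \<Otimes>\<^sub>M U)" by (simp add: split_beta')
    show "AE a in U. integrable U (\<lambda>b. case (a, b) of (a, b) \<Rightarrow> W (X t a - X t b))" using i1 by simp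
    show "integrable U (\<lambda>a. \<integral>b. norm (case (a, b) of (a, b) \<Rightarrow> W (X t a - X t b)) \<partial>U)"
    proof (rule Bochner_Integration.integrable_bound)
      show "integrable U (\<lambda>a. \<bar>W 0\<bar> + 4 * C * (1 + (X t a)\<^sup>2 + (\<integral>b. (X t b)\<^sup>2 \<partial>U)))" using X_int[OF t] by simp
      show "(\<lambda>a. \<integral>b. norm (case (a, b) of (a, b) \<Rightarrow> W (X t a - X t b)) \<partial>U) \<in> borel_measurable U"
        by (intro U.borel_measurable_lebesgue_integral) (simp add: split_beta')
      show "AE a in U. norm (\<integral>b. norm (case (a, b) of (a, b) \<Rightarrow> W (X t a - X t b)) \<partial>U)
          \<le> norm (\<bar>W 0\<bar> + 4 * C * (1 + (X t a)\<^sup>2 + (\<integral>b. (X t b)\<^sup>2 \<partial>U)))"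
      proof (rule AE_I2)
        fix a
        have "(\<integral>b. \<bar>W (X t a - X t b)\<bar> \<partial>U) \<le> (\<integral>b. ?M a b \<partial>U)"
          using i1[of a] iM[of a] bd by (intro integral_mono) auto
        then show "norm (\<integral>b. norm (case (a, b) of (a, b) \<Rightarrow> W (X t a - X t b)) \<partial>U)
          \<le> norm (\<bar>W 0\<bar> + 4 * C * (1 + (X t a)\<^sup>2 + (\<integral>b. (X t b)\<^sup>2 \<partial>U)))"
          unfolding eq by simp
      qed
    qed
  qed
qed

lemma work_fubini:
  assumes st: "0 < s" "s \<le> t"
  shows "(\<integral>a. (LBINT r:{s<..t}. F r a * V r a) \<partial>U) = (LBINT r:{s<..t}. \<integral>a. F r a * V r a \<partial>U)"
    and "integrable U (\<lambda>a. LBINT r:{s<..t}. F r a * V r a)"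
proof -
  have m: "(\<lambda>(r, a). F r a * V r a) \<in> borel_measurable (borel \<Otimes>\<^sub>M borel)" by (simp add: split_beta')
  have i: "integrable U (\<lambda>a. F r a * V r a)" if "s < r" for r
    using that st F_int[of r] V_int[of r] by (intro integrable_mult_square) auto
  have b: "(\<integral>a. \<bar>F r a * V r a\<bar> \<partial>U) \<le> KF t * Kb (t + 1)" if "s < r" "r \<le> t" for r
    using that st F_int[of r] V_int[of r] F_L2[of r t] V_L2[of r t] KF_nonneg[of t] Kb_nonneg[of "t + 1"]
    by (intro cauchy_schwarz_U) auto
  note fub = time_space_fubini[OF m st(2) i b]
  show "(\<integral>a. (LBINT r:{s<..t}. F r a * V r a) \<partial>U) = (LBINT r:{s<..t}. \<integral>a. F r a * V r a \<partial>U)" by (rule fub(3))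
  show "integrable U (\<lambda>a. LBINT r:{s<..t}. F r a * V r a)" by (rule fub(2))
qed

text \<open>
  The power \<open>w (X a - X b) (V a - V b)\<close> of the pair splits by oddness of
  \<open>w\<close> into two terms that are exchanged by swapping \<open>a\<close> and
  \<open>b\<close>; integrating \<open>w (X a - X b)\<close> over \<open>b\<close> gives minus
  the force on \<open>a\<close>.
\<close>
lemma potential_decrement:
  assumes W: "\<And>x. (W has_real_derivative w x) (at x)" and st: "0 < s" "s \<le> t"
  shows "(\<integral>b. (\<integral>a. W (X t a - X t b) \<partial>U) \<partial>U) - (\<integral>b. (\<integral>a. W (X s a - X s b) \<partial>U) \<partial>U)
    = - 2 * (LBINT r:{s<..t}. \<integral>a. F r a * V r a \<partial>U)"
proof -
  interpret P: pair_sigma_finite U U by unfold_locales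
  have t0: "0 \<le> t" and s0: "0 \<le> s" using st by auto
  define A where "A a b = (LBINT r:{s<..t}. w (X r a - X r b) * V r a)" for a b
  have A_m: "(\<lambda>(a, b). A a b) \<in> borel_measurable (U \<Otimes>\<^sub>M U)"
    unfolding A_def set_lebesgue_integral_def split_beta'
    by (intro lborel.borel_measurable_lebesgue_integral) (simp add: split_beta')
  \<comment> \<open>an integrable majorant that separates the variables \<open>a\<close> and
      \<open>b\<close>, so that Fubini's theorem applies in all orders\<close>
  define p where "p r a = 3 * C\<^sup>2 * (1 + (X r a)\<^sup>2) + (V r a)\<^sup>2" for r a
  define k where "k r b = 3 * C\<^sup>2 * (X r b)\<^sup>2" for r b
  have wV: "\<bar>w (X r a - X r b) * V r a\<bar> \<le> p r a + k r b" for r a b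
  proof -
    have "(w (X r a - X r b))\<^sup>2 \<le> (C * (1 + \<bar>X r a\<bar> + \<bar>X r b\<bar>))\<^sup>2"
    proof (rule power2_le_iff_abs_le[THEN iffD2])
      show "0 \<le> C * (1 + \<bar>X r a\<bar> + \<bar>X r b\<bar>)" using C_nonneg by simp
      have "\<bar>w (X r a - X r b)\<bar> \<le> C * (1 + \<bar>X r a - X r b\<bar>)" by (rule w_growth)
      also have "\<dots> \<le> C * (1 + \<bar>X r a\<bar> + \<bar>X r b\<bar>)" using C_nonneg by (intro mult_left_mono) auto
      finally show "\<bar>w (X r a - X r b)\<bar> \<le> C * (1 + \<bar>X r a\<bar> + \<bar>X r b\<bar>)" .
    qed
    also have "\<dots> = C\<^sup>2 * (1 + \<bar>X r a\<bar> + \<bar>X r b\<bar>)\<^sup>2" by (simp add: power_mult_distrib)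
    also have "\<dots> \<le> C\<^sup>2 * (3 * (1 + (X r a)\<^sup>2 + (X r b)\<^sup>2))"
    proof (rule mult_left_mono)
      have "(1 + u + v)\<^sup>2 \<le> 3 * (1 + u\<^sup>2 + v\<^sup>2)" for u v :: real
        using zero_le_power2[of "1 - u"] zero_le_power2[of "1 - v"] zero_le_power2[of "u - v"]
        by (simp add: power2_eq_square algebra_simps)
      from this[of "\<bar>X r a\<bar>" "\<bar>X r b\<bar>"] show "(1 + \<bar>X r a\<bar> + \<bar>X r b\<bar>)\<^sup>2 \<le> 3 * (1 + (X r a)\<^sup>2 + (X r b)\<^sup>2)" by simp
    qed simp
    finally show ?thesis using abs_le_square_sum[of "w (X r a - X r b)" "V r a"]
      by (simp add: p_def k_def algebra_simps)
  qed
  have V2: "(V r a)\<^sup>2 \<le> (Lc s (t + 1) * \<beta> a)\<^sup>2" and X2: "(X r a)\<^sup>2 \<le> (Kb t * \<beta> a)\<^sup>2"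
    if "s < r" "r \<le> t" "a \<in> {0<..<1}" for r a
    using V_bound[OF st(1), of r t a] X_pointwise[of r t a] that st by (auto simp: abs_le_square_iff[symmetric] intro: order_trans[OF _ abs_ge_self])
  have psi: "set_integrable lborel {s<..t} (\<lambda>r. p r a)" and ksi: "set_integrable lborel {s<..t} (\<lambda>r. k r a)"
    if a: "a \<in> {0<..<1}" for a
  proof -
    show "set_integrable lborel {s<..t} (\<lambda>r. p r a)"
    proof (rule bounded_set_integrable[where B = "3 * C\<^sup>2 * (1 + (Kb t * \<beta> a)\<^sup>2) + (Lc s (t + 1) * \<beta> a)\<^sup>2"])
      fix r assume r: "s < r" "r \<le> t"
      have "p r a \<le> 3 * C\<^sup>2 * (1 + (Kb t * \<beta> a)\<^sup>2) + (Lc s (t + 1) * \<beta> a)\<^sup>2"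
        unfolding p_def using V2[OF r a] X2[OF r a] by (intro add_mono mult_left_mono) auto
      moreover have "0 \<le> p r a" by (simp add: p_def)
      ultimately show "\<bar>p r a\<bar> \<le> 3 * C\<^sup>2 * (1 + (Kb t * \<beta> a)\<^sup>2) + (Lc s (t + 1) * \<beta> a)\<^sup>2" by simp
    qed (simp add: p_def)
    show "set_integrable lborel {s<..t} (\<lambda>r. k r a)"
    proof (rule bounded_set_integrable[where B = "3 * C\<^sup>2 * (Kb t * \<beta> a)\<^sup>2"])
      fix r assume r: "s < r" "r \<le> t"
      show "\<bar>k r a\<bar> \<le> 3 * C\<^sup>2 * (Kb t * \<beta> a)\<^sup>2"
        unfolding k_def using X2[OF r a] by (simp add: mult_left_mono)
    qed (simp add: k_def)
  qed
  have p_int: "integrable U (\<lambda>a. LBINT r:{s<..t}. p r a)"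
  proof (rule time_space_fubini(2)[where M = "3 * C\<^sup>2 * (1 + (Kb t)\<^sup>2) + (Kb (t + 1))\<^sup>2"])
    fix r assume r: "s < r" "r \<le> t"
    show ip: "integrable U (p r)" unfolding p_def[abs_def] using X_int[of r] V_int[of r] r st by simp
    have "(\<integral>a. \<bar>p r a\<bar> \<partial>U) = (\<integral>a. p r a \<partial>U)" by (simp add: p_def)
    also have "\<dots> = 3 * C\<^sup>2 * (1 + (\<integral>a. (X r a)\<^sup>2 \<partial>U)) + (\<integral>a. (V r a)\<^sup>2 \<partial>U)"
      unfolding p_def using X_int[of r] V_int[of r] r st by (simp add: U.prob_space[unfolded space_U] distrib_left)
    also have "\<dots> \<le> 3 * C\<^sup>2 * (1 + (Kb t)\<^sup>2) + (Kb (t + 1))\<^sup>2"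
      using X_bound[of r t] V_L2[of r t] r st by (intro add_mono mult_left_mono) auto
    finally show "(\<integral>a. \<bar>p r a\<bar> \<partial>U) \<le> 3 * C\<^sup>2 * (1 + (Kb t)\<^sup>2) + (Kb (t + 1))\<^sup>2" .
  qed (use st in \<open>auto simp: p_def split_beta'\<close>)
  have k_int: "integrable U (\<lambda>a. LBINT r:{s<..t}. k r a)"
  proof (rule time_space_fubini(2)[where M = "3 * C\<^sup>2 * (Kb t)\<^sup>2"])
    fix r assume r: "s < r" "r \<le> t"
    show "integrable U (k r)" unfolding k_def[abs_def] using X_int[of r] r st by simp
    have "(\<integral>a. \<bar>k r a\<bar> \<partial>U) = 3 * C\<^sup>2 * (\<integral>a. (X r a)\<^sup>2 \<partial>U)" by (simp add: k_def)
    also have "\<dots> \<le> 3 * C\<^sup>2 * (Kb t)\<^sup>2" using X_bound[of r t] r st by (intro mult_left_mono) auto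
    finally show "(\<integral>a. \<bar>k r a\<bar> \<partial>U) \<le> 3 * C\<^sup>2 * (Kb t)\<^sup>2" .
  qed (use st in \<open>auto simp: k_def split_beta'\<close>)
  let ?p = "\<lambda>a. LBINT r:{s<..t}. p r a" and ?k = "\<lambda>b. LBINT r:{s<..t}. k r b"
  have A_si: "set_integrable lborel {s<..t} (\<lambda>r. w (X r a - X r b) * V r a)"
    and A_le: "\<bar>A a b\<bar> \<le> ?p a + ?k b" if a: "a \<in> {0<..<1}" and b: "b \<in> {0<..<1}" for a b
  proof -
    have pk: "set_integrable lborel {s<..t} (\<lambda>r. p r a + k r b)" using psi[OF a] ksi[OF b] by (rule set_integral_add(1))
    have mw: "set_borel_measurable lborel {s<..t} (\<lambda>r. w (X r a - X r b) * V r a)"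
      unfolding set_borel_measurable_def by measurable
    show si: "set_integrable lborel {s<..t} (\<lambda>r. w (X r a - X r b) * V r a)"
      by (rule set_integrable_bound[OF pk mw]) (use wV in \<open>auto intro!: AE_I2 order_trans[OF wV abs_ge_self]\<close>)
    have "\<bar>A a b\<bar> \<le> (LBINT r:{s<..t}. \<bar>w (X r a - X r b) * V r a\<bar>)"
      unfolding A_def using set_integral_norm_bound[OF si] by simp
    also have "\<dots> \<le> (LBINT r:{s<..t}. p r a + k r b)"
      using set_integrable_abs[OF si] pk wV by (intro set_integral_mono) auto
    also have "\<dots> = ?p a + ?k b" using psi[OF a] ksi[OF b] by (rule set_integral_add(2))
    finally show "\<bar>A a b\<bar> \<le> ?p a + ?k b" .
  qed
  have [measurable]: "(\<lambda>b. A a b) \<in> borel_measurable U" for a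
    unfolding A_def set_lebesgue_integral_def
    by (intro lborel.borel_measurable_lebesgue_integral) (simp add: split_beta')
  have A_int1: "integrable U (\<lambda>b. A a b)" if a: "a \<in> {0<..<1}" for a
  proof (rule Bochner_Integration.integrable_bound)
    show "integrable U (\<lambda>b. ?p a + ?k b)" using k_int by simp
    show "AE b in U. norm (A a b) \<le> norm (?p a + ?k b)"
      using A_le[OF a] by (intro AE_I2) (auto intro: order_trans[OF _ abs_ge_self])
  qed measurable
  have A_int: "integrable (U \<Otimes>\<^sub>M U) (\<lambda>(a, b). A a b)"
  proof (rule P.Fubini_integrable[OF A_m])
    show "AE a in U. integrable U (\<lambda>b. case (a, b) of (a, b) \<Rightarrow> A a b)" using A_int1 by (intro AE_I2) auto
    show "integrable U (\<lambda>a. \<integral>b. norm (case (a, b) of (a, b) \<Rightarrow> A a b) \<partial>U)"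
    proof (rule Bochner_Integration.integrable_bound)
      show "integrable U (\<lambda>a. ?p a + (\<integral>b. ?k b \<partial>U))" using p_int by simp
      show "(\<lambda>a. \<integral>b. norm (case (a, b) of (a, b) \<Rightarrow> A a b) \<partial>U) \<in> borel_measurable U"
        using A_m by (intro U.borel_measurable_lebesgue_integral) (simp add: split_beta')
      show "AE a in U. norm (\<integral>b. norm (case (a, b) of (a, b) \<Rightarrow> A a b) \<partial>U) \<le> norm (?p a + (\<integral>b. ?k b \<partial>U))"
      proof (rule AE_I2)
        fix a assume "a \<in> space U"
        then have a: "a \<in> {0<..<1}" by simp
        have "(\<integral>b. \<bar>A a b\<bar> \<partial>U) \<le> (\<integral>b. ?p a + ?k b \<partial>U)"
          using A_int1[OF a] k_int A_le[OF a] by (intro integral_mono) auto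
        also have "\<dots> = ?p a + (\<integral>b. ?k b \<partial>U)" using k_int by (simp add: U.prob_space[unfolded space_U])
        finally show "norm (\<integral>b. norm (case (a, b) of (a, b) \<Rightarrow> A a b) \<partial>U) \<le> norm (?p a + (\<integral>b. ?k b \<partial>U))"
          by simp
      qed
    qed
  qed
  have A_int2: "integrable (U \<Otimes>\<^sub>M U) (\<lambda>(a, b). A b a)"
    using P.integrable_product_swap[OF A_int] by (simp add: split_beta')
  \<comment> \<open>\<open>w\<close> is odd, so the second half of the power is the first one with
      \<open>a\<close> and \<open>b\<close> exchanged\<close>
  have path: "AE b in U. AE a in U. W (X t a - X t b) - W (X s a - X s b) = A a b + A b a"
    using V_lim_time AE_space
  proof eventually_elim
    case b: (elim b)
    show ?case using V_lim_time AE_space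
    proof eventually_elim
      case a: (elim a)
      have ab: "a \<in> {0<..<1}" "b \<in> {0<..<1}" using a b by auto
      have "w (X r a - X r b) * (V r a - V r b) = w (X r a - X r b) * V r a + w (X r b - X r a) * V r b" for r
        using w_odd[of "X r a - X r b"] by (simp add: algebra_simps)
      then have "(LBINT r:{s<..t}. w (X r a - X r b) * (V r a - V r b)) = A a b + A b a"
        unfolding A_def using set_integral_add(2)[OF A_si[OF ab] A_si[OF ab(2,1)]] by simp
      then show ?case using W_path[OF W st ab(1) a(1) ab(2) b(1)] by simp
    qed
  qed
  have "(\<integral>b. (\<integral>a. W (X t a - X t b) \<partial>U) \<partial>U) - (\<integral>b. (\<integral>a. W (X s a - X s b) \<partial>U) \<partial>U)
      = (\<integral>b. (\<integral>a. W (X t a - X t b) \<partial>U) - (\<integral>a. W (X s a - X s b) \<partial>U) \<partial>U)"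
    using P.integrable_snd[OF W_integrable[OF W, of t]] P.integrable_snd[OF W_integrable[OF W, of s]] st by simp
  also have "\<dots> = (\<integral>b. (\<integral>a. A a b \<partial>U) + (\<integral>a. A b a \<partial>U) \<partial>U)"
  proof (rule integral_cong_AE)
    have [measurable]: "W \<in> borel_measurable borel"
      using DERIV_isCont[OF W] by (intro borel_measurable_continuous_onI) (simp add: continuous_on_eq_continuous_at)
    show "(\<lambda>b. (\<integral>a. W (X t a - X t b) \<partial>U) - (\<integral>a. W (X s a - X s b) \<partial>U)) \<in> borel_measurable U"
      by (intro borel_measurable_diff U.borel_measurable_lebesgue_integral) (simp_all add: split_beta')
    show "(\<lambda>b. (\<integral>a. A a b \<partial>U) + (\<integral>a. A b a \<partial>U)) \<in> borel_measurable U"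
      using P.integrable_snd[OF A_int] P.integrable_snd[OF A_int2] by simp
    show "AE b in U. (\<integral>a. W (X t a - X t b) \<partial>U) - (\<integral>a. W (X s a - X s b) \<partial>U) = (\<integral>a. A a b \<partial>U) + (\<integral>a. A b a \<partial>U)"
      using path P.AE_integrable_snd[OF W_integrable[OF W t0]] P.AE_integrable_snd[OF W_integrable[OF W s0]]
        P.AE_integrable_snd[OF A_int] P.AE_integrable_snd[OF A_int2]
    proof eventually_elim
      case (elim b)
      have i: "integrable U (\<lambda>a. W (X t a - X t b))" "integrable U (\<lambda>a. W (X s a - X s b))"
        "integrable U (\<lambda>a. A a b)" "integrable U (\<lambda>a. A b a)" using elim st by auto
      have "(\<integral>a. W (X t a - X t b) \<partial>U) - (\<integral>a. W (X s a - X s b) \<partial>U) = (\<integral>a. W (X t a - X t b) - W (X s a - X s b) \<partial>U)"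
        using i by simp
      also have "\<dots> = (\<integral>a. A a b + A b a \<partial>U)"
        by (rule integral_cong_AE) (use i elim(1) in auto)
      also have "\<dots> = (\<integral>a. A a b \<partial>U) + (\<integral>a. A b a \<partial>U)" using i by simp
      finally show ?case .
    qed
  qed
  also have "\<dots> = (\<integral>b. (\<integral>a. A a b \<partial>U) \<partial>U) + (\<integral>b. (\<integral>a. A b a \<partial>U) \<partial>U)"
    using P.integrable_snd[OF A_int] P.integrable_snd[OF A_int2] by simp
  also have "(\<integral>b. (\<integral>a. A a b \<partial>U) \<partial>U) = (\<integral>a. (\<integral>b. A a b \<partial>U) \<partial>U)" by (rule P.Fubini_integral[OF A_int])
  also have "(\<integral>a. (\<integral>b. A a b \<partial>U) \<partial>U) + (\<integral>b. (\<integral>a. A b a \<partial>U) \<partial>U) = 2 * (\<integral>a. (\<integral>b. A a b \<partial>U) \<partial>U)" by simp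
  also have "(\<integral>a. (\<integral>b. A a b \<partial>U) \<partial>U) = (\<integral>a. - (LBINT r:{s<..t}. F r a * V r a) \<partial>U)"
  proof (intro Bochner_Integration.integral_cong refl)
    fix a assume "a \<in> space U"
    then have a: "a \<in> {0<..<1}" by simp
    define M where "M = (\<integral>b. C * (1 + (Kb t * \<beta> a + Kb t * \<beta> b)) * (Lc s (t + 1) * \<beta> a) \<partial>U)"
    have iM: "integrable U (\<lambda>b. C * (1 + (Kb t * \<beta> a + Kb t * \<beta> b)) * (Lc s (t + 1) * \<beta> a))" using integrable_\<beta> by simp
    have "(\<integral>b. A a b \<partial>U) = (LBINT r:{s<..t}. \<integral>b. w (X r a - X r b) * V r a \<partial>U)"
      unfolding A_def
    proof (rule time_space_fubini(3)[OF _ st(2)])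
      show "(\<lambda>(r, b). w (X r a - X r b) * V r a) \<in> borel_measurable (borel \<Otimes>\<^sub>M borel)" by (simp add: split_beta')
      fix r assume r: "s < r" "r \<le> t"
      show i: "integrable U (\<lambda>b. w (X r a - X r b) * V r a)" using w_integrable[of r a] a r st by simp
      show "(\<integral>b. \<bar>w (X r a - X r b) * V r a\<bar> \<partial>U) \<le> M"
        unfolding M_def
      proof (rule integral_mono[OF _ iM])
        show "integrable U (\<lambda>b. \<bar>w (X r a - X r b) * V r a\<bar>)" using i by simp
        fix b assume "b \<in> space U"
        then have b: "b \<in> {0<..<1}" by simp
        have "\<bar>w (X r a - X r b)\<bar> \<le> C * (1 + \<bar>X r a - X r b\<bar>)" by (rule w_growth)
        also have "\<dots> \<le> C * (1 + (Kb t * \<beta> a + Kb t * \<beta> b))"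
          using X_pointwise[of r t a] X_pointwise[of r t b] a b r st C_nonneg by (intro mult_left_mono add_left_mono) auto
        finally show "\<bar>w (X r a - X r b) * V r a\<bar> \<le> C * (1 + (Kb t * \<beta> a + Kb t * \<beta> b)) * (Lc s (t + 1) * \<beta> a)"
          unfolding abs_mult using V_bound[OF st(1), of r t a] a r by (intro mult_mono) auto
      qed
    qed
    also have "\<dots> = (LBINT r:{s<..t}. - (F r a * V r a))"
      unfolding lag_force_def by simp
    also have "\<dots> = - (LBINT r:{s<..t}. F r a * V r a)"
      unfolding set_lebesgue_integral_def by simp
    finally show "(\<integral>b. A a b \<partial>U) = - (LBINT r:{s<..t}. F r a * V r a)" .
  qed
  also have "\<dots> = - (LBINT r:{s<..t}. \<integral>a. F r a * V r a \<partial>U)" using work_fubini[OF st] by simp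
  finally show ?thesis by simp
qed

text \<open>
  The force \<open>F\<^sub>r\<close> is a function of \<open>X\<^sub>r\<close>, hence also of
  \<open>X\<^sub>s\<close>. Against it \<open>V\<^sub>r\<close> may be replaced by
  \<open>Z\<^sub>r\<close>, and \<open>Z\<^sub>s\<close> by \<open>V\<^sub>s\<close>, so the
  power is \<open>F\<^sub>r (V\<^sub>s + Z\<^sub>r - Z\<^sub>s)\<close>. As \<open>F\<close> is
  the time derivative of \<open>Z\<close>, this is the derivative of \<open>V\<^sub>s (Z\<^sub>r
  - Z\<^sub>s) + (Z\<^sub>r - Z\<^sub>s)\<^sup>2 / 2\<close>.
\<close>
lemma work_of_force:
  assumes st: "0 < s" "s \<le> t"
  shows "(LBINT r:{s<..t}. \<integral>a. F r a * V r a \<partial>U)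
    = (\<integral>a. V s a * (Z t a - Z s a) + (Z t a - Z s a)\<^sup>2 / 2 \<partial>U)"
proof -
  define H where "H r a = F r a * (V s a + (Z r a - Z s a))" for r a
  have H_m: "(\<lambda>(r, a). H r a) \<in> borel_measurable (borel \<Otimes>\<^sub>M borel)" unfolding H_def by (simp add: split_beta')
  have proj: "(\<integral>a. F r a * V r a \<partial>U) = (\<integral>a. H r a \<partial>U)" if r: "s < r" "r \<le> t" for r
  proof -
    have r0: "0 < r" "0 \<le> r" using r st by auto
    have i: "integrable U (\<lambda>a. F r a * V r a)" "integrable U (\<lambda>a. F r a * Z r a)" "integrable U (\<lambda>a. F r a * V s a)" "integrable U (\<lambda>a. F r a * Z s a)"
      using r0 st F_int[of r] V_int[of r] V_int[of s] Z_int[of r] Z_int[of s] by (auto intro!: integrable_mult_square)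
    have Fm: "F r (Minv r (X r a)) = F r a" if "a \<in> {0<..<1}" for a
      using Minv_X(2)[of r a] r0 that by (simp add: lag_force_def)
    have eqi: "integrable U (\<lambda>a. g a * f a) \<Longrightarrow> (\<And>a. a \<in> {0<..<1} \<Longrightarrow> g' a = g a) \<Longrightarrow> integrable U (\<lambda>a. g' a * f a :: real)"
      and eqI: "(\<And>a. a \<in> {0<..<1} \<Longrightarrow> g' a = g a) \<Longrightarrow> (\<integral>a. g' a * f a \<partial>U) = (\<integral>a. g a * f a \<partial>U)" for f g g' :: "real \<Rightarrow> real"
      using integrable_cong_U[of "\<lambda>a. g' a * f a" "\<lambda>a. g a * f a"] integral_cong_U[of "\<lambda>a. g' a * f a" "\<lambda>a. g a * f a"] by auto
    have 1: "(\<integral>a. F r a * V r a \<partial>U) = (\<integral>a. F r a * Z r a \<partial>U)"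
    proof -
      have "(\<integral>a. F r (Minv r (X r a)) * V r a \<partial>U) = (\<integral>a. F r (Minv r (X r a)) * Z r a \<partial>U)"
        by (rule V_projection[OF r0(1), where \<psi> = "\<lambda>x. F r (Minv r x)"]) (use eqi[OF i(1) Fm] eqi[OF i(2) Fm] in auto)
      then show ?thesis using eqI[OF Fm] by simp
    qed
    have Fm2: "F r (Minv r (X r (Minv s (X s a)))) = F r a" if "a \<in> {0<..<1}" for a
      using X_Minv[OF st(1), of r a] Fm[OF that] r that by simp
    have 2: "(\<integral>a. F r a * V s a \<partial>U) = (\<integral>a. F r a * Z s a \<partial>U)"
    proof -
      have "(\<integral>a. F r (Minv r (X r (Minv s (X s a)))) * V s a \<partial>U) = (\<integral>a. F r (Minv r (X r (Minv s (X s a)))) * Z s a \<partial>U)"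
        by (rule V_projection[OF st(1), where \<psi> = "\<lambda>x. F r (Minv r (X r (Minv s x)))"]) (use eqi[OF i(3) Fm2] eqi[OF i(4) Fm2] in auto)
      then show ?thesis using eqI[OF Fm2] by simp
    qed
    have "(\<integral>a. H r a \<partial>U) = (\<integral>a. F r a * V s a + (F r a * Z r a - F r a * Z s a) \<partial>U)"
      unfolding H_def by (intro Bochner_Integration.integral_cong) (auto simp: algebra_simps)
    also have "\<dots> = (\<integral>a. F r a * V s a \<partial>U) + ((\<integral>a. F r a * Z r a \<partial>U) - (\<integral>a. F r a * Z s a \<partial>U))" using i by simp
    finally show ?thesis using 1 2 by simp
  qed
  have path: "(LBINT r:{s<..t}. H r a) = V s a * (Z t a - Z s a) + (Z t a - Z s a)\<^sup>2 / 2" if a: "a \<in> {0<..<1}" for a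
  proof -
    \<comment> \<open>a primitive of \<open>H\<close> as a function of the impulse\<close>
    let ?G = "\<lambda>z. V s a * (z - Z s a) + (z - Z s a)\<^sup>2 / 2"
    have G: "(?G has_real_derivative V s a + (z - Z s a)) (at z)" for z
      by (auto intro!: derivative_eq_intros)
    define B where "B = (\<bar>V s a\<bar> + 2 * BZ (t + 1) a) * BF (t + 1) a"
    have "?G (Z t a) - ?G (Z s a) = (LBINT r:{s<..t}. H r a)"
    proof (rule seq_FTC[OF st(2), where f = "\<lambda>r. ?G (Z r a)" and B = B])
      show "isCont (\<lambda>r. ?G (Z r a)) r" if "s \<le> r" for r
        using that st Z_isCont[of r a] a by (intro continuous_intros) auto
      show "\<bar>real (Suc n) * (?G (Z (r + 1 / real (Suc n)) a) - ?G (Z r a))\<bar> \<le> B" if r: "s < r" "r \<le> t" for n r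
      proof -
        let ?z = "Z (r + tstep n) a" and ?y = "Z r a"
        have "r + tstep n \<le> t + 1" "0 \<le> tstep n" using r by auto
        then have zb: "\<bar>?z\<bar> \<le> BZ (t + 1) a" "\<bar>?y\<bar> \<le> BZ (t + 1) a" "\<bar>Z s a\<bar> \<le> BZ (t + 1) a"
          using r st a by (intro Z_bound; linarith)+
        have e: "?G ?z - ?G ?y = (?z - ?y) * (V s a + (?z + ?y) / 2 - Z s a)"
          by (simp add: power2_eq_square field_simps)
        have "\<bar>real (Suc n) * (?G ?z - ?G ?y)\<bar> = \<bar>real (Suc n) * (?z - ?y)\<bar> * \<bar>V s a + (?z + ?y) / 2 - Z s a\<bar>"
          unfolding e abs_mult[symmetric] by (simp only: mult.assoc)
        also have "\<dots> \<le> BF (t + 1) a * (\<bar>V s a\<bar> + 2 * BZ (t + 1) a)"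
        proof (rule mult_mono)
          have "\<bar>(?z + ?y) / 2\<bar> \<le> BZ (t + 1) a" using zb by (simp add: abs_le_iff)
          then show "\<bar>V s a + (?z + ?y) / 2 - Z s a\<bar> \<le> \<bar>V s a\<bar> + 2 * BZ (t + 1) a"
            using zb(3) unfolding mult_2 by linarith
        qed (use Z_quotient_bound[of r t a n] r st a BF_nonneg[OF a, of "t + 1"] in auto)
        finally show ?thesis by (simp add: B_def mult.commute)
      qed
      have "(\<lambda>n. real (Suc n) * (?G (Z (r + 1 / real (Suc n)) a) - ?G (Z r a))) \<longlonglongrightarrow> H r a" if "s < r" for r
        using quotient_chain_rule[OF G Z_quotient[of r a]] that st a by (simp add: H_def mult.commute)
      then show "AE r in lborel. s < r \<and> r \<le> t \<longrightarrow> (\<lambda>n. real (Suc n) * (?G (Z (r + 1 / real (Suc n)) a) - ?G (Z r a))) \<longlonglongrightarrow> H r a"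
        by (intro AE_I2) auto
    qed (simp_all add: H_def)
    then show ?thesis by simp
  qed
  define KH where "KH = Kb (s + 1) + (KZ t + KZ t)"
  have KH0: "0 \<le> KH" using Kb_nonneg[of "s + 1"] KZ_nonneg[of t] st by (simp add: KH_def)
  have H2: "integrable U (\<lambda>a. (V s a + (Z r a - Z s a))\<^sup>2)" "(\<integral>a. (V s a + (Z r a - Z s a))\<^sup>2 \<partial>U) \<le> KH\<^sup>2" if r: "s < r" "r \<le> t" for r
  proof -
    have zz: "integrable U (\<lambda>a. (Z r a - Z s a)\<^sup>2)"
      using integrable_square_add[of "Z r" "Z s" 1 "-1"] Z_int[of r] Z_int[of s] r st by simp
    then show "integrable U (\<lambda>a. (V s a + (Z r a - Z s a))\<^sup>2)"
      using integrable_square_add[of "V s" "\<lambda>a. Z r a - Z s a" 1 1] V_int[OF st(1)] by simp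
    have "(\<integral>a. (Z r a + (- Z s a))\<^sup>2 \<partial>U) \<le> (KZ t + KZ t)\<^sup>2"
      using Z_int[of r] Z_int[of s] Z_L2[of r t] Z_L2[of s t] KZ_nonneg[of t] r st by (intro minkowski_U) auto
    then show "(\<integral>a. (V s a + (Z r a - Z s a))\<^sup>2 \<partial>U) \<le> KH\<^sup>2"
      unfolding KH_def using zz V_int[OF st(1)] V_L2[OF st(1) order_refl] KZ_nonneg[of t] Kb_nonneg[of "s + 1"] st
      by (intro minkowski_U) auto
  qed
  have "(LBINT r:{s<..t}. \<integral>a. F r a * V r a \<partial>U) = (LBINT r:{s<..t}. \<integral>a. H r a \<partial>U)"
    by (rule set_lebesgue_integral_cong) (use proj in auto)
  also have "\<dots> = (\<integral>a. (LBINT r:{s<..t}. H r a) \<partial>U)"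
  proof (rule time_space_fubini(3)[OF H_m st(2), symmetric])
    fix r assume r: "s < r" "r \<le> t"
    show "integrable U (H r)"
      unfolding H_def[abs_def] using F_int[of r] H2[OF r] r st by (intro integrable_mult_square) auto
    show "(\<integral>a. \<bar>H r a\<bar> \<partial>U) \<le> KF t * KH"
      unfolding H_def using F_int[of r] F_L2[of r t] H2[OF r] r st KH0 KF_nonneg[of t] by (intro cauchy_schwarz_U) auto
  qed
  also have "\<dots> = (\<integral>a. V s a * (Z t a - Z s a) + (Z t a - Z s a)\<^sup>2 / 2 \<partial>U)"
    by (intro Bochner_Integration.integral_cong) (use path in auto)
  finally show ?thesis .
qed

text \<open>
  With \<open>I = Z\<^sub>t - Z\<^sub>s\<close>, the projection property at the times
  \<open>s\<close> and \<open>t\<close> gives \<open>\<parallel>V\<^sub>t\<parallel>\<^sup>2 =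
  \<langle>V\<^sub>t, V\<^sub>s + I\<rangle>\<close>, hence
  \<open>\<parallel>V\<^sub>t\<parallel>\<^sup>2 \<le> \<parallel>V\<^sub>s +
  I\<parallel>\<^sup>2\<close>. The terms \<open>2 \<langle>V\<^sub>s, I\<rangle> +
  \<parallel>I\<parallel>\<^sup>2\<close> gained on the right are exactly what the potential
  energy loses.
\<close>
theorem energy_inequality:
  assumes W: "\<And>x. (W has_real_derivative w x) (at x)" and st: "0 < s" "s \<le> t"
  shows "1 / 2 * (\<integral>a. (V t a)\<^sup>2 \<partial>U) + 1 / 2 * (\<integral>b. (\<integral>a. W (X t a - X t b) \<partial>U) \<partial>U)
    \<le> 1 / 2 * (\<integral>a. (V s a)\<^sup>2 \<partial>U) + 1 / 2 * (\<integral>b. (\<integral>a. W (X s a - X s b) \<partial>U) \<partial>U)"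
proof -
  have t: "0 < t" using st by simp
  let ?I = "\<lambda>a. Z t a - Z s a"
  have I2: "integrable U (\<lambda>a. (?I a)\<^sup>2)" using impulse_increment_L2(1)[of s t] st by simp
  have i: "integrable U (\<lambda>a. V t a * V t a)" "integrable U (\<lambda>a. V t a * Z t a)" "integrable U (\<lambda>a. V t a * Z s a)"
    "integrable U (\<lambda>a. V t a * V s a)" "integrable U (\<lambda>a. V t a * ?I a)" "integrable U (\<lambda>a. V s a * ?I a)"
    using V_int[OF t] V_int[OF st(1)] Z_int[of t] Z_int[of s] I2 st by (auto intro!: integrable_mult_square)
  have m1: "V t (Minv t (X t a)) = V t a" if "a \<in> {0<..<1}" for a using V_Minv[OF t that] .
  have m2: "V t (Minv t (X t (Minv s (X s a)))) = V t a" if "a \<in> {0<..<1}" for a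
    using X_Minv[OF st that] m1[OF that] by simp
  have eqi: "integrable U (\<lambda>a. g a * f a) \<Longrightarrow> (\<And>a. a \<in> {0<..<1} \<Longrightarrow> g' a = g a) \<Longrightarrow> integrable U (\<lambda>a. g' a * f a :: real)"
    and eqI: "(\<And>a. a \<in> {0<..<1} \<Longrightarrow> g' a = g a) \<Longrightarrow> (\<integral>a. g' a * f a \<partial>U) = (\<integral>a. g a * f a \<partial>U)" for f g g' :: "real \<Rightarrow> real"
    using integrable_cong_U[of "\<lambda>a. g' a * f a" "\<lambda>a. g a * f a"] integral_cong_U[of "\<lambda>a. g' a * f a" "\<lambda>a. g a * f a"] by auto
  have "(\<integral>a. V t (Minv t (X t a)) * V t a \<partial>U) = (\<integral>a. V t (Minv t (X t a)) * Z t a \<partial>U)"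
    by (rule V_projection[OF t, where \<psi> = "\<lambda>x. V t (Minv t x)"]) (use eqi[OF i(1) m1] eqi[OF i(2) m1] in auto)
  then have 1: "(\<integral>a. V t a * V t a \<partial>U) = (\<integral>a. V t a * Z t a \<partial>U)" using eqI[OF m1] by simp
  have "(\<integral>a. V t (Minv t (X t (Minv s (X s a)))) * V s a \<partial>U) = (\<integral>a. V t (Minv t (X t (Minv s (X s a)))) * Z s a \<partial>U)"
    by (rule V_projection[OF st(1), where \<psi> = "\<lambda>x. V t (Minv t (X t (Minv s x)))"]) (use eqi[OF i(4) m2] eqi[OF i(3) m2] in auto)
  then have 2: "(\<integral>a. V t a * V s a \<partial>U) = (\<integral>a. V t a * Z s a \<partial>U)" using eqI[OF m2] by simp
  have "(\<integral>a. V t a * Z t a \<partial>U) = (\<integral>a. V t a * Z s a + V t a * ?I a \<partial>U)"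
    by (intro Bochner_Integration.integral_cong) (auto simp: algebra_simps)
  also have "\<dots> = (\<integral>a. V t a * Z s a \<partial>U) + (\<integral>a. V t a * ?I a \<partial>U)" using i by simp
  finally have 3: "(\<integral>a. V t a * V t a \<partial>U) = (\<integral>a. V t a * V s a \<partial>U) + (\<integral>a. V t a * ?I a \<partial>U)" using 1 2 by simp
  have "0 \<le> (\<integral>a. (V t a - V s a - ?I a)\<^sup>2 \<partial>U)" by simp
  also have "\<dots> = (\<integral>a. (V t a)\<^sup>2 - 2 * (V t a * V s a) - 2 * (V t a * ?I a) + ((V s a)\<^sup>2 + 2 * (V s a * ?I a) + (?I a)\<^sup>2) \<partial>U)"
    by (intro Bochner_Integration.integral_cong) (auto simp: power2_eq_square algebra_simps)
  also have "\<dots> = (\<integral>a. (V t a)\<^sup>2 \<partial>U) - 2 * (\<integral>a. V t a * V s a \<partial>U) - 2 * (\<integral>a. V t a * ?I a \<partial>U)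
      + ((\<integral>a. (V s a)\<^sup>2 \<partial>U) + 2 * (\<integral>a. V s a * ?I a \<partial>U) + (\<integral>a. (?I a)\<^sup>2 \<partial>U))"
    using V_int[OF t] V_int[OF st(1)] i I2 by simp
  finally have 4: "(\<integral>a. (V t a)\<^sup>2 \<partial>U) \<le> (\<integral>a. (V s a)\<^sup>2 \<partial>U) + 2 * (\<integral>a. V s a * ?I a \<partial>U) + (\<integral>a. (?I a)\<^sup>2 \<partial>U)"
    using 3 by (simp add: power2_eq_square)
  have "(LBINT r:{s<..t}. \<integral>a. F r a * V r a \<partial>U) = (\<integral>a. V s a * ?I a \<partial>U) + (\<integral>a. (?I a)\<^sup>2 \<partial>U) / 2"
    unfolding work_of_force[OF st] using i(6) I2 by simp
  then show ?thesis using potential_decrement[OF W st] 4 by simp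
qed

end

declare of_nat_Suc [simp]

section \<open>The weak equations in Lagrangian form\<close>

text \<open>
  Extension of a function on the half-plane to the plane by its values at time \<open>0\<close>.
  It is continuous, so all compositions with the flow are Borel measurable without restricting
  to nonnegative times.
\<close>
definition past_frozen :: "(real \<times> real \<Rightarrow> real) \<Rightarrow> real \<Rightarrow> real \<Rightarrow> real" where
  "past_frozen f x t = f (x, max 0 t)"

lemma past_frozen_eq [simp]: "0 \<le> t \<Longrightarrow> past_frozen f x t = f (x, t)"
  by (simp add: past_frozen_def)

lemma continuous_past_frozen:
  assumes "continuous_on half_plane f"
  shows "continuous_on UNIV (\<lambda>p. past_frozen f (fst p) (snd p))"
  unfolding past_frozen_def
  by (rule continuous_on_compose2[OF assms]) (auto intro!: continuous_intros)

lemma measurable_past_frozen: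
  assumes f: "continuous_on half_plane f" and [measurable]: "g \<in> borel_measurable M" "h \<in> borel_measurable M"
  shows "(\<lambda>z. past_frozen f (g z) (h z)) \<in> borel_measurable M"
proof -
  have "(\<lambda>p. past_frozen f (fst p) (snd p)) \<in> borel_measurable borel"
    by (rule borel_measurable_continuous_onI[OF continuous_past_frozen[OF f]])
  then have [measurable]: "(\<lambda>p. past_frozen f (fst p) (snd p)) \<in> borel_measurable (borel \<Otimes>\<^sub>M borel)"
    by (simp add: borel_prod)
  have "(\<lambda>z. (\<lambda>p. past_frozen f (fst p) (snd p)) (g z, h z)) \<in> borel_measurable M"
    by (rule measurable_compose[of "\<lambda>z. (g z, h z)" M "borel \<Otimes>\<^sub>M borel"]) measurable
  then show ?thesis by simp
qed

lemma test_function_derivatives: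
  assumes "test_function \<phi>"
  shows "continuous_on half_plane \<phi>" "continuous_on half_plane (dx \<phi>)" "continuous_on half_plane (dt \<phi>)"
    and "\<And>x t. 0 \<le> t \<Longrightarrow> ((\<lambda>y. \<phi> (y, t)) has_real_derivative dx \<phi> (x, t)) (at x)"
    and "\<And>x t. 0 \<le> t \<Longrightarrow> ((\<lambda>s. \<phi> (x, s)) has_real_derivative dt \<phi> (x, t)) (at t within {0..})"
proof -
  have "Ck_half_plane (Suc 0) \<phi>" using assms by (auto simp only: test_function_def)
  then have 1: "continuous_on half_plane \<phi>" "continuous_on half_plane (dx \<phi>)" "continuous_on half_plane (dt \<phi>)"
    and 2: "\<And>x t. 0 \<le> t \<Longrightarrow> (\<lambda>y. \<phi> (y, t)) differentiable (at x)"
    and 3: "\<And>x t. 0 \<le> t \<Longrightarrow> (\<lambda>s. \<phi> (x, s)) differentiable (at t within {0..})"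
    by auto
  show "continuous_on half_plane \<phi>" "continuous_on half_plane (dx \<phi>)" "continuous_on half_plane (dt \<phi>)"
    by fact+
  show "((\<lambda>y. \<phi> (y, t)) has_real_derivative dx \<phi> (x, t)) (at x)" if "0 \<le> t" for x t
    using 2[OF that, of x] DERIV_deriv_iff_real_differentiable by (simp add: dx_def)
  show "((\<lambda>s. \<phi> (x, s)) has_real_derivative dt \<phi> (x, t)) (at t within {0..})" if "0 \<le> t" for x t
    unfolding has_real_derivative_iff_has_vector_derivative
    using 3[OF that, of x] by (simp add: dt_def vector_derivative_works)
qed

text \<open>
  The derivatives vanish outside a compact set as well, because \<open>\<phi>\<close> is locally
  zero there; at \<open>t = 0\<close> the time derivative is one-sided.
\<close>
lemma test_function_support:
  assumes \<phi>: "test_function \<phi>"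
  obtains T where "0 < T" "\<And>x t. 0 \<le> t \<Longrightarrow> T < \<bar>x\<bar> \<or> T < t \<Longrightarrow> \<phi> (x, t) = 0 \<and> dx \<phi> (x, t) = 0 \<and> dt \<phi> (x, t) = 0"
proof -
  note der = test_function_derivatives(4,5)[OF \<phi>]
  have "bounded (closure {z \<in> half_plane. \<phi> z \<noteq> 0})"
    using \<phi> unfolding test_function_def by (blast intro: compact_imp_bounded)
  then obtain a where a: "\<And>z. z \<in> closure {z \<in> half_plane. \<phi> z \<noteq> 0} \<Longrightarrow> norm z \<le> a"
    unfolding bounded_iff by blast
  define T where "T = max a 1"
  have zero: "\<phi> (x, t) = 0" if "0 \<le> t" "T < \<bar>x\<bar> \<or> T < t" for x t
  proof (rule ccontr)
    assume "\<phi> (x, t) \<noteq> 0"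
    then have "(x, t) \<in> closure {z \<in> half_plane. \<phi> z \<noteq> 0}"
      using that by (intro subsetD[OF closure_subset]) auto
    then have "norm (x, t) \<le> a" by (rule a)
    moreover have "\<bar>x\<bar> \<le> norm (x, t)" "\<bar>t\<bar> \<le> norm (x, t)"
      using norm_fst_le[of x t] norm_snd_le[of t x] by auto
    ultimately show False using that by (auto simp: T_def)
  qed
  have "dx \<phi> (x, t) = 0" if t: "0 \<le> t" "T < \<bar>x\<bar> \<or> T < t" for x t
  proof -
    have "((\<lambda>y. \<phi> (y, t)) has_real_derivative 0) (at x)"
    proof (cases "T < t")
      case True
      then have "(\<lambda>y. \<phi> (y, t)) = (\<lambda>y. 0)" using zero t by auto
      then show ?thesis by simp
    next
      case False
      then have xT: "x \<in> {y. T < \<bar>y\<bar>}" using t by simp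
      have op: "open {y::real. T < \<bar>y\<bar>}" by (intro open_Collect_less continuous_intros)
      show ?thesis
        by (rule has_field_derivative_transform_within_open[OF DERIV_const[of 0] op xT]) (use zero t in auto)
    qed
    then show ?thesis using der(1)[OF t(1), of x] DERIV_unique by blast
  qed
  moreover have "dt \<phi> (x, t) = 0" if t: "0 \<le> t" "T < \<bar>x\<bar> \<or> T < t" for x t
  proof -
    have "((\<lambda>s. \<phi> (x, s)) has_real_derivative 0) (at t within {0..})"
    proof (cases "T < \<bar>x\<bar>")
      case True
      show ?thesis
        by (rule has_field_derivative_transform_within[OF DERIV_const[of 0], of 1])
           (use zero[of _ x] t True in auto)
    next
      case False
      then have tT: "T < t" using t by simp
      have "\<phi> (x, s) = 0" if "0 \<le> s" "\<bar>s - t\<bar> < t - T" for s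
        using that by (intro zero) linarith+
      then show ?thesis
        by (intro has_field_derivative_transform_within[OF DERIV_const[of 0], of "t - T"])
           (use t tT in \<open>auto simp: dist_real_def\<close>)
    qed
    moreover have "at t within {0..} \<noteq> bot"
    proof
      assume bot: "at t within {0..} = bot"
      have "at_right t \<le> at t within {0..}" using t(1) by (intro at_le) auto
      then show False unfolding bot using trivial_limit_at_right_real[of t] by (simp add: bot_unique)
    qed
    ultimately show ?thesis
      using der(2)[OF t(1), of x] vector_derivative_unique_within unfolding has_real_derivative_iff_has_vector_derivative by blast
  qed
  ultimately show ?thesis using zero by (intro that[of T]) (auto simp: T_def)
qed

lemma test_function_bounds:
  assumes \<phi>: "test_function \<phi>"
  obtains T B where "0 < T" "0 \<le> B"
    "\<forall>x t. T \<le> t \<longrightarrow> \<phi> (x, t) = 0 \<and> dx \<phi> (x, t) = 0 \<and> dt \<phi> (x, t) = 0"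
    "\<forall>x t. 0 \<le> t \<longrightarrow> \<bar>\<phi> (x, t)\<bar> \<le> B \<and> \<bar>dx \<phi> (x, t)\<bar> \<le> B \<and> \<bar>dt \<phi> (x, t)\<bar> \<le> B"
proof -
  obtain T where T: "0 < T" "\<And>x t. 0 \<le> t \<Longrightarrow> T < \<bar>x\<bar> \<or> T < t \<Longrightarrow> \<phi> (x, t) = 0 \<and> dx \<phi> (x, t) = 0 \<and> dt \<phi> (x, t) = 0"
    using test_function_support[OF \<phi>] by blast
  have bd: "\<exists>B\<ge>0. \<forall>x t. 0 \<le> t \<longrightarrow> \<bar>f (x, t)\<bar> \<le> B"
    if f: "continuous_on half_plane f" "\<And>x t. 0 \<le> t \<Longrightarrow> T < \<bar>x\<bar> \<or> T < t \<Longrightarrow> f (x, t) = 0" for f :: "real \<times> real \<Rightarrow> real"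
  proof -
    have "compact ({- T..T} \<times> {0..T})" by (intro compact_Times) auto
    then have "compact (f ` ({- T..T} \<times> {0..T}))"
      by (rule compact_continuous_image[rotated]) (rule continuous_on_subset[OF f(1)], auto)
    then obtain B where B: "\<And>z. z \<in> {- T..T} \<times> {0..T} \<Longrightarrow> \<bar>f z\<bar> \<le> B"
      using compact_imp_bounded[of "f ` ({- T..T} \<times> {0..T})"] unfolding bounded_iff by auto
    have "\<bar>f (x, t)\<bar> \<le> max B 0" if "0 \<le> t" for x t
    proof (cases "T < \<bar>x\<bar> \<or> T < t")
      case True
      then show ?thesis using f(2)[OF that, of x] by simp
    next
      case False
      then have "(x, t) \<in> {- T..T} \<times> {0..T}" using that by (auto simp: abs_le_iff)
      from B[OF this] show ?thesis by simp
    qed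
    then show ?thesis by (intro exI[of _ "max B 0"]) auto
  qed
  note cont = test_function_derivatives(1-3)[OF \<phi>]
  obtain B1 B2 B3 where B: "0 \<le> B1" "0 \<le> B2" "0 \<le> B3"
    "\<And>x t. 0 \<le> t \<Longrightarrow> \<bar>\<phi> (x, t)\<bar> \<le> B1" "\<And>x t. 0 \<le> t \<Longrightarrow> \<bar>dx \<phi> (x, t)\<bar> \<le> B2" "\<And>x t. 0 \<le> t \<Longrightarrow> \<bar>dt \<phi> (x, t)\<bar> \<le> B3"
    using bd[OF cont(1)] bd[OF cont(2)] bd[OF cont(3)] T(2) by metis
  show ?thesis
  proof (rule that[of "T + 1" "max B1 (max B2 B3)"])
    show "\<forall>x t. T + 1 \<le> t \<longrightarrow> \<phi> (x, t) = 0 \<and> dx \<phi> (x, t) = 0 \<and> dt \<phi> (x, t) = 0"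
      using T by auto
    show "\<forall>x t. 0 \<le> t \<longrightarrow> \<bar>\<phi> (x, t)\<bar> \<le> max B1 (max B2 B3) \<and> \<bar>dx \<phi> (x, t)\<bar> \<le> max B1 (max B2 B3) \<and> \<bar>dt \<phi> (x, t)\<bar> \<le> max B1 (max B2 B3)"
      using B(4-6) by (auto simp: le_max_iff_disj)
  qed (use T B in auto)
qed

lemma test_function_lipschitz:
  assumes \<phi>: "test_function \<phi>"
    and B: "\<And>x t. 0 \<le> t \<Longrightarrow> \<bar>dx \<phi> (x, t)\<bar> \<le> B" "\<And>x t. 0 \<le> t \<Longrightarrow> \<bar>dt \<phi> (x, t)\<bar> \<le> B"
    and st: "0 \<le> s" "0 \<le> t"
  shows "\<bar>\<phi> (x, t) - \<phi> (y, s)\<bar> \<le> B * (\<bar>x - y\<bar> + \<bar>t - s\<bar>)"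
proof -
  note der = test_function_derivatives(4,5)[OF \<phi>]
  have "norm (\<phi> (x, t) - \<phi> (y, t)) \<le> B * norm (x - y)"
    by (rule field_differentiable_bound[of UNIV "\<lambda>x. \<phi> (x, t)" "\<lambda>x. dx \<phi> (x, t)"]) (use der st B in auto)
  moreover have "norm (\<phi> (y, t) - \<phi> (y, s)) \<le> B * norm (t - s)"
    by (rule field_differentiable_bound[of "{0..}" "\<lambda>t. \<phi> (y, t)" "\<lambda>t. dt \<phi> (y, t)"]) (use der st B in auto)
  ultimately show ?thesis by (simp add: distrib_left)
qed

text \<open>
  The chain rule along the sequence \<open>1/n\<close>, from the mean value theorem in space and
  joint continuity of the space derivative.
\<close>
lemma test_function_quotient:
  assumes \<phi>: "test_function \<phi>" and r: "0 < r" and b: "(\<lambda>n. real (Suc n) * (b n - a)) \<longlonglongrightarrow> v"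
  shows "(\<lambda>n. real (Suc n) * (\<phi> (b n, r + 1 / real (Suc n)) - \<phi> (a, r))) \<longlonglongrightarrow> dt \<phi> (a, r) + v * dx \<phi> (a, r)"
proof -
  note der = test_function_derivatives[OF \<phi>]
  let ?t = "\<lambda>n. r + 1 / real (Suc n)"
  have t0: "0 \<le> ?t n" for n using r by simp
  have "(\<lambda>n. (1 / real (Suc n)) * (real (Suc n) * (b n - a))) \<longlonglongrightarrow> 0 * v"
    by (intro tendsto_mult inverse_nat_tendsto b)
  then have "(\<lambda>n. b n - a) \<longlonglongrightarrow> 0" by simp
  then have ba: "b \<longlonglongrightarrow> a" by (simp add: LIM_zero_iff)
  have tr: "?t \<longlonglongrightarrow> r" using tendsto_add[OF tendsto_const inverse_nat_tendsto, of r] by simp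
  have "\<exists>\<xi>. \<bar>\<xi> - a\<bar> \<le> \<bar>b n - a\<bar> \<and> \<phi> (b n, ?t n) - \<phi> (a, ?t n) = dx \<phi> (\<xi>, ?t n) * (b n - a)" for n
  proof -
    consider "b n = a" | "b n < a" | "a < b n" by linarith
    then show ?thesis
    proof cases
      case 1 then show ?thesis by (intro exI[of _ a]) simp
    next
      case 2
      from MVT2[OF 2, of "\<lambda>y. \<phi> (y, ?t n)" "\<lambda>y. dx \<phi> (y, ?t n)", OF der(4)[OF t0]]
      obtain z where z: "b n < z" "z < a" "\<phi> (a, ?t n) - \<phi> (b n, ?t n) = (a - b n) * dx \<phi> (z, ?t n)" by blast
      then show ?thesis by (intro exI[of _ z]) (auto simp: algebra_simps)
    next
      case 3
      from MVT2[OF 3, of "\<lambda>y. \<phi> (y, ?t n)" "\<lambda>y. dx \<phi> (y, ?t n)", OF der(4)[OF t0]]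
      obtain z where z: "a < z" "z < b n" "\<phi> (b n, ?t n) - \<phi> (a, ?t n) = (b n - a) * dx \<phi> (z, ?t n)" by blast
      then show ?thesis by (intro exI[of _ z]) (auto simp: algebra_simps)
    qed
  qed
  then obtain \<xi> where \<xi>: "\<And>n. \<bar>\<xi> n - a\<bar> \<le> \<bar>b n - a\<bar>" "\<And>n. \<phi> (b n, ?t n) - \<phi> (a, ?t n) = dx \<phi> (\<xi> n, ?t n) * (b n - a)"
    by metis
  have "(\<lambda>n. \<xi> n - a) \<longlonglongrightarrow> 0"
    by (rule Lim_null_comparison[where g = "\<lambda>n. \<bar>b n - a\<bar>"])
       (use \<xi>(1) tendsto_rabs[OF \<open>(\<lambda>n. b n - a) \<longlonglongrightarrow> 0\<close>] in auto)
  then have \<xi>a: "\<xi> \<longlonglongrightarrow> a" by (simp add: LIM_zero_iff)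
  have "(\<lambda>n. dx \<phi> (\<xi> n, ?t n)) \<longlonglongrightarrow> dx \<phi> (a, r)"
    by (rule continuous_on_tendsto_compose[OF der(2) tendsto_Pair[OF \<xi>a tr]]) (use r t0 in auto)
  from tendsto_mult[OF this b]
  have 1: "(\<lambda>n. real (Suc n) * (\<phi> (b n, ?t n) - \<phi> (a, ?t n))) \<longlonglongrightarrow> dx \<phi> (a, r) * v"
    unfolding \<xi>(2) by (simp add: mult_ac)
  have "at r within {0..} = at r" using r by (intro at_within_interior) simp
  then have "((\<lambda>s. \<phi> (a, s)) has_real_derivative dt \<phi> (a, r)) (at r)" using der(5)[of r a] r by simp
  moreover have "(\<lambda>n. real (Suc n) * (?t n - r)) \<longlonglongrightarrow> 1" by simp
  ultimately have 2: "(\<lambda>n. real (Suc n) * (\<phi> (a, ?t n) - \<phi> (a, r))) \<longlonglongrightarrow> dt \<phi> (a, r) * 1"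
    by (rule quotient_chain_rule)
  from tendsto_add[OF 1 2] show ?thesis by (simp add: right_diff_distrib mult.commute add.commute)
qed

text \<open>
  The pathwise identity holds on \<open>(s, T]\<close> for \<open>s > 0\<close> only, since
  paths are differentiable away from time \<open>0\<close>. The initial value is recovered from
  the convergence of the means, for which continuity of the flow in \<open>L\<^sup>2\<close>
  suffices.
\<close>
lemma time_integration_by_parts:
  fixes \<Phi> G :: "real \<Rightarrow> real \<Rightarrow> real"
  assumes G: "(\<lambda>(r, m). G r m) \<in> borel_measurable (borel \<Otimes>\<^sub>M borel)" and T: "0 < T"
    and int: "\<And>r. 0 < r \<Longrightarrow> r \<le> T \<Longrightarrow> integrable U (G r)"
    and bd: "\<And>r. 0 < r \<Longrightarrow> r \<le> T \<Longrightarrow> (\<integral>m. \<bar>G r m\<bar> \<partial>U) \<le> M"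
    and \<Phi>_m: "\<And>s. \<Phi> s \<in> borel_measurable U"
    and path: "\<And>s. 0 < s \<Longrightarrow> s \<le> T \<Longrightarrow> AE m in U. - \<Phi> s m = (LBINT r:{s<..T}. G r m)"
    and lim: "(\<lambda>n. \<integral>m. \<Phi> (1 / real (Suc n)) m \<partial>U) \<longlonglongrightarrow> I"
  shows "(LBINT r:{0<..T}. \<integral>m. G r m \<partial>U) = - I"
proof -
  note [measurable] = measurable_uncurried[OF G] \<Phi>_m
  let ?g = "\<lambda>r. \<integral>m. G r m \<partial>U"
  have g_m: "?g \<in> borel_measurable borel"
    by (intro U.borel_measurable_lebesgue_integral) (simp add: split_beta')
  have g_bd: "\<bar>?g r\<bar> \<le> M" if "0 < r" "r \<le> T" for r
    by (rule order_trans[OF integral_abs_bound bd[OF that]])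
  have M: "0 \<le> M" using order_trans[OF abs_ge_zero g_bd[of T]] T by simp
  have tail: "(LBINT r:{s<..T}. ?g r) = - (\<integral>m. \<Phi> s m \<partial>U)" if s: "0 < s" "s \<le> T" for s
  proof -
    have "(LBINT r:{s<..T}. ?g r) = (\<integral>m. (LBINT r:{s<..T}. G r m) \<partial>U)"
      by (rule time_space_fubini(3)[OF G s(2), where M = M, symmetric]) (use int bd s in auto)
    also have "\<dots> = (\<integral>m. - \<Phi> s m \<partial>U)"
    proof (rule integral_cong_AE)
      show "(\<lambda>m. LBINT r:{s<..T}. G r m) \<in> borel_measurable U"
        by (rule borel_measurable_integrable, rule time_space_fubini(2)[OF G s(2), where M = M]) (use int bd s in auto)
      show "AE m in U. (LBINT r:{s<..T}. G r m) = - \<Phi> s m" using path[OF s] by eventually_elim simp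
    qed measurable
    finally show ?thesis by simp
  qed
  let ?h = "\<lambda>n. 1 / real (Suc n)"
  have "(\<lambda>n. (LBINT r:{0<..T}. ?g r) + (\<integral>m. \<Phi> (?h n) m \<partial>U)) \<longlonglongrightarrow> 0"
  proof (rule Lim_null_comparison)
    show "\<forall>\<^sub>F n in sequentially. norm ((LBINT r:{0<..T}. ?g r) + (\<integral>m. \<Phi> (?h n) m \<partial>U)) \<le> ?h n * M"
      using order_tendstoD(2)[OF inverse_nat_tendsto T]
    proof eventually_elim
      case (elim n)
      have "(LBINT r:{0<..T}. ?g r) = (LBINT r:{0<..?h n}. ?g r) + (LBINT r:{?h n<..T}. ?g r)"
        by (rule time_integral_split[OF g_m g_bd]) (use elim in auto)
      then have "(LBINT r:{0<..T}. ?g r) + (\<integral>m. \<Phi> (?h n) m \<partial>U) = (LBINT r:{0<..?h n}. ?g r)"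
        using tail[of "?h n"] elim by simp
      moreover have "\<bar>LBINT r:{0<..?h n}. ?g r\<bar> \<le> (?h n - 0) * M"
        using M g_bd elim by (intro set_int_abs_le) auto
      ultimately show ?case by simp
    qed
    show "(\<lambda>n. ?h n * M) \<longlonglongrightarrow> 0" using tendsto_mult[OF inverse_nat_tendsto tendsto_const, of M] by simp
  qed
  moreover have "(\<lambda>n. (LBINT r:{0<..T}. ?g r) + (\<integral>m. \<Phi> (?h n) m \<partial>U)) \<longlonglongrightarrow> (LBINT r:{0<..T}. ?g r) + I"
    by (intro tendsto_intros lim)
  ultimately have "(LBINT r:{0<..T}. ?g r) + I = 0" using LIMSEQ_unique by blast
  then show ?thesis by simp
qed

context sticky_flow
begin

lemma mean_abs_V: "0 < t \<Longrightarrow> t \<le> T \<Longrightarrow> (\<integral>m. \<bar>V t m\<bar> \<partial>U) \<le> Kb (T + 1)"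
  using cauchy_schwarz_U[of "V t" "\<lambda>_. 1" "Kb (T + 1)" 1] V_int V_L2[of t T] Kb_nonneg[of "T + 1"] by simp

lemma mean_abs_Z: "0 \<le> t \<Longrightarrow> t \<le> T \<Longrightarrow> (\<integral>m. \<bar>Z t m\<bar> \<partial>U) \<le> KZ T"
  using cauchy_schwarz_U[of "Z t" "\<lambda>_. 1" "KZ T" 1] Z_int Z_L2[of t T] KZ_nonneg[of T] by simp

lemma mean_abs_F: "0 \<le> t \<Longrightarrow> t \<le> T \<Longrightarrow> (\<integral>m. \<bar>F t m\<bar> \<partial>U) \<le> KF T"
  using cauchy_schwarz_U[of "F t" "\<lambda>_. 1" "KF T" 1] F_int F_L2[of t T] KF_nonneg[of T] by simp

lemma F_integrable: "0 \<le> t \<Longrightarrow> integrable U (F t)"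
  by (rule integrable_of_square[OF F_U_m F_int])

lemma mean_abs_ZV: "0 < t \<Longrightarrow> t \<le> T \<Longrightarrow> (\<integral>m. \<bar>Z t m * V t m\<bar> \<partial>U) \<le> KZ T * Kb (T + 1)"
  using Z_int[of t] Z_L2[of t T] V_int[of t] V_L2[of t T] KZ_nonneg[of T] Kb_nonneg[of "T + 1"]
  by (intro cauchy_schwarz_U) auto

lemma ZV_integrable: "0 < t \<Longrightarrow> integrable U (\<lambda>m. Z t m * V t m)"
  using Z_int[of t] V_int[of t] by (intro integrable_mult_square) auto

context
  fixes \<phi> T B
  assumes \<phi>: "test_function \<phi>" and T: "0 < T" and B0: "0 \<le> B"
    and late: "\<forall>x t. T \<le> t \<longrightarrow> \<phi> (x, t) = 0 \<and> dx \<phi> (x, t) = 0 \<and> dt \<phi> (x, t) = 0"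
    and bounded: "\<forall>x t. 0 \<le> t \<longrightarrow> \<bar>\<phi> (x, t)\<bar> \<le> B \<and> \<bar>dx \<phi> (x, t)\<bar> \<le> B \<and> \<bar>dt \<phi> (x, t)\<bar> \<le> B"
begin

lemma B: "0 \<le> t \<Longrightarrow> \<bar>\<phi> (x, t)\<bar> \<le> B" "0 \<le> t \<Longrightarrow> \<bar>dx \<phi> (x, t)\<bar> \<le> B" "0 \<le> t \<Longrightarrow> \<bar>dt \<phi> (x, t)\<bar> \<le> B"
  using bounded by blast+

abbreviation "fphi \<equiv> past_frozen \<phi>"
abbreviation "fdx \<equiv> past_frozen (dx \<phi>)"
abbreviation "fdt \<equiv> past_frozen (dt \<phi>)"

lemmas fphi_m [measurable (raw)] = measurable_past_frozen[OF test_function_derivatives(1)[OF \<phi>]]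
lemmas fdx_m [measurable (raw)] = measurable_past_frozen[OF test_function_derivatives(2)[OF \<phi>]]
lemmas fdt_m [measurable (raw)] = measurable_past_frozen[OF test_function_derivatives(3)[OF \<phi>]]

lemma frozen_bounds: "\<bar>fphi x t\<bar> \<le> B" "\<bar>fdx x t\<bar> \<le> B" "\<bar>fdt x t\<bar> \<le> B"
  using B[of "max 0 t" x] by (simp_all add: past_frozen_def)

lemma frozen_zero: "T \<le> t \<Longrightarrow> fphi x t = 0" "T \<le> t \<Longrightarrow> fdx x t = 0" "T \<le> t \<Longrightarrow> fdt x t = 0"
  using late T by simp_all

text \<open>
  The material derivative of \<open>\<phi>\<close> along the flow.
\<close>
definition mat_deriv :: "real \<Rightarrow> real \<Rightarrow> real" where
  "mat_deriv r m = fdt (X r m) r + V r m * fdx (X r m) r"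

lemma mat_deriv_m [measurable (raw)]:
  assumes [measurable]: "f \<in> borel_measurable M" "g \<in> borel_measurable M"
  shows "(\<lambda>x. mat_deriv (f x) (g x)) \<in> borel_measurable M"
  unfolding mat_deriv_def by measurable

lemma mat_deriv_bound: "\<bar>mat_deriv r m\<bar> \<le> B + B * \<bar>V r m\<bar>"
proof -
  have "\<bar>V r m * fdx (X r m) r\<bar> \<le> \<bar>V r m\<bar> * B"
    unfolding abs_mult by (intro mult_left_mono frozen_bounds) auto
  then show ?thesis unfolding mat_deriv_def using frozen_bounds(3)[of "X r m" r] by (simp add: mult.commute)
qed

lemma phi_isCont:
  assumes "0 < r" "m \<in> {0<..<1}"
  shows "isCont (\<lambda>r. fphi (X r m) r) r"
proof -
  have c: "isCont (\<lambda>p. fphi (fst p) (snd p)) (X r m, r)"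
    using continuous_past_frozen[OF test_function_derivatives(1)[OF \<phi>]] by (simp add: continuous_on_eq_continuous_at)
  have "isCont (\<lambda>r. (X r m, r)) r" by (intro continuous_Pair X_isCont assms continuous_ident)
  from isCont_o2[OF this c] show ?thesis by simp
qed

lemma phi_quotient:
  assumes r: "0 < r" and q: "(\<lambda>n. q n r m) \<longlonglongrightarrow> V r m"
  shows "(\<lambda>n. real (Suc n) * (fphi (X (r + tstep n) m) (r + tstep n) - fphi (X r m) r)) \<longlonglongrightarrow> mat_deriv r m"
proof -
  have "(\<lambda>n. real (Suc n) * (\<phi> (X (r + tstep n) m, r + tstep n) - \<phi> (X r m, r))) \<longlonglongrightarrow> dt \<phi> (X r m, r) + V r m * dx \<phi> (X r m, r)"
    by (rule test_function_quotient[OF \<phi> r]) (use q in \<open>simp add: q_def\<close>)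
  then show ?thesis using r by (simp add: mat_deriv_def)
qed

lemma phi_quotient_bound:
  assumes r: "0 < r"
  shows "\<bar>real (Suc n) * (fphi (X (r + tstep n) m) (r + tstep n) - fphi (X r m) r)\<bar> \<le> B * (\<bar>q n r m\<bar> + 1)"
proof -
  have "\<bar>\<phi> (X (r + tstep n) m, r + tstep n) - \<phi> (X r m, r)\<bar> \<le> B * (\<bar>X (r + tstep n) m - X r m\<bar> + \<bar>r + tstep n - r\<bar>)"
    using r by (intro test_function_lipschitz \<phi> B) auto
  then have "real (Suc n) * \<bar>fphi (X (r + tstep n) m) (r + tstep n) - fphi (X r m) r\<bar>
      \<le> real (Suc n) * (B * (\<bar>X (r + tstep n) m - X r m\<bar> + tstep n))"
    using r by (intro mult_left_mono) auto
  also have "\<dots> = B * (real (Suc n) * \<bar>X (r + tstep n) m - X r m\<bar> + real (Suc n) * tstep n)" by (simp add: algebra_simps)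
  also have "\<dots> = B * (\<bar>q n r m\<bar> + 1)" by (simp add: q_def abs_mult)
  finally show ?thesis by (simp add: abs_mult)
qed

lemma mat_deriv_integrable:
  assumes "0 < r"
  shows "integrable U (mat_deriv r)" "integrable U (\<lambda>m. Z r m * mat_deriv r m)" "integrable U (\<lambda>m. V r m * mat_deriv r m)"
    "integrable U (\<lambda>m. F r m * fphi (X r m) r)"
proof -
  have r0: "0 \<le> r" using assms by simp
  have V2: "integrable U (\<lambda>m. V r m * V r m)" using V_int[OF assms] by (intro integrable_mult_square) auto
  have m: "integrable U (\<lambda>m. g m * mat_deriv r m)" if "integrable U g" "integrable U (\<lambda>m. g m * V r m)" for g
  proof -
    have [measurable]: "g \<in> borel_measurable U" using that by simp
    show ?thesis
    proof (rule Bochner_Integration.integrable_bound)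
      show "integrable U (\<lambda>m. B * \<bar>g m\<bar> + B * \<bar>g m * V r m\<bar>)" using that by simp
      show "AE m in U. norm (g m * mat_deriv r m) \<le> norm (B * \<bar>g m\<bar> + B * \<bar>g m * V r m\<bar>)"
      proof (rule AE_I2)
        fix m
        have "\<bar>g m\<bar> * \<bar>mat_deriv r m\<bar> \<le> \<bar>g m\<bar> * (B + B * \<bar>V r m\<bar>)" by (intro mult_left_mono mat_deriv_bound) auto
        also have "\<dots> = B * \<bar>g m\<bar> + B * \<bar>g m * V r m\<bar>" by (simp add: algebra_simps abs_mult)
        also have "\<dots> \<le> \<bar>B * \<bar>g m\<bar> + B * \<bar>g m * V r m\<bar>\<bar>" by (rule abs_ge_self)
        finally show "norm (g m * mat_deriv r m) \<le> norm (B * \<bar>g m\<bar> + B * \<bar>g m * V r m\<bar>)" by (simp only: real_norm_def abs_mult)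
      qed
    qed measurable
  qed
  show "integrable U (mat_deriv r)" using m[of "\<lambda>_. 1"] V_integrable[OF assms] by simp
  show "integrable U (\<lambda>m. Z r m * mat_deriv r m)" by (rule m[OF Z_integrable[OF r0] ZV_integrable[OF assms]])
  show "integrable U (\<lambda>m. V r m * mat_deriv r m)" by (rule m[OF V_integrable[OF assms] V2])
  show "integrable U (\<lambda>m. F r m * fphi (X r m) r)"
    using integrable_bounded_mult[OF F_integrable[OF r0], of "\<lambda>m. fphi (X r m) r" B] frozen_bounds by (simp add: mult.commute)
qed

lemma mean_abs_mult_mat_deriv:
  assumes r: "0 < r" "r \<le> T" and g: "integrable U g" "integrable U (\<lambda>m. g m * V r m)"
    and M: "(\<integral>m. \<bar>g m\<bar> \<partial>U) \<le> M1" "(\<integral>m. \<bar>g m * V r m\<bar> \<partial>U) \<le> M2" and i: "integrable U (\<lambda>m. g m * mat_deriv r m)"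
  shows "(\<integral>m. \<bar>g m * mat_deriv r m\<bar> \<partial>U) \<le> B * M1 + B * M2"
proof -
  have "(\<integral>m. \<bar>g m * mat_deriv r m\<bar> \<partial>U) \<le> (\<integral>m. B * \<bar>g m\<bar> + B * \<bar>g m * V r m\<bar> \<partial>U)"
  proof (rule integral_mono)
    show "integrable U (\<lambda>m. \<bar>g m * mat_deriv r m\<bar>)" using i by simp
    show "integrable U (\<lambda>m. B * \<bar>g m\<bar> + B * \<bar>g m * V r m\<bar>)" using g by simp
    fix m
    have "\<bar>g m\<bar> * \<bar>mat_deriv r m\<bar> \<le> \<bar>g m\<bar> * (B + B * \<bar>V r m\<bar>)" by (intro mult_left_mono mat_deriv_bound) auto
    then show "\<bar>g m * mat_deriv r m\<bar> \<le> B * \<bar>g m\<bar> + B * \<bar>g m * V r m\<bar>" by (simp add: algebra_simps abs_mult)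
  qed
  also have "\<dots> = B * (\<integral>m. \<bar>g m\<bar> \<partial>U) + B * (\<integral>m. \<bar>g m * V r m\<bar> \<partial>U)" using g by simp
  also have "\<dots> \<le> B * M1 + B * M2" using M B0 by (intro add_mono mult_left_mono) auto
  finally show ?thesis .
qed

lemma mean_abs_mat_deriv:
  assumes r: "0 < r" "r \<le> T"
  shows "(\<integral>m. \<bar>mat_deriv r m\<bar> \<partial>U) \<le> B * 1 + B * Kb (T + 1)"
    and "(\<integral>m. \<bar>Z r m * mat_deriv r m\<bar> \<partial>U) \<le> B * KZ T + B * (KZ T * Kb (T + 1))"
    and "(\<integral>m. \<bar>V r m * mat_deriv r m\<bar> \<partial>U) \<le> B * Kb (T + 1) + B * (Kb (T + 1) * Kb (T + 1))"
    and "(\<integral>m. \<bar>F r m * fphi (X r m) r\<bar> \<partial>U) \<le> KF T * B"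
proof -
  have r0: "0 \<le> r" using r by simp
  note mi = mat_deriv_integrable[OF r(1)]
  have V2: "integrable U (\<lambda>m. V r m * V r m)" using V_int[OF r(1)] by (intro integrable_mult_square) auto
  have VV: "(\<integral>m. \<bar>V r m * V r m\<bar> \<partial>U) \<le> Kb (T + 1) * Kb (T + 1)"
    using V_int[OF r(1)] V_L2[OF r] Kb_nonneg[of "T + 1"] T by (intro cauchy_schwarz_U) auto
  show "(\<integral>m. \<bar>mat_deriv r m\<bar> \<partial>U) \<le> B * 1 + B * Kb (T + 1)"
    using mean_abs_mult_mat_deriv[OF r, of "\<lambda>_. 1" 1 "Kb (T + 1)"] mi(1) V_integrable[OF r(1)] mean_abs_V[OF r]
    by (simp add: U.prob_space[unfolded space_U])
  show "(\<integral>m. \<bar>Z r m * mat_deriv r m\<bar> \<partial>U) \<le> B * KZ T + B * (KZ T * Kb (T + 1))"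
    by (rule mean_abs_mult_mat_deriv[OF r Z_integrable[OF r0] ZV_integrable[OF r(1)] mean_abs_Z[OF r0 r(2)] mean_abs_ZV[OF r] mi(2)])
  show "(\<integral>m. \<bar>V r m * mat_deriv r m\<bar> \<partial>U) \<le> B * Kb (T + 1) + B * (Kb (T + 1) * Kb (T + 1))"
    by (rule mean_abs_mult_mat_deriv[OF r V_integrable[OF r(1)] V2 mean_abs_V[OF r] VV mi(3)])
  have "(\<integral>m. \<bar>F r m * fphi (X r m) r\<bar> \<partial>U) \<le> (\<integral>m. \<bar>F r m\<bar> * B \<partial>U)"
  proof (rule integral_mono)
    show "integrable U (\<lambda>m. \<bar>F r m * fphi (X r m) r\<bar>)" using mi(4) by simp
    show "integrable U (\<lambda>m. \<bar>F r m\<bar> * B)" using F_integrable[OF r0] by simp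
    show "\<bar>F r m * fphi (X r m) r\<bar> \<le> \<bar>F r m\<bar> * B" for m unfolding abs_mult by (intro mult_left_mono frozen_bounds) auto
  qed
  also have "\<dots> \<le> KF T * B" using mean_abs_F[OF r0 r(2)] B0 F_integrable[OF r0] by (simp add: mult_right_mono)
  finally show "(\<integral>m. \<bar>F r m * fphi (X r m) r\<bar> \<partial>U) \<le> KF T * B" .
qed

lemma phi_initial_diff:
  assumes "0 \<le> h"
  shows "\<bar>fphi (X h m) h - fphi (X 0 m) 0\<bar> \<le> B * (\<bar>X h m - X 0 m\<bar> + h)"
  using test_function_lipschitz[OF \<phi> B(2,3), where s = 0 and t = h and x = "X h m" and y = "X 0 m"] assms by simp

lemma X_diff_int: "0 \<le> h \<Longrightarrow> integrable U (\<lambda>m. (X h m - X 0 m)\<^sup>2)"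
  using integrable_square_add[of "X h" "X 0" 1 "-1"] X_int[of h] X_int[of 0] by simp

text \<open>
  Integration of the material derivative along each path, as \<open>\<phi>\<close> vanishes from
  time \<open>T\<close> on.
\<close>
lemma mass_identity:
  "(LBINT r:{0<..T}. \<integral>m. mat_deriv r m \<partial>U) = - (\<integral>m. fphi (X 0 m) 0 \<partial>U)"
proof (rule time_integration_by_parts[where \<Phi> = "\<lambda>s m. fphi (X s m) s" and M = "B * 1 + B * Kb (T + 1)"])
  show "(\<lambda>(r, m). mat_deriv r m) \<in> borel_measurable (borel \<Otimes>\<^sub>M borel)" by (simp add: split_beta')
  fix s assume s: "0 < s" "s \<le> T"
  show "AE m in U. - fphi (X s m) s = (LBINT r:{s<..T}. mat_deriv r m)"
    using V_lim_time AE_space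
  proof eventually_elim
    case (elim m)
    then have m: "m \<in> {0<..<1}" by simp
    have "fphi (X T m) T - fphi (X s m) s = (LBINT r:{s<..T}. mat_deriv r m)"
    proof (rule seq_FTC[OF s(2), where B = "B * (Lc s (T + 1) * \<beta> m + 1)"])
      show "isCont (\<lambda>r. fphi (X r m) r) r" if "s \<le> r" for r using that s m by (intro phi_isCont) auto
      show "\<bar>real (Suc n) * (fphi (X (r + 1 / real (Suc n)) m) (r + 1 / real (Suc n)) - fphi (X r m) r)\<bar> \<le> B * (Lc s (T + 1) * \<beta> m + 1)"
        if r: "s < r" "r \<le> T" for n r
      proof -
        have "B * (\<bar>q n r m\<bar> + 1) \<le> B * (Lc s (T + 1) * \<beta> m + 1)"
          using q_bound[OF s(1), of r T m n] r m B0 by (intro mult_left_mono add_right_mono) auto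
        then show ?thesis using phi_quotient_bound[of r n m] r s by linarith
      qed
      show "AE r in lborel. s < r \<and> r \<le> T \<longrightarrow> (\<lambda>n. real (Suc n) * (fphi (X (r + 1 / real (Suc n)) m) (r + 1 / real (Suc n)) - fphi (X r m) r)) \<longlonglongrightarrow> mat_deriv r m"
        using elim(1)
      proof eventually_elim
        case (elim r)
        then show ?case using phi_quotient[of r m] s by simp
      qed
    qed measurable
    then show ?case using frozen_zero(1)[of T] by simp
  qed
next
  show "(\<lambda>n. \<integral>m. fphi (X (1 / real (Suc n)) m) (1 / real (Suc n)) \<partial>U) \<longlonglongrightarrow> (\<integral>m. fphi (X 0 m) 0 \<partial>U)"
  proof -
    have i: "integrable U (\<lambda>m. fphi (X h m) h)" for h
      using integrable_bounded_mult[of "\<lambda>_. 1" "\<lambda>m. fphi (X h m) h" B] frozen_bounds by simp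
    have "(\<lambda>n. (\<integral>m. fphi (X (tstep n) m) (tstep n) \<partial>U) - (\<integral>m. fphi (X 0 m) 0 \<partial>U)) \<longlonglongrightarrow> 0"
    proof (rule Lim_null_comparison)
      show "\<forall>\<^sub>F n in sequentially. norm ((\<integral>m. fphi (X (tstep n) m) (tstep n) \<partial>U) - (\<integral>m. fphi (X 0 m) 0 \<partial>U)) \<le> (B * (Kb 1 + 1)) * tstep n"
      proof (intro always_eventually allI)
        fix n
        have ix: "integrable U (\<lambda>m. \<bar>X (tstep n) m - X 0 m\<bar>)" using X_integrable[of "tstep n"] X_integrable[of 0] by simp
        have "norm ((\<integral>m. fphi (X (tstep n) m) (tstep n) \<partial>U) - (\<integral>m. fphi (X 0 m) 0 \<partial>U)) = \<bar>\<integral>m. fphi (X (tstep n) m) (tstep n) - fphi (X 0 m) 0 \<partial>U\<bar>"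
          by (simp only: real_norm_def Bochner_Integration.integral_diff[OF i i])
        also have "\<dots> \<le> (\<integral>m. \<bar>fphi (X (tstep n) m) (tstep n) - fphi (X 0 m) 0\<bar> \<partial>U)" by (rule integral_abs_bound)
        also have "\<dots> \<le> (\<integral>m. B * (\<bar>X (tstep n) m - X 0 m\<bar> + tstep n) \<partial>U)"
          using ix by (intro integral_mono integrable_abs Bochner_Integration.integrable_diff i phi_initial_diff) auto
        also have "\<dots> = B * ((\<integral>m. \<bar>X (tstep n) m - X 0 m\<bar> \<partial>U) + tstep n)" using ix by (simp add: U.prob_space[unfolded space_U])
        also have "(\<integral>m. \<bar>X (tstep n) m - X 0 m\<bar> \<partial>U) \<le> Kb 1 * (tstep n - 0)"
          using cauchy_schwarz_U[of "\<lambda>m. X (tstep n) m - X 0 m" "\<lambda>_. 1" "Kb 1 * (tstep n - 0)" 1] X_diff_int[of "tstep n"] X_lip[of 0 "tstep n" 1] Kb_nonneg[of 1]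
          by simp
        finally show "norm ((\<integral>m. fphi (X (tstep n) m) (tstep n) \<partial>U) - (\<integral>m. fphi (X 0 m) 0 \<partial>U)) \<le> (B * (Kb 1 + 1)) * tstep n"
          using B0 by (simp add: mult_left_mono distrib_right distrib_left mult.assoc add_divide_distrib)
      qed
      show "(\<lambda>n. (B * (Kb 1 + 1)) * tstep n) \<longlonglongrightarrow> 0" using tendsto_mult[OF tendsto_const tstep_tendsto, of "B * (Kb 1 + 1)"] by simp
    qed
    then show ?thesis by (simp add: LIM_zero_iff)
  qed
qed (use T mat_deriv_integrable mean_abs_mat_deriv in auto)

text \<open>
  The product rule for \<open>Z \<phi>\<close> along each path. It is stated with the impulse
  \<open>Z\<close>, which has the time derivative \<open>F\<close>; the velocity
  \<open>V\<close> itself may jump at collisions.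
\<close>
lemma momentum_identity_impulse:
  "(LBINT r:{0<..T}. \<integral>m. F r m * fphi (X r m) r + Z r m * mat_deriv r m \<partial>U) = - (\<integral>m. Z 0 m * fphi (X 0 m) 0 \<partial>U)"
proof (rule time_integration_by_parts[where \<Phi> = "\<lambda>s m. Z s m * fphi (X s m) s" and M = "KF T * B + (B * KZ T + B * (KZ T * Kb (T + 1)))"])
  show "(\<lambda>(r, m). F r m * fphi (X r m) r + Z r m * mat_deriv r m) \<in> borel_measurable (borel \<Otimes>\<^sub>M borel)" by (simp add: split_beta')
  fix s assume s: "0 < s" "s \<le> T"
  note mi = mat_deriv_integrable[OF s(1)]
  show "integrable U (\<lambda>m. F s m * fphi (X s m) s + Z s m * mat_deriv s m)" using mi(2,4) by simp
  have "(\<integral>m. \<bar>F s m * fphi (X s m) s + Z s m * mat_deriv s m\<bar> \<partial>U) \<le> (\<integral>m. \<bar>F s m * fphi (X s m) s\<bar> + \<bar>Z s m * mat_deriv s m\<bar> \<partial>U)"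
    using mi(2,4) by (intro integral_mono) auto
  also have "\<dots> = (\<integral>m. \<bar>F s m * fphi (X s m) s\<bar> \<partial>U) + (\<integral>m. \<bar>Z s m * mat_deriv s m\<bar> \<partial>U)" using mi(2,4) by simp
  also have "\<dots> \<le> KF T * B + (B * KZ T + B * (KZ T * Kb (T + 1)))" using mean_abs_mat_deriv(2,4)[OF s] by (rule add_mono[rotated])
  finally show "(\<integral>m. \<bar>F s m * fphi (X s m) s + Z s m * mat_deriv s m\<bar> \<partial>U) \<le> KF T * B + (B * KZ T + B * (KZ T * Kb (T + 1)))" .
  show "AE m in U. - (Z s m * fphi (X s m) s) = (LBINT r:{s<..T}. F r m * fphi (X r m) r + Z r m * mat_deriv r m)"
    using V_lim_time AE_space
  proof eventually_elim
    case (elim m)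
    then have m: "m \<in> {0<..<1}" by simp
    have split: "real (Suc n) * (Z (r + tstep n) m * fphi (X (r + tstep n) m) (r + tstep n) - Z r m * fphi (X r m) r)
        = real (Suc n) * (Z (r + tstep n) m - Z r m) * fphi (X (r + tstep n) m) (r + tstep n)
          + Z r m * (real (Suc n) * (fphi (X (r + tstep n) m) (r + tstep n) - fphi (X r m) r))" for n r
      by (simp add: algebra_simps)
    have "Z T m * fphi (X T m) T - Z s m * fphi (X s m) s = (LBINT r:{s<..T}. F r m * fphi (X r m) r + Z r m * mat_deriv r m)"
    proof (rule seq_FTC[OF s(2), where B = "BF (T + 1) m * B + BZ T m * (B * (Lc s (T + 1) * \<beta> m + 1))"])
      show "isCont (\<lambda>r. Z r m * fphi (X r m) r) r" if "s \<le> r" for r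
        using that s m by (intro isCont_mult phi_isCont Z_isCont) auto
      show "\<bar>real (Suc n) * (Z (r + 1 / real (Suc n)) m * fphi (X (r + 1 / real (Suc n)) m) (r + 1 / real (Suc n)) - Z r m * fphi (X r m) r)\<bar>
          \<le> BF (T + 1) m * B + BZ T m * (B * (Lc s (T + 1) * \<beta> m + 1))"
        if r: "s < r" "r \<le> T" for n r
      proof -
        have "B * (\<bar>q n r m\<bar> + 1) \<le> B * (Lc s (T + 1) * \<beta> m + 1)"
          using q_bound[OF s(1), of r T m n] r m B0 by (intro mult_left_mono add_right_mono) auto
        then have qb: "\<bar>real (Suc n) * (fphi (X (r + tstep n) m) (r + tstep n) - fphi (X r m) r)\<bar> \<le> B * (Lc s (T + 1) * \<beta> m + 1)"
          using phi_quotient_bound[of r n m] r s by linarith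
        have "\<bar>real (Suc n) * (Z (r + tstep n) m - Z r m)\<bar> * \<bar>fphi (X (r + tstep n) m) (r + tstep n)\<bar> \<le> BF (T + 1) m * B"
          using Z_quotient_bound[of r T m n] r s m BF_nonneg[OF m, of "T + 1"] T by (intro mult_mono frozen_bounds) auto
        moreover have "\<bar>Z r m\<bar> * \<bar>real (Suc n) * (fphi (X (r + tstep n) m) (r + tstep n) - fphi (X r m) r)\<bar> \<le> BZ T m * (B * (Lc s (T + 1) * \<beta> m + 1))"
          using Z_bound[of r T m] r s m qb BZ_nonneg[OF m, of T] T by (intro mult_mono) auto
        ultimately show ?thesis
          unfolding split by (intro order_trans[OF abs_triangle_ineq]) (simp add: abs_mult)
      qed
      show "AE r in lborel. s < r \<and> r \<le> T \<longrightarrow>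
          (\<lambda>n. real (Suc n) * (Z (r + 1 / real (Suc n)) m * fphi (X (r + 1 / real (Suc n)) m) (r + 1 / real (Suc n)) - Z r m * fphi (X r m) r))
          \<longlonglongrightarrow> F r m * fphi (X r m) r + Z r m * mat_deriv r m"
        using elim(1)
      proof eventually_elim
        case (elim r)
        show ?case
        proof
          assume "s < r \<and> r \<le> T"
          then have r: "0 < r" using s by simp
          have "(\<lambda>n. r + tstep n) \<longlonglongrightarrow> r" using tendsto_add[OF tendsto_const tstep_tendsto, of r] by simp
          from isCont_tendsto_compose[OF phi_isCont[OF r m] this]
          show "(\<lambda>n. real (Suc n) * (Z (r + 1 / real (Suc n)) m * fphi (X (r + 1 / real (Suc n)) m) (r + 1 / real (Suc n)) - Z r m * fphi (X r m) r))
          \<longlonglongrightarrow> F r m * fphi (X r m) r + Z r m * mat_deriv r m"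
            unfolding split using elim r m by (intro tendsto_add tendsto_mult tendsto_const Z_quotient phi_quotient) auto
        qed
      qed
    qed measurable
    then show ?case using frozen_zero(1)[of T] by simp
  qed
next
  show "(\<lambda>n. \<integral>m. Z (1 / real (Suc n)) m * fphi (X (1 / real (Suc n)) m) (1 / real (Suc n)) \<partial>U) \<longlonglongrightarrow> (\<integral>m. Z 0 m * fphi (X 0 m) 0 \<partial>U)"
  proof -
    have i: "integrable U (\<lambda>m. Z h m * fphi (X h m) h)" if "0 \<le> h" for h
      using integrable_bounded_mult[OF Z_integrable[OF that], of "\<lambda>m. fphi (X h m) h" B] frozen_bounds by (simp add: mult.commute)
    define b where "b = (\<integral>m. BF 1 m \<partial>U)"
    \<comment> \<open>Lipschitz constant at time \<open>0\<close> of the mean of \<open>Z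
        \<phi>\<close>\<close>
    define K where "K = b * B + B * (KZ 0 * Kb 1 + KZ 0)"
    have "(\<lambda>n. (\<integral>m. Z (tstep n) m * fphi (X (tstep n) m) (tstep n) \<partial>U) - (\<integral>m. Z 0 m * fphi (X 0 m) 0 \<partial>U)) \<longlonglongrightarrow> 0"
    proof (rule Lim_null_comparison)
      show "\<forall>\<^sub>F n in sequentially. norm ((\<integral>m. Z (tstep n) m * fphi (X (tstep n) m) (tstep n) \<partial>U) - (\<integral>m. Z 0 m * fphi (X 0 m) 0 \<partial>U)) \<le> K * tstep n"
      proof (intro always_eventually allI)
        fix n
        have h: "0 \<le> tstep n" "tstep n \<le> 1" by auto
        have izx: "integrable U (\<lambda>m. Z 0 m * (X (tstep n) m - X 0 m))"
          using Z_int[of 0] X_diff_int[OF h(1)] by (intro integrable_mult_square) auto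
        let ?D = "\<lambda>m. tstep n * B * BF 1 m + B * (\<bar>Z 0 m * (X (tstep n) m - X 0 m)\<bar> + tstep n * \<bar>Z 0 m\<bar>)"
        have iD: "integrable U ?D" using izx integrable_BF Z_integrable[of 0] by simp
        have pw: "\<bar>Z (tstep n) m * fphi (X (tstep n) m) (tstep n) - Z 0 m * fphi (X 0 m) 0\<bar> \<le> ?D m" if m: "m \<in> {0<..<1}" for m
        proof -
          have "Z (tstep n) m * fphi (X (tstep n) m) (tstep n) - Z 0 m * fphi (X 0 m) 0
              = (Z (tstep n) m - Z 0 m) * fphi (X (tstep n) m) (tstep n) + Z 0 m * (fphi (X (tstep n) m) (tstep n) - fphi (X 0 m) 0)"
            by (simp add: algebra_simps)
          moreover have "\<bar>(Z (tstep n) m - Z 0 m) * fphi (X (tstep n) m) (tstep n)\<bar> \<le> ((tstep n - 0) * BF 1 m) * B"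
            unfolding abs_mult using h m BF_nonneg[OF m, of 1] by (intro mult_mono Z_lip frozen_bounds) auto
          moreover have "\<bar>Z 0 m * (fphi (X (tstep n) m) (tstep n) - fphi (X 0 m) 0)\<bar> \<le> \<bar>Z 0 m\<bar> * (B * (\<bar>X (tstep n) m - X 0 m\<bar> + tstep n))"
            unfolding abs_mult using phi_initial_diff[OF h(1)] by (intro mult_left_mono) auto
          ultimately have "\<bar>Z (tstep n) m * fphi (X (tstep n) m) (tstep n) - Z 0 m * fphi (X 0 m) 0\<bar>
              \<le> ((tstep n - 0) * BF 1 m) * B + \<bar>Z 0 m\<bar> * (B * (\<bar>X (tstep n) m - X 0 m\<bar> + tstep n))"
            by linarith
          also have "\<dots> = ?D m" by (simp only: abs_mult diff_0_right distrib_left mult_ac)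
          finally show ?thesis .
        qed
        have "norm ((\<integral>m. Z (tstep n) m * fphi (X (tstep n) m) (tstep n) \<partial>U) - (\<integral>m. Z 0 m * fphi (X 0 m) 0 \<partial>U))
            = \<bar>\<integral>m. Z (tstep n) m * fphi (X (tstep n) m) (tstep n) - Z 0 m * fphi (X 0 m) 0 \<partial>U\<bar>"
          by (simp only: real_norm_def Bochner_Integration.integral_diff[OF i[OF h(1)] i[OF order_refl]])
        also have "\<dots> \<le> (\<integral>m. \<bar>Z (tstep n) m * fphi (X (tstep n) m) (tstep n) - Z 0 m * fphi (X 0 m) 0\<bar> \<partial>U)" by (rule integral_abs_bound)
        also have "\<dots> \<le> (\<integral>m. ?D m \<partial>U)"
          by (intro integral_mono integrable_abs Bochner_Integration.integrable_diff i iD pw order_refl h) simp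
        also have "\<dots> = tstep n * B * b + B * ((\<integral>m. \<bar>Z 0 m * (X (tstep n) m - X 0 m)\<bar> \<partial>U) + tstep n * (\<integral>m. \<bar>Z 0 m\<bar> \<partial>U))"
          unfolding b_def using izx integrable_BF Z_integrable[of 0] by simp
        also have "\<dots> \<le> tstep n * B * b + B * (KZ 0 * (Kb 1 * (tstep n - 0)) + tstep n * KZ 0)"
        proof (intro add_left_mono mult_left_mono add_mono B0)
          show "(\<integral>m. \<bar>Z 0 m * (X (tstep n) m - X 0 m)\<bar> \<partial>U) \<le> KZ 0 * (Kb 1 * (tstep n - 0))"
            using Z_int[of 0] Z_L2[of 0 0] X_diff_int[OF h(1)] X_lip[of 0 "tstep n" 1] h KZ_nonneg[of 0] Kb_nonneg[of 1]
            by (intro cauchy_schwarz_U) auto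
          show "(\<integral>m. \<bar>Z 0 m\<bar> \<partial>U) \<le> KZ 0" by (rule mean_abs_Z) auto
        qed (use h in auto)
        also have "\<dots> = K * tstep n" by (simp add: K_def algebra_simps)
        finally show "norm ((\<integral>m. Z (tstep n) m * fphi (X (tstep n) m) (tstep n) \<partial>U) - (\<integral>m. Z 0 m * fphi (X 0 m) 0 \<partial>U)) \<le> K * tstep n" .
      qed
      show "(\<lambda>n. K * tstep n) \<longlonglongrightarrow> 0" using tendsto_mult[OF tendsto_const tstep_tendsto, of K] by simp
    qed
    then show ?thesis by (simp add: LIM_zero_iff)
  qed
qed (use T in auto)

text \<open>
  The material derivative is a function of the position.
\<close>
lemma mat_deriv_projection:
  assumes r: "0 < r"
  shows "(\<integral>m. V r m * mat_deriv r m \<partial>U) = (\<integral>m. Z r m * mat_deriv r m \<partial>U)"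
proof -
  define \<psi> where "\<psi> x = fdt x r + V r (Minv r x) * fdx x r" for x
  have [measurable]: "\<psi> \<in> borel_measurable borel" unfolding \<psi>_def[abs_def] by measurable
  have \<psi>: "\<psi> (X r m) = mat_deriv r m" if "m \<in> {0<..<1}" for m
    using V_Minv[OF r that] by (simp add: \<psi>_def mat_deriv_def)
  note mi = mat_deriv_integrable[OF r]
  have "(\<integral>m. \<psi> (X r m) * V r m \<partial>U) = (\<integral>m. \<psi> (X r m) * Z r m \<partial>U)"
  proof (rule V_projection[OF r])
    show "integrable U (\<lambda>m. \<psi> (X r m) * V r m)"
      using mi(3) integrable_cong_U[of "\<lambda>m. \<psi> (X r m) * V r m" "\<lambda>m. V r m * mat_deriv r m"] \<psi> by (simp add: mult.commute)
    show "integrable U (\<lambda>m. \<psi> (X r m) * Z r m)"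
      using mi(2) integrable_cong_U[of "\<lambda>m. \<psi> (X r m) * Z r m" "\<lambda>m. Z r m * mat_deriv r m"] \<psi> by (simp add: mult.commute)
  qed measurable
  then show ?thesis
    using integral_cong_U[of "\<lambda>m. \<psi> (X r m) * V r m" "\<lambda>m. V r m * mat_deriv r m"]
      integral_cong_U[of "\<lambda>m. \<psi> (X r m) * Z r m" "\<lambda>m. Z r m * mat_deriv r m"] \<psi> by (simp add: mult.commute)
qed

lemma momentum_identity:
  "(LBINT r:{0<..T}. \<integral>m. V r m * mat_deriv r m \<partial>U) + (\<integral>m. fphi (X 0 m) 0 * v0 (X 0 m) \<partial>U)
    = (LBINT r:{0<..T}. \<integral>m. - (F r m * fphi (X r m) r) \<partial>U)"
proof -
  have "(LBINT r:{0<..T}. \<integral>m. F r m * fphi (X r m) r + Z r m * mat_deriv r m \<partial>U)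
      = (LBINT r:{0<..T}. (\<integral>m. F r m * fphi (X r m) r \<partial>U) + (\<integral>m. V r m * mat_deriv r m \<partial>U))"
    by (rule set_lebesgue_integral_cong) (use mat_deriv_integrable mat_deriv_projection in auto)
  also have "\<dots> = (LBINT r:{0<..T}. \<integral>m. F r m * fphi (X r m) r \<partial>U) + (LBINT r:{0<..T}. \<integral>m. V r m * mat_deriv r m \<partial>U)"
  proof (rule set_integral_add(2))
    show "set_integrable lborel {0<..T} (\<lambda>r. \<integral>m. F r m * fphi (X r m) r \<partial>U)"
      by (rule time_space_fubini(1)[where M = "KF T * B"])
         (use T mat_deriv_integrable(4) mean_abs_mat_deriv(4) in \<open>auto simp: split_beta'\<close>)
    show "set_integrable lborel {0<..T} (\<lambda>r. \<integral>m. V r m * mat_deriv r m \<partial>U)"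
      by (rule time_space_fubini(1)[where M = "B * Kb (T + 1) + B * (Kb (T + 1) * Kb (T + 1))"])
         (use T mat_deriv_integrable(3) mean_abs_mat_deriv(3) in \<open>auto simp: split_beta'\<close>)
  qed
  finally show ?thesis
    using momentum_identity_impulse by (simp add: Z_0 mult.commute set_lebesgue_integral_def)
qed

end

end

section \<open>The Eulerian solution\<close>

text \<open>
  A single interval already gives uniform continuity.
\<close>
lemma absolutely_continuous_fun_single:
  assumes "absolutely_continuous_fun f" "0 < \<epsilon>"
  obtains \<delta> where "0 < \<delta>" "\<And>x y. \<bar>x - y\<bar> < \<delta> \<Longrightarrow> \<bar>f x - f y\<bar> < \<epsilon>"
proof -
  obtain \<delta> where \<delta>: "0 < \<delta>" and ac: "\<And>(n::nat) a b.
        (\<forall>k<n. a k < b k) \<and> disjoint_family_on (\<lambda>k. {a k<..<b k}) {..<n} \<and> (\<Sum>k<n. b k - a k) < \<delta> \<longrightarrow>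
        (\<Sum>k<n. \<bar>f (b k) - f (a k)\<bar>) < \<epsilon>"
    using assms unfolding absolutely_continuous_fun_def by blast
  have lt: "\<bar>f y - f x\<bar> < \<epsilon>" if "x < y" "y - x < \<delta>" for x y
    using ac[of 1 "\<lambda>_. x" "\<lambda>_. y"] that by (simp add: disjoint_family_on_def)
  have "\<bar>f x - f y\<bar> < \<epsilon>" if "\<bar>x - y\<bar> < \<delta>" for x y
    using lt[of x y] lt[of y x] that assms(2) by (cases x y rule: linorder_cases) auto
  with \<delta> show ?thesis by (rule that)
qed

lemma absolutely_continuous_fun_continuous:
  assumes "absolutely_continuous_fun f"
  shows "continuous_on UNIV f"
  unfolding continuous_on_iff
proof (intro ballI allI impI)
  fix x \<epsilon> :: real assume "0 < \<epsilon>"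
  then obtain \<delta> where "0 < \<delta>" "\<And>x y. \<bar>x - y\<bar> < \<delta> \<Longrightarrow> \<bar>f x - f y\<bar> < \<epsilon>"
    using absolutely_continuous_fun_single[OF assms] by metis
  then show "\<exists>d>0. \<forall>x'\<in>UNIV. dist x' x < d \<longrightarrow> dist (f x') (f x) < \<epsilon>"
    by (intro exI[of _ \<delta>]) (auto simp: dist_real_def)
qed

text \<open>
  A uniformly continuous function changes by at most \<open>1\<close> on each of the \<open>1 +
  \<bar>x\<bar> / \<delta>\<close> short pieces between \<open>0\<close> and \<open>x\<close>.
\<close>
lemma absolutely_continuous_fun_growth:
  assumes "absolutely_continuous_fun f"
  obtains D where "\<And>x. \<bar>f x\<bar> \<le> D * (1 + \<bar>x\<bar>)"
proof -
  obtain \<delta> where \<delta>: "0 < \<delta>" "\<And>x y. \<bar>x - y\<bar> < \<delta> \<Longrightarrow> \<bar>f x - f y\<bar> < 1"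
    using absolutely_continuous_fun_single[OF assms, of 1] by auto
  have "\<bar>f x\<bar> \<le> (\<bar>f 0\<bar> + 1 + 1 / \<delta>) * (1 + \<bar>x\<bar>)" for x
  proof -
    define n where "n = Suc (nat \<lfloor>\<bar>x\<bar> / \<delta>\<rfloor>)"
    have n: "\<bar>x\<bar> / \<delta> < real n" "real n \<le> 1 + \<bar>x\<bar> / \<delta>"
      using \<delta>(1) by (simp_all add: n_def) linarith+
    have n0: "0 < real n" by (simp add: n_def)
    have step: "\<bar>x / real n\<bar> < \<delta>" using n(1) \<delta>(1) n0 by (simp add: field_simps)
    have "\<bar>f (real k * (x / real n)) - f 0\<bar> \<le> real k" for k
    proof (induction k)
      case (Suc k)
      have "real (Suc k) * (x / real n) - real k * (x / real n) = x / real n"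
        by (simp only: left_diff_distrib[symmetric]) simp
      then have "\<bar>f (real (Suc k) * (x / real n)) - f (real k * (x / real n))\<bar> < 1"
        using step by (intro \<delta>(2)) simp
      then show ?case using Suc by simp
    qed simp
    from this[of n] n0 have "\<bar>f x - f 0\<bar> \<le> real n" by simp
    then have "\<bar>f x\<bar> \<le> \<bar>f 0\<bar> + 1 + \<bar>x\<bar> / \<delta>" using n(2) by linarith
    also have "\<dots> \<le> (\<bar>f 0\<bar> + 1 + 1 / \<delta>) * (1 + \<bar>x\<bar>)"
      using \<delta>(1) by (simp add: algebra_simps)
    finally show ?thesis .
  qed
  then show ?thesis by (rule that)
qed

text \<open>
  Monotonicity of the derivative of the convex function \<open>W + c x\<^sup>2 / 2\<close> comes
  from adding its tangent inequalities at two points.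
\<close>
lemma interaction_force_deriv:
  assumes C1: "W C1_differentiable_on UNIV" and even: "\<And>x. W (- x) = W x" and c: "0 < c"
    and convex: "convex_on UNIV (\<lambda>x. W x + c / 2 * x\<^sup>2)"
    and bdd: "bdd_above (range (\<lambda>x. \<bar>deriv W x\<bar> / (1 + \<bar>x\<bar>)))"
  shows "\<And>x. (W has_real_derivative deriv W x) (at x)" and "\<exists>C. interaction_force (deriv W) c C"
proof -
  show der: "(W has_real_derivative deriv W x) (at x)" for x
    using C1 by (simp add: C1_differentiable_on_eq DERIV_deriv_iff_real_differentiable)
  then have "vector_derivative W (at x) = deriv W x" for x
    by (simp add: vector_derivative_at has_real_derivative_iff_has_vector_derivative)
  then have cont: "continuous_on UNIV (deriv W)" using C1 by (simp add: C1_differentiable_on_eq)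
  have odd: "deriv W (- x) = - deriv W x" for x
  proof -
    have "((\<lambda>x. W (- x)) has_real_derivative - deriv W (- x)) (at x)"
      using der[of "- x"] by (simp add: DERIV_mirror)
    then have "deriv W x = - deriv W (- x)" using DERIV_unique[OF der] by (simp add: even)
    then show ?thesis by simp
  qed
  have mono: "deriv W x + c * x \<le> deriv W y + c * y" if "x \<le> y" for x y
  proof (cases "x = y")
    case False
    have d: "((\<lambda>x. W x + c / 2 * x\<^sup>2) has_real_derivative deriv W z + c * z) (at z)" for z
      by (auto intro!: derivative_eq_intros der)
    have t: "(deriv W z + c * z) * (z' - z) \<le> (W z' + c / 2 * z'\<^sup>2) - (W z + c / 2 * z\<^sup>2)" for z z'
      using convex_on_imp_above_tangent[OF convex, of z z'] d[of z] by simp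
    from t[of x y] t[of y x] have "(deriv W x + c * x) * (y - x) \<le> (deriv W y + c * y) * (y - x)"
      by (simp add: algebra_simps)
    then show ?thesis using that False by simp
  qed simp
  obtain C where "\<bar>deriv W x\<bar> / (1 + \<bar>x\<bar>) \<le> C" for x using bdd unfolding bdd_above_def by blast
  then have "\<bar>deriv W x\<bar> \<le> C * (1 + \<bar>x\<bar>)" for x by (simp add: pos_divide_le_eq add_pos_nonneg)
  then show "\<exists>C. interaction_force (deriv W) c C"
    using cont odd mono c by (intro exI[of _ C] interaction_force.intro) auto
qed

context sticky_flow
begin

definition law :: "real \<Rightarrow> real measure" where "law t = distr U borel (X t)"

text \<open>
  The Eulerian velocity is the velocity of any label at \<open>x\<close>; by
  \<open>V_fun\<close> the choice is immaterial.
\<close>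
definition velocity :: "real \<Rightarrow> real \<Rightarrow> real" where "velocity x t = V t (Minv t x)"

lemma velocity_X: "0 < t \<Longrightarrow> m \<in> {0<..<1} \<Longrightarrow> velocity (X t m) t = V t m"
  by (simp add: velocity_def V_Minv)

lemma velocity_m [measurable (raw)]:
  assumes [measurable]: "f \<in> borel_measurable M" "g \<in> borel_measurable M"
  shows "(\<lambda>x. velocity (f x) (g x)) \<in> borel_measurable M"
  unfolding velocity_def by measurable

lemma real_distribution_law: "real_distribution (law t)"
  unfolding law_def by (rule U.real_distribution_distr) measurable

lemma sets_law [simp, measurable_cong]: "sets (law t) = sets borel"
  by (simp add: law_def)

lemma integral_law: "g \<in> borel_measurable borel \<Longrightarrow> (\<integral>x. g x \<partial>law t) = (\<integral>m. g (X t m) \<partial>U)"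
  for g :: "real \<Rightarrow> real"
  unfolding law_def by (rule integral_distr) measurable

lemma integrable_law: "g \<in> borel_measurable borel \<Longrightarrow> integrable (law t) g \<longleftrightarrow> integrable U (\<lambda>m. g (X t m))"
  for g :: "real \<Rightarrow> real"
  unfolding law_def by (rule integrable_distr_eq) measurable

lemma narrowly_continuous_law: "narrowly_continuous law"
  unfolding narrowly_continuous_def narrowly_converges_def
proof (intro allI impI, elim conjE)
  fix t :: real and s :: "nat \<Rightarrow> real" and g :: "real \<Rightarrow> real"
  assume t: "0 < t" and s: "\<forall>k. 0 < s k" "s \<longlonglongrightarrow> t" and g: "continuous_on UNIV g" "bounded (range g)"
  have [measurable]: "g \<in> borel_measurable borel" by (rule borel_measurable_continuous_onI[OF g(1)])
  obtain B where B: "\<And>x. \<bar>g x\<bar> \<le> B" using g(2) by (auto simp: bounded_iff)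
  have "(\<lambda>k. \<integral>m. g (X (s k) m) \<partial>U) \<longlonglongrightarrow> (\<integral>m. g (X t m) \<partial>U)"
  proof (rule integral_dominated_convergence[where w = "\<lambda>_. B"])
    show "AE m in U. (\<lambda>k. g (X (s k) m)) \<longlonglongrightarrow> g (X t m)"
      using AE_space
    proof eventually_elim
      case (elim m)
      then have "(\<lambda>k. X (s k) m) \<longlonglongrightarrow> X t m" by (intro isCont_tendsto_compose[OF X_isCont[OF t] s(2)]) simp
      then show ?case by (rule continuous_on_tendsto_compose[OF g(1)]) auto
    qed
  qed (use B in auto)
  then show "(\<lambda>k. \<integral>x. g x \<partial>law (s k)) \<longlonglongrightarrow> (\<integral>x. g x \<partial>law t)" by (simp add: integral_law)
qed

lemma velocity_measurable: "(\<lambda>(x, t). velocity x t) \<in> borel_measurable (restrict_space borel (UNIV \<times> {0<..}))"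
proof (rule measurable_restrict_space1)
  have "(\<lambda>p. velocity (fst p) (snd p)) \<in> borel_measurable (borel \<Otimes>\<^sub>M borel)" by measurable
  then show "(\<lambda>(x, t). velocity x t) \<in> borel_measurable borel" by (simp add: borel_prod split_beta')
qed

lemma conv_law:
  assumes "0 \<le> t" "m \<in> {0<..<1}"
  shows "conv_measure w (law t) (X t m) = - F t m"
  by (simp add: conv_measure_def integral_law lag_force_def)

lemma integrable_conv_law: "0 \<le> t \<Longrightarrow> integrable (law t) (\<lambda>y. w (x - y))"
proof -
  assume t: "0 \<le> t"
  have "integrable U (\<lambda>m. w (x - X t m))"
  proof (rule Bochner_Integration.integrable_bound)
    show "integrable U (\<lambda>m. C * (1 + \<bar>x\<bar> + \<bar>X t m\<bar>))" using X_integrable[OF t] by simp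
    show "AE m in U. norm (w (x - X t m)) \<le> norm (C * (1 + \<bar>x\<bar> + \<bar>X t m\<bar>))"
    proof (rule AE_I2)
      fix m
      have "\<bar>w (x - X t m)\<bar> \<le> C * (1 + \<bar>x - X t m\<bar>)" by (rule w_growth)
      also have "\<dots> \<le> C * (1 + \<bar>x\<bar> + \<bar>X t m\<bar>)" using C_nonneg by (intro mult_left_mono) auto
      finally show "norm (w (x - X t m)) \<le> norm (C * (1 + \<bar>x\<bar> + \<bar>X t m\<bar>))" by simp
    qed
  qed measurable
  then show ?thesis by (simp add: integrable_law)
qed

text \<open>
  Change of variables from the Eulerian integrals to integrals over times and labels. The
  integrand vanishes from time \<open>T\<close> on, which reduces the half-line to a bounded
  interval.
\<close>
lemma spacetime_law:
  assumes H: "\<And>t. 0 < t \<Longrightarrow> (\<lambda>x. H x t) \<in> borel_measurable borel"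
    and HG: "\<And>t m. 0 < t \<Longrightarrow> m \<in> {0<..<1} \<Longrightarrow> H (X t m) t = G t m"
    and G: "(\<lambda>(t, m). G t m) \<in> borel_measurable (borel \<Otimes>\<^sub>M borel)"
    and int: "\<And>t. 0 < t \<Longrightarrow> integrable U (G t)"
    and bd: "\<And>t. 0 < t \<Longrightarrow> t \<le> T \<Longrightarrow> (\<integral>m. \<bar>G t m\<bar> \<partial>U) \<le> M"
    and zero: "\<And>t m. T \<le> t \<Longrightarrow> G t m = 0" and T: "0 < T"
  shows "spacetime_integrable law H" and "spacetime_integral law H = (LBINT t:{0<..T}. \<integral>m. G t m \<partial>U)"
proof -
  have i: "integrable (law t) (\<lambda>x. H x t)" if "0 < t" for t
    using int[OF that] HG[OF that] integrable_law[OF H[OF that]] integrable_cong_U[of "\<lambda>m. H (X t m) t" "G t"] by simp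
  have abs_eq: "(\<integral>x. \<bar>H x t\<bar> \<partial>law t) = (\<integral>m. \<bar>G t m\<bar> \<partial>U)" if "0 < t" for t
    using H[OF that] HG[OF that] integral_cong_U[of "\<lambda>m. \<bar>H (X t m) t\<bar>" "\<lambda>m. \<bar>G t m\<bar>"] by (subst integral_law) auto
  have eq: "(\<integral>x. H x t \<partial>law t) = (\<integral>m. G t m \<partial>U)" if "0 < t" for t
    using H[OF that] HG[OF that] integral_cong_U[of "\<lambda>m. H (X t m) t" "G t"] by (subst integral_law) auto
  have "set_integrable lborel {0<..T} (\<lambda>t. \<integral>m. \<bar>G t m\<bar> \<partial>U)"
    by (rule time_space_fubini(1)[where M = M]) (use G int bd T in \<open>auto simp: split_beta'\<close>)
  moreover have "indicator {0<..T} t *\<^sub>R (\<integral>m. \<bar>G t m\<bar> \<partial>U) = indicator {0<..} t *\<^sub>R (\<integral>x. \<bar>H x t\<bar> \<partial>law t)" for t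
    using abs_eq[of t] zero[of t] by (auto simp: indicator_def)
  ultimately show "spacetime_integrable law H"
    using i by (simp add: spacetime_integrable_def set_integrable_def)
  have "indicator {0<..} t *\<^sub>R (\<integral>x. H x t \<partial>law t) = indicator {0<..T} t *\<^sub>R (\<integral>m. G t m \<partial>U)" for t
    using eq[of t] zero by (cases "t \<le> T") (auto simp: indicator_def ext[of "G t" "\<lambda>_. 0"])
  then show "spacetime_integral law H = (LBINT t:{0<..T}. \<integral>m. G t m \<partial>U)"
    by (simp add: spacetime_integral_def set_lebesgue_integral_def)
qed

lemma weak_equations:
  assumes \<phi>: "test_function \<phi>"
  shows "spacetime_integrable law (\<lambda>x t. dt \<phi> (x, t) + velocity x t * dx \<phi> (x, t))" (is "?I1")
    and "spacetime_integrable law (\<lambda>x t. velocity x t * dt \<phi> (x, t) + (velocity x t)\<^sup>2 * dx \<phi> (x, t))" (is "?I2")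
    and "spacetime_integrable law (\<lambda>x t. \<phi> (x, t) * conv_measure w (law t) x)" (is "?I3")
    and "spacetime_integral law (\<lambda>x t. dt \<phi> (x, t) + velocity x t * dx \<phi> (x, t)) + (\<integral>x. \<phi> (x, 0) \<partial>law 0) = 0" (is "?E1")
    and "spacetime_integral law (\<lambda>x t. velocity x t * dt \<phi> (x, t) + (velocity x t)\<^sup>2 * dx \<phi> (x, t))
          + (\<integral>x. \<phi> (x, 0) * v0 x \<partial>law 0)
          = spacetime_integral law (\<lambda>x t. \<phi> (x, t) * conv_measure w (law t) x)" (is "?E2")
proof -
  obtain T B where T: "0 < T" and B0: "0 \<le> B"
    and late: "\<forall>x t. T \<le> t \<longrightarrow> \<phi> (x, t) = 0 \<and> dx \<phi> (x, t) = 0 \<and> dt \<phi> (x, t) = 0"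
    and bounded: "\<forall>x t. 0 \<le> t \<longrightarrow> \<bar>\<phi> (x, t)\<bar> \<le> B \<and> \<bar>dx \<phi> (x, t)\<bar> \<le> B \<and> \<bar>dt \<phi> (x, t)\<bar> \<le> B"
    by (rule test_function_bounds[OF \<phi>])
  note ctx = \<phi> T B0 late bounded
  note [measurable (raw)] = fphi_m[OF ctx] fdx_m[OF ctx] fdt_m[OF ctx] mat_deriv_m[OF ctx]
  note mat_deriv = mat_deriv_def[OF ctx]
  let ?mat = "mat_deriv \<phi>"
  have fr: "\<phi> (x, t) = past_frozen \<phi> x t" "dx \<phi> (x, t) = past_frozen (dx \<phi>) x t" "dt \<phi> (x, t) = past_frozen (dt \<phi>) x t"
    if "0 \<le> t" for x t using that by simp_all
  have mat0: "?mat t m = 0" if "T \<le> t" for t m using frozen_zero[OF ctx, OF that] by (simp add: mat_deriv)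
  have conv_m [measurable]: "conv_measure w (law t) \<in> borel_measurable borel" for t
    unfolding conv_measure_def by (simp add: integral_law) measurable
  have mass_G: "dt \<phi> (X t m, t) + velocity (X t m) t * dx \<phi> (X t m, t) = ?mat t m" if "0 < t" "m \<in> {0<..<1}" for t m
    using that by (simp add: mat_deriv velocity_X)
  have mom_G: "velocity (X t m) t * dt \<phi> (X t m, t) + (velocity (X t m) t)\<^sup>2 * dx \<phi> (X t m, t) = V t m * ?mat t m"
    if "0 < t" "m \<in> {0<..<1}" for t m
    using that by (simp add: mat_deriv velocity_X power2_eq_square algebra_simps)
  have force_G: "\<phi> (X t m, t) * conv_measure w (law t) (X t m) = - (F t m * past_frozen \<phi> (X t m) t)"
    if "0 < t" "m \<in> {0<..<1}" for t m
    using that by (simp add: conv_law)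
  have mass_H: "(\<lambda>x. dt \<phi> (x, t) + velocity x t * dx \<phi> (x, t)) \<in> borel_measurable borel"
    and mom_H: "(\<lambda>x. velocity x t * dt \<phi> (x, t) + (velocity x t)\<^sup>2 * dx \<phi> (x, t)) \<in> borel_measurable borel"
    and force_H: "(\<lambda>x. \<phi> (x, t) * conv_measure w (law t) x) \<in> borel_measurable borel" if "0 < t" for t
    using that by (simp_all add: fr del: past_frozen_eq)
  note int = mat_deriv_integrable[OF ctx] and bd = mean_abs_mat_deriv[OF ctx]
  have m1: "(\<lambda>(t, m). ?mat t m) \<in> borel_measurable (borel \<Otimes>\<^sub>M borel)"
    and m2: "(\<lambda>(t, m). V t m * ?mat t m) \<in> borel_measurable (borel \<Otimes>\<^sub>M borel)"
    and m3: "(\<lambda>(t, m). - (F t m * past_frozen \<phi> (X t m) t)) \<in> borel_measurable (borel \<Otimes>\<^sub>M borel)"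
    by (simp_all add: split_beta')
  have zero3: "- (F t m * past_frozen \<phi> (X t m) t) = 0" if "T \<le> t" for t m
    using frozen_zero(1)[OF ctx, OF that] by simp
  have int3: "integrable U (\<lambda>m. - (F t m * past_frozen \<phi> (X t m) t))" if "0 < t" for t
    using int(4)[OF that] by simp
  have bd3: "(\<integral>m. \<bar>- (F t m * past_frozen \<phi> (X t m) t)\<bar> \<partial>U) \<le> KF T * B" if "0 < t" "t \<le> T" for t
    using bd(4)[OF that] by (simp only: abs_minus_cancel)
  have mat0': "V t m * ?mat t m = 0" if "T \<le> t" for t m using mat0[OF that] by simp
  have 1: ?I1 "spacetime_integral law (\<lambda>x t. dt \<phi> (x, t) + velocity x t * dx \<phi> (x, t)) = (LBINT t:{0<..T}. \<integral>m. ?mat t m \<partial>U)"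
    by (rule spacetime_law[where G = ?mat and T = T and M = "B * 1 + B * Kb (T + 1)"],
        (rule mass_H mass_G m1 int(1) bd(1) mat0 T; assumption)+)+
  have 2: ?I2 "spacetime_integral law (\<lambda>x t. velocity x t * dt \<phi> (x, t) + (velocity x t)\<^sup>2 * dx \<phi> (x, t))
      = (LBINT t:{0<..T}. \<integral>m. V t m * ?mat t m \<partial>U)"
    by (rule spacetime_law[where G = "\<lambda>t m. V t m * ?mat t m" and T = T and M = "B * Kb (T + 1) + B * (Kb (T + 1) * Kb (T + 1))"],
        (rule mom_H mom_G m2 int(3) bd(3) mat0' T; assumption)+)+
  have 3: ?I3 "spacetime_integral law (\<lambda>x t. \<phi> (x, t) * conv_measure w (law t) x)
      = (LBINT t:{0<..T}. \<integral>m. - (F t m * past_frozen \<phi> (X t m) t) \<partial>U)"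
    by (rule spacetime_law[where G = "\<lambda>t m. - (F t m * past_frozen \<phi> (X t m) t)" and T = T and M = "KF T * B"],
        (rule force_H force_G m3 int3 bd3 zero3 T; assumption)+)+
  show ?I1 ?I2 ?I3 by (fact 1 2 3)+
  have initial: "(\<integral>x. \<phi> (x, 0) \<partial>law 0) = (\<integral>m. past_frozen \<phi> (X 0 m) 0 \<partial>U)"
    "(\<integral>x. \<phi> (x, 0) * v0 x \<partial>law 0) = (\<integral>m. past_frozen \<phi> (X 0 m) 0 * v0 (X 0 m) \<partial>U)"
    by (simp_all add: fr integral_law del: past_frozen_eq)
  show ?E1 unfolding 1(2) initial mass_identity[OF ctx] by simp
  show ?E2 unfolding 2(2) 3(2) initial by (rule momentum_identity[OF ctx])
qed

lemma weak_solution_pair_law: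
  assumes W: "\<And>x. (W has_real_derivative w x) (at x)"
  shows "weak_solution_pair W (law 0) v0 law velocity"
proof -
  have [simp]: "deriv W = w" using DERIV_imp_deriv[OF W] by auto
  show ?thesis
    unfolding weak_solution_pair_def
    using real_distribution_law narrowly_continuous_law velocity_measurable integrable_conv_law weak_equations by simp
qed

lemma energy_law:
  assumes W: "\<And>x. (W has_real_derivative w x) (at x)" and t: "0 < t"
  shows "integrable (law t) (\<lambda>x. (velocity x t)\<^sup>2)"
    and "integrable (law t \<Otimes>\<^sub>M law t) (\<lambda>(x, y). W (x - y))"
    and "1 / 2 * (\<integral>x. (velocity x t)\<^sup>2 \<partial>law t) + 1 / 2 * (\<integral>y. (\<integral>x. W (x - y) \<partial>law t) \<partial>law t)
      = 1 / 2 * (\<integral>a. (V t a)\<^sup>2 \<partial>U) + 1 / 2 * (\<integral>b. (\<integral>a. W (X t a - X t b) \<partial>U) \<partial>U)"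
proof -
  have "isCont W x" for x using W by (rule DERIV_isCont)
  then have [measurable]: "W \<in> borel_measurable borel"
    by (intro borel_measurable_continuous_onI) (simp add: continuous_on_eq_continuous_at)
  show "integrable (law t) (\<lambda>x. (velocity x t)\<^sup>2)"
    using V_int[OF t] integrable_cong_U[of "\<lambda>m. (velocity (X t m) t)\<^sup>2" "\<lambda>m. (V t m)\<^sup>2"] velocity_X[OF t]
    by (subst integrable_law) auto
  have "law t \<Otimes>\<^sub>M law t = distr (U \<Otimes>\<^sub>M U) (borel \<Otimes>\<^sub>M borel) (\<lambda>(a, b). (X t a, X t b))"
    unfolding law_def
    by (rule pair_measure_distr) (use real_distribution_law[of t] in \<open>auto simp: law_def real_distribution_def prob_space_imp_sigma_finite\<close>)
  then show "integrable (law t \<Otimes>\<^sub>M law t) (\<lambda>(x, y). W (x - y))"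
    using W_integrable[OF W, of t] t by (simp add: integrable_distr_eq split_beta')
  have "(\<integral>x. (velocity x t)\<^sup>2 \<partial>law t) = (\<integral>a. (V t a)\<^sup>2 \<partial>U)"
    using integral_cong_U[of "\<lambda>m. (velocity (X t m) t)\<^sup>2" "\<lambda>m. (V t m)\<^sup>2"] velocity_X[OF t]
    by (subst integral_law) auto
  moreover have "(\<integral>y. (\<integral>x. W (x - y) \<partial>law t) \<partial>law t) = (\<integral>b. (\<integral>a. W (X t a - X t b) \<partial>U) \<partial>U)"
    by (simp add: integral_law)
  ultimately show "1 / 2 * (\<integral>x. (velocity x t)\<^sup>2 \<partial>law t) + 1 / 2 * (\<integral>y. (\<integral>x. W (x - y) \<partial>law t) \<partial>law t)
      = 1 / 2 * (\<integral>a. (V t a)\<^sup>2 \<partial>U) + 1 / 2 * (\<integral>b. (\<integral>a. W (X t a - X t b) \<partial>U) \<partial>U)" by simp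
qed

text \<open>
  The exceptional set consists of the points that are not the position of their own label.
\<close>
lemma entropy_law:
  assumes t: "0 < t"
  shows "\<exists>Z \<in> null_sets (law t). \<forall>x y. x \<notin> Z \<and> y \<notin> Z \<longrightarrow>
    (velocity x t - velocity y t) * (x - y) \<le> sqrt c / tanh (sqrt c * t) * (x - y)\<^sup>2"
proof
  \<comment> \<open>a null set by \<open>Minv_X\<close>\<close>
  define Z where "Z = {x. \<not> (Minv t x \<in> {0<..<1} \<and> X t (Minv t x) = x)}"
  have [measurable]: "Z \<in> sets borel" unfolding Z_def by measurable
  have "AE m in U. X t m \<notin> Z"
    using AE_space by eventually_elim (use Minv_X[of t] t in \<open>auto simp: Z_def\<close>)
  then have "AE x in law t. x \<notin> Z" unfolding law_def by (subst AE_distr_iff) auto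
  then show "Z \<in> null_sets (law t)" by (subst AE_iff_null_sets) auto
  let ?L = "sqrt c / tanh (sqrt c * t)"
  have ordered: "(velocity y t - velocity x t) * (y - x) \<le> ?L * (y - x)\<^sup>2"
    if xy: "x \<notin> Z" "y \<notin> Z" "Minv t x \<le> Minv t y" for x y
  proof -
    have M: "0 < Minv t x" "Minv t y < 1" "X t (Minv t x) = x" "X t (Minv t y) = y" using xy by (auto simp: Z_def)
    have "velocity y t - velocity x t \<le> ?L * (y - x)" using V_entropy[OF t M(1) xy(3) M(2)] M(3,4) by (simp add: velocity_def)
    moreover have "0 \<le> y - x" using X_mono[of t, OF _ M(1) xy(3) M(2)] t M(3,4) by simp
    ultimately have "(velocity y t - velocity x t) * (y - x) \<le> (?L * (y - x)) * (y - x)" by (rule mult_right_mono)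
    then show ?thesis by (simp add: power2_eq_square mult.assoc)
  qed
  show "\<forall>x y. x \<notin> Z \<and> y \<notin> Z \<longrightarrow> (velocity x t - velocity y t) * (x - y) \<le> ?L * (x - y)\<^sup>2"
  proof (intro allI impI, elim conjE)
    fix x y assume "x \<notin> Z" "y \<notin> Z"
    then show "(velocity x t - velocity y t) * (x - y) \<le> ?L * (x - y)\<^sup>2"
      using ordered[of x y] ordered[of y x] by (cases "Minv t x \<le> Minv t y") (auto simp: power2_commute algebra_simps)
  qed
qed

end

theorem theorem1p3:
  fixes W :: "real \<Rightarrow> real" and c :: real
    and \<rho>\<^sub>0 :: "real measure" and v\<^sub>0 :: "real \<Rightarrow> real"
  assumes "W C1_differentiable_on UNIV"
    and "\<And>x. W (- x) = W x"
    and "c > 0"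
    and "convex_on UNIV (\<lambda>x. W x + c / 2 * x\<^sup>2)"
    and "bdd_above (range (\<lambda>x. \<bar>deriv W x\<bar> / (1 + \<bar>x\<bar>)))"
    and "real_distribution \<rho>\<^sub>0"
    and "integrable \<rho>\<^sub>0 (\<lambda>x. x\<^sup>2)"
    and "absolutely_continuous_fun v\<^sub>0"
  shows "\<exists>(\<rho> :: real \<Rightarrow> real measure) (v :: real \<Rightarrow> real \<Rightarrow> real).
    weak_solution_pair W \<rho>\<^sub>0 v\<^sub>0 \<rho> v \<and>
    (\<exists>N \<in> null_sets lborel.
       (\<forall>t\<ge>0. t \<notin> N \<longrightarrow>
          integrable (\<rho> t) (\<lambda>x. (v x t)\<^sup>2) \<and>
          integrable (\<rho> t \<Otimes>\<^sub>M \<rho> t) (\<lambda>(x, y). W (x - y))) \<and>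
       (\<forall>s t. 0 \<le> s \<and> s \<le> t \<and> s \<notin> N \<and> t \<notin> N \<longrightarrow>
          1 / 2 * (\<integral>x. (v x t)\<^sup>2 \<partial>\<rho> t) + 1 / 2 * (\<integral>y. (\<integral>x. W (x - y) \<partial>\<rho> t) \<partial>\<rho> t)
          \<le> 1 / 2 * (\<integral>x. (v x s)\<^sup>2 \<partial>\<rho> s) + 1 / 2 * (\<integral>y. (\<integral>x. W (x - y) \<partial>\<rho> s) \<partial>\<rho> s))) \<and>
    (AE t in lborel. t > 0 \<longrightarrow>
       (\<exists>Z \<in> null_sets (\<rho> t). \<forall>x y. x \<notin> Z \<and> y \<notin> Z \<longrightarrow>
          (v x t - v y t) * (x - y) \<le> sqrt c / tanh (sqrt c * t) * (x - y)\<^sup>2))"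
proof -
  have W': "(W has_real_derivative deriv W x) (at x)" for x
    by (rule interaction_force_deriv(1)[OF assms(1-5)])
  obtain C where C: "interaction_force (deriv W) c C" using interaction_force_deriv(2)[OF assms(1-5)] by blast
  obtain D where D: "\<And>x. \<bar>v\<^sub>0 x\<bar> \<le> D * (1 + \<bar>x\<bar>)" using absolutely_continuous_fun_growth[OF assms(8)] by blast
  obtain Q where Q [measurable]: "Q \<in> borel_measurable U" and Q_mono: "\<And>m m'. 0 < m \<Longrightarrow> m \<le> m' \<Longrightarrow> m' < 1 \<Longrightarrow> Q m \<le> Q m'"
    and Q_law: "distr U borel Q = \<rho>\<^sub>0"
    using quantile_exists[OF assms(6)] by blast
  have "integrable U (\<lambda>m. (Q m)\<^sup>2)" using assms(7) unfolding Q_law[symmetric] by (subst (asm) integrable_distr_eq) auto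
  then interpret L: sticky_limit "deriv W" c C v\<^sub>0 D Q
    using C Q Q_mono D absolutely_continuous_fun_continuous[OF assms(8)]
    by (intro sticky_limit.intro sticky_limit_axioms.intro)
  interpret E: sticky_flow "deriv W" c C v\<^sub>0 D L.X L.Kb by (rule L.sticky_flow_X)
  have "E.law 0 = \<rho>\<^sub>0"
    unfolding E.law_def Q_law[symmetric] by (rule distr_cong_AE) (use L.X_0 in auto)
  then have "weak_solution_pair W \<rho>\<^sub>0 v\<^sub>0 E.law E.velocity" using E.weak_solution_pair_law[OF W'] by simp
  moreover have "\<exists>N \<in> null_sets lborel.
       (\<forall>t\<ge>0. t \<notin> N \<longrightarrow>
          integrable (E.law t) (\<lambda>x. (E.velocity x t)\<^sup>2) \<and>
          integrable (E.law t \<Otimes>\<^sub>M E.law t) (\<lambda>(x, y). W (x - y))) \<and>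
       (\<forall>s t. 0 \<le> s \<and> s \<le> t \<and> s \<notin> N \<and> t \<notin> N \<longrightarrow>
          1 / 2 * (\<integral>x. (E.velocity x t)\<^sup>2 \<partial>E.law t) + 1 / 2 * (\<integral>y. (\<integral>x. W (x - y) \<partial>E.law t) \<partial>E.law t)
          \<le> 1 / 2 * (\<integral>x. (E.velocity x s)\<^sup>2 \<partial>E.law s) + 1 / 2 * (\<integral>y. (\<integral>x. W (x - y) \<partial>E.law s) \<partial>E.law s))"
  \<comment> \<open>nothing is known about the velocity at the initial time\<close>
  proof (intro bexI[of _ "{0}"] conjI allI impI)
    fix s t :: real assume "0 \<le> s \<and> s \<le> t \<and> s \<notin> {0} \<and> t \<notin> {0}"
    then have "0 < s" "s \<le> t" "0 < t" by auto
    then show "1 / 2 * (\<integral>x. (E.velocity x t)\<^sup>2 \<partial>E.law t) + 1 / 2 * (\<integral>y. (\<integral>x. W (x - y) \<partial>E.law t) \<partial>E.law t)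
          \<le> 1 / 2 * (\<integral>x. (E.velocity x s)\<^sup>2 \<partial>E.law s) + 1 / 2 * (\<integral>y. (\<integral>x. W (x - y) \<partial>E.law s) \<partial>E.law s)"
      unfolding E.energy_law(3)[OF W' \<open>0 < s\<close>] E.energy_law(3)[OF W' \<open>0 < t\<close>] by (intro E.energy_inequality W')
  qed (use E.energy_law(1,2)[OF W'] in auto)
  ultimately show ?thesis using E.entropy_law by (intro exI[of _ E.law] exI[of _ E.velocity] conjI) auto
qed

end
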